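(* Let $\lambda_1,\lambda_2,\lambda_3>0$, $\kappa\in\mathbb{R}$, let $W$ be a standard real-valued Wiener process, and consider the system of stochastic differential equations in $\mathbb{R}^3$ $$\begin{aligned} \mathrm{d}u_1&=\left[-\lambda_1u_1-\left(u_2^2+u_3^2\right)\right]\mathrm{d}t+\kappa\,\mathrm{d}t+\sigma\,\mathrm{d}W(t),\\ \mathrm{d}u_2&=\left[-\lambda_2u_2+u_1u_2\right]\mathrm{d}t,\\ \mathrm{d}u_3&=\left[-\lambda_3u_3+u_1u_3\right]\mathrm{d}t, \end{aligned}\tag{S}$$ where $\sigma>0$ unless a different range of $\sigma$ is specified below. For $v\in\mathbb{R}^3$ let $u(\cdot;v)=(u_1,u_2,u_3)(\cdot;v)$ be the solution of (S) starting at time $0$ from $v$. Let $f_1=(1,0,0)$ and let $\nu_{\sigma,\kappa}$ be the law on $(\mathbb{R}^3,\mathcal{B}(\mathbb{R}^3))$ of $$\frac{\kappa}{\lambda_1}f_1+\sigma\int_0^{+\infty}\mathrm{e}^{-\lambda_1t}\,\mathrm{d}W(t)\,f_1 .$$ Then the following hold. (i) For arbitrary parameters there exists an invariant probability measure for (S). In fact, for any initial value $v\in\mathbb{R}^3$ there exists a sequence $t_n\nearrow+\infty$ such that the sequence of Borel probability measures on $\mathbb{R}^3$ $$\mathcal{L}\left(\frac{1}{t_n}\int_0^{t_n}u(s;v)\,\mathrm{d}s\right)$$ converges weakly to a Borel probability measure on $\mathbb{R}^3$; consequently, (S) has at least one invariant probability measure. (ii) For arbitrary $\lambda_1>0$ and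 $\kappa,\sigma\in\mathbb{R}$, the law $\nu_{\sigma,\kappa}$ is Gaussian and is invariant both for (S) and for the linear equation $$\mathrm{d}z=Az\,\mathrm{d}t+\left(\kappa f_1\,\mathrm{d}t+\sigma f_1\,\mathrm{d}W\right)\quad\text{in }\mathbb{R}^3,\qquad A(z_1,z_2,z_3)=-(\lambda_1z_1,\lambda_2z_2,\lambda_3z_3).$$ (iii) If $\kappa<\lambda_1\min\{\lambda_2,\lambda_3\}$, then for any $\sigma\ge 0$ the system (S) admits a unique invariant probability measure, namely $\nu_{\sigma,\kappa}$, and it is stochastically stable, i.e. for any initial data $v\in\mathbb{R}^3$ the laws $\mathcal{L}(u(t;v))$ converge weakly to $\nu_{\sigma,\kappa}$ as $t\to+\infty$. (iv) If $\kappa>\lambda_1\min\{\lambda_2,\lambda_3\}$, then there are invariant probability measures for (S) different from the Gaussian measure $\nu_{\sigma,\kappa}$.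
   Context: $\mathcal{L}(X)$ denotes the law of the random variable $X$. A Borel probability measure on $\mathbb{R}^3$ is invariant for a stochastic differential equation if it is invariant for the associated Markov process on $\mathbb{R}^3$. Gaussian measures are allowed to be degenerate. *)

theory Defs
  imports "HOL-Probability.Probability"
begin

section \<open>Wiener processes and the Wiener integral\<close>

text \<open>Processes are functions of time and outcome; only times \<open>t \<ge> 0\<close> matter.\<close>

definition wiener_process :: "'w measure \<Rightarrow> (real \<Rightarrow> 'w \<Rightarrow> real) \<Rightarrow> bool" where
  "wiener_process M W \<longleftrightarrow>
     prob_space M \<and>
     (\<forall>t\<ge>0. W t \<in> borel_measurable M) \<and>
     (AE \<omega> in M. W 0 \<omega> = 0) \<and>
     (\<forall>\<omega>\<in>space M. continuous_on {0..} (\<lambda>t. W t \<omega>)) \<and>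
     (\<forall>s t. 0 \<le> s \<and> s < t \<longrightarrow>
        distributed M lborel (\<lambda>\<omega>. W t \<omega> - W s \<omega>) (normal_density 0 (sqrt (t - s)))) \<and>
     (\<forall>n (\<tau>::nat \<Rightarrow> real). 0 \<le> \<tau> 0 \<and> (\<forall>i<n. \<tau> i \<le> \<tau> (Suc i)) \<longrightarrow>
        prob_space.indep_vars M (\<lambda>_. borel) (\<lambda>i \<omega>. W (\<tau> (Suc i)) \<omega> - W (\<tau> i) \<omega>) {..<n})"

text \<open>The step function \<open>\<Sum>i<n. c i * indicator (\<tau> i, \<tau> (i+1)]\<close> and its integral against \<open>W\<close>.\<close>

definition step_function :: "nat \<Rightarrow> (nat \<Rightarrow> real) \<Rightarrow> (nat \<Rightarrow> real) \<Rightarrow> real \<Rightarrow> real" where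
  "step_function n \<tau> c t = (\<Sum>i<n. c i * indicator {\<tau> i<..\<tau> (Suc i)} t)"

definition step_integral ::
  "(real \<Rightarrow> 'w \<Rightarrow> real) \<Rightarrow> nat \<Rightarrow> (nat \<Rightarrow> real) \<Rightarrow> (nat \<Rightarrow> real) \<Rightarrow> 'w \<Rightarrow> real" where
  "step_integral W n \<tau> c \<omega> = (\<Sum>i<n. c i * (W (\<tau> (Suc i)) \<omega> - W (\<tau> i) \<omega>))"

text \<open>\<open>I\<close> is a version of \<open>\<integral>\<^sub>0\<^sup>\<infinity> f dW\<close> for deterministic \<open>f \<in> L\<^sup>2(0,\<infinity>)\<close>: the \<open>L\<^sup>2(M)\<close>-limit of
  the integrals of step functions that converge to \<open>f\<close> in \<open>L\<^sup>2(0,\<infinity>)\<close>. By the isometry property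
  it is unique up to null sets.\<close>

definition is_wiener_integral ::
  "'w measure \<Rightarrow> (real \<Rightarrow> 'w \<Rightarrow> real) \<Rightarrow> (real \<Rightarrow> real) \<Rightarrow> ('w \<Rightarrow> real) \<Rightarrow> bool" where
  "is_wiener_integral M W f I \<longleftrightarrow>
     I \<in> borel_measurable M \<and>
     (\<exists>(n::nat \<Rightarrow> nat) (\<tau>::nat \<Rightarrow> nat \<Rightarrow> real) (c::nat \<Rightarrow> nat \<Rightarrow> real).
        (\<forall>k. 0 \<le> \<tau> k 0 \<and> (\<forall>i<n k. \<tau> k i \<le> \<tau> k (Suc i))) \<and>
        (\<lambda>k. \<integral>\<^sup>+t\<in>{0..}. ennreal ((f t - step_function (n k) (\<tau> k) (c k) t)\<^sup>2) \<partial>lborel)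
          \<longlonglongrightarrow> 0 \<and>
        (\<lambda>k. \<integral>\<^sup>+\<omega>. ennreal ((I \<omega> - step_integral W (n k) (\<tau> k) (c k) \<omega>)\<^sup>2) \<partial>M)
          \<longlonglongrightarrow> 0)"

definition wiener_integral ::
  "'w measure \<Rightarrow> (real \<Rightarrow> 'w \<Rightarrow> real) \<Rightarrow> (real \<Rightarrow> real) \<Rightarrow> 'w \<Rightarrow> real" where
  "wiener_integral M W f = (SOME I. is_wiener_integral M W f I)"

section \<open>Stochastic differential equations with additive noise\<close>

definition natural_filtration ::
  "'w measure \<Rightarrow> (real \<Rightarrow> 'w \<Rightarrow> real) \<Rightarrow> real \<Rightarrow> 'w measure" where
  "natural_filtration M W t =
     sigma (space M) {W s -` B \<inter> space M | s B. 0 \<le> s \<and> s \<le> t \<and> B \<in> sets borel}"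

text \<open>\<open>X\<close> is a (strong, global) solution of \<open>dX = b(X) dt + g dW\<close>, \<open>X(0) = v\<close>, with constant \<open>g\<close>:
  the stochastic integral of the constant \<open>g\<close> over \<open>[0,t]\<close> is \<open>W(t) g\<close>, as \<open>W(0) = 0\<close> almost surely.\<close>

definition is_sde_solution ::
  "'w measure \<Rightarrow> (real \<Rightarrow> 'w \<Rightarrow> real) \<Rightarrow> ('a::euclidean_space \<Rightarrow> 'a) \<Rightarrow> 'a \<Rightarrow> 'a \<Rightarrow>
    (real \<Rightarrow> 'w \<Rightarrow> 'a) \<Rightarrow> bool" where
  "is_sde_solution M W b g v X \<longleftrightarrow>
     (\<forall>t\<ge>0. X t \<in> borel_measurable (natural_filtration M W t)) \<and>
     (\<forall>\<omega>\<in>space M. continuous_on {0..} (\<lambda>t. X t \<omega>)) \<and>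
     (AE \<omega> in M. \<forall>t\<ge>0. X t \<omega> = v + integral {0..t} (\<lambda>s. b (X s \<omega>)) + W t \<omega> *\<^sub>R g)"

text \<open>For locally Lipschitz \<open>b\<close> solutions are pathwise unique, so the choice only concerns a null
  set and does not affect laws.\<close>

definition sde_solution ::
  "'w measure \<Rightarrow> (real \<Rightarrow> 'w \<Rightarrow> real) \<Rightarrow> ('a::euclidean_space \<Rightarrow> 'a) \<Rightarrow> 'a \<Rightarrow> 'a \<Rightarrow>
    (real \<Rightarrow> 'w \<Rightarrow> 'a)" where
  "sde_solution M W b g v = (SOME X. is_sde_solution M W b g v X)"

definition law :: "'w measure \<Rightarrow> ('w \<Rightarrow> 'a::topological_space) \<Rightarrow> 'a measure" where
  "law M X = distr M borel X"

definition borel_prob :: "'a::topological_space measure \<Rightarrow> bool" where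
  "borel_prob \<mu> \<longleftrightarrow> prob_space \<mu> \<and> sets \<mu> = sets borel"

text \<open>Invariance for the Markov process with transition kernel \<open>P\<^sub>t(v, B) = Prob(X(t;v) \<in> B)\<close>.\<close>

definition sde_invariant ::
  "'w measure \<Rightarrow> (real \<Rightarrow> 'w \<Rightarrow> real) \<Rightarrow> ('a::euclidean_space \<Rightarrow> 'a) \<Rightarrow> 'a \<Rightarrow> 'a measure \<Rightarrow> bool" where
  "sde_invariant M W b g \<mu> \<longleftrightarrow>
     borel_prob \<mu> \<and>
     (\<forall>t\<ge>0. \<forall>B\<in>sets borel.
        (\<integral>\<^sup>+v. emeasure (law M (sde_solution M W b g v t)) B \<partial>\<mu>) = emeasure \<mu> B)"

section \<open>Weak convergence and Gaussian measures\<close>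

definition weakly_converges ::
  "('i \<Rightarrow> 'a::topological_space measure) \<Rightarrow> 'a measure \<Rightarrow> 'i filter \<Rightarrow> bool" where
  "weakly_converges \<mu> \<nu> F \<longleftrightarrow>
     (\<forall>f::'a \<Rightarrow> real. continuous_on UNIV f \<and> bounded (range f) \<longrightarrow>
        ((\<lambda>i. integral\<^sup>L (\<mu> i) f) \<longlongrightarrow> integral\<^sup>L \<nu> f) F)"

text \<open>Every one-dimensional projection is normal; a point mass counts as normal with variance \<open>0\<close>.\<close>

definition gaussian_measure :: "'a::euclidean_space measure \<Rightarrow> bool" where
  "gaussian_measure \<mu> \<longleftrightarrow>
     borel_prob \<mu> \<and>
     (\<forall>w. \<exists>m::real.
        distr \<mu> borel (\<lambda>x. w \<bullet> x) = return borel m \<or>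
        (\<exists>s>0. distr \<mu> borel (\<lambda>x. w \<bullet> x) = density lborel (normal_density m s)))"

section \<open>The three-dimensional system\<close>

definition f1 :: "real ^ 3" where
  "f1 = vector [1, 0, 0]"

definition drift_S :: "real \<Rightarrow> real \<Rightarrow> real \<Rightarrow> real \<Rightarrow> real ^ 3 \<Rightarrow> real ^ 3" where
  "drift_S l\<^sub>1 l\<^sub>2 l\<^sub>3 \<kappa> u = vector
     [- l\<^sub>1 * u$1 - ((u$2)\<^sup>2 + (u$3)\<^sup>2) + \<kappa>,
      - l\<^sub>2 * u$2 + u$1 * u$2,
      - l\<^sub>3 * u$3 + u$1 * u$3]"

definition A_lin :: "real \<Rightarrow> real \<Rightarrow> real \<Rightarrow> real ^ 3 \<Rightarrow> real ^ 3" where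
  "A_lin l\<^sub>1 l\<^sub>2 l\<^sub>3 z = - vector [l\<^sub>1 * z$1, l\<^sub>2 * z$2, l\<^sub>3 * z$3]"

definition sol_S ::
  "'w measure \<Rightarrow> (real \<Rightarrow> 'w \<Rightarrow> real) \<Rightarrow> real \<Rightarrow> real \<Rightarrow> real \<Rightarrow> real \<Rightarrow> real \<Rightarrow>
    real ^ 3 \<Rightarrow> real \<Rightarrow> 'w \<Rightarrow> real ^ 3" where
  "sol_S M W l\<^sub>1 l\<^sub>2 l\<^sub>3 \<kappa> \<sigma> v = sde_solution M W (drift_S l\<^sub>1 l\<^sub>2 l\<^sub>3 \<kappa>) (\<sigma> *\<^sub>R f1) v"

definition invariant_S ::
  "'w measure \<Rightarrow> (real \<Rightarrow> 'w \<Rightarrow> real) \<Rightarrow> real \<Rightarrow> real \<Rightarrow> real \<Rightarrow> real \<Rightarrow> real \<Rightarrow>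
    (real ^ 3) measure \<Rightarrow> bool" where
  "invariant_S M W l\<^sub>1 l\<^sub>2 l\<^sub>3 \<kappa> \<sigma> \<mu> \<longleftrightarrow>
     sde_invariant M W (drift_S l\<^sub>1 l\<^sub>2 l\<^sub>3 \<kappa>) (\<sigma> *\<^sub>R f1) \<mu>"

definition invariant_lin ::
  "'w measure \<Rightarrow> (real \<Rightarrow> 'w \<Rightarrow> real) \<Rightarrow> real \<Rightarrow> real \<Rightarrow> real \<Rightarrow> real \<Rightarrow> real \<Rightarrow>
    (real ^ 3) measure \<Rightarrow> bool" where
  "invariant_lin M W l\<^sub>1 l\<^sub>2 l\<^sub>3 \<kappa> \<sigma> \<mu> \<longleftrightarrow>
     sde_invariant M W (\<lambda>z. A_lin l\<^sub>1 l\<^sub>2 l\<^sub>3 z + \<kappa> *\<^sub>R f1) (\<sigma> *\<^sub>R f1) \<mu>"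

definition nu ::
  "'w measure \<Rightarrow> (real \<Rightarrow> 'w \<Rightarrow> real) \<Rightarrow> real \<Rightarrow> real \<Rightarrow> real \<Rightarrow> (real ^ 3) measure" where
  "nu M W l\<^sub>1 \<sigma> \<kappa> =
     law M (\<lambda>\<omega>. (\<kappa> / l\<^sub>1) *\<^sub>R f1
                 + (\<sigma> * wiener_integral M W (\<lambda>t. exp (- l\<^sub>1 * t)) \<omega>) *\<^sub>R f1)"

end

theory Submission
  imports Defs "HOL-Real_Asymp.Real_Asymp"
begin

text \<open>
  The noise is additive and one-dimensional, so the equation is solved path by path: for a fixed
  continuous path \<open>w\<close> a solution \<open>X\<close> of \<open>X t = x + \<integral>\<^sub>0\<^sup>t b (X s) ds + w t g\<close> differs by \<open>w g\<close> from a
  differentiable function, and every estimate is a differential Gronwall inequality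
  (\<open>gronwall_linear\<close>). Coercivity of the drift gives global flows. Probability enters through the Euler
  scheme, a continuous function of finitely many increments of \<open>w\<close> which converges to the flow
  (\<open>euler_converges\<close>). Adaptedness, measurability and the Markov property (\<open>markov\<close>) pass to the limit
  from finitely many independent normal increments. Invariance of \<open>\<mu>\<close> then means \<open>\<integral> P\<^sub>t f d\<mu> = \<integral> f d\<mu>\<close> for bounded
  continuous \<open>f\<close> (\<open>invariant_iff\<close>), and a weak limit of asymptotically invariant measures is invariant
  (\<open>limit_invariant\<close>).

  On the axis \<open>u\<^sub>2 = u\<^sub>3 = 0\<close> the nonlinear and the linear system both reduce to the Ornstein--Uhlenbeck
  equation \<open>dz = (\<kappa> - \<lambda>\<^sub>1 z) dt + \<sigma> dW\<close>. Its laws are Gaussian (\<open>ou_law\<close>) and converge to the law of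
  \<open>\<kappa> / \<lambda>\<^sub>1 + \<sigma> \<integral>\<^sub>0\<^sup>\<infinity> exp (- \<lambda>\<^sub>1 t) dW\<close>; the latter is Gaussian with variance \<open>\<sigma>\<^sup>2 / (2 \<lambda>\<^sub>1)\<close> by the isometry of
  the Wiener integral (\<open>wiener_integral_exp_law\<close>). A limit of laws of one solution is invariant, and
  therefore \<open>\<nu>\<close> is invariant for both systems.

  The threshold compares the mean \<open>\<kappa> / \<lambda>\<^sub>1\<close> of \<open>u\<^sub>1\<close> under \<open>\<nu>\<close> with \<open>min \<lambda>\<^sub>2 \<lambda>\<^sub>3\<close>, since \<open>u\<^sub>1 - \<lambda>\<^sub>i\<close> is the
  growth rate of \<open>u\<^sub>i\<close> for \<open>i = 2, 3\<close>. Below the threshold, \<open>u\<^sub>1\<close> stays below the Ornstein--Uhlenbeck process \<open>z\<close>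
  driven by the same path, so \<open>u\<^sub>2\<close> and \<open>u\<^sub>3\<close> grow at most at a rate whose time average tends to \<open>\<kappa> / \<lambda>\<^sub>1 - min \<lambda>\<^sub>2 \<lambda>\<^sub>3 < 0\<close>.
  Every solution thus approaches \<open>z\<close> in probability (\<open>distance_to_axis\<close>, \<open>S_stable\<close>), its laws converge
  to \<open>\<nu>\<close>, and this leaves no other invariant measure (\<open>stable_imp_unique\<close>).

  Existence of limits rests on second moments that are bounded in time. They come from one short time
  step, during which the damping beats the exponential moment of the noise (\<open>lyapunov_step\<close>), iterated by
  the Markov property (\<open>second_moment_bound\<close>). Bounded second moments give tightness, and Prokhorov's theorem
  is obtained from Helly's theorem on the line by a space-filling curve (\<open>prokhorov\<close>). This yields the
  limits of laws of time averages, and, for time averages of laws, the invariant measures of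
  Krylov and Bogoliubov (\<open>krylov_bogoliubov\<close>).
  Above the threshold the latter are started off the axis, at a point with \<open>u\<^sub>i = 1\<close> for a \<open>\<lambda>\<^sub>i < \<kappa> / \<lambda>\<^sub>1\<close>. If the
  limit were \<open>\<nu>\<close>, the time average of \<open>u\<^sub>1\<close> would tend to \<open>\<kappa> / \<lambda>\<^sub>1 > \<lambda>\<^sub>i\<close> and \<open>u\<^sub>i\<close> would grow exponentially,
  against the bounded second moments (\<open>log_growth\<close>, \<open>another_invariant_measure\<close>).
\<close>

section \<open>A differential Gronwall inequality\<close>

text \<open>With \<open>P\<close> a primitive of \<open>p\<close>, the function \<open>exp (- P) \<phi> - \<integral> exp (- P) q\<close> does not increase. The
  coefficient \<open>p\<close> may have either sign, so the inequality also expresses decay.\<close>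

lemma gronwall_linear:
  fixes \<phi> p q :: "real \<Rightarrow> real"
  assumes "a \<le> t"
    and c\<phi>: "continuous_on {a..t} \<phi>"
    and deriv: "\<And>s. a < s \<Longrightarrow> s < t \<Longrightarrow> \<exists>d. (\<phi> has_real_derivative d) (at s) \<and> d \<le> p s * \<phi> s + q s"
    and cp: "continuous_on {a..t} p" and cq: "continuous_on {a..t} q"
  shows "\<phi> t \<le> exp (integral {a..t} p) * (\<phi> a + integral {a..t} (\<lambda>s. exp (- integral {a..s} p) * q s))"
proof -
  define P where "P s = integral {a..s} p" for s
  define h where "h s = exp (- P s) * q s" for s
  define \<psi> where "\<psi> s = exp (- P s) * \<phi> s - integral {a..s} h" for s
  have cP: "continuous_on {a..t} P"
    unfolding P_def using cp by (intro indefinite_integral_continuous_1 integrable_continuous_real)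
  have ch: "continuous_on {a..t} h"
    unfolding h_def by (intro continuous_intros cP cq)
  have dP: "(P has_real_derivative p s) (at s)" if "a < s" "s < t" for s
  proof -
    have "(P has_real_derivative p s) (at s within {a..t})"
      unfolding P_def using integral_has_real_derivative[OF cp] that by simp
    then show ?thesis using that by (simp add: at_within_Icc_at)
  qed
  have dH: "((\<lambda>s. integral {a..s} h) has_real_derivative h s) (at s)" if "a < s" "s < t" for s
  proof -
    have "((\<lambda>s. integral {a..s} h) has_real_derivative h s) (at s within {a..t})"
      using integral_has_real_derivative[OF ch] that by simp
    then show ?thesis using that by (simp add: at_within_Icc_at)
  qed
  have "\<psi> t \<le> \<psi> a"
  proof (rule DERIV_nonpos_imp_decreasing_open[OF \<open>a \<le> t\<close>])
    show "continuous_on {a..t} \<psi>"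
      unfolding \<psi>_def
      by (intro continuous_intros cP c\<phi> indefinite_integral_continuous_1 integrable_continuous_real ch)
    fix s assume s: "a < s" "s < t"
    obtain d where d: "(\<phi> has_real_derivative d) (at s)" "d \<le> p s * \<phi> s + q s"
      using deriv s by blast
    have "(\<psi> has_real_derivative (exp (- P s) * (- p s) * \<phi> s + exp (- P s) * d - h s)) (at s)"
      unfolding \<psi>_def by (rule derivative_eq_intros dP dH d(1) s refl | simp)+
    moreover have "exp (- P s) * (- p s) * \<phi> s + exp (- P s) * d - h s
        = exp (- P s) * (d - (p s * \<phi> s + q s))"
      unfolding h_def by (simp add: algebra_simps)
    moreover have "\<dots> \<le> 0" using d(2) by (simp add: mult_nonneg_nonpos)
    ultimately show "\<exists>y. (\<psi> has_real_derivative y) (at s) \<and> y \<le> 0" by auto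
  qed
  then have "exp (- P t) * \<phi> t \<le> \<phi> a + integral {a..t} h"
    unfolding \<psi>_def by (simp add: P_def)
  then have "exp (P t) * (exp (- P t) * \<phi> t) \<le> exp (P t) * (\<phi> a + integral {a..t} h)"
    by (simp add: mult_left_mono)
  moreover have "exp (P t) * (exp (- P t) * \<phi> t) = \<phi> t"
    by (simp add: exp_minus)
  ultimately have "\<phi> t \<le> exp (P t) * (\<phi> a + integral {a..t} h)" by simp
  then show ?thesis unfolding h_def P_def .
qed

corollary gronwall_homogeneous:
  fixes \<phi> p :: "real \<Rightarrow> real"
  assumes "a \<le> t" "continuous_on {a..t} \<phi>"
    and "\<And>s. a < s \<Longrightarrow> s < t \<Longrightarrow> \<exists>d. (\<phi> has_real_derivative d) (at s) \<and> d \<le> p s * \<phi> s"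
    and "continuous_on {a..t} p"
  shows "\<phi> t \<le> exp (integral {a..t} p) * \<phi> a"
  using gronwall_linear[of a t \<phi> p "\<lambda>_. 0"] assms by simp

section \<open>Deterministic equations driven by a continuous path\<close>

text \<open>The path \<open>w\<close> may start anywhere, so that \<open>X 0 = x + w 0 g\<close>: a Wiener process starts at \<open>0\<close> only
  almost surely, while solutions are constructed for every outcome.\<close>

definition path_sol :: "('a::euclidean_space \<Rightarrow> 'a) \<Rightarrow> 'a \<Rightarrow> 'a \<Rightarrow> (real \<Rightarrow> real) \<Rightarrow> real \<Rightarrow> (real \<Rightarrow> 'a) \<Rightarrow> bool" where
  "path_sol b g x w T X \<longleftrightarrow> continuous_on {0..T} X \<and>
     (\<forall>t\<in>{0..T}. X t = x + integral {0..t} (\<lambda>s. b (X s)) + w t *\<^sub>R g)"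

lemma path_sol_mono: "path_sol b g x w T X \<Longrightarrow> T' \<le> T \<Longrightarrow> path_sol b g x w T' X"
  unfolding path_sol_def by (auto intro: continuous_on_subset)

lemma continuous_on_atLeast:
  fixes f :: "real \<Rightarrow> 'a::topological_space"
  assumes "\<And>T. T \<ge> a \<Longrightarrow> continuous_on {a..T} f"
  shows "continuous_on {a..} f"
proof -
  have "continuous (at x within {a..}) f" if "x \<in> {a..}" for x
  proof -
    have "continuous (at x within {a..x+1}) f"
      using assms[of "x+1"] that by (auto simp: continuous_on_eq_continuous_within)
    moreover have "at x within {a..x+1} = at x within {a..}"
      by (rule at_within_nhd[of x "{..<x+1}"]) (use that in auto)
    ultimately show ?thesis by simp
  qed
  then show ?thesis by (simp add: continuous_on_eq_continuous_within)
qed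

text \<open>Subtracting the driving path leaves a differentiable function; all estimates are made on it.\<close>

lemma path_sol_has_derivative:
  assumes sol: "path_sol b g x w T X" and b: "continuous_on UNIV b" and s: "0 < s" "s < T"
  shows "((\<lambda>s. X s - w s *\<^sub>R g) has_vector_derivative b (X s)) (at s)"
proof -
  have cX: "continuous_on {0..T} X" using sol by (simp add: path_sol_def)
  have cb: "continuous_on {0..T} (\<lambda>s. b (X s))"
    by (rule continuous_on_compose2[OF b cX]) auto
  have "((\<lambda>u. integral {0..u} (\<lambda>s. b (X s))) has_vector_derivative b (X s)) (at s within {0..T})"
    using integral_has_vector_derivative[OF cb] s by auto
  then have "((\<lambda>u. integral {0..u} (\<lambda>s. b (X s))) has_vector_derivative b (X s)) (at s)"
    using s by (simp add: at_within_Icc_at)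
  then have "((\<lambda>u. x + integral {0..u} (\<lambda>s. b (X s))) has_vector_derivative b (X s)) (at s)"
    by (auto intro!: derivative_eq_intros)
  then show ?thesis
  proof (rule has_vector_derivative_transform_within_open[of _ _ _ "{0<..<T}"])
    fix u assume "u \<in> {0<..<T}"
    then have "X u = x + integral {0..u} (\<lambda>s. b (X s)) + w u *\<^sub>R g"
      using sol by (auto simp: path_sol_def)
    then show "x + integral {0..u} (\<lambda>s. b (X s)) = X u - w u *\<^sub>R g" by simp
  qed (use s in auto)
qed

lemma path_sol_continuous_diff:
  assumes sol: "path_sol b g x w T X" and b: "continuous_on UNIV b"
  shows "continuous_on {0..T} (\<lambda>s. X s - w s *\<^sub>R g)"
proof -
  have cX: "continuous_on {0..T} X" using sol by (simp add: path_sol_def)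
  have cb: "continuous_on {0..T} (\<lambda>s. b (X s))"
    by (rule continuous_on_compose2[OF b cX]) auto
  have "continuous_on {0..T} (\<lambda>u. x + integral {0..u} (\<lambda>s. b (X s)))"
    by (intro continuous_intros indefinite_integral_continuous_1 integrable_continuous_real cb)
  then show ?thesis
    by (rule continuous_on_eq) (use sol in \<open>auto simp: path_sol_def\<close>)
qed

lemma has_real_derivative_inner_self:
  assumes "(Y has_vector_derivative y') (at s)"
  shows "((\<lambda>s. Y s \<bullet> Y s) has_real_derivative 2 * (Y s \<bullet> y')) (at s)"
  using assms unfolding has_vector_derivative_def has_field_derivative_def
  by (auto intro!: derivative_eq_intros simp: fun_eq_iff inner_commute algebra_simps)

text \<open>Picard iteration; in the sup norm weighted by \<open>exp (- 2 K t)\<close>, for a positive Lipschitz constant \<open>K\<close>, every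
  step contracts by the factor \<open>1/2\<close>, on intervals of any length.\<close>

lemma path_sol_exists_lipschitz:
  fixes b :: "'a::euclidean_space \<Rightarrow> 'a"
  assumes L: "L-lipschitz_on UNIV b" and w: "continuous_on {0..T} w" and T: "0 \<le> T"
  shows "\<exists>X. path_sol b g x w T X"
proof -
  \<comment> \<open>The increment by 1 allows division by \<open>K\<close> also if \<open>L = 0\<close>.\<close>
  define K where "K = L + 1"
  have K: "K > 0" using lipschitz_on_nonneg[OF L] by (simp add: K_def)
  have lip: "norm (b y - b z) \<le> K * norm (y - z)" for y z
  proof -
    have "norm (b y - b z) \<le> L * norm (y - z)"
      using lipschitz_onD[OF L, of y z] by (simp add: dist_norm)
    also have "\<dots> \<le> K * norm (y - z)" by (simp add: K_def algebra_simps)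
    finally show ?thesis .
  qed
  have cb: "continuous_on UNIV b" using L by (rule lipschitz_on_continuous_on)
  define h where "h s = w s *\<^sub>R g" for s
  have ch: "continuous_on {0..T} h" unfolding h_def by (intro continuous_intros w)
  define \<Psi> where "\<Psi> Y t = x + integral {0..t} (\<lambda>s. b (Y s + h s))" for Y :: "real \<Rightarrow> 'a" and t
  define Y where "Y n = (\<Psi> ^^ n) (\<lambda>_. x)" for n
  have YS: "Y (Suc n) = \<Psi> (Y n)" for n by (simp add: Y_def)
  have cbY: "continuous_on {0..T} (\<lambda>s. b (Z s + h s))" if "continuous_on {0..T} Z" for Z
    by (rule continuous_on_compose2[OF cb]) (intro continuous_intros that ch, auto)
  have cY: "continuous_on {0..T} (Y n)" for n
  proof (induction n)
    case (Suc n)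
    show ?case unfolding YS \<Psi>_def
      by (intro continuous_intros indefinite_integral_continuous_1 integrable_continuous_real cbY Suc)
  qed (simp add: Y_def)
  have int: "(\<lambda>s. b (Z s + h s)) integrable_on {0..t}"
    if "continuous_on {0..T} Z" "t \<in> {0..T}" for Z t
    by (rule integrable_continuous_real, rule continuous_on_subset[OF cbY[OF that(1)]]) (use that in auto)
  have expint: "integral {0..t} (\<lambda>s. exp (2 * K * s)) \<le> exp (2 * K * t) / (2 * K)"
    "(\<lambda>s. exp (2 * K * s)) integrable_on {0..t}" if "0 \<le> t" for t
  proof -
    have "((\<lambda>s. exp (2 * K * s)) has_integral (exp (2 * K * t) / (2 * K) - exp (2 * K * 0) / (2 * K))) {0..t}"
      by (rule fundamental_theorem_of_calculus[OF that])
         (use K in \<open>auto intro!: derivative_eq_intros simp: has_real_derivative_iff_has_vector_derivative[symmetric]\<close>)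
    then show "integral {0..t} (\<lambda>s. exp (2 * K * s)) \<le> exp (2 * K * t) / (2 * K)"
      "(\<lambda>s. exp (2 * K * s)) integrable_on {0..t}" using K by (auto simp: has_integral_iff)
  qed
  have step: "norm (\<Psi> U t - \<Psi> V t) \<le> c / 2 * exp (2 * K * t)"
    if U: "continuous_on {0..T} U" and V: "continuous_on {0..T} V" and t: "t \<in> {0..T}"
      and c: "c \<ge> 0" and d: "\<And>s. s \<in> {0..T} \<Longrightarrow> norm (U s - V s) \<le> c * exp (2 * K * s)" for U V t c
  proof -
    have "\<Psi> U t - \<Psi> V t = integral {0..t} (\<lambda>s. b (U s + h s) - b (V s + h s))"
      unfolding \<Psi>_def using int[OF U t] int[OF V t] by (simp add: integral_diff)
    also have "norm \<dots> \<le> integral {0..t} (\<lambda>s. K * c * exp (2 * K * s))"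
    proof (rule integral_norm_bound_integral)
      show "(\<lambda>s. b (U s + h s) - b (V s + h s)) integrable_on {0..t}"
        using int[OF U t] int[OF V t] by (rule integrable_diff)
      show "(\<lambda>s. K * c * exp (2 * K * s)) integrable_on {0..t}"
        using expint(2)[of t] t by (intro integrable_on_mult_right) auto
      fix s assume s: "s \<in> {0..t}"
      have "norm (b (U s + h s) - b (V s + h s)) \<le> K * norm (U s - V s)"
        using lip[of "U s + h s" "V s + h s"] by simp
      also have "\<dots> \<le> K * (c * exp (2 * K * s))"
        using d[of s] s t K by (intro mult_left_mono) auto
      finally show "norm (b (U s + h s) - b (V s + h s)) \<le> K * c * exp (2 * K * s)" by simp
    qed
    also have "\<dots> = K * c * integral {0..t} (\<lambda>s. exp (2 * K * s))" by simp
    also have "\<dots> \<le> K * c * (exp (2 * K * t) / (2 * K))"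
      using expint(1)[of t] t K c by (intro mult_left_mono) auto
    also have "\<dots> = c / 2 * exp (2 * K * t)" using K by simp
    finally show ?thesis .
  qed
  obtain D where D: "D \<ge> 0" "\<And>s. s \<in> {0..T} \<Longrightarrow> norm (Y 1 s - Y 0 s) \<le> D"
  proof -
    have "compact ((\<lambda>s. Y 1 s - Y 0 s) ` {0..T})"
      by (intro compact_continuous_image continuous_intros cY) auto
    then have "bounded ((\<lambda>s. Y 1 s - Y 0 s) ` {0..T})" by (rule compact_imp_bounded)
    then obtain D where "\<forall>s\<in>{0..T}. norm (Y 1 s - Y 0 s) \<le> D"
      unfolding bounded_iff by auto
    then show ?thesis by (intro that[of "max D 0"]) (auto simp: le_max_iff_disj)
  qed
  have bound: "norm (Y (Suc n) t - Y n t) \<le> D / 2 ^ n * exp (2 * K * t)" if "t \<in> {0..T}" for n t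
    using that
  proof (induction n arbitrary: t)
    case 0
    have "D * 1 \<le> D * exp (2 * K * t)" using D(1) K 0 by (intro mult_left_mono) auto
    then show ?case using D(2)[OF 0] by simp
  next
    case (Suc n)
    show ?case
      using step[OF cY cY Suc.prems, of "D / 2 ^ n" "Suc n" n] Suc.IH D(1) by (simp add: YS)
  qed
  have uc: "uniform_limit {0..T} (\<lambda>n t. \<Sum>i<n. Y (Suc i) t - Y i t) (\<lambda>t. suminf (\<lambda>i. Y (Suc i) t - Y i t)) sequentially"
  proof (rule Weierstrass_m_test)
    fix n t assume t: "t \<in> {0..T}"
    have "norm (Y (Suc n) t - Y n t) \<le> D / 2 ^ n * exp (2 * K * t)" by (rule bound[OF t])
    also have "\<dots> \<le> D / 2 ^ n * exp (2 * K * T)" using t K D(1) by (intro mult_left_mono) auto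
    finally show "norm (Y (Suc n) t - Y n t) \<le> D * exp (2 * K * T) * (1/2) ^ n"
      by (simp add: power_divide field_simps)
  qed (intro summable_mult summable_geometric, simp)
  define Z where "Z t = x + suminf (\<lambda>i. Y (Suc i) t - Y i t)" for t
  have Ysum: "Y n t = x + (\<Sum>i<n. Y (Suc i) t - Y i t)" for n t
    using sum_lessThan_telescope[of "\<lambda>i. Y i t" n] by (simp add: Y_def)
  have ul: "uniform_limit {0..T} Y Z sequentially"
  proof -
    have "uniform_limit {0..T} (\<lambda>n t. x + (\<Sum>i<n. Y (Suc i) t - Y i t)) Z sequentially"
      unfolding Z_def by (intro uniform_limit_intros uc)
    then show ?thesis by (simp add: Ysum[symmetric])
  qed
  have cZ: "continuous_on {0..T} Z"
    by (rule uniform_limit_theorem[OF always_eventually ul]) (auto intro: cY)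
  have fix_pt: "Z t = \<Psi> Z t" if t: "t \<in> {0..T}" for t
  proof (rule LIMSEQ_unique)
    show "(\<lambda>n. Y (Suc n) t) \<longlonglongrightarrow> Z t"
      using tendsto_uniform_limitI[OF ul t] by (rule LIMSEQ_Suc)
    show "(\<lambda>n. Y (Suc n) t) \<longlonglongrightarrow> \<Psi> Z t"
    proof (rule LIMSEQ_I)
      fix e :: real assume e: "e > 0"
      define c where "c = e / exp (2 * K * T)"
      have c: "c > 0" using e by (simp add: c_def)
      obtain N where N: "\<And>n s. n \<ge> N \<Longrightarrow> s \<in> {0..T} \<Longrightarrow> dist (Y n s) (Z s) < c"
        using uniform_limitD[OF ul c] unfolding eventually_sequentially by blast
      have "norm (Y (Suc n) t - \<Psi> Z t) < e" if n: "n \<ge> N" for n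
      proof -
        have "norm (Y (Suc n) t - \<Psi> Z t) \<le> c / 2 * exp (2 * K * t)"
          unfolding YS
        proof (rule step[OF cY cZ t])
          fix s assume s: "s \<in> {0..T}"
          have "norm (Y n s - Z s) \<le> c * 1" using N[OF n s] by (simp add: dist_norm)
          also have "\<dots> \<le> c * exp (2 * K * s)" using s K c by (intro mult_left_mono) auto
          finally show "norm (Y n s - Z s) \<le> c * exp (2 * K * s)" .
        qed (use c in auto)
        also have "\<dots> \<le> c / 2 * exp (2 * K * T)" using t K c by (intro mult_left_mono) auto
        also have "\<dots> < e" using e by (simp add: c_def)
        finally show ?thesis .
      qed
      then show "\<exists>N. \<forall>n\<ge>N. norm (Y (Suc n) t - \<Psi> Z t) < e" by blast
    qed
  qed
  have "path_sol b g x w T (\<lambda>t. Z t + h t)"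
    unfolding path_sol_def
    using fix_pt by (auto intro!: continuous_intros cZ ch simp: \<Psi>_def h_def[symmetric] algebra_simps)
  then show ?thesis by blast
qed

section \<open>Coercive drifts: global flows\<close>

text \<open>The coercivity condition is stated for the drift seen along \<open>y = X - w g\<close>, uniformly over
  bounded values \<open>\<beta>\<close> of the driving path: this is what rules out explosion for one fixed path.\<close>

locale coercive_drift =
  fixes b :: "'a::euclidean_space \<Rightarrow> 'a" and g :: 'a
  assumes local_lipschitz: "\<And>R. \<exists>L. L-lipschitz_on (cball 0 R) b"
    and coercive: "\<And>B. \<exists>C. \<forall>y \<beta>. \<bar>\<beta>\<bar> \<le> B \<longrightarrow> y \<bullet> b (y + \<beta> *\<^sub>R g) \<le> C * (1 + y \<bullet> y)"
begin

lemma continuous_drift: "continuous_on UNIV b"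
proof -
  have "continuous (at x) b" for x
  proof -
    obtain L where "L-lipschitz_on (cball 0 (norm x + 1)) b" using local_lipschitz by blast
    then have "continuous_on (cball 0 (norm x + 1)) b" by (rule lipschitz_on_continuous_on)
    then have "continuous_on (ball 0 (norm x + 1)) b"
      by (rule continuous_on_subset) auto
    then show ?thesis by (simp add: continuous_on_eq_continuous_at)
  qed
  then show ?thesis by (simp add: continuous_on_eq_continuous_at)
qed

text \<open>Gronwall for \<open>1 + |X - w g|\<^sup>2\<close>. The bound depends on the path only through \<open>B\<close> and is uniform over the
  interval of existence, which excludes explosion.\<close>

lemma a_priori_bound:
  "\<exists>K. \<forall>x w T' X. norm x \<le> r \<longrightarrow> 0 \<le> T' \<longrightarrow> T' \<le> T \<longrightarrow> (\<forall>s\<in>{0..T}. \<bar>w s\<bar> \<le> B) \<longrightarrow> path_sol b g x w T' X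
     \<longrightarrow> (\<forall>t\<in>{0..T'}. norm (X t) \<le> K)"
proof -
  obtain C0 where C0: "\<And>y \<beta>. \<bar>\<beta>\<bar> \<le> B \<Longrightarrow> y \<bullet> b (y + \<beta> *\<^sub>R g) \<le> C0 * (1 + y \<bullet> y)"
    using coercive[of B] by blast
  define C where "C = max C0 0"
  have C: "y \<bullet> b (y + \<beta> *\<^sub>R g) \<le> C * (1 + y \<bullet> y)" if "\<bar>\<beta>\<bar> \<le> B" for y \<beta>
  proof -
    have "C0 * (1 + y \<bullet> y) \<le> C * (1 + y \<bullet> y)" by (intro mult_right_mono) (auto simp: C_def add_nonneg_nonneg)
    then show ?thesis using C0[OF that, of y] by linarith
  qed
  define Q where "Q = exp (2 * C * T) * (1 + r^2)"
  define K where "K = sqrt Q + B * norm g"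
  have "norm (X t) \<le> K"
    if x: "norm x \<le> r" and T': "0 \<le> T'" "T' \<le> T" and w: "\<forall>s\<in>{0..T}. \<bar>w s\<bar> \<le> B"
      and sol: "path_sol b g x w T' X" and t: "t \<in> {0..T'}" for x w T' X t
  proof -
    define Y where "Y s = X s - w s *\<^sub>R g" for s
    have Y0: "Y 0 = x" using sol T' by (auto simp: Y_def path_sol_def)
    have cY: "continuous_on {0..t} Y"
      using path_sol_continuous_diff[OF path_sol_mono[OF sol, of t] continuous_drift] t by (simp add: Y_def)
    have "1 + Y t \<bullet> Y t \<le> exp (integral {0..t} (\<lambda>_. 2 * C)) * (1 + Y 0 \<bullet> Y 0)"
    proof (rule gronwall_homogeneous)
      show "continuous_on {0..t} (\<lambda>s. 1 + Y s \<bullet> Y s)" by (intro continuous_intros cY)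
      fix s assume s: "0 < s" "s < t"
      have "(Y has_vector_derivative b (X s)) (at s)"
        unfolding Y_def using s t by (intro path_sol_has_derivative[OF sol continuous_drift]) auto
      then have d: "((\<lambda>s. 1 + Y s \<bullet> Y s) has_real_derivative 2 * (Y s \<bullet> b (X s))) (at s)"
        by (auto intro!: derivative_eq_intros has_real_derivative_inner_self)
      have "X s = Y s + w s *\<^sub>R g" by (simp add: Y_def)
      then have "Y s \<bullet> b (X s) \<le> C * (1 + Y s \<bullet> Y s)"
        using C[of "w s" "Y s"] w s t T' by auto
      then show "\<exists>d. ((\<lambda>s. 1 + Y s \<bullet> Y s) has_real_derivative d) (at s) \<and> d \<le> 2 * C * (1 + Y s \<bullet> Y s)"
        using d by (intro exI[of _ "2 * (Y s \<bullet> b (X s))"]) auto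
    qed (use t in auto)
    also have "\<dots> \<le> Q" unfolding Q_def Y0
    proof (intro mult_mono add_mono)
      have "t * C \<le> T * C" using t T' by (intro mult_right_mono) (auto simp: C_def)
      then show "exp (integral {0..t} (\<lambda>_. 2 * C)) \<le> exp (2 * C * T)" using t by (simp add: mult.commute)
      show "x \<bullet> x \<le> r^2" using x by (simp add: power2_norm_eq_inner[symmetric] power_mono)
    qed auto
    finally have "(norm (Y t))^2 \<le> Q" by (simp add: power2_norm_eq_inner)
    then have "norm (Y t) \<le> sqrt Q" by (rule real_le_rsqrt)
    moreover have "norm (w t *\<^sub>R g) \<le> B * norm g" using w t T' by (auto intro!: mult_right_mono)
    moreover have "X t = Y t + w t *\<^sub>R g" by (simp add: Y_def)
    ultimately show ?thesis unfolding K_def using norm_triangle_ineq[of "Y t" "w t *\<^sub>R g"] by simp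
  qed
  then show ?thesis by blast
qed

lemma bounded_driver:
  fixes w :: "real \<Rightarrow> real"
  assumes "continuous_on {0..} w"
  obtains B where "B \<ge> 0" "\<And>s. s \<in> {0..T} \<Longrightarrow> \<bar>w s\<bar> \<le> B"
proof -
  have "continuous_on {0..T} w" using assms by (rule continuous_on_subset) auto
  then have "compact (w ` {0..T})" by (rule compact_continuous_image) auto
  then have "bounded (w ` {0..T})" by (rule compact_imp_bounded)
  then obtain B where "\<forall>s\<in>{0..T}. \<bar>w s\<bar> \<le> B"
    unfolding bounded_iff by auto
  then show ?thesis by (intro that[of "max B 0"]) (auto simp: le_max_iff_disj)
qed

lemma solutions_bounded:
  assumes w: "continuous_on {0..} w"
  obtains K where "K \<ge> 0"
    "\<And>x T' X t. norm x \<le> r \<Longrightarrow> 0 \<le> T' \<Longrightarrow> T' \<le> T \<Longrightarrow> path_sol b g x w T' X \<Longrightarrow> t \<in> {0..T'} \<Longrightarrow> norm (X t) \<le> K"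
proof -
  obtain B where "B \<ge> 0" and B: "\<And>s. s \<in> {0..T} \<Longrightarrow> \<bar>w s\<bar> \<le> B" using bounded_driver[OF w, of T] by blast
  obtain K where K: "\<And>x w T' X. norm x \<le> r \<Longrightarrow> 0 \<le> T' \<Longrightarrow> T' \<le> T \<Longrightarrow> (\<forall>s\<in>{0..T}. \<bar>w s\<bar> \<le> B) \<Longrightarrow> path_sol b g x w T' X
     \<Longrightarrow> (\<forall>t\<in>{0..T'}. norm (X t) \<le> K)" using a_priori_bound[of r T B] by blast
  show ?thesis
  proof (rule that[of "max K 0"])
    fix x T' X t assume *: "norm x \<le> r" "0 \<le> T'" "T' \<le> T" "path_sol b g x w T' X" "t \<in> {0..T'}"
    show "norm (X t) \<le> max K 0" using K[OF *(1-3) _ *(4)] B *(5) by (auto simp: le_max_iff_disj)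
  qed auto
qed

text \<open>The driving path cancels in the difference of two solutions, which is therefore differentiable.\<close>

lemma dependence_on_initial_value:
  assumes X: "path_sol b g x w T X" and X': "path_sol b g x' w T X'" and T: "0 \<le> T"
    and K: "\<And>t. t \<in> {0..T} \<Longrightarrow> norm (X t) \<le> K" "\<And>t. t \<in> {0..T} \<Longrightarrow> norm (X' t) \<le> K"
    and L: "L-lipschitz_on (cball 0 K) b"
  shows "norm (X T - X' T) \<le> exp (L * T) * norm (x - x')"
proof -
  define D where "D s = X s - X' s" for s
  have D0: "D 0 = x - x'" using X X' T by (auto simp: D_def path_sol_def)
  have cD: "continuous_on {0..T} D" using X X' unfolding D_def path_sol_def by (intro continuous_intros) auto
  have "D T \<bullet> D T \<le> exp (integral {0..T} (\<lambda>_. 2 * L)) * (D 0 \<bullet> D 0)"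
  proof (rule gronwall_homogeneous[OF T])
    show "continuous_on {0..T} (\<lambda>s. D s \<bullet> D s)" by (intro continuous_intros cD)
    fix s assume s: "0 < s" "s < T"
    have "((\<lambda>s. (X s - w s *\<^sub>R g) - (X' s - w s *\<^sub>R g)) has_vector_derivative b (X s) - b (X' s)) (at s)"
      by (intro has_vector_derivative_diff path_sol_has_derivative[OF X continuous_drift s]
          path_sol_has_derivative[OF X' continuous_drift s])
    then have "(D has_vector_derivative b (X s) - b (X' s)) (at s)" by (simp add: D_def[abs_def])
    then have d: "((\<lambda>s. D s \<bullet> D s) has_real_derivative 2 * (D s \<bullet> (b (X s) - b (X' s)))) (at s)"
      by (rule has_real_derivative_inner_self)
    have "D s \<bullet> (b (X s) - b (X' s)) \<le> norm (D s) * norm (b (X s) - b (X' s))" by (rule norm_cauchy_schwarz)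
    also have "\<dots> \<le> norm (D s) * (L * norm (X s - X' s))"
      using lipschitz_onD[OF L, of "X s" "X' s"] K s by (intro mult_left_mono) (auto simp: dist_norm)
    also have "\<dots> = L * (D s \<bullet> D s)" by (simp add: D_def power2_norm_eq_inner[symmetric] power2_eq_square)
    finally show "\<exists>d. ((\<lambda>s. D s \<bullet> D s) has_real_derivative d) (at s) \<and> d \<le> 2 * L * (D s \<bullet> D s)"
      using d by (intro exI[of _ "2 * (D s \<bullet> (b (X s) - b (X' s)))"]) auto
  qed auto
  also have "\<dots> = (exp (L * T) * norm (x - x'))^2"
    using T by (simp add: D0 power2_norm_eq_inner power_mult_distrib exp_double[symmetric] mult_ac)
  finally have "(norm (D T))^2 \<le> (exp (L * T) * norm (x - x'))^2" by (simp add: power2_norm_eq_inner)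
  then show ?thesis unfolding D_def by (rule power2_le_imp_le) auto
qed

lemma path_sol_unique:
  assumes X: "path_sol b g x w T X" and X': "path_sol b g x w T X'" and t: "t \<in> {0..T}"
  shows "X t = X' t"
proof -
  have "bounded (X ` {0..T})" "bounded (X' ` {0..T})"
    using conjunct1[OF X[unfolded path_sol_def]] conjunct1[OF X'[unfolded path_sol_def]]
    by (intro compact_imp_bounded compact_continuous_image; simp)+
  then obtain K1 K2 where K: "\<forall>s\<in>{0..T}. norm (X s) \<le> K1" "\<forall>s\<in>{0..T}. norm (X' s) \<le> K2"
    unfolding bounded_iff by auto
  define K where "K = max K1 K2"
  obtain L where L: "L-lipschitz_on (cball 0 K) b" using local_lipschitz by blast
  have "norm (X t - X' t) \<le> exp (L * t) * norm (x - x)"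
    by (rule dependence_on_initial_value[OF path_sol_mono[OF X] path_sol_mono[OF X'] _ _ _ L])
       (use t K in \<open>auto simp: K_def le_max_iff_disj\<close>)
  then show ?thesis by simp
qed

text \<open>Up to the first exit from a ball a solution for the truncated drift solves the original
  equation, so the a priori bound \<open>K\<close> holds until that exit; the radius \<open>K + 1\<close> is then never reached.\<close>

lemma path_sol_exists:
  assumes w: "continuous_on {0..} w" and T: "0 \<le> T"
  shows "\<exists>X. path_sol b g x w T X"
proof -
  obtain K where K: "K \<ge> 0" "\<And>T' X t. 0 \<le> T' \<Longrightarrow> T' \<le> T \<Longrightarrow> path_sol b g x w T' X \<Longrightarrow> t \<in> {0..T'} \<Longrightarrow> norm (X t) \<le> K"
    using solutions_bounded[OF w, of "norm x" T] by (metis order_refl)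
  define \<pi> where "\<pi> = closest_point (cball (0::'a) (K + 1))"
  have ne: "cball (0::'a) (K + 1) \<noteq> {}" using K(1) by auto
  obtain L where L: "L-lipschitz_on (cball 0 (K + 1)) b" using local_lipschitz by blast
  have \<pi>_id: "\<pi> y = y" if "norm y \<le> K + 1" for y
    unfolding \<pi>_def by (rule closest_point_self) (use that in auto)
  have \<pi>_in: "\<pi> y \<in> cball 0 (K + 1)" for y
    unfolding \<pi>_def by (rule closest_point_in_set) (use ne in auto)
  have "L-lipschitz_on UNIV (\<lambda>y. b (\<pi> y))"
  proof (rule lipschitz_onI)
    fix y z
    have "dist (b (\<pi> y)) (b (\<pi> z)) \<le> L * dist (\<pi> y) (\<pi> z)" by (rule lipschitz_onD[OF L]) (rule \<pi>_in)+
    also have "\<dots> \<le> L * dist y z" unfolding \<pi>_def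
      by (intro mult_left_mono closest_point_lipschitz lipschitz_on_nonneg[OF L]) (use ne in auto)
    finally show "dist (b (\<pi> y)) (b (\<pi> z)) \<le> L * dist y z" .
  qed (rule lipschitz_on_nonneg[OF L])
  moreover have "continuous_on {0..T} w" using w by (rule continuous_on_subset) auto
  ultimately obtain X where X: "path_sol (\<lambda>y. b (\<pi> y)) g x w T X"
    using path_sol_exists_lipschitz[OF _ _ T] by blast
  have cX: "continuous_on {0..T} X" using X by (simp add: path_sol_def)
  have until: "path_sol b g x w T' X" if "0 \<le> T'" "T' \<le> T" "\<forall>s\<in>{0..T'}. norm (X s) \<le> K + 1" for T'
    unfolding path_sol_def
  proof (intro conjI ballI)
    show "continuous_on {0..T'} X" using cX by (rule continuous_on_subset) (use that in auto)
    fix t assume t: "t \<in> {0..T'}"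
    have "integral {0..t} (\<lambda>s. b (\<pi> (X s))) = integral {0..t} (\<lambda>s. b (X s))"
      by (rule integral_cong) (use t that(3) \<pi>_id in auto)
    then show "X t = x + integral {0..t} (\<lambda>s. b (X s)) + w t *\<^sub>R g"
      using X t that by (auto simp: path_sol_def)
  qed
  have "\<forall>s\<in>{0..T}. norm (X s) \<le> K + 1"
  proof (rule ccontr)
    assume "\<not> ?thesis"
    then obtain s1 where s1: "s1 \<in> {0..T}" "norm (X s1) > K + 1" by force
    define A where "A = {s\<in>{0..T}. norm (X s) \<ge> K + 1}"
    have "closed A"
    proof -
      have "closed ({0..T} \<inter> (\<lambda>s. norm (X s)) -` {K + 1..})"
        by (intro continuous_closed_preimage continuous_intros cX)
      moreover have "{0..T} \<inter> (\<lambda>s. norm (X s)) -` {K + 1..} = A" by (auto simp: A_def)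
      ultimately show ?thesis by simp
    qed
    moreover have "A \<noteq> {}" using s1 by (auto simp: A_def)
    moreover have bddA: "bdd_below A" unfolding A_def by (intro bdd_belowI[of _ 0]) auto
    ultimately have inA: "Inf A \<in> A" by (simp add: closed_contains_Inf)
    define \<tau> where "\<tau> = Inf A"
    have \<tau>: "0 \<le> \<tau>" "\<tau> \<le> T" "norm (X \<tau>) \<ge> K + 1" using inA by (auto simp: A_def \<tau>_def)
    have before: "norm (X s) < K + 1" if "0 \<le> s" "s < \<tau>" for s
    proof (rule ccontr)
      assume "\<not> ?thesis"
      then have "s \<in> A" using that \<tau> by (auto simp: A_def)
      then have "\<tau> \<le> s" unfolding \<tau>_def by (rule cInf_lower[OF _ bddA])
      then show False using that by simp
    qed
    have "norm (X \<tau>) \<le> K + 1"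
    proof (cases "\<tau> = 0")
      case True
      have "path_sol b g x w 0 (\<lambda>_. X 0)" using X T by (auto simp: path_sol_def)
      then have "norm (X 0) \<le> K" using K(2)[of 0 "\<lambda>_. X 0" 0] T by auto
      then show ?thesis using True by simp
    next
      case False
      have "continuous_on {0..\<tau>} (\<lambda>s. norm (X s))"
        by (intro continuous_intros continuous_on_subset[OF cX]) (use \<tau> in auto)
      moreover have "closure {0..<\<tau>} = {0..\<tau>}" using \<tau> False by (simp add: closure_atLeastLessThan)
      ultimately show ?thesis
        using before \<tau> by (intro continuous_le_on_closure[of "{0..<\<tau>}" "\<lambda>s. norm (X s)" \<tau> "K + 1"]) (auto intro: less_imp_le)
    qed
    then have "\<forall>s\<in>{0..\<tau>}. norm (X s) \<le> K + 1" using before by (force simp: le_less)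
    then have "norm (X \<tau>) \<le> K" using K(2)[OF \<tau>(1,2) until[OF \<tau>(1,2)]] \<tau> by auto
    then show False using \<tau>(3) by simp
  qed
  then show ?thesis using until[OF T order_refl] by blast
qed

definition flow :: "'a \<Rightarrow> (real \<Rightarrow> real) \<Rightarrow> real \<Rightarrow> 'a" where
  "flow x w = (SOME X. \<forall>T\<ge>0. path_sol b g x w T X)"

lemma flow_path_sol:
  assumes w: "continuous_on {0..} w"
  shows "path_sol b g x w T (flow x w)"
proof -
  have "\<forall>n::nat. \<exists>X. path_sol b g x w (real n) X" using path_sol_exists[OF w] by auto
  then obtain X where X: "\<And>n::nat. path_sol b g x w (real n) (X n)" by metis
  define Z where "Z t = X (nat \<lceil>t\<rceil>) t" for t
  have Z_eq: "Z t = X n t" if "0 \<le> t" "t \<le> real n" for t n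
  proof -
    have "nat \<lceil>t\<rceil> \<le> n" using that by (simp add: ceiling_le_iff nat_le_iff)
    then have "path_sol b g x w (real (nat \<lceil>t\<rceil>)) (X n)" by (intro path_sol_mono[OF X[of n]]) auto
    from path_sol_unique[OF X this, of t] show ?thesis using that by (simp add: Z_def of_nat_ceiling)
  qed
  have "path_sol b g x w T Z" for T
  proof -
    obtain n :: nat where n: "T \<le> real n" using real_arch_simple by blast
    have sol: "path_sol b g x w T (X n)" using X[of n] n by (rule path_sol_mono)
    show ?thesis unfolding path_sol_def
    proof (intro conjI ballI)
      show "continuous_on {0..T} Z"
      proof (rule continuous_on_eq[of _ "X n"])
        show "continuous_on {0..T} (X n)" using sol by (simp add: path_sol_def)
        show "X n s = Z s" if "s \<in> {0..T}" for s using Z_eq[of s n] that n by simp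
      qed
      fix t assume t: "t \<in> {0..T}"
      have "integral {0..t} (\<lambda>s. b (X n s)) = integral {0..t} (\<lambda>s. b (Z s))"
        using Z_eq[of _ n] t n by (intro integral_cong) simp
      then show "Z t = x + integral {0..t} (\<lambda>s. b (Z s)) + w t *\<^sub>R g"
        using sol t n Z_eq[of t n] by (auto simp: path_sol_def)
    qed
  qed
  then have "\<forall>T\<ge>0. path_sol b g x w T (flow x w)"
    unfolding flow_def by (intro someI[of "\<lambda>X. \<forall>T\<ge>0. path_sol b g x w T X" Z]) blast
  then have "path_sol b g x w (max T 0) (flow x w)" by auto
  then show ?thesis by (rule path_sol_mono) auto
qed

lemma flow_unique:
  assumes w: "continuous_on {0..} w" and X: "path_sol b g x w T X" and t: "0 \<le> t" "t \<le> T"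
  shows "flow x w t = X t"
  using path_sol_unique[OF flow_path_sol[OF w] X, of t] t by simp

lemma flow_eq:
  assumes w: "continuous_on {0..} w" and t: "0 \<le> t"
  shows "flow x w t = x + integral {0..t} (\<lambda>s. b (flow x w s)) + w t *\<^sub>R g"
  using flow_path_sol[OF w, of x t] t by (auto simp: path_sol_def)

lemma flow_continuous:
  assumes w: "continuous_on {0..} w"
  shows "continuous_on {0..} (flow x w)"
  by (rule continuous_on_atLeast) (use flow_path_sol[OF w] in \<open>auto simp: path_sol_def\<close>)

lemma flow_continuous_initial:
  assumes w: "continuous_on {0..} w" and t: "0 \<le> t"
  shows "continuous_on UNIV (\<lambda>x. flow x w t)"
proof -
  have "((\<lambda>y. flow y w t) \<longlongrightarrow> flow x w t) (at x)" for x
  proof -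
    obtain K where K: "\<And>y T' X s. norm y \<le> norm x + 1 \<Longrightarrow> 0 \<le> T' \<Longrightarrow> T' \<le> t \<Longrightarrow> path_sol b g y w T' X \<Longrightarrow> s \<in> {0..T'} \<Longrightarrow> norm (X s) \<le> K"
      using solutions_bounded[OF w, of "norm x + 1" t] by metis
    \<comment> \<open>Solutions from a neighbourhood of \<open>x\<close> share one bound, hence one Lipschitz constant.\<close>
    obtain L where L: "L-lipschitz_on (cball 0 K) b" using local_lipschitz by blast
    have bd: "norm (flow y w t - flow x w t) \<le> exp (L * t) * norm (y - x)" if "norm (y - x) < 1" for y
    proof -
      have "norm y \<le> norm x + 1" using that norm_triangle_ineq2[of y x] by simp
      then show ?thesis
        by (intro dependence_on_initial_value[OF flow_path_sol[OF w] flow_path_sol[OF w] t _ _ L] K[OF _ t order_refl flow_path_sol[OF w]])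
           auto
    qed
    have "\<forall>\<^sub>F y in at x. norm (flow y w t - flow x w t) \<le> exp (L * t) * norm (y - x)"
      using bd unfolding eventually_at by (auto intro!: exI[of _ 1] simp: dist_norm)
    moreover have "((\<lambda>y. exp (L * t) * norm (y - x)) \<longlongrightarrow> 0) (at x)"
      by (intro tendsto_eq_intros) (auto simp: intro!: tendsto_mult_right_zero tendsto_norm_zero LIM_zero tendsto_ident_at)
    ultimately have "((\<lambda>y. flow y w t - flow x w t) \<longlongrightarrow> 0) (at x)"
      by (rule Lim_null_comparison)
    then show ?thesis by (simp add: LIM_zero_iff)
  qed
  then show ?thesis by (simp add: continuous_on_def)
qed

text \<open>Restarting at time \<open>s\<close> sees only the increments of the path after \<open>s\<close>; this is the pathwise root of the
  Markov property.\<close>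

lemma flow_shift:
  assumes w: "continuous_on {0..} w" and s: "0 \<le> s" and t: "0 \<le> t"
  shows "flow x w (s + t) = flow (flow x w s) (\<lambda>r. w (s + r) - w s) t"
proof (rule flow_unique[symmetric])
  have cw: "continuous_on {0..} (\<lambda>r. w (s + r))"
    by (rule continuous_on_compose2[OF w]) (use s in \<open>auto intro!: continuous_intros\<close>)
  then show "continuous_on {0..} (\<lambda>r. w (s + r) - w s)" by (intro continuous_intros)
  have cf: "continuous_on {0..} (flow x w)" by (rule flow_continuous[OF w])
  have cb: "continuous_on {0..} (\<lambda>r. b (flow x w r))"
    by (rule continuous_on_compose2[OF continuous_drift cf]) auto
  show "path_sol b g (flow x w s) (\<lambda>r. w (s + r) - w s) t (\<lambda>r. flow x w (s + r))"
    unfolding path_sol_def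
  proof (intro conjI ballI)
    show "continuous_on {0..t} (\<lambda>r. flow x w (s + r))"
      by (rule continuous_on_compose2[OF cf]) (use s in \<open>auto intro!: continuous_intros\<close>)
    fix r assume r: "r \<in> {0..t}"
    have int: "(\<lambda>r. b (flow x w r)) integrable_on {0..s + r}"
      by (rule integrable_continuous_real, rule continuous_on_subset[OF cb]) auto
    have "integral {0..s} (\<lambda>r. b (flow x w r)) + integral {s..s + r} (\<lambda>r. b (flow x w r)) = integral {0..s + r} (\<lambda>r. b (flow x w r))"
      by (rule Henstock_Kurzweil_Integration.integral_combine[OF _ _ int]) (use s r in auto)
    moreover have "integral {0..r} (\<lambda>u. b (flow x w (s + u))) = integral {s..s + r} (\<lambda>u. b (flow x w u))"
      using integral_shift_Icc_real[of 0 r "\<lambda>r. b (flow x w r)" s]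
      by (simp add: add.commute comp_def)
    moreover have "flow x w (s + r) = x + integral {0..s + r} (\<lambda>s. b (flow x w s)) + w (s + r) *\<^sub>R g"
      using s r by (intro flow_eq[OF w]) auto
    moreover have "flow x w s = x + integral {0..s} (\<lambda>s. b (flow x w s)) + w s *\<^sub>R g"
      using s by (intro flow_eq[OF w]) auto
    ultimately show "flow x w (s + r) = flow x w s + integral {0..r} (\<lambda>u. b (flow x w (s + u))) + (w (s + r) - w s) *\<^sub>R g"
      by (simp add: algebra_simps)
  qed
qed (use t in auto)

text \<open>The explicit Euler scheme with step \<open>\<delta>\<close> and driver increments \<open>\<xi>\<close>. It depends on finitely many
  increments only, and this is how measurability, independence and the Markov property reach the flow.\<close>

fun euler :: "real \<Rightarrow> 'a \<Rightarrow> (nat \<Rightarrow> real) \<Rightarrow> nat \<Rightarrow> 'a" where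
  "euler \<delta> y \<xi> 0 = y"
| "euler \<delta> y \<xi> (Suc i) = euler \<delta> y \<xi> i + \<delta> *\<^sub>R b (euler \<delta> y \<xi> i) + \<xi> i *\<^sub>R g"

lemma euler_cong: "(\<And>i. i < n \<Longrightarrow> \<xi> i = \<xi>' i) \<Longrightarrow> euler \<delta> y \<xi> n = euler \<delta> y \<xi>' n"
  by (induction n) auto

text \<open>The usual recursion \<open>e\<^sub>i\<^sub>+\<^sub>1 \<le> (1 + L \<delta>) e\<^sub>i + L \<delta> \<eta>\<close>. As the drift is Lipschitz on balls only, the induction
  also has to keep the scheme in the ball of radius \<open>K + 1\<close>: the error stays below \<open>1\<close> because
  \<open>\<eta> exp (L t) \<le> 1\<close>.\<close>

lemma euler_error:
  assumes w: "continuous_on {0..} w" and t: "0 \<le> t" and n: "n > 0"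
    and K: "\<And>s. s \<in> {0..t} \<Longrightarrow> norm (flow x w s) \<le> K"
    and L: "L-lipschitz_on (cball 0 (K + 1)) b"
    and \<eta>: "\<And>r s. r \<in> {0..t} \<Longrightarrow> s \<in> {0..t} \<Longrightarrow> \<bar>r - s\<bar> \<le> t / n \<Longrightarrow> norm (flow x w r - flow x w s) \<le> \<eta>"
    and \<eta>1: "\<eta> \<ge> 0" "\<eta> * exp (L * t) \<le> 1"
  shows "norm (flow x w t - euler (t / n) (x + w 0 *\<^sub>R g) (\<lambda>i. w (Suc i * (t / n)) - w (i * (t / n))) n) \<le> \<eta> * exp (L * t)"
proof -
  define \<delta> where "\<delta> = t / n"
  define X where "X = flow x w"
  define E where "E i = euler \<delta> (x + w 0 *\<^sub>R g) (\<lambda>i. w (Suc i * \<delta>) - w (i * \<delta>)) i" for i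
  have \<delta>: "\<delta> \<ge> 0" "real n * \<delta> = t" using t n by (auto simp: \<delta>_def)
  have L0: "L \<ge> 0" using L by (rule lipschitz_on_nonneg)
  have grid: "real i * \<delta> \<in> {0..t}" if "i \<le> n" for i
    using that \<delta> by (auto intro: order_trans[OF mult_right_mono[of "real i" "real n"]])
  have cX: "continuous_on {0..} X" unfolding X_def by (rule flow_continuous[OF w])
  have cb: "continuous_on {0..} (\<lambda>s. b (X s))"
    by (rule continuous_on_compose2[OF continuous_drift cX]) auto
  have pow: "\<eta> * (1 + L * \<delta>) ^ i \<le> \<eta> * exp (L * t)" if "i \<le> n" for i
  proof (rule mult_left_mono[OF _ \<eta>1(1)])
    have "(1 + L * \<delta>) ^ i \<le> exp (L * \<delta>) ^ i" using L0 \<delta> by (intro power_mono) auto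
    also have "\<dots> = exp (L * (i * \<delta>))" by (simp add: exp_of_nat_mult[symmetric] mult_ac)
    also have "\<dots> \<le> exp (L * t)" using grid[OF that] L0 by (auto intro: mult_left_mono)
    finally show "(1 + L * \<delta>) ^ i \<le> exp (L * t)" .
  qed
  have "norm (X (i * \<delta>) - E i) \<le> \<eta> * ((1 + L * \<delta>) ^ i - 1)" if "i \<le> n" for i
    using that
  proof (induction i)
    case 0
    then show ?case using flow_eq[OF w, of 0 x] by (simp add: E_def X_def)
  next
    case (Suc i)
    define e where "e = norm (X (i * \<delta>) - E i)"
    have e: "e \<le> \<eta> * ((1 + L * \<delta>) ^ i - 1)" using Suc by (simp add: e_def)
    then have e1: "e \<le> 1" using pow[of i] Suc.prems \<eta>1 by (simp add: algebra_simps)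
    have gi: "real i * \<delta> \<in> {0..t}" "real (Suc i) * \<delta> \<in> {0..t}" using grid[of i] grid[of "Suc i"] Suc.prems by simp_all
    have le: "real i * \<delta> \<le> real (Suc i) * \<delta>" using \<delta> by (intro mult_right_mono) auto
    have Xi: "norm (X (i * \<delta>)) \<le> K" using K[OF gi(1)] by (simp add: X_def)
    have Ei: "E i \<in> cball 0 (K + 1)"
      using e1 Xi norm_triangle_ineq3[of "E i" "X (i * \<delta>)"] by (simp add: e_def norm_minus_commute)
    have intb: "(\<lambda>s. b (X s)) integrable_on {u..v}" if "0 \<le> u" for u v
      by (rule integrable_continuous_real, rule continuous_on_subset[OF cb]) (use that in auto)
    have incr: "X (Suc i * \<delta>) = X (i * \<delta>) + integral {i * \<delta>..Suc i * \<delta>} (\<lambda>s. b (X s))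
        + (w (Suc i * \<delta>) - w (i * \<delta>)) *\<^sub>R g"
    proof -
      have "integral {0..i * \<delta>} (\<lambda>s. b (X s)) + integral {i * \<delta>..Suc i * \<delta>} (\<lambda>s. b (X s)) = integral {0..Suc i * \<delta>} (\<lambda>s. b (X s))"
        by (rule Henstock_Kurzweil_Integration.integral_combine[OF _ le intb]) (use gi in auto)
      then show ?thesis
        using flow_eq[OF w, of "real (Suc i) * \<delta>" x] flow_eq[OF w, of "real i * \<delta>" x] gi
        by (simp add: X_def algebra_simps)
    qed
    have "X (Suc i * \<delta>) - E (Suc i) = (X (i * \<delta>) - E i)
        + (integral {i * \<delta>..Suc i * \<delta>} (\<lambda>s. b (X s)) - \<delta> *\<^sub>R b (E i))"
      unfolding incr by (simp add: E_def algebra_simps)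
    also have "integral {i * \<delta>..Suc i * \<delta>} (\<lambda>s. b (X s)) - \<delta> *\<^sub>R b (E i)
        = integral {i * \<delta>..Suc i * \<delta>} (\<lambda>s. b (X s) - b (E i))"
    proof -
      have "integral {i * \<delta>..Suc i * \<delta>} (\<lambda>s. b (X s) - b (E i))
        = integral {i * \<delta>..Suc i * \<delta>} (\<lambda>s. b (X s)) - integral {i * \<delta>..Suc i * \<delta>} (\<lambda>s. b (E i))"
        by (rule integral_diff) (use gi in \<open>auto intro!: intb\<close>)
      moreover have "integral {i * \<delta>..Suc i * \<delta>} (\<lambda>s. b (E i)) = \<delta> *\<^sub>R b (E i)"
        using \<delta>(1) by (simp add: algebra_simps)
      ultimately show ?thesis by (simp only:)
    qed
    finally have "norm (X (Suc i * \<delta>) - E (Suc i)) \<le> e + norm (integral {i * \<delta>..Suc i * \<delta>} (\<lambda>s. b (X s) - b (E i)))"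
      unfolding e_def using norm_triangle_ineq by metis
    also have "norm (integral {i * \<delta>..Suc i * \<delta>} (\<lambda>s. b (X s) - b (E i))) \<le> (L * (\<eta> + e)) * (Suc i * \<delta> - i * \<delta>)"
    proof (rule integral_bound[OF le])
      show "continuous_on {i * \<delta>..Suc i * \<delta>} (\<lambda>s. b (X s) - b (E i))"
        by (intro continuous_intros continuous_on_subset[OF cb]) (use gi in auto)
      fix s assume s: "s \<in> {i * \<delta>..Suc i * \<delta>}"
      have st: "s \<in> {0..t}" using s gi by auto
      have "norm (b (X s) - b (E i)) \<le> L * norm (X s - E i)"
        using lipschitz_onD[OF L, of "X s" "E i"] K[OF st] Ei by (simp add: dist_norm X_def)
      also have "norm (X s - E i) \<le> norm (X s - X (i * \<delta>)) + e"
        unfolding e_def by (rule norm_diff_triangle_le[OF order_refl order_refl])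
      also have "norm (X s - X (i * \<delta>)) \<le> \<eta>"
      proof -
        have "\<bar>s - i * \<delta>\<bar> \<le> \<delta>" using s by (auto simp: algebra_simps)
        then show ?thesis using \<eta>[OF st gi(1)] by (simp add: X_def \<delta>_def)
      qed
      finally show "norm (b (X s) - b (E i)) \<le> L * (\<eta> + e)" using L0 by (simp add: mult_left_mono)
    qed
    also have "e + (L * (\<eta> + e)) * (Suc i * \<delta> - i * \<delta>) = (1 + L * \<delta>) * e + L * \<delta> * \<eta>"
      by (simp add: algebra_simps)
    also have "\<dots> \<le> (1 + L * \<delta>) * (\<eta> * ((1 + L * \<delta>) ^ i - 1)) + L * \<delta> * \<eta>"
      using e L0 \<delta> by (intro add_right_mono mult_left_mono) auto
    also have "\<dots> = \<eta> * ((1 + L * \<delta>) ^ Suc i - 1)" by (simp add: algebra_simps)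
    finally show ?case by simp
  qed
  from this[of n] have "norm (X t - E n) \<le> \<eta> * ((1 + L * \<delta>) ^ n - 1)" using \<delta> by simp
  also have "\<dots> \<le> \<eta> * exp (L * t)" using pow[of n] \<eta>1 by (simp add: algebra_simps)
  finally show ?thesis by (simp add: X_def E_def \<delta>_def)
qed

lemma euler_converges:
  assumes w: "continuous_on {0..} w" and t: "0 \<le> t"
  shows "(\<lambda>n. euler (t / Suc n) (x + w 0 *\<^sub>R g) (\<lambda>i. w (Suc i * (t / Suc n)) - w (i * (t / Suc n))) (Suc n))
    \<longlonglongrightarrow> flow x w t"
proof (rule LIMSEQ_I)
  fix \<epsilon> :: real assume \<epsilon>: "\<epsilon> > 0"
  have cX: "continuous_on {0..t} (flow x w)" using flow_continuous[OF w] by (rule continuous_on_subset) auto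
  then have "bounded (flow x w ` {0..t})" by (intro compact_imp_bounded compact_continuous_image) auto
  then obtain K where K: "\<forall>s\<in>{0..t}. norm (flow x w s) \<le> K" unfolding bounded_iff by auto
  obtain L where L: "L-lipschitz_on (cball 0 (K + 1)) b" using local_lipschitz by blast
  define \<eta> where "\<eta> = min 1 (\<epsilon> / 2) / exp (L * t)"
  have \<eta>: "\<eta> > 0" "\<eta> * exp (L * t) \<le> 1" "\<eta> * exp (L * t) < \<epsilon>" using \<epsilon> by (auto simp: \<eta>_def)
  have "uniformly_continuous_on {0..t} (flow x w)" by (rule compact_uniformly_continuous[OF cX]) auto
  then obtain d where d: "d > 0" "\<And>r s. r \<in> {0..t} \<Longrightarrow> s \<in> {0..t} \<Longrightarrow> dist r s < d \<Longrightarrow> dist (flow x w r) (flow x w s) < \<eta>"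
    unfolding uniformly_continuous_on_def using \<eta>(1) by metis
  obtain N :: nat where N: "t / d < N" using reals_Archimedean2 by blast
  show "\<exists>N. \<forall>n\<ge>N. norm (euler (t / Suc n) (x + w 0 *\<^sub>R g) (\<lambda>i. w (Suc i * (t / Suc n)) - w (i * (t / Suc n))) (Suc n)
      - flow x w t) < \<epsilon>"
  proof (intro exI[of _ N] allI impI)
    fix n assume n: "N \<le> n"
    have "t / d < Suc n" using N n by linarith
    then have small: "t / Suc n < d" using d(1) by (simp add: field_simps)
    have "norm (flow x w t - euler (t / Suc n) (x + w 0 *\<^sub>R g) (\<lambda>i. w (Suc i * (t / Suc n)) - w (i * (t / Suc n))) (Suc n)) \<le> \<eta> * exp (L * t)"
    proof (rule euler_error[OF w t _ _ L])
      fix r s assume "r \<in> {0..t}" "s \<in> {0..t}" "\<bar>r - s\<bar> \<le> t / Suc n"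
      then show "norm (flow x w r - flow x w s) \<le> \<eta>" using d(2)[of r s] small by (simp add: dist_norm less_imp_le)
    qed (use K \<eta> in auto)
    then show "norm (euler (t / Suc n) (x + w 0 *\<^sub>R g) (\<lambda>i. w (Suc i * (t / Suc n)) - w (i * (t / Suc n))) (Suc n)
      - flow x w t) < \<epsilon>" using \<eta>(3) by (simp add: norm_minus_commute)
  qed
qed

end

text \<open>This covers the two linear equations to which the nonlinear system is compared.\<close>

lemma lipschitz_imp_coercive_drift:
  fixes b :: "'a::euclidean_space \<Rightarrow> 'a"
  assumes L: "L-lipschitz_on UNIV b"
  shows "coercive_drift b g"
proof
  show "\<exists>L. L-lipschitz_on (cball 0 R) b" for R using lipschitz_on_subset[OF L] by blast
  show "\<exists>C. \<forall>y \<beta>. \<bar>\<beta>\<bar> \<le> B \<longrightarrow> y \<bullet> b (y + \<beta> *\<^sub>R g) \<le> C * (1 + y \<bullet> y)" for B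
  proof (intro exI allI impI)
    fix y :: 'a and \<beta> :: real assume \<beta>: "\<bar>\<beta>\<bar> \<le> B"
    have L0: "L \<ge> 0" using L by (rule lipschitz_on_nonneg)
    define c where "c = norm (b 0) + L * (B * norm g)"
    have c0: "c \<ge> 0" unfolding c_def using L0 \<beta> by (intro add_nonneg_nonneg mult_nonneg_nonneg) auto
    have "norm (b (y + \<beta> *\<^sub>R g)) \<le> norm (b 0) + L * norm (y + \<beta> *\<^sub>R g)"
      using lipschitz_onD[OF L, of "y + \<beta> *\<^sub>R g" 0] norm_triangle_sub[of "b (y + \<beta> *\<^sub>R g)" "b 0"]
      by (simp add: dist_norm)
    also have "\<dots> \<le> norm (b 0) + L * (norm y + B * norm g)"
      using \<beta> L0 norm_triangle_ineq[of y "\<beta> *\<^sub>R g"]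
      by (intro add_left_mono mult_left_mono) (auto intro!: order_trans[OF norm_triangle_ineq] add_mono mult_right_mono)
    also have "\<dots> = c + L * norm y" by (simp add: c_def algebra_simps)
    finally have nb: "norm (b (y + \<beta> *\<^sub>R g)) \<le> c + L * norm y" .
    have "y \<bullet> b (y + \<beta> *\<^sub>R g) \<le> norm y * norm (b (y + \<beta> *\<^sub>R g))" by (rule norm_cauchy_schwarz)
    also have "\<dots> \<le> norm y * (c + L * norm y)" using nb by (intro mult_left_mono) auto
    also have "\<dots> = c * norm y + L * (norm y)^2" by (simp add: algebra_simps power2_eq_square)
    also have "\<dots> \<le> c * (1 + (norm y)^2) + L * (1 + (norm y)^2)"
    proof (intro add_mono mult_left_mono c0 L0)
      show "norm y \<le> 1 + (norm y)^2" using zero_le_power2[of "norm y - 1/2"] by (simp add: power2_eq_square algebra_simps)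
    qed auto
    also have "\<dots> = (c + L) * (1 + y \<bullet> y)" by (simp add: power2_norm_eq_inner algebra_simps)
    finally show "y \<bullet> b (y + \<beta> *\<^sub>R g) \<le> (norm (b 0) + L * (B * norm g) + L) * (1 + y \<bullet> y)" by (simp add: c_def)
  qed
qed

section \<open>Bounded continuous test functions\<close>

definition bcont :: "('a::topological_space \<Rightarrow> real) \<Rightarrow> bool" where
  "bcont f \<longleftrightarrow> continuous_on UNIV f \<and> bounded (range f)"

lemma bcont_bound:
  assumes "bcont f"
  obtains C where "C \<ge> 0" "\<And>x. \<bar>f x\<bar> \<le> C"
proof -
  from assms obtain C where "\<forall>x\<in>range f. norm x \<le> C" unfolding bcont_def bounded_iff by blast
  then show ?thesis by (intro that[of "max C 0"]) (auto simp: le_max_iff_disj)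
qed

lemma bcontI: "continuous_on UNIV f \<Longrightarrow> (\<And>x. \<bar>f x\<bar> \<le> C) \<Longrightarrow> bcont f"
  unfolding bcont_def bounded_iff by auto

lemma bcont_measurable: "bcont f \<Longrightarrow> f \<in> borel_measurable borel"
  unfolding bcont_def by (simp add: borel_measurable_continuous_onI)

lemma bcont_compose: "bcont f \<Longrightarrow> continuous_on UNIV h \<Longrightarrow> bcont (\<lambda>x. f (h x))"
  unfolding bcont_def by (auto intro: continuous_on_compose2 bounded_subset)

lemma (in prob_space) integrable_bcont:
  assumes "bcont f" "X \<in> borel_measurable M"
  shows "integrable M (\<lambda>\<omega>. f (X \<omega>))"
proof -
  obtain C where "\<And>x. \<bar>f x\<bar> \<le> C" using bcont_bound[OF assms(1)] by metis
  then show ?thesis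
    using measurable_compose[OF assms(2) bcont_measurable[OF assms(1)]]
    by (intro integrable_const_bound[of _ C]) auto
qed

lemma (in prob_space) expectation_bcont_le:
  assumes "bcont f" "X \<in> borel_measurable M" "\<And>x. \<bar>f x\<bar> \<le> C"
  shows "\<bar>\<integral>\<omega>. f (X \<omega>) \<partial>M\<bar> \<le> C"
proof -
  have "\<bar>\<integral>\<omega>. f (X \<omega>) \<partial>M\<bar> \<le> (\<integral>\<omega>. C \<partial>M)"
    by (rule order_trans[OF integral_abs_bound integral_mono])
       (use assms integrable_bcont[OF assms(1,2)] in auto)
  then show ?thesis by (simp add: prob_space)
qed

text \<open>A closed set is the decreasing limit of the continuous functions \<open>max 0 (1 - k dist(x, A))\<close>, and
  closed sets generate the Borel sets.\<close>

lemma measure_eqI_bcont: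
  fixes \<mu> \<nu> :: "'a::metric_space measure"
  assumes "borel_prob \<mu>" "borel_prob \<nu>"
    and eq: "\<And>f. bcont f \<Longrightarrow> integral\<^sup>L \<mu> f = integral\<^sup>L \<nu> f"
  shows "\<mu> = \<nu>"
proof -
  interpret \<mu>: prob_space \<mu> using assms by (simp add: borel_prob_def)
  interpret \<nu>: prob_space \<nu> using assms by (simp add: borel_prob_def)
  have s[measurable_cong]: "sets \<mu> = sets borel" "sets \<nu> = sets borel" using assms by (auto simp: borel_prob_def)
  have lim: "(\<lambda>k. \<integral>x. max 0 (1 - real k * infdist x A) \<partial>\<rho>) \<longlonglongrightarrow> measure \<rho> A"
    if A: "closed A" "A \<noteq> {}" and \<rho>: "borel_prob \<rho>" for A and \<rho> :: "'a measure"
  proof -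
    interpret \<rho>: prob_space \<rho> using \<rho> by (simp add: borel_prob_def)
    have s[measurable_cong]: "sets \<rho> = sets borel" using \<rho> by (auto simp: borel_prob_def)
    have Am: "A \<in> sets \<rho>" using A s by auto
    have [measurable]: "(\<lambda>x. infdist x A) \<in> borel_measurable borel"
      by (intro borel_measurable_continuous_onI continuous_intros)
    \<comment> \<open>Off \<open>A\<close> the functions vanish as soon as \<open>k infdist x A \<ge> 1\<close>.\<close>
    have "(\<lambda>k. \<integral>x. max 0 (1 - real k * infdist x A) \<partial>\<rho>) \<longlonglongrightarrow> (\<integral>x. indicator A x \<partial>\<rho>)"
    proof (rule integral_dominated_convergence[where w="\<lambda>_. 1"])
      show "(indicator A :: _ \<Rightarrow> real) \<in> borel_measurable \<rho>" using Am by simp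
      show "AE x in \<rho>. (\<lambda>k. max 0 (1 - real k * infdist x A)) \<longlonglongrightarrow> indicator A x"
      proof (rule AE_I2)
        fix x
        show "(\<lambda>k. max 0 (1 - real k * infdist x A)) \<longlonglongrightarrow> indicator A x"
        proof (cases "x \<in> A")
          case False
          then have d: "infdist x A > 0" using A in_closed_iff_infdist_zero[of A x] infdist_nonneg[of x A] by force
          obtain N :: nat where N: "1 / infdist x A < N" using reals_Archimedean2 by blast
          have "max 0 (1 - real k * infdist x A) = 0" if "k \<ge> N" for k
          proof -
            have "1 < N * infdist x A" using N d by (simp add: field_simps)
            also have "\<dots> \<le> k * infdist x A" using that d by (intro mult_right_mono) auto
            finally show ?thesis by simp
          qed
          then show ?thesis using False by (intro tendsto_eventually) (auto simp: eventually_sequentially)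
        qed simp
      qed
    qed (auto simp: infdist_nonneg)
    then show ?thesis using Am by simp
  qed
  have clo: "emeasure \<mu> A = emeasure \<nu> A" if A: "closed A" for A
  proof (cases "A = {}")
    case False
    have "bcont (\<lambda>x. max 0 (1 - real k * infdist x A))" for k
      by (intro bcontI[where C=1] continuous_intros) (auto simp: infdist_nonneg)
    then have "measure \<mu> A = measure \<nu> A"
      using LIMSEQ_unique[OF lim[OF A False assms(1)]] lim[OF A False assms(2)] eq by simp
    then show ?thesis by (simp add: \<mu>.emeasure_eq_measure \<nu>.emeasure_eq_measure)
  qed simp
  show ?thesis
  proof (rule measure_eqI_generator_eq[where \<Omega>=UNIV and E="Collect closed" and A="\<lambda>_. UNIV"])
    show "sets \<mu> = sigma_sets UNIV (Collect closed)" "sets \<nu> = sigma_sets UNIV (Collect closed)"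
      unfolding s borel_eq_closed by (simp_all add: sets_measure_of)
  qed (auto simp: Int_stable_def clo)
qed

lemma (in prob_space) continuous_on_expectation:
  fixes X :: "'i::metric_space \<Rightarrow> 'a \<Rightarrow> 'b::metric_space"
  assumes f: "bcont f" and X: "\<And>x. x \<in> S \<Longrightarrow> X x \<in> borel_measurable M"
    and c: "\<And>\<omega>. \<omega> \<in> space M \<Longrightarrow> continuous_on S (\<lambda>x. X x \<omega>)"
  shows "continuous_on S (\<lambda>x. \<integral>\<omega>. f (X x \<omega>) \<partial>M)"
  unfolding continuous_on_sequentially comp_def
proof (intro allI ballI impI)
  fix u a assume a: "a \<in> S" and "(\<forall>n. u n \<in> S) \<and> u \<longlonglongrightarrow> a"
  then have u: "\<forall>n. u n \<in> S" "a \<in> S" "u \<longlonglongrightarrow> a" by auto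
  obtain C where C: "\<And>x. \<bar>f x\<bar> \<le> C" using bcont_bound[OF f] by metis
  show "(\<lambda>n. \<integral>\<omega>. f (X (u n) \<omega>) \<partial>M) \<longlonglongrightarrow> (\<integral>\<omega>. f (X a \<omega>) \<partial>M)"
  proof (rule integral_dominated_convergence[where w="\<lambda>_. C"])
    show "(\<lambda>\<omega>. f (X a \<omega>)) \<in> borel_measurable M" "\<And>n. (\<lambda>\<omega>. f (X (u n) \<omega>)) \<in> borel_measurable M"
      using u by (auto intro!: measurable_compose[OF X bcont_measurable[OF f]])
    show "AE \<omega> in M. (\<lambda>n. f (X (u n) \<omega>)) \<longlonglongrightarrow> f (X a \<omega>)"
    proof (rule AE_I2)
      fix \<omega> assume "\<omega> \<in> space M"
      then have "(\<lambda>n. X (u n) \<omega>) \<longlonglongrightarrow> X a \<omega>"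
        using c u by (auto simp: continuous_on_sequentially comp_def)
      then show "(\<lambda>n. f (X (u n) \<omega>)) \<longlonglongrightarrow> f (X a \<omega>)"
        using f unfolding bcont_def by (intro continuous_on_tendsto_compose[of UNIV f]) auto
    qed
  qed (use C in auto)
qed

text \<open>A process with continuous paths is the pointwise limit of its values on the grids \<open>k / n\<close>.\<close>

lemma measurable_continuous_process:
  fixes X :: "real \<Rightarrow> 'w \<Rightarrow> 'a::metric_space"
  assumes X: "\<And>t. t \<ge> 0 \<Longrightarrow> X t \<in> borel_measurable M"
    and c: "\<And>\<omega>. \<omega> \<in> space M \<Longrightarrow> continuous_on {0..} (\<lambda>t. X t \<omega>)"
  shows "(\<lambda>(t, \<omega>). X (max 0 t) \<omega>) \<in> borel_measurable (borel \<Otimes>\<^sub>M M)"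
proof (rule borel_measurable_LIMSEQ_metric)
  define r where "r n t = real (nat \<lceil>max 0 t * Suc n\<rceil>) / Suc n" for n and t :: real
  show "(\<lambda>(t, \<omega>). X (r n t) \<omega>) \<in> borel_measurable (borel \<Otimes>\<^sub>M M)" for n
  proof -
    have "(\<lambda>p. X (real k / Suc n) (snd p)) \<in> borel_measurable (borel \<Otimes>\<^sub>M M)" for k
    proof -
      have "X (real k / Suc n) \<in> borel_measurable M" by (rule X) simp
      then show ?thesis by (rule measurable_compose[OF measurable_snd])
    qed
    moreover have "(\<lambda>p. nat \<lceil>max 0 (fst p) * real (Suc n)\<rceil>) \<in> measurable (borel \<Otimes>\<^sub>M M) (count_space UNIV)"
    proof -
      have "(\<lambda>t::real. nat \<lceil>max 0 t * Suc n\<rceil>) \<in> measurable borel (count_space UNIV)" by measurable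
      then show ?thesis by (rule measurable_compose[OF measurable_fst])
    qed
    ultimately have "(\<lambda>p. X (real (nat \<lceil>max 0 (fst p) * real (Suc n)\<rceil>) / real (Suc n)) (snd p)) \<in> borel_measurable (borel \<Otimes>\<^sub>M M)"
      by (rule measurable_compose_countable)
    then show ?thesis by (simp add: r_def case_prod_beta)
  qed
  fix p :: "real \<times> 'w" assume p: "p \<in> space (borel \<Otimes>\<^sub>M M)"
  obtain t \<omega> where [simp]: "p = (t, \<omega>)" by force
  have \<omega>: "\<omega> \<in> space M" using p by (simp add: space_pair_measure)
  have "(\<lambda>n. r n t) \<longlonglongrightarrow> max 0 t"
  proof (rule tendsto_sandwich[of "\<lambda>_. max 0 t" _ _ "\<lambda>n. max 0 t + 1 / Suc n"])
    have b: "max 0 t * Suc n \<le> nat \<lceil>max 0 t * Suc n\<rceil>" "nat \<lceil>max 0 t * Suc n\<rceil> \<le> max 0 t * Suc n + 1" for n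
    proof -
      have "0 \<le> max 0 t * Suc n" by simp
      then show "max 0 t * Suc n \<le> nat \<lceil>max 0 t * Suc n\<rceil>" "nat \<lceil>max 0 t * Suc n\<rceil> \<le> max 0 t * Suc n + 1"
        by linarith+
    qed
    show "\<forall>\<^sub>F n in sequentially. max 0 t \<le> r n t"
    proof (intro always_eventually allI)
      fix n
      have "max 0 t * real (Suc n) / real (Suc n) \<le> r n t"
        unfolding r_def by (rule divide_right_mono[OF b(1)]) simp
      then show "max 0 t \<le> r n t" by (simp only: nonzero_mult_div_cancel_right of_nat_neq_0 not_False_eq_True)
    qed
    show "\<forall>\<^sub>F n in sequentially. r n t \<le> max 0 t + 1 / Suc n"
    proof (intro always_eventually allI)
      fix n
      have "r n t \<le> (max 0 t * real (Suc n) + 1) / real (Suc n)"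
        unfolding r_def by (rule divide_right_mono[OF b(2)]) simp
      also have "\<dots> = max 0 t * real (Suc n) / real (Suc n) + 1 / real (Suc n)" by (rule add_divide_distrib)
      finally show "r n t \<le> max 0 t + 1 / Suc n"
        by (simp only: nonzero_mult_div_cancel_right of_nat_neq_0 not_False_eq_True)
    qed
    show "(\<lambda>n. max 0 t + 1 / Suc n) \<longlonglongrightarrow> max 0 t"
      using tendsto_add[OF tendsto_const[of "max 0 t"] LIMSEQ_inverse_real_of_nat] by (simp add: inverse_eq_divide)
  qed simp
  moreover have "0 \<le> r n t" for n unfolding r_def by (intro divide_nonneg_nonneg of_nat_0_le_iff)
  ultimately have "(\<lambda>n. X (r n t) \<omega>) \<longlonglongrightarrow> X (max 0 t) \<omega>"
    using c[OF \<omega>] by (intro continuous_on_tendsto_compose[of "{0..}" "\<lambda>t. X t \<omega>"]) auto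
  then show "(\<lambda>i. case p of (t, \<omega>) \<Rightarrow> X (r i t) \<omega>) \<longlonglongrightarrow> (case p of (t, \<omega>) \<Rightarrow> X (max 0 t) \<omega>)"
    by simp
qed

lemma (in prob_space) indep_var_expectation:
  assumes ind: "indep_var S X T Y" and h[measurable]: "h \<in> borel_measurable (S \<Otimes>\<^sub>M T)"
    and C: "\<And>z. \<bar>h z\<bar> \<le> (C::real)"
  shows "(\<integral>\<omega>. h (X \<omega>, Y \<omega>) \<partial>M) = (\<integral>\<omega>. (\<integral>\<omega>'. h (X \<omega>, Y \<omega>') \<partial>M) \<partial>M)"
proof -
  have X[measurable]: "X \<in> measurable M S" and Y[measurable]: "Y \<in> measurable M T"
    using ind by (auto dest: indep_var_rv1 indep_var_rv2)
  interpret X: prob_space "distr M S X" by (rule prob_space_distr) fact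
  interpret Y: prob_space "distr M T Y" by (rule prob_space_distr) fact
  interpret P: pair_prob_space "distr M S X" "distr M T Y" ..
  have int: "integrable (distr M S X \<Otimes>\<^sub>M distr M T Y) h"
    using C by (intro P.P.integrable_const_bound[of _ C]) auto
  have "(\<integral>\<omega>. h (X \<omega>, Y \<omega>) \<partial>M) = (\<integral>z. h z \<partial>distr M (S \<Otimes>\<^sub>M T) (\<lambda>\<omega>. (X \<omega>, Y \<omega>)))"
    by (subst integral_distr) auto
  also have "\<dots> = (\<integral>z. h z \<partial>(distr M S X \<Otimes>\<^sub>M distr M T Y))"
    using ind by (simp add: indep_var_distribution_eq)
  also have "\<dots> = (\<integral>x. (\<integral>y. h (x, y) \<partial>distr M T Y) \<partial>distr M S X)"
    using P.integral_fst'[OF int] by simp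
  also have "\<dots> = (\<integral>\<omega>. (\<integral>y. h (X \<omega>, y) \<partial>distr M T Y) \<partial>M)"
    by (subst integral_distr) (auto intro!: Y.borel_measurable_lebesgue_integral)
  also have "\<dots> = (\<integral>\<omega>. (\<integral>\<omega>'. h (X \<omega>, Y \<omega>') \<partial>M) \<partial>M)"
    by (intro Bochner_Integration.integral_cong refl, subst integral_distr) (auto dest: measurable_space)
  finally show ?thesis .
qed

section \<open>One-dimensional Gaussian laws\<close>

text \<open>As the law of \<open>m + s N\<close> with \<open>N\<close> standard normal, so that point masses (\<open>s = 0\<close>) are included.\<close>

definition gauss :: "real \<Rightarrow> real \<Rightarrow> real measure" where
  "gauss m s = distr std_normal_distribution borel (\<lambda>x. m + s * x)"

lemma prob_space_std_normal: "prob_space std_normal_distribution"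
  by (rule prob_space_normal_density) simp

lemma real_distribution_gauss: "real_distribution (gauss m s)"
  unfolding gauss_def
  by (intro real_distribution.intro prob_space.prob_space_distr prob_space_std_normal real_distribution_axioms.intro) auto

lemma sets_gauss[simp, measurable_cong]: "sets (gauss m s) = sets borel"
  by (simp add: gauss_def)

lemma prob_space_gauss: "prob_space (gauss m s)"
  using real_distribution_gauss by (rule real_distribution.axioms)

lemma integral_gauss:
  fixes f :: "real \<Rightarrow> 'b::{banach, second_countable_topology}"
  assumes "f \<in> borel_measurable borel"
  shows "integral\<^sup>L (gauss m s) f = (\<integral>x. f (m + s * x) \<partial>std_normal_distribution)"
  unfolding gauss_def by (subst integral_distr) (use assms in auto)

lemma char_gauss: "char (gauss m s) t = exp (\<i> * (t * m)) * exp (- ((s * t)^2) / 2)"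
proof -
  have "char (gauss m s) t = (\<integral>x. iexp (t * (m + s * x)) \<partial>std_normal_distribution)"
    unfolding char_def by (subst integral_gauss) auto
  also have "\<dots> = (\<integral>x. exp (\<i> * (t * m)) * iexp ((s * t) * x) \<partial>std_normal_distribution)"
    by (simp add: algebra_simps exp_add[symmetric])
  also have "\<dots> = exp (\<i> * (t * m)) * char std_normal_distribution (s * t)"
    unfolding char_def by simp
  finally show ?thesis by (simp add: char_std_normal_distribution)
qed

lemma gauss_eqI:
  assumes "real_distribution N" "\<And>t. char N t = exp (\<i> * (t * m)) * exp (- ((s * t)^2) / 2)"
  shows "N = gauss m s"
  by (rule Levy_uniqueness[OF assms(1) real_distribution_gauss]) (simp add: fun_eq_iff char_gauss assms(2))

lemma gauss_degenerate: "gauss m 0 = return borel m"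
  unfolding gauss_def
  using prob_space.distr_const[OF prob_space_std_normal, of m borel] by simp

lemma gauss_density:
  assumes "s > 0"
  shows "gauss m s = density lborel (normal_density m s)"
proof -
  interpret prob_space std_normal_distribution by (rule prob_space_std_normal)
  have "distributed std_normal_distribution lborel (\<lambda>x. x) (normal_density 0 1)"
    unfolding distributed_def by (auto intro!: distr_id2)
  from normal_density_affine[OF this, of s m]
  have "distributed std_normal_distribution lborel (\<lambda>x. m + s * x) (normal_density m s)"
    using assms by simp
  then have "distr std_normal_distribution lborel (\<lambda>x. m + s * x) = density lborel (normal_density m s)"
    by (rule distributed_distr_eq_density)
  then show ?thesis unfolding gauss_def by (simp cong: distr_cong)
qed

lemma gauss_uminus: "gauss m (- s) = gauss m s"
  by (rule gauss_eqI[OF real_distribution_gauss]) (simp add: char_gauss)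

lemma integrable_std_normal_power: "integrable std_normal_distribution (\<lambda>x. x ^ k)"
  by (rule integrable_std_normal_distribution_moment)

lemma std_normal_moments:
  "(\<integral>x. x \<partial>std_normal_distribution) = 0" "(\<integral>x. x^2 \<partial>std_normal_distribution) = 1"
  using std_normal_distribution_even_moments[of 1] integral_std_normal_moment_odd[of 0]
  by (simp_all add: integral_density)

lemma gauss_second_moment:
  "integrable (gauss m s) (\<lambda>x. x^2)" "(\<integral>x. x^2 \<partial>gauss m s) = m^2 + s^2"
proof -
  have e: "(m + s * x)^2 = m^2 + (2 * m * s) * x + s^2 * x^2" for x :: real
    by (simp add: power2_eq_square algebra_simps)
  have i: "integrable std_normal_distribution (\<lambda>x. x)" "integrable std_normal_distribution (\<lambda>x. x^2)"
    using integrable_std_normal_power[of 1] integrable_std_normal_power[of 2] by auto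
  interpret prob_space std_normal_distribution by (rule prob_space_std_normal)
  have p: "measure std_normal_distribution UNIV = 1" using prob_space by simp
  show "integrable (gauss m s) (\<lambda>x. x^2)"
  proof -
    have "integrable std_normal_distribution (\<lambda>x. m^2 + (2 * m * s) * x + s^2 * x^2)"
      by (intro Bochner_Integration.integrable_add integrable_mult_right i) auto
    then have "integrable std_normal_distribution (\<lambda>x. (m + s * x)^2)" by (simp only: e)
    then show ?thesis unfolding gauss_def by (subst integrable_distr_eq) auto
  qed
  show "(\<integral>x. x^2 \<partial>gauss m s) = m^2 + s^2"
    unfolding integral_gauss[of "\<lambda>x. x^2", simplified] e
    using i by (simp add: std_normal_moments p)
qed

lemma gauss_first_moment:
  "integrable (gauss m s) (\<lambda>x. x)" "(\<integral>x. x \<partial>gauss m s) = m"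
proof -
  have i: "integrable std_normal_distribution (\<lambda>x. x)" using integrable_std_normal_power[of 1] by auto
  interpret prob_space std_normal_distribution by (rule prob_space_std_normal)
  have p: "measure std_normal_distribution UNIV = 1" using prob_space by simp
  show "integrable (gauss m s) (\<lambda>x. x)"
    unfolding gauss_def by (subst integrable_distr_eq) (auto intro!: i)
  show "(\<integral>x. x \<partial>gauss m s) = m"
    unfolding integral_gauss[of "\<lambda>x. x", simplified] using i by (simp add: std_normal_moments p)
qed

lemma continuous_gauss:
  assumes "bcont f"
  shows "continuous_on UNIV (\<lambda>p. integral\<^sup>L (gauss (fst p) (snd p)) f)"
proof -
  interpret prob_space std_normal_distribution by (rule prob_space_std_normal)
  show ?thesis
    unfolding integral_gauss[OF bcont_measurable[OF assms]]
    by (rule continuous_on_expectation[OF assms]) (auto intro!: continuous_intros)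
qed

lemma gauss_tendsto:
  assumes "bcont f" "(m \<longlongrightarrow> m') F" "(s \<longlongrightarrow> s') F"
  shows "((\<lambda>i. integral\<^sup>L (gauss (m i) (s i)) f) \<longlongrightarrow> integral\<^sup>L (gauss m' s') f) F"
  using continuous_on_tendsto_compose[OF continuous_gauss[OF assms(1)] tendsto_Pair[OF assms(2,3)]] by simp

text \<open>Exponential square integrability, by completing the square in the density.\<close>

lemma gauss_exp_square:
  assumes s: "0 \<le> s" and a: "2 * a * s^2 < 1"
  shows "(\<integral>\<^sup>+x. ennreal (exp (a * x^2)) \<partial>gauss 0 s) = ennreal (1 / sqrt (1 - 2 * a * s^2))"
proof (cases "s = 0")
  case True
  then show ?thesis by (simp add: gauss_degenerate nn_integral_return)
next
  case False
  then have s: "s > 0" using s by simp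
  define d where "d = 1 - 2 * a * s^2"
  have d: "d > 0" using a by (simp add: d_def)
  define r where "r = s / sqrt d"
  have r: "r > 0" using s d by (simp add: r_def)
  have r2: "r^2 = s^2 / d" using d by (simp add: r_def power_divide)
  have eq: "normal_density 0 s x * exp (a * x^2) = 1 / sqrt d * normal_density 0 r x" for x
  proof -
    have "exp (- (x^2) / (2 * s^2)) * exp (a * x^2) = exp (- (x^2) / (2 * r^2))"
      unfolding exp_add[symmetric] r2 using s d by (simp add: d_def field_simps power2_eq_square)
    moreover have "1 / sqrt (2 * pi * s^2) = 1 / sqrt d * (1 / sqrt (2 * pi * r^2))"
      using s d by (simp add: r2 real_sqrt_divide real_sqrt_mult)
    ultimately show ?thesis by (simp add: normal_density_def)
  qed
  have "(\<integral>\<^sup>+x. ennreal (exp (a * x^2)) \<partial>gauss 0 s)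
      = (\<integral>\<^sup>+x. ennreal (normal_density 0 s x) * ennreal (exp (a * x^2)) \<partial>lborel)"
    unfolding gauss_density[OF s] by (subst nn_integral_density) auto
  also have "\<dots> = (\<integral>\<^sup>+x. ennreal (1 / sqrt d) * ennreal (normal_density 0 r x) \<partial>lborel)"
    using d by (intro nn_integral_cong) (simp add: ennreal_mult'[symmetric] eq)
  also have "\<dots> = ennreal (1 / sqrt d) * (\<integral>\<^sup>+x. ennreal (normal_density 0 r x) \<partial>lborel)"
    by (rule nn_integral_cmult) auto
  also have "(\<integral>\<^sup>+x. ennreal (normal_density 0 r x) \<partial>lborel) = 1"
    using prob_space.emeasure_space_1[OF prob_space_normal_density[OF r, of 0]] by (simp add: emeasure_density)
  finally show ?thesis by (simp add: d_def)
qed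

section \<open>Increments of a Wiener process\<close>

locale wiener =
  fixes M :: "'w measure" and W :: "real \<Rightarrow> 'w \<Rightarrow> real"
  assumes wiener: "wiener_process M W"
begin

sublocale prob_space M using wiener by (simp add: wiener_process_def)

lemma W_measurable[measurable]: "0 \<le> t \<Longrightarrow> W t \<in> borel_measurable M"
  using wiener by (simp add: wiener_process_def)

lemma W_continuous: "\<omega> \<in> space M \<Longrightarrow> continuous_on {0..} (\<lambda>t. W t \<omega>)"
  using wiener by (simp add: wiener_process_def)

lemma W_0: "AE \<omega> in M. W 0 \<omega> = 0"
  using wiener by (simp add: wiener_process_def)

lemma increment_law:
  assumes "0 \<le> s" "s \<le> t"
  shows "distr M borel (\<lambda>\<omega>. W t \<omega> - W s \<omega>) = gauss 0 (sqrt (t - s))"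
proof (cases "s = t")
  case True
  then show ?thesis by (simp add: gauss_degenerate distr_const)
next
  case False
  then have "distributed M lborel (\<lambda>\<omega>. W t \<omega> - W s \<omega>) (normal_density 0 (sqrt (t - s)))"
    using wiener assms by (simp add: wiener_process_def)
  then have "distr M lborel (\<lambda>\<omega>. W t \<omega> - W s \<omega>) = density lborel (normal_density 0 (sqrt (t - s)))"
    by (rule distributed_distr_eq_density)
  then show ?thesis using False assms by (simp add: gauss_density cong: distr_cong)
qed

lemma W_law: "0 \<le> t \<Longrightarrow> distr M borel (W t) = gauss 0 (sqrt t)"
proof -
  assume t: "0 \<le> t"
  have "distr M borel (W t) = distr M borel (\<lambda>\<omega>. W t \<omega> - W 0 \<omega>)"
    by (rule distr_cong_AE) (use W_0 t in \<open>auto simp: W_measurable intro!: borel_measurable_diff\<close>)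
  then show ?thesis using increment_law[of 0 t] t by simp
qed

lemma increments_indep:
  assumes "0 \<le> \<tau> 0" "\<And>i. i < n \<Longrightarrow> \<tau> i \<le> \<tau> (Suc i)"
  shows "indep_vars (\<lambda>_. borel) (\<lambda>i \<omega>. W (\<tau> (Suc i)) \<omega> - W (\<tau> i) \<omega>) {..<n}"
  using wiener assms by (simp add: wiener_process_def)

lemma nn_integral_increment:
  assumes "0 \<le> s" "s \<le> t" "f \<in> borel_measurable borel"
  shows "(\<integral>\<^sup>+\<omega>. f (W t \<omega> - W s \<omega>) \<partial>M) = (\<integral>\<^sup>+x. f x \<partial>gauss 0 (sqrt (t - s)))"
  unfolding increment_law[OF assms(1,2), symmetric]
  by (subst nn_integral_distr) (use assms in auto)

lemma nn_integral_W:
  assumes "0 \<le> t" "f \<in> borel_measurable borel"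
  shows "(\<integral>\<^sup>+\<omega>. f (W t \<omega>) \<partial>M) = (\<integral>\<^sup>+x. f x \<partial>gauss 0 (sqrt t))"
  unfolding W_law[OF assms(1), symmetric]
  by (subst nn_integral_distr) (use assms in auto)

lemma increment_second_moment:
  assumes "0 \<le> s" "s \<le> t"
  shows "(\<integral>\<^sup>+\<omega>. ennreal ((W t \<omega> - W s \<omega>)^2) \<partial>M) = ennreal (t - s)"
  using nn_integral_increment[OF assms, of "\<lambda>x. ennreal (x^2)"] gauss_second_moment[of 0 "sqrt (t - s)"] assms
  by (simp add: nn_integral_eq_integral)

lemma W_second_moment: "0 \<le> t \<Longrightarrow> (\<integral>\<^sup>+\<omega>. ennreal ((W t \<omega>)^2) \<partial>M) = ennreal t"
  using nn_integral_W[of t "\<lambda>x. ennreal (x^2)"] gauss_second_moment[of 0 "sqrt t"]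
  by (simp add: nn_integral_eq_integral)

end

section \<open>The Markov semigroup of a coercive equation\<close>

context coercive_drift
begin

lemma measurable_drift[measurable]: "b \<in> borel_measurable borel"
  by (rule borel_measurable_continuous_onI[OF continuous_drift])

lemma euler_measurable:
  assumes "y \<in> borel_measurable N" "\<And>i. i < n \<Longrightarrow> \<xi> i \<in> borel_measurable N"
  shows "(\<lambda>z. euler \<delta> (y z) (\<lambda>i. \<xi> i z) n) \<in> borel_measurable N"
  using assms(2)
proof (induction n)
  case 0
  then show ?case using assms(1) by simp
next
  case (Suc n)
  have [measurable]: "(\<lambda>z. euler \<delta> (y z) (\<lambda>i. \<xi> i z) n) \<in> borel_measurable N" using Suc by simp
  have [measurable]: "\<xi> n \<in> borel_measurable N" using Suc by simp
  show ?case by simp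
qed

lemma euler_continuous: "continuous_on UNIV (\<lambda>y. euler \<delta> y \<xi> n)"
proof (induction n)
  case (Suc n)
  have "continuous_on UNIV (\<lambda>y. b (euler \<delta> y \<xi> n))"
    by (rule continuous_on_compose2[OF continuous_drift Suc]) auto
  then show ?case using Suc by (auto intro!: continuous_intros)
qed (simp add: continuous_on_id)

end

locale coercive_sde = coercive_drift b g + wiener M W
  for b :: "'a::euclidean_space \<Rightarrow> 'a" and g :: 'a and M :: "'w measure" and W :: "real \<Rightarrow> 'w \<Rightarrow> real"
begin

definition sol :: "'a \<Rightarrow> real \<Rightarrow> 'w \<Rightarrow> 'a" where
  "sol x t \<omega> = flow x (\<lambda>s. W s \<omega>) t"

definition increment :: "real \<Rightarrow> real \<Rightarrow> nat \<Rightarrow> 'w \<Rightarrow> real" where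
  "increment a \<delta> i \<omega> = W (a + real (Suc i) * \<delta>) \<omega> - W (a + real i * \<delta>) \<omega>"

lemma increment_measurable[measurable]: "0 \<le> a \<Longrightarrow> 0 \<le> \<delta> \<Longrightarrow> increment a \<delta> i \<in> borel_measurable M"
  unfolding increment_def[abs_def] by (intro borel_measurable_diff W_measurable) auto

text \<open>Stated for an abstract \<open>F\<close>, since the case \<open>F = natural_filtration M W t\<close> gives adaptedness and the case
  \<open>F = M\<close> joint measurability in the initial value and the outcome.\<close>

lemma sol_measurable_filtration:
  assumes t: "0 \<le> t" and F: "space F = space M" "\<And>s. 0 \<le> s \<Longrightarrow> s \<le> t \<Longrightarrow> W s \<in> borel_measurable F"
  shows "(\<lambda>(x, \<omega>). sol x t \<omega>) \<in> borel_measurable (borel \<Otimes>\<^sub>M F)"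
proof (rule borel_measurable_LIMSEQ_metric)
  fix n
  have grid: "0 \<le> real i * (t / real (Suc n))" "real i * (t / real (Suc n)) \<le> t" if "i \<le> Suc n" for i
  proof -
    show "0 \<le> real i * (t / real (Suc n))" using t by simp
    have "real i * (t / real (Suc n)) \<le> real (Suc n) * (t / real (Suc n))"
      using t that by (intro mult_right_mono) auto
    then show "real i * (t / real (Suc n)) \<le> t" by simp
  qed
  have W: "(\<lambda>p. W (real i * (t / real (Suc n))) (snd p)) \<in> borel_measurable (borel \<Otimes>\<^sub>M F)" if "i \<le> Suc n" for i
    using grid[OF that] by (intro measurable_compose[OF measurable_snd F(2)])
  have W0: "(\<lambda>p. W 0 (snd p)) \<in> borel_measurable (borel \<Otimes>\<^sub>M F)" using W[of 0] by simp
  show "(\<lambda>p. euler (t / Suc n) (fst p + W 0 (snd p) *\<^sub>R g)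
      (\<lambda>i. W (Suc i * (t / Suc n)) (snd p) - W (i * (t / Suc n)) (snd p)) (Suc n)) \<in> borel_measurable (borel \<Otimes>\<^sub>M F)"
  proof (rule euler_measurable)
    show "(\<lambda>p. fst p + W 0 (snd p) *\<^sub>R g) \<in> borel_measurable (borel \<Otimes>\<^sub>M F)"
      using W0 by measurable
    fix i assume "i < Suc n"
    then show "(\<lambda>p. W (Suc i * (t / Suc n)) (snd p) - W (i * (t / Suc n)) (snd p)) \<in> borel_measurable (borel \<Otimes>\<^sub>M F)"
      by (intro borel_measurable_diff W) simp_all
  qed
next
  fix p :: "'a \<times> 'w" assume "p \<in> space (borel \<Otimes>\<^sub>M F)"
  then have "snd p \<in> space M" unfolding space_pair_measure F(1) by (rule mem_Times_iff[THEN iffD1, THEN conjunct2])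
  then show "(\<lambda>n. euler (t / Suc n) (fst p + W 0 (snd p) *\<^sub>R g)
      (\<lambda>i. W (Suc i * (t / Suc n)) (snd p) - W (i * (t / Suc n)) (snd p)) (Suc n)) \<longlonglongrightarrow> (case p of (x, \<omega>) \<Rightarrow> sol x t \<omega>)"
    using euler_converges[OF W_continuous t, of "snd p" "fst p"] by (simp add: sol_def case_prod_beta)
qed

lemma sol_pair_measurable[measurable]:
  "0 \<le> t \<Longrightarrow> (\<lambda>(x, \<omega>). sol x t \<omega>) \<in> borel_measurable (borel \<Otimes>\<^sub>M M)"
  by (rule sol_measurable_filtration) auto

lemma sol_measurable[measurable]: "0 \<le> t \<Longrightarrow> sol x t \<in> borel_measurable M"
  using measurable_compose[OF measurable_Pair1' sol_pair_measurable, of x t] by simp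

lemma sol_continuous: "\<omega> \<in> space M \<Longrightarrow> continuous_on {0..} (\<lambda>t. sol x t \<omega>)"
  unfolding sol_def by (rule flow_continuous[OF W_continuous])

lemma sol_continuous_initial: "\<omega> \<in> space M \<Longrightarrow> 0 \<le> t \<Longrightarrow> continuous_on UNIV (\<lambda>x. sol x t \<omega>)"
  unfolding sol_def by (rule flow_continuous_initial[OF W_continuous])

lemma natural_filtration_measurable:
  assumes "0 \<le> s" "s \<le> t"
  shows "W s \<in> borel_measurable (natural_filtration M W t)"
proof (rule measurableI)
  fix B :: "real set" assume B: "B \<in> sets borel"
  have "{W s -` B \<inter> space M |s B. 0 \<le> s \<and> s \<le> t \<and> B \<in> sets borel} \<subseteq> Pow (space M)" by auto
  then show "W s -` B \<inter> space (natural_filtration M W t) \<in> sets (natural_filtration M W t)"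
    unfolding natural_filtration_def using assms B
    by (auto simp: sets_measure_of space_measure_of intro!: sigma_sets.Basic)
qed simp

lemma space_natural_filtration: "space (natural_filtration M W t) = space M"
  unfolding natural_filtration_def by (rule space_measure_of) auto

lemma sets_natural_filtration: "sets (natural_filtration M W t) \<subseteq> sets M"
  unfolding natural_filtration_def
  by (subst sets_measure_of) (auto intro!: sets.sigma_sets_subset measurable_sets[OF W_measurable])

lemma sol_is_sde_solution: "is_sde_solution M W b g x (sol x)"
  unfolding is_sde_solution_def
proof (intro conjI allI impI ballI AE_I2)
  fix t :: real assume t: "0 \<le> t"
  have "(\<lambda>(x, \<omega>). sol x t \<omega>) \<in> borel_measurable (borel \<Otimes>\<^sub>M natural_filtration M W t)"
    by (rule sol_measurable_filtration[OF t space_natural_filtration natural_filtration_measurable])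
  from measurable_compose[OF measurable_Pair1' this, of x]
  show "sol x t \<in> borel_measurable (natural_filtration M W t)" by simp
qed (auto simp: sol_def[abs_def] flow_eq[OF W_continuous] flow_continuous[OF W_continuous])

lemma sde_solution_is_solution: "is_sde_solution M W b g x (sde_solution M W b g x)"
  unfolding sde_solution_def by (rule someI[of _ "sol x"]) (rule sol_is_sde_solution)

lemma sde_solution_continuous:
  "\<omega> \<in> space M \<Longrightarrow> continuous_on {0..} (\<lambda>t. sde_solution M W b g x t \<omega>)"
  using sde_solution_is_solution[of x] by (simp add: is_sde_solution_def)

lemma sde_solution_measurable:
  assumes "0 \<le> t"
  shows "sde_solution M W b g x t \<in> borel_measurable M"
proof -
  have "sde_solution M W b g x t \<in> borel_measurable (natural_filtration M W t)"
    using sde_solution_is_solution[of x] assms by (simp add: is_sde_solution_def)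
  then show ?thesis
    by (rule subsetD[OF measurable_mono[OF order_refl refl sets_natural_filtration space_natural_filtration]])
qed

text \<open>Both are solutions for almost every path, and pathwise solutions are unique.\<close>

lemma sde_solution_AE: "AE \<omega> in M. \<forall>t\<ge>0. sde_solution M W b g x t \<omega> = sol x t \<omega>"
proof -
  let ?X = "sde_solution M W b g x"
  have "AE \<omega> in M. \<forall>t\<ge>0. ?X t \<omega> = x + integral {0..t} (\<lambda>s. b (?X s \<omega>)) + W t \<omega> *\<^sub>R g"
    using sde_solution_is_solution[of x] by (simp add: is_sde_solution_def)
  with AE_space show ?thesis
  proof eventually_elim
    case (elim \<omega>)
    have "path_sol b g x (\<lambda>s. W s \<omega>) t (\<lambda>s. ?X s \<omega>)" for t
      unfolding path_sol_def using elim(2) sde_solution_continuous[OF elim(1), of x]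
      by (auto intro: continuous_on_subset)
    then show ?case
      unfolding sol_def using flow_unique[OF W_continuous[OF elim(1)], of x] by (metis order_refl)
  qed
qed

lemma law_sde_solution: "0 \<le> t \<Longrightarrow> law M (sde_solution M W b g x t) = distr M borel (sol x t)"
  unfolding law_def
  using sde_solution_AE[of x] sde_solution_measurable[of t x]
  by (intro distr_cong_AE) auto

definition semi :: "real \<Rightarrow> ('a \<Rightarrow> real) \<Rightarrow> 'a \<Rightarrow> real" where
  "semi t f x = (\<integral>\<omega>. f (sol x t \<omega>) \<partial>M)"

text \<open>Solutions depend continuously on the initial value for every single path.\<close>

lemma feller:
  assumes f: "bcont f" and t: "0 \<le> t"
  shows "bcont (semi t f)"
proof -
  obtain C where C: "\<And>x. \<bar>f x\<bar> \<le> C" using bcont_bound[OF f] by metis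
  show ?thesis
  proof (rule bcontI)
    show "continuous_on UNIV (semi t f)"
      unfolding semi_def[abs_def]
      by (rule continuous_on_expectation[OF f]) (use t sol_continuous_initial in auto)
    show "\<bar>semi t f x\<bar> \<le> C" for x
      unfolding semi_def by (rule expectation_bcont_le[OF f _ C]) (use t in auto)
  qed
qed

lemma increments_law:
  assumes "0 \<le> a" "0 \<le> \<delta>" "N > 0"
  shows "distr M (PiM {..<N} (\<lambda>_. borel)) (\<lambda>\<omega>. \<lambda>i\<in>{..<N}. increment a \<delta> i \<omega>) = PiM {..<N} (\<lambda>_. gauss 0 (sqrt \<delta>))"
proof -
  have ind: "indep_vars (\<lambda>_. borel) (increment a \<delta>) {..<N}"
    using increments_indep[of "\<lambda>i. a + i * \<delta>" N] assms
    by (simp add: increment_def[abs_def] mult_right_mono)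
  have "distr M (PiM {..<N} (\<lambda>_. borel)) (\<lambda>\<omega>. \<lambda>i\<in>{..<N}. increment a \<delta> i \<omega>)
      = PiM {..<N} (\<lambda>i. distr M borel (increment a \<delta> i))"
    using indep_vars_iff_distr_eq_PiM'[where I="{..<N}" and X="increment a \<delta>" and M'="\<lambda>_. borel"] ind assms by auto
  also have "\<dots> = PiM {..<N} (\<lambda>_. gauss 0 (sqrt \<delta>))"
  proof (rule PiM_cong)
    fix i
    have "a + Suc i * \<delta> - (a + i * \<delta>) = \<delta>" by (simp add: algebra_simps)
    then show "distr M borel (increment a \<delta> i) = gauss 0 (sqrt \<delta>)"
      using increment_law[of "a + i * \<delta>" "a + Suc i * \<delta>"] assms
      by (simp add: increment_def[abs_def] mult_right_mono)
  qed simp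
  finally show ?thesis .
qed

text \<open>Only the joint law of the increments matters, and it is the same on every time interval.\<close>

lemma euler_stationary:
  assumes f: "bcont f" and a: "0 \<le> a" "0 \<le> \<delta>" and N: "N > 0"
  shows "(\<integral>\<omega>. f (euler \<delta> y (\<lambda>i. increment a \<delta> i \<omega>) N) \<partial>M) = (\<integral>\<omega>. f (euler \<delta> y (\<lambda>i. increment 0 \<delta> i \<omega>) N) \<partial>M)"
proof -
  have "(\<integral>\<omega>. f (euler \<delta> y (\<lambda>i. increment c \<delta> i \<omega>) N) \<partial>M) = (\<integral>\<zeta>. f (euler \<delta> y \<zeta> N) \<partial>PiM {..<N} (\<lambda>_. gauss 0 (sqrt \<delta>)))"
    if c: "0 \<le> c" for c
  proof -
    have m: "(\<lambda>\<zeta>. f (euler \<delta> y \<zeta> N)) \<in> borel_measurable (PiM {..<N} (\<lambda>_. borel))"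
      by (rule measurable_compose[OF euler_measurable bcont_measurable[OF f]]) (auto intro: measurable_component_singleton)
    have "(\<integral>\<omega>. f (euler \<delta> y (\<lambda>i. increment c \<delta> i \<omega>) N) \<partial>M)
        = (\<integral>\<omega>. f (euler \<delta> y (\<lambda>i\<in>{..<N}. increment c \<delta> i \<omega>) N) \<partial>M)"
      by (intro Bochner_Integration.integral_cong arg_cong[of _ _ f] euler_cong) auto
    also have "\<dots> = (\<integral>\<zeta>. f (euler \<delta> y \<zeta> N) \<partial>distr M (PiM {..<N} (\<lambda>_. borel)) (\<lambda>\<omega>. \<lambda>i\<in>{..<N}. increment c \<delta> i \<omega>))"
      by (subst integral_distr[OF _ m]) (use c a in \<open>auto intro!: measurable_restrict\<close>)
    finally show ?thesis using increments_law[OF c a(2) N] by simp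
  qed
  from this[of a] this[of 0] a show ?thesis by simp
qed

text \<open>The Markov property at the level of the Euler schemes. The grid \<open>\<tau>\<close> runs through \<open>[0, t]\<close> in \<open>p\<close>
  steps and then through \<open>[t, t + s]\<close> in \<open>q\<close> steps; the two blocks of increments are independent.\<close>

lemma euler_markov:
  assumes f: "bcont f" and t: "0 \<le> t" and s: "0 \<le> s" and p: "p > 0" and q: "q > 0"
  defines "\<delta>\<^sub>1 \<equiv> t / real p" and "\<delta>\<^sub>2 \<equiv> s / real q"
  shows "(\<integral>\<omega>. f (euler \<delta>\<^sub>2 (euler \<delta>\<^sub>1 x (\<lambda>i. increment 0 \<delta>\<^sub>1 i \<omega>) p) (\<lambda>i. increment t \<delta>\<^sub>2 i \<omega>) q) \<partial>M)
    = (\<integral>\<omega>. (\<integral>\<omega>'. f (euler \<delta>\<^sub>2 (euler \<delta>\<^sub>1 x (\<lambda>i. increment 0 \<delta>\<^sub>1 i \<omega>) p) (\<lambda>i. increment 0 \<delta>\<^sub>2 i \<omega>') q) \<partial>M) \<partial>M)"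
proof -
  have \<delta>: "0 \<le> \<delta>\<^sub>1" "0 \<le> \<delta>\<^sub>2" "real p * \<delta>\<^sub>1 = t" using t s p q by (auto simp: \<delta>\<^sub>1_def \<delta>\<^sub>2_def)
  define \<tau> where "\<tau> i = (if i \<le> p then i * \<delta>\<^sub>1 else t + (i - p) * \<delta>\<^sub>2)" for i :: nat
  define \<xi> where "\<xi> i \<omega> = W (\<tau> (Suc i)) \<omega> - W (\<tau> i) \<omega>" for i \<omega>
  have \<xi>1: "\<xi> i = increment 0 \<delta>\<^sub>1 i" if "i < p" for i
    using that by (simp add: \<xi>_def[abs_def] increment_def[abs_def] \<tau>_def)
  have \<xi>2: "\<xi> (p + i) = increment t \<delta>\<^sub>2 i" for i
    using \<delta> by (cases i) (simp_all add: \<xi>_def[abs_def] increment_def[abs_def] \<tau>_def)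
  have mono: "\<tau> i \<le> \<tau> (Suc i)" for i
  proof (cases "i < p")
    case False
    then show ?thesis using \<delta> by (auto simp: \<tau>_def of_nat_diff intro!: mult_right_mono)
  qed (use \<delta> in \<open>auto simp: \<tau>_def intro!: mult_right_mono\<close>)
  have ind: "indep_vars (\<lambda>_. borel) \<xi> {..<p + q}"
    unfolding \<xi>_def[abs_def] by (rule increments_indep) (use mono in \<open>auto simp: \<tau>_def\<close>)
  define h where "h z = f (euler \<delta>\<^sub>2 (euler \<delta>\<^sub>1 x (fst z) p) (\<lambda>i. snd z (p + i)) q)" for z
  have hm: "h \<in> borel_measurable (PiM {..<p} (\<lambda>_. borel) \<Otimes>\<^sub>M PiM {p..<p + q} (\<lambda>_. borel))"
    unfolding h_def[abs_def]
    by (intro measurable_compose[OF euler_measurable bcont_measurable[OF f]] euler_measurable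
        measurable_compose[OF measurable_snd measurable_component_singleton]
        measurable_compose[OF measurable_fst measurable_component_singleton]) auto
  obtain C where C: "\<And>y. \<bar>f y\<bar> \<le> C" using bcont_bound[OF f] by metis
  have ind2: "indep_var (PiM {..<p} (\<lambda>_. borel)) (\<lambda>\<omega>. restrict (\<lambda>i. \<xi> i \<omega>) {..<p})
      (PiM {p..<p + q} (\<lambda>_. borel)) (\<lambda>\<omega>. restrict (\<lambda>i. \<xi> i \<omega>) {p..<p + q})"
    by (rule indep_var_restrict[OF ind]) auto
  have A_eq: "euler \<delta>\<^sub>1 x (restrict (\<lambda>i. \<xi> i \<omega>) {..<p}) p = euler \<delta>\<^sub>1 x (\<lambda>i. increment 0 \<delta>\<^sub>1 i \<omega>) p" for \<omega>
    by (rule euler_cong) (simp add: \<xi>1)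
  have h_eq: "h (restrict (\<lambda>i. \<xi> i \<omega>) {..<p}, restrict (\<lambda>i. \<xi> i \<omega>') {p..<p + q})
      = f (euler \<delta>\<^sub>2 (euler \<delta>\<^sub>1 x (\<lambda>i. increment 0 \<delta>\<^sub>1 i \<omega>) p) (\<lambda>i. increment t \<delta>\<^sub>2 i \<omega>') q)" for \<omega> \<omega>'
    unfolding h_def fst_conv snd_conv A_eq by (intro arg_cong[of _ _ f] euler_cong) (simp add: \<xi>2)
  have "\<bar>h z\<bar> \<le> C" for z by (simp add: h_def C)
  from indep_var_expectation[OF ind2 hm this]
  have "(\<integral>\<omega>. f (euler \<delta>\<^sub>2 (euler \<delta>\<^sub>1 x (\<lambda>i. increment 0 \<delta>\<^sub>1 i \<omega>) p) (\<lambda>i. increment t \<delta>\<^sub>2 i \<omega>) q) \<partial>M)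
      = (\<integral>\<omega>. (\<integral>\<omega>'. f (euler \<delta>\<^sub>2 (euler \<delta>\<^sub>1 x (\<lambda>i. increment 0 \<delta>\<^sub>1 i \<omega>) p) (\<lambda>i. increment t \<delta>\<^sub>2 i \<omega>') q) \<partial>M) \<partial>M)"
    by (simp only: h_eq)
  then show ?thesis by (simp add: euler_stationary[OF f t \<delta>(2) q])
qed

lemma euler_tendsto_sol:
  assumes "0 \<le> t"
  shows "AE \<omega> in M. (\<lambda>n. euler (t / Suc n) x (\<lambda>i. increment 0 (t / Suc n) i \<omega>) (Suc n)) \<longlonglongrightarrow> sol x t \<omega>"
  using W_0 AE_space
proof eventually_elim
  case (elim \<omega>)
  then show ?case
    using euler_converges[OF W_continuous[OF elim(2)] assms, of x] by (simp add: increment_def sol_def)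
qed

lemma semi_euler:
  assumes f: "bcont f" and t: "0 \<le> t"
  shows "(\<lambda>n. \<integral>\<omega>. f (euler (t / Suc n) x (\<lambda>i. increment 0 (t / Suc n) i \<omega>) (Suc n)) \<partial>M) \<longlonglongrightarrow> semi t f x"
  unfolding semi_def
proof -
  obtain C where C: "\<And>x. \<bar>f x\<bar> \<le> C" using bcont_bound[OF f] by metis
  show "(\<lambda>n. \<integral>\<omega>. f (euler (t / Suc n) x (\<lambda>i. increment 0 (t / Suc n) i \<omega>) (Suc n)) \<partial>M) \<longlonglongrightarrow> (\<integral>\<omega>. f (sol x t \<omega>) \<partial>M)"
  proof (rule integral_dominated_convergence[where w="\<lambda>_. C"])
    show "(\<lambda>\<omega>. f (sol x t \<omega>)) \<in> borel_measurable M"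
      using t by (intro measurable_compose[OF _ bcont_measurable[OF f]]) auto
    show "(\<lambda>\<omega>. f (euler (t / Suc n) x (\<lambda>i. increment 0 (t / Suc n) i \<omega>) (Suc n))) \<in> borel_measurable M" for n
      using t by (intro measurable_compose[OF euler_measurable bcont_measurable[OF f]]) auto
    show "AE \<omega> in M. (\<lambda>n. f (euler (t / Suc n) x (\<lambda>i. increment 0 (t / Suc n) i \<omega>) (Suc n))) \<longlonglongrightarrow> f (sol x t \<omega>)"
      using euler_tendsto_sol[OF t, of x]
      by eventually_elim (use f in \<open>auto simp: bcont_def intro: continuous_on_tendsto_compose\<close>)
  qed (use C in auto)
qed

text \<open>Euler schemes approximate the solution on \<open>[0, t]\<close> with \<open>m\<close> steps and on \<open>[t, t + s]\<close> with \<open>n\<close> steps. The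
  limit \<open>m \<rightarrow> \<infinity>\<close> is taken first: for fixed \<open>n\<close> the second scheme is continuous in its initial value. Then
  \<open>n \<rightarrow> \<infinity>\<close> applies to a scheme started at the solution itself.\<close>

theorem markov:
  assumes f: "bcont f" and t: "0 \<le> t" and s: "0 \<le> s"
  shows "semi (t + s) f x = semi t (semi s f) x"
proof -
  obtain C where C: "\<And>x. \<bar>f x\<bar> \<le> C" using bcont_bound[OF f] by metis
  have fc: "continuous_on UNIV f" using f by (simp add: bcont_def)
  define E where "E n y \<omega> = euler (s / Suc n) y (\<lambda>i. increment t (s / Suc n) i \<omega>) (Suc n)" for n y \<omega>
  define E0 where "E0 n y \<omega> = euler (s / Suc n) y (\<lambda>i. increment 0 (s / Suc n) i \<omega>) (Suc n)" for n y \<omega>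
  define V where "V m \<omega> = euler (t / Suc m) x (\<lambda>i. increment 0 (t / Suc m) i \<omega>) (Suc m)" for m \<omega>
  define G where "G n y = (\<integral>\<omega>. f (E0 n y \<omega>) \<partial>M)" for n y
  have Vm: "V m \<in> borel_measurable M" for m
    unfolding V_def[abs_def] using t by (intro euler_measurable) auto
  have Em: "(\<lambda>\<omega>. E n (Y \<omega>) \<omega>) \<in> borel_measurable M" if "Y \<in> borel_measurable M" for n Y
    unfolding E_def[abs_def] using t s that by (intro euler_measurable) auto
  have E0m: "E0 n y \<in> borel_measurable M" for n y
    unfolding E0_def[abs_def] using t s by (intro euler_measurable) auto
  have Ec: "continuous_on UNIV (\<lambda>y. E n y \<omega>)" "continuous_on UNIV (\<lambda>y. E0 n y \<omega>)" for n \<omega>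
    unfolding E_def E0_def by (rule euler_continuous)+
  have Gb: "bcont (G n)" for n
  proof (rule bcontI)
    show "continuous_on UNIV (G n)"
      unfolding G_def[abs_def] by (rule continuous_on_expectation[OF f]) (use E0m Ec in auto)
    show "\<bar>G n x\<bar> \<le> C" for x
      unfolding G_def by (rule expectation_bcont_le[OF f E0m C])
  qed
  have Vlim: "AE \<omega> in M. (\<lambda>m. V m \<omega>) \<longlonglongrightarrow> sol x t \<omega>"
    unfolding V_def by (rule euler_tendsto_sol[OF t])
  have sm: "sol x t \<in> borel_measurable M" using t by simp
  have step1: "(\<integral>\<omega>. f (E n (V m \<omega>) \<omega>) \<partial>M) = (\<integral>\<omega>. G n (V m \<omega>) \<partial>M)" for n m
    using euler_markov[OF f t s, of "Suc m" "Suc n" x] by (simp only: E_def V_def G_def E0_def zero_less_Suc simp_thms)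
  have step2: "(\<integral>\<omega>. f (E n (sol x t \<omega>) \<omega>) \<partial>M) = (\<integral>\<omega>. G n (sol x t \<omega>) \<partial>M)" for n
  proof (rule LIMSEQ_unique)
    show "(\<lambda>m. \<integral>\<omega>. f (E n (V m \<omega>) \<omega>) \<partial>M) \<longlonglongrightarrow> (\<integral>\<omega>. f (E n (sol x t \<omega>) \<omega>) \<partial>M)"
    proof (rule integral_dominated_convergence[where w="\<lambda>_. C"])
      show "AE \<omega> in M. (\<lambda>m. f (E n (V m \<omega>) \<omega>)) \<longlonglongrightarrow> f (E n (sol x t \<omega>) \<omega>)"
        using Vlim
      proof eventually_elim
        case (elim \<omega>)
        show ?case
          by (intro continuous_on_tendsto_compose[OF fc] continuous_on_tendsto_compose[OF Ec(1)] elim) auto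
      qed
    qed (use C in \<open>auto intro!: measurable_compose[OF Em bcont_measurable[OF f]] Vm sm\<close>)
    obtain D where D: "\<And>x. \<bar>G n x\<bar> \<le> D" using bcont_bound[OF Gb] by metis
    have Gc: "continuous_on UNIV (G n)" using Gb by (simp add: bcont_def)
    show "(\<lambda>m. \<integral>\<omega>. f (E n (V m \<omega>) \<omega>) \<partial>M) \<longlonglongrightarrow> (\<integral>\<omega>. G n (sol x t \<omega>) \<partial>M)"
      unfolding step1
    proof (rule integral_dominated_convergence[where w="\<lambda>_. D"])
      show "AE \<omega> in M. (\<lambda>m. G n (V m \<omega>)) \<longlonglongrightarrow> G n (sol x t \<omega>)"
        using Vlim by eventually_elim (auto intro: continuous_on_tendsto_compose[OF Gc])
    qed (use D in \<open>auto intro!: measurable_compose[OF _ bcont_measurable[OF Gb]] Vm sm\<close>)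
  qed
  show ?thesis
  proof (rule LIMSEQ_unique)
    show "(\<lambda>n. \<integral>\<omega>. f (E n (sol x t \<omega>) \<omega>) \<partial>M) \<longlonglongrightarrow> semi (t + s) f x"
      unfolding semi_def
    proof (rule integral_dominated_convergence[where w="\<lambda>_. C"])
      show "AE \<omega> in M. (\<lambda>n. f (E n (sol x t \<omega>) \<omega>)) \<longlonglongrightarrow> f (sol x (t + s) \<omega>)"
      proof (rule AE_I2)
        fix \<omega> assume \<omega>: "\<omega> \<in> space M"
        note w = W_continuous[OF \<omega>]
        have w': "continuous_on {0..} (\<lambda>r. W (t + r) \<omega> - W t \<omega>)"
          by (intro continuous_intros continuous_on_compose2[OF w]) (use t in auto)
        have "(\<lambda>n. E n (sol x t \<omega>) \<omega>) \<longlonglongrightarrow> flow (sol x t \<omega>) (\<lambda>r. W (t + r) \<omega> - W t \<omega>) s"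
          using euler_converges[OF w' s, of "sol x t \<omega>"] by (simp add: E_def increment_def)
        also have "flow (sol x t \<omega>) (\<lambda>r. W (t + r) \<omega> - W t \<omega>) s = sol x (t + s) \<omega>"
          using flow_shift[OF w t s, of x] by (simp add: sol_def)
        finally show "(\<lambda>n. f (E n (sol x t \<omega>) \<omega>)) \<longlonglongrightarrow> f (sol x (t + s) \<omega>)"
          by (auto intro: continuous_on_tendsto_compose[OF fc])
      qed
    qed (use C t s in \<open>auto intro!: measurable_compose[OF _ bcont_measurable[OF f]] Em sm\<close>)
    have "(\<lambda>n. \<integral>\<omega>. G n (sol x t \<omega>) \<partial>M) \<longlonglongrightarrow> semi t (semi s f) x"
      unfolding semi_def[of t]
    proof (rule integral_dominated_convergence[where w="\<lambda>_. C"])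
      show "AE \<omega> in M. (\<lambda>n. G n (sol x t \<omega>)) \<longlonglongrightarrow> semi s f (sol x t \<omega>)"
        using semi_euler[OF f s] by (simp add: G_def E0_def)
      show "AE \<omega> in M. norm (G n (sol x t \<omega>)) \<le> C" for n
        by (simp add: G_def expectation_bcont_le[OF f E0m C])
    qed (auto intro!: measurable_compose[OF sm bcont_measurable] Gb feller f s)
    then show "(\<lambda>n. \<integral>\<omega>. f (E n (sol x t \<omega>) \<omega>) \<partial>M) \<longlonglongrightarrow> semi t (semi s f) x" by (simp add: step2)
  qed
qed

text \<open>Both sides speak about the law \<open>\<rho>\<close> of the solution at time \<open>t\<close> when its initial value is drawn from \<open>\<mu>\<close>
  independently of the noise, that is, about the image of \<open>\<mu> \<Otimes> M\<close> under the solution map.\<close>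

lemma invariant_iff:
  "sde_invariant M W b g \<mu> \<longleftrightarrow>
    borel_prob \<mu> \<and> (\<forall>t\<ge>0. \<forall>f. bcont f \<longrightarrow> (\<integral>x. semi t f x \<partial>\<mu>) = integral\<^sup>L \<mu> f)"
proof (cases "borel_prob \<mu>")
  case True
  interpret \<mu>: prob_space \<mu> using True by (simp add: borel_prob_def)
  interpret P: pair_prob_space \<mu> M ..
  have s[measurable_cong]: "sets \<mu> = sets borel" using True by (auto simp: borel_prob_def)
  have "(\<forall>B\<in>sets borel. (\<integral>\<^sup>+v. emeasure (law M (sde_solution M W b g v t)) B \<partial>\<mu>) = emeasure \<mu> B)
      \<longleftrightarrow> (\<forall>f. bcont f \<longrightarrow> (\<integral>x. semi t f x \<partial>\<mu>) = integral\<^sup>L \<mu> f)" if t: "0 \<le> t" for t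
  proof -
    define \<rho> where "\<rho> = distr (\<mu> \<Otimes>\<^sub>M M) borel (\<lambda>(x, \<omega>). sol x t \<omega>)"
    have m[measurable]: "(\<lambda>(x, \<omega>). sol x t \<omega>) \<in> borel_measurable (\<mu> \<Otimes>\<^sub>M M)"
      using sol_pair_measurable[OF t] by (simp cong: measurable_cong_sets sets_pair_measure_cong add: s)
    have \<rho>: "borel_prob \<rho>" unfolding borel_prob_def \<rho>_def by (simp add: P.prob_space_distr)
    have em: "(\<integral>\<^sup>+v. emeasure (law M (sde_solution M W b g v t)) B \<partial>\<mu>) = emeasure \<rho> B"
      if B[measurable]: "B \<in> sets borel" for B
    proof -
      have "emeasure \<rho> B = (\<integral>\<^sup>+z. indicator B (case z of (x, \<omega>) \<Rightarrow> sol x t \<omega>) \<partial>(\<mu> \<Otimes>\<^sub>M M))"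
        unfolding \<rho>_def by (subst nn_integral_indicator[symmetric], simp, subst nn_integral_distr) auto
      also have "\<dots> = (\<integral>\<^sup>+x. \<integral>\<^sup>+\<omega>. indicator B (sol x t \<omega>) \<partial>M \<partial>\<mu>)"
        by (subst nn_integral_fst[symmetric]) auto
      also have "\<dots> = (\<integral>\<^sup>+v. emeasure (law M (sde_solution M W b g v t)) B \<partial>\<mu>)"
        unfolding law_sde_solution[OF t]
        by (intro nn_integral_cong, subst nn_integral_indicator[symmetric], simp, subst nn_integral_distr) (use t in auto)
      finally show ?thesis by simp
    qed
    have int: "integral\<^sup>L \<rho> f = (\<integral>x. semi t f x \<partial>\<mu>)" if f: "bcont f" for f
    proof -
      have "integral\<^sup>L \<rho> f = (\<integral>z. f (case z of (x, \<omega>) \<Rightarrow> sol x t \<omega>) \<partial>(\<mu> \<Otimes>\<^sub>M M))"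
        unfolding \<rho>_def by (rule integral_distr[OF m bcont_measurable[OF f]])
      also have "\<dots> = (\<integral>x. \<integral>\<omega>. f (sol x t \<omega>) \<partial>M \<partial>\<mu>)"
        using P.integral_fst'[OF P.integrable_bcont[OF f m]] by simp
      finally show ?thesis by (simp add: semi_def)
    qed
    have "(\<forall>B\<in>sets borel. emeasure \<rho> B = emeasure \<mu> B) \<longleftrightarrow> \<rho> = \<mu>"
      using \<rho> s by (auto simp: borel_prob_def intro!: measure_eqI)
    moreover have "(\<forall>f. bcont f \<longrightarrow> integral\<^sup>L \<rho> f = integral\<^sup>L \<mu> f) \<longleftrightarrow> \<rho> = \<mu>"
      using measure_eqI_bcont[OF \<rho> True] by auto
    ultimately show ?thesis by (simp add: em int)
  qed
  then show ?thesis by (simp add: sde_invariant_def True)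
qed (simp add: sde_invariant_def)

text \<open>The mechanism behind every existence statement below: by the Feller property, a weak limit of
  measures that are asymptotically invariant is invariant.\<close>

lemma limit_invariant:
  assumes \<mu>: "borel_prob \<mu>"
    and lim: "\<And>f. bcont f \<Longrightarrow> (\<lambda>n::nat. integral\<^sup>L (m n) f) \<longlonglongrightarrow> integral\<^sup>L \<mu> f"
    and asym: "\<And>s f. 0 \<le> s \<Longrightarrow> bcont f \<Longrightarrow> (\<lambda>n. integral\<^sup>L (m n) (semi s f) - integral\<^sup>L (m n) f) \<longlonglongrightarrow> 0"
  shows "sde_invariant M W b g \<mu>"
  unfolding invariant_iff
proof (intro conjI allI impI \<mu>)
  fix s :: real and f :: "'a \<Rightarrow> real" assume s: "0 \<le> s" and f: "bcont f"
  have "(\<lambda>n. integral\<^sup>L (m n) (semi s f) - integral\<^sup>L (m n) f) \<longlonglongrightarrow> integral\<^sup>L \<mu> (semi s f) - integral\<^sup>L \<mu> f"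
    by (intro tendsto_diff lim f feller s)
  from LIMSEQ_unique[OF this asym[OF s f]] show "integral\<^sup>L \<mu> (semi s f) = integral\<^sup>L \<mu> f" by simp
qed

text \<open>Integrating the convergence of the laws over the initial value: \<open>\<integral> f d\<mu> = \<integral> P\<^sub>n f d\<mu>\<close> tends to \<open>\<integral> f d\<nu>\<close> by
  dominated convergence.\<close>

lemma stable_imp_unique:
  assumes stable: "\<And>x f. bcont f \<Longrightarrow> ((\<lambda>t. semi t f x) \<longlongrightarrow> integral\<^sup>L \<nu> f) at_top"
    and \<nu>: "borel_prob \<nu>" and inv: "sde_invariant M W b g \<mu>"
  shows "\<mu> = \<nu>"
proof (rule measure_eqI_bcont[OF _ \<nu>])
  show \<mu>: "borel_prob \<mu>" using inv by (simp add: sde_invariant_def)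
  interpret \<mu>: prob_space \<mu> using \<mu> by (simp add: borel_prob_def)
  have s[measurable_cong]: "sets \<mu> = sets borel" using \<mu> by (auto simp: borel_prob_def)
  fix f :: "'a \<Rightarrow> real" assume f: "bcont f"
  obtain C where C: "\<And>x. \<bar>f x\<bar> \<le> C" using bcont_bound[OF f] by metis
  have "(\<lambda>n. \<integral>x. semi (real n) f x \<partial>\<mu>) \<longlonglongrightarrow> (\<integral>x. integral\<^sup>L \<nu> f \<partial>\<mu>)"
  proof (rule integral_dominated_convergence[where w="\<lambda>_. C"])
    show "AE x in \<mu>. (\<lambda>n. semi (real n) f x) \<longlonglongrightarrow> integral\<^sup>L \<nu> f"
      by (intro AE_I2 filterlim_compose[OF stable[OF f] filterlim_real_sequentially])
    show "semi (real n) f \<in> borel_measurable \<mu>" for n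
      using bcont_measurable[OF feller[OF f, of "real n"]] by (simp cong: measurable_cong_sets add: s)
    show "AE x in \<mu>. norm (semi (real n) f x) \<le> C" for n
      by (simp add: semi_def expectation_bcont_le[OF f _ C])
  qed auto
  moreover have "(\<integral>x. semi (real n) f x \<partial>\<mu>) = integral\<^sup>L \<mu> f" for n
    using inv f by (simp add: invariant_iff)
  ultimately show "integral\<^sup>L \<mu> f = integral\<^sup>L \<nu> f"
    by (simp add: LIMSEQ_const_iff \<mu>.prob_space)
qed

end

section \<open>Tightness and weakly convergent subsequences in several dimensions\<close>

text \<open>Prokhorov's theorem is reduced to Helly's theorem on the line by a continuous surjection of
  the line onto the space that has a Borel right inverse mapping bounded sets to bounded sets:
  Schoenberg's space-filling curve, traversed once in every time interval \<open>[2 m, 2 m + 1]\<close>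
  and there scaled to the cube \<open>[-m, m]\<^sup>n\<close>.\<close>

text \<open>The 2-periodic triangular wave.\<close>

definition even_dist :: "real \<Rightarrow> real" where
  "even_dist t = infdist t (range (\<lambda>k::int. 2 * of_int k))"

lemma even_dist_continuous[continuous_intros]: "continuous_on S f \<Longrightarrow> continuous_on S (\<lambda>t. even_dist (f t))"
  unfolding even_dist_def by (rule continuous_on_infdist)

lemma even_dist:
  assumes "0 \<le> r" "r \<le> 1"
  shows "even_dist (2 * of_int k + r) = r"
proof (rule antisym)
  have ne: "range (\<lambda>k::int. 2 * of_int k :: real) \<noteq> {}" by simp
  show "even_dist (2 * of_int k + r) \<le> r"
    unfolding even_dist_def
    using infdist_le[of "2 * of_int k" "range (\<lambda>k::int. 2 * of_int k)" "2 * of_int k + r"] assms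
    by (simp add: dist_real_def)
  show "r \<le> even_dist (2 * of_int k + r)"
    unfolding even_dist_def infdist_notempty[OF ne]
  proof (rule cINF_greatest)
    fix a :: real assume "a \<in> range (\<lambda>k::int. 2 * of_int k)"
    then obtain j :: int where a: "a = 2 * of_int j" by auto
    have "k = j \<or> k \<le> j - 1 \<or> k \<ge> j + 1" by linarith
    then have "real_of_int k = real_of_int j \<or> real_of_int k \<le> real_of_int j - 1 \<or> real_of_int k \<ge> real_of_int j + 1"
      by linarith
    then show "r \<le> dist (2 * of_int k + r) a"
      unfolding a dist_real_def using assms by linarith
  qed simp
qed

text \<open>It vanishes up to distance \<open>1/3\<close> from the even integers and is \<open>1\<close> from distance \<open>2/3\<close> on: at points of
  the Cantor set, shifted by an even integer, it is the first Cantor digit.\<close>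

definition digit_reader :: "real \<Rightarrow> real" where
  "digit_reader t = max 0 (min 1 (3 * even_dist t - 1))"

lemma digit_reader_continuous[continuous_intros]:
  "continuous_on S f \<Longrightarrow> continuous_on S (\<lambda>t. digit_reader (f t))"
  unfolding digit_reader_def by (intro continuous_intros)

lemma digit_reader_bounds: "0 \<le> digit_reader t" "digit_reader t \<le> 1"
  unfolding digit_reader_def by auto

text \<open>The Cantor set: the base 3 digits are \<open>0\<close> and \<open>2\<close>.\<close>

definition ternary :: "(nat \<Rightarrow> real) \<Rightarrow> real" where
  "ternary a = (\<Sum>k. 2 * a k / 3 ^ Suc k)"

lemma ternary_summable:
  fixes a :: "nat \<Rightarrow> real"
  assumes "\<And>k. a k \<in> {0, 1}"
  shows "summable (\<lambda>k. 2 * a k / 3 ^ Suc k)"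
proof (rule summable_comparison_test[OF _ summable_mult[OF summable_geometric[of "1/3::real"], of "2/3"]])
  have "norm (2 * a k / 3 ^ Suc k) \<le> 2/3 * (1/3) ^ k" for k
    using assms[of k] by (auto simp: power_divide)
  then show "\<exists>N. \<forall>n\<ge>N. norm (2 * a n / 3 ^ Suc n) \<le> 2/3 * (1/3) ^ n" by blast
qed simp

lemma ternary_bounds:
  assumes "\<And>k. a k \<in> {0, 1}"
  shows "0 \<le> ternary a" "ternary a \<le> 1"
proof -
  have le: "2 * a k / 3 ^ Suc k \<le> 2/3 * (1/3) ^ k" "0 \<le> 2 * a k / 3 ^ Suc k" for k
    using assms[of k] by (auto simp: power_divide)
  show "0 \<le> ternary a" unfolding ternary_def by (rule suminf_nonneg[OF ternary_summable[OF assms] le(2)])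
  have "ternary a \<le> (\<Sum>k. 2/3 * (1/3::real) ^ k)"
    unfolding ternary_def by (rule suminf_le[OF le(1) ternary_summable[OF assms]]) (intro summable_mult summable_geometric, simp)
  also have "\<dots> = 1" by (subst suminf_mult) (auto simp: suminf_geometric summable_geometric)
  finally show "ternary a \<le> 1" .
qed

lemma ternary_shift:
  assumes "\<And>k. a k \<in> {0, 1}"
  shows "3 * ternary a = 2 * a 0 + ternary (\<lambda>k. a (Suc k))"
proof -
  have "(\<Sum>k. 2 * a (Suc k) / 3 ^ Suc (Suc k)) = ternary a - 2 * a 0 / 3"
    using suminf_split_head[OF ternary_summable[OF assms]] by (simp add: ternary_def)
  moreover have "(\<Sum>k. 2 * a (Suc k) / 3 ^ Suc (Suc k)) = ternary (\<lambda>k. a (Suc k)) / 3"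
    unfolding ternary_def
    by (subst suminf_divide[symmetric]) (use ternary_summable[of "\<lambda>k. a (Suc k)"] assms in \<open>auto simp: field_simps\<close>)
  ultimately show ?thesis by (simp add: field_simps)
qed

text \<open>Multiplication by \<open>3\<^sup>m\<close> moves the first \<open>m\<close> digits before the point, where they form an even integer,
  which the 2-periodic reader does not see.\<close>

lemma digit_reader_ternary:
  assumes a: "\<And>k. a k \<in> {0, 1}"
  shows "digit_reader (3 ^ m * (2 * of_int j + ternary a)) = a m"
proof -
  have "\<exists>i::int. 3 ^ m * (2 * of_int j + ternary a) = 2 * of_int i + ternary (\<lambda>k. a (m + k))"
  proof (induction m)
    case (Suc m)
    then obtain i :: int where "3 ^ m * (2 * of_int j + ternary a) = 2 * of_int i + ternary (\<lambda>k. a (m + k))" by blast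
    then have "3 ^ Suc m * (2 * of_int j + ternary a) = 6 * of_int i + 3 * ternary (\<lambda>k. a (m + k))" by (simp add: algebra_simps)
    also have "\<dots> = 6 * of_int i + 2 * a m + ternary (\<lambda>k. a (Suc m + k))"
      using ternary_shift[of "\<lambda>k. a (m + k)"] a by simp
    finally have eq: "3 ^ Suc m * (2 * of_int j + ternary a) = 6 * of_int i + 2 * a m + ternary (\<lambda>k. a (Suc m + k))" .
    show ?case
    proof (cases "a m = 0")
      case True
      then show ?thesis using eq by (intro exI[of _ "3 * i"]) simp
    next
      case False
      then show ?thesis using eq a[of m] by (intro exI[of _ "3 * i + 1"]) simp
    qed
  qed (auto intro: exI[of _ j])
  then obtain i :: int where i: "3 ^ m * (2 * of_int j + ternary a) = 2 * of_int i + ternary (\<lambda>k. a (m + k))" by blast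
  have b: "0 \<le> ternary (\<lambda>k. a (m + k))" "ternary (\<lambda>k. a (m + k)) \<le> 1" by (rule ternary_bounds, rule a)+
  have b': "0 \<le> ternary (\<lambda>k. a (m + Suc k))" "ternary (\<lambda>k. a (m + Suc k)) \<le> 1" by (rule ternary_bounds, rule a)+
  have "3 * ternary (\<lambda>k. a (m + k)) = 2 * a m + ternary (\<lambda>k. a (m + Suc k))"
    using ternary_shift[of "\<lambda>k. a (m + k)"] a by simp
  then show ?thesis
    unfolding i digit_reader_def even_dist[OF b] using b' a[of m] by auto
qed

definition binary_digit :: "nat \<Rightarrow> real \<Rightarrow> real" where
  "binary_digit n y = of_int (\<lfloor>2 ^ Suc n * y\<rfloor> mod 2)"

lemma binary_digit_values: "binary_digit n y \<in> {0, 1}"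
proof -
  have "\<lfloor>2 ^ Suc n * y\<rfloor> mod 2 = 0 \<or> \<lfloor>2 ^ Suc n * y\<rfloor> mod 2 = 1" by presburger
  then show ?thesis unfolding binary_digit_def by auto
qed

lemma binary_expansion:
  assumes "0 \<le> y" "y < 1"
  shows "(\<lambda>n. binary_digit n y / 2 ^ Suc n) sums y"
proof -
  have partial: "(\<Sum>n<m. binary_digit n y / 2 ^ Suc n) = of_int \<lfloor>2 ^ m * y\<rfloor> / 2 ^ m" for m
  proof (induction m)
    case 0
    have "\<lfloor>y\<rfloor> = 0" using assms by linarith
    then show ?case by simp
  next
    case (Suc m)
    have "\<lfloor>2 ^ Suc m * y\<rfloor> = 2 * \<lfloor>2 ^ m * y\<rfloor> + \<lfloor>2 ^ Suc m * y\<rfloor> mod 2"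
    proof -
      have "\<lfloor>2 ^ Suc m * y\<rfloor> div 2 = \<lfloor>2 ^ m * y\<rfloor>"
        using floor_divide_real_eq_div[of 2 "2 ^ Suc m * y"] by simp
      then show ?thesis by presburger
    qed
    then have "(of_int \<lfloor>2 ^ Suc m * y\<rfloor> :: real) = 2 * of_int \<lfloor>2 ^ m * y\<rfloor> + binary_digit m y"
      unfolding binary_digit_def by linarith
    then show ?case using Suc by (simp add: field_simps)
  qed
  have "(\<lambda>m. of_int \<lfloor>2 ^ m * y\<rfloor> / 2 ^ m) \<longlonglongrightarrow> y"
  proof (rule tendsto_sandwich[of "\<lambda>m. y - (1/2) ^ m" _ _ "\<lambda>_. y"])
    show "\<forall>\<^sub>F m in sequentially. y - (1/2) ^ m \<le> of_int \<lfloor>2 ^ m * y\<rfloor> / 2 ^ m"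
    proof (intro always_eventually allI)
      fix m :: nat
      have "2 ^ m * y - 1 \<le> of_int \<lfloor>2 ^ m * y\<rfloor>" by linarith
      then have "(2 ^ m * y - 1) / 2 ^ m \<le> of_int \<lfloor>2 ^ m * y\<rfloor> / 2 ^ m" by (rule divide_right_mono) simp
      then show "y - (1/2) ^ m \<le> of_int \<lfloor>2 ^ m * y\<rfloor> / 2 ^ m" by (simp add: diff_divide_distrib power_divide)
    qed
    show "\<forall>\<^sub>F m in sequentially. of_int \<lfloor>2 ^ m * y\<rfloor> / 2 ^ m \<le> y"
      by (intro always_eventually allI) (simp add: pos_divide_le_eq mult.commute)
    have "(\<lambda>m. y - (1/2::real) ^ m) \<longlonglongrightarrow> y - 0" by (intro tendsto_diff tendsto_const LIMSEQ_power_zero) simp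
    then show "(\<lambda>m. y - (1/2::real) ^ m) \<longlonglongrightarrow> y" by simp
  qed simp
  then show ?thesis unfolding sums_def partial .
qed

text \<open>The right inverse interleaves the binary digits of the \<open>N\<close> rescaled coordinates into one Cantor expansion:
  digit \<open>n\<close> of coordinate \<open>i\<close> becomes digit \<open>n N + i\<close>. The even part \<open>t - even_dist t\<close> of the time, which on
  \<open>[2 m, 2 m + 1]\<close> equals \<open>2 m\<close>, carries the scale \<open>m\<close> of the cube.\<close>

theorem space_filling_curve:
  "\<exists>(g :: real \<Rightarrow> real ^ 'n) s. continuous_on UNIV g \<and> s \<in> borel_measurable borel \<and> (\<forall>x. g (s x) = x) \<and>
     (\<forall>x. \<bar>s x\<bar> \<le> 2 * norm x + 5)"
proof -
  define N where "N = CARD('n)"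
  have N: "N > 0" by (simp add: N_def)
  obtain e :: "'n \<Rightarrow> nat" where e: "bij_betw e UNIV {..<N}"
    using ex_bij_betw_finite_nat[of "UNIV :: 'n set"] by (auto simp: N_def atLeast0LessThan)
  define e' where "e' = inv_into UNIV e"
  have e'e: "e' (e i) = i" for i unfolding e'_def using e by (auto simp: bij_betw_def)
  have eN: "e i < N" for i using e by (auto simp: bij_betw_def)
  define S where "S i t = (\<Sum>n. digit_reader (3 ^ (n * N + e i) * t) / 2 ^ Suc n)" for i t
  define g :: "real \<Rightarrow> real ^ 'n" where "g t = (\<chi> i. (t - even_dist t) / 2 * (2 * S i t - 1))" for t
  have "continuous_on UNIV (S i)" for i
  proof (rule uniform_limit_theorem)
    show "uniform_limit UNIV (\<lambda>m t. \<Sum>n<m. digit_reader (3 ^ (n * N + e i) * t) / 2 ^ Suc n) (S i) sequentially"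
      unfolding S_def[abs_def]
    proof (rule Weierstrass_m_test)
      show "norm (digit_reader (3 ^ (n * N + e i) * t) / 2 ^ Suc n) \<le> 1/2 * (1/2) ^ n" for n t
        using digit_reader_bounds[of "3 ^ (n * N + e i) * t"] by (simp add: power_divide divide_right_mono)
    qed (intro summable_mult summable_geometric, simp)
  qed (auto intro!: always_eventually continuous_intros)
  then have gc: "continuous_on UNIV g"
    unfolding g_def[abs_def] by (intro continuous_intros) auto
  define R where "R x = nat \<lceil>norm x\<rceil> + 1" for x :: "real ^ 'n"
  define y where "y x i = (x $ i / R x + 1) / 2" for x :: "real ^ 'n" and i
  define a where "a x k = binary_digit (k div N) (y x (e' (k mod N)))" for x k
  define s where "s x = 2 * real (R x) + ternary (a x)" for x
  have R: "norm x < R x" "R x \<le> norm x + 2" for x unfolding R_def using norm_ge_zero[of x] by linarith+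
  have y: "0 \<le> y x i" "y x i < 1" for x i
  proof -
    have "\<bar>x $ i\<bar> < R x" using component_le_norm_cart[of x i] R(1)[of x] by linarith
    moreover have "R x > 0" by (simp add: R_def)
    ultimately have "-1 < x $ i / R x" "x $ i / R x < 1" by (auto simp: field_simps abs_less_iff)
    then show "0 \<le> y x i" "y x i < 1" by (auto simp: y_def)
  qed
  have av: "a x k \<in> {0, 1}" for x k unfolding a_def by (rule binary_digit_values)
  have tb: "0 \<le> ternary (a x)" "ternary (a x) \<le> 1" for x by (rule ternary_bounds, rule av)+
  have "g (s x) = x" for x
  proof -
    have Sy: "S i (s x) = y x i" for i
    proof -
      have "digit_reader (3 ^ (n * N + e i) * s x) = binary_digit n (y x i)" for n
      proof -
        have "digit_reader (3 ^ (n * N + e i) * s x) = a x (n * N + e i)"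
          using digit_reader_ternary[of "a x" "n * N + e i" "int (R x)"] av by (simp add: s_def)
        also have "\<dots> = binary_digit n (y x i)"
          using eN[of i] N by (simp add: a_def e'e)
        finally show ?thesis .
      qed
      then show ?thesis
        unfolding S_def using binary_expansion[OF y, of x i] by (simp add: sums_iff)
    qed
    have "2 * S i (s x) - 1 = x $ i / R x" for i unfolding Sy y_def by (simp add: field_simps)
    moreover have "even_dist (s x) = ternary (a x)"
      unfolding s_def using even_dist[OF tb, of "int (R x)"] by simp
    then have "(s x - even_dist (s x)) / 2 = R x" by (simp add: s_def)
    moreover have "R x > 0" by (simp add: R_def)
    ultimately have "g (s x) $ i = x $ i" for i
      by (simp add: g_def)
    then show ?thesis by (simp add: vec_eq_iff)
  qed
  moreover have "s \<in> borel_measurable borel"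
  proof -
    have [measurable]: "(\<lambda>x. real (R x)) \<in> borel_measurable borel" unfolding R_def by measurable
    have [measurable]: "(\<lambda>x::real^'n. x $ i) \<in> borel_measurable borel" for i
      by (intro borel_measurable_continuous_onI continuous_intros)
    have [measurable]: "(\<lambda>x. y x i) \<in> borel_measurable borel" for i unfolding y_def by measurable
    have [measurable]: "binary_digit n \<in> borel_measurable borel" for n unfolding binary_digit_def[abs_def] by measurable
    have [measurable]: "(\<lambda>x. a x k) \<in> borel_measurable borel" for k
      unfolding a_def by measurable
    have "(\<lambda>x. ternary (a x)) \<in> borel_measurable borel" unfolding ternary_def by measurable
    then show ?thesis unfolding s_def[abs_def] by measurable
  qed
  moreover have "\<bar>s x\<bar> \<le> 2 * norm x + 5" for x
    unfolding s_def using R(2)[of x] tb[of x] by simp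
  ultimately show ?thesis using gc by blast
qed

text \<open>The images of the measures under the right inverse \<open>s\<close> are tight on the line, Helly's theorem applies to
  them, and the continuous curve \<open>g\<close> transports the limit back because \<open>g \<circ> s\<close> is the identity.\<close>

theorem prokhorov:
  fixes \<mu> :: "nat \<Rightarrow> (real ^ 'n) measure"
  assumes \<mu>: "\<And>n. borel_prob (\<mu> n)"
    and tight: "\<And>\<epsilon>. \<epsilon> > 0 \<Longrightarrow> \<exists>K. \<forall>n. measure (\<mu> n) {x. K < norm x} \<le> \<epsilon>"
  shows "\<exists>r \<nu>. strict_mono r \<and> borel_prob \<nu> \<and> (\<forall>f. bcont f \<longrightarrow> (\<lambda>n. integral\<^sup>L (\<mu> (r n)) f) \<longlonglongrightarrow> integral\<^sup>L \<nu> f)"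
proof -
  obtain g :: "real \<Rightarrow> real ^ 'n" and s where gs: "continuous_on UNIV g" "s \<in> borel_measurable borel"
    "\<And>x. g (s x) = x" "\<And>x. \<bar>s x\<bar> \<le> 2 * norm x + 5"
    using space_filling_curve by blast
  have gm: "g \<in> borel_measurable borel" using gs(1) by (rule borel_measurable_continuous_onI)
  have sets: "sets (\<mu> n) = sets borel" for n using \<mu> by (simp add: borel_prob_def)
  have P: "prob_space (\<mu> n)" for n using \<mu> by (simp add: borel_prob_def)
  have sm: "s \<in> borel_measurable (\<mu> n)" for n using gs(2) by (simp cong: measurable_cong_sets add: sets)
  define \<eta> where "\<eta> n = distr (\<mu> n) borel s" for n
  have \<eta>: "real_distribution (\<eta> n)" for n
    unfolding \<eta>_def real_distribution_def real_distribution_axioms_def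
    by (simp add: prob_space.prob_space_distr[OF P sm])
  have "tight \<eta>"
    unfolding tight_def
  proof (intro conjI allI impI \<eta>)
    fix \<epsilon> :: real assume "\<epsilon> > 0"
    then obtain K where K: "\<And>n. measure (\<mu> n) {x. K < norm x} \<le> \<epsilon> / 2" using tight[of "\<epsilon> / 2"] by auto
    define c where "c = 2 * \<bar>K\<bar> + 6"
    show "\<exists>a b. a < b \<and> (\<forall>n. 1 - \<epsilon> < measure (\<eta> n) {a<..b})"
    proof (intro exI conjI allI)
      show "- c < c" by (simp add: c_def)
      fix n
      interpret prob_space "\<mu> n" by (rule P)
      have m: "{x. K < norm x} \<in> sets (\<mu> n)" unfolding sets by measurable
      have "1 - \<epsilon> < 1 - \<epsilon> / 2" using \<open>\<epsilon> > 0\<close> by simp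
      also have "\<dots> \<le> 1 - measure (\<mu> n) {x. K < norm x}" using K[of n] by simp
      also have "\<dots> = measure (\<mu> n) (space (\<mu> n) - {x. K < norm x})" using m by (simp add: prob_compl)
      also have "\<dots> \<le> measure (\<mu> n) (s -` {- c<..c} \<inter> space (\<mu> n))"
      proof (rule finite_measure_mono)
        have "\<bar>s x\<bar> \<le> c - 1" if "norm x \<le> K" for x using gs(4)[of x] that unfolding c_def by linarith
        then show "space (\<mu> n) - {x. K < norm x} \<subseteq> s -` {- c<..c} \<inter> space (\<mu> n)" by (force simp: not_less)
      qed (intro measurable_sets[OF sm], simp)
      also have "\<dots> = measure (\<eta> n) {- c<..c}" unfolding \<eta>_def by (subst measure_distr[OF sm]) auto
      finally show "1 - \<epsilon> < measure (\<eta> n) {- c<..c}" .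
    qed
  qed
  from tight_imp_convergent_subsubsequence[OF this strict_mono_id]
  obtain r \<eta>' where r: "strict_mono r" and \<eta>': "real_distribution \<eta>'" and w: "weak_conv_m (\<lambda>n. \<eta> (r n)) \<eta>'"
    by (auto simp: comp_def)
  interpret \<eta>': real_distribution \<eta>' by (rule \<eta>')
  define \<nu> where "\<nu> = distr \<eta>' borel g"
  have gm': "g \<in> borel_measurable \<eta>'" using gm by (simp cong: measurable_cong_sets)
  have "borel_prob \<nu>" unfolding \<nu>_def borel_prob_def by (simp add: \<eta>'.prob_space_distr[OF gm'])
  moreover have "(\<lambda>n. integral\<^sup>L (\<mu> (r n)) f) \<longlonglongrightarrow> integral\<^sup>L \<nu> f" if f: "bcont f" for f
  proof -
    have fg: "bcont (\<lambda>t. f (g t))" using f gs(1) by (rule bcont_compose)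
    obtain C where C: "\<And>t. \<bar>f t\<bar> \<le> C" using bcont_bound[OF f] by metis
    have "(\<lambda>n. integral\<^sup>L (\<eta> (r n)) (\<lambda>t. f (g t))) \<longlonglongrightarrow> integral\<^sup>L \<eta>' (\<lambda>t. f (g t))"
      by (rule weak_conv_imp_integral_bdd_continuous_conv[OF \<eta> \<eta>' w, of _ C])
         (use fg C in \<open>auto simp: bcont_def continuous_on_eq_continuous_at\<close>)
    moreover have "integral\<^sup>L (\<eta> n) (\<lambda>t. f (g t)) = integral\<^sup>L (\<mu> n) f" for n
      unfolding \<eta>_def by (subst integral_distr[OF sm bcont_measurable[OF fg]]) (simp add: gs(3))
    moreover have "integral\<^sup>L \<nu> f = integral\<^sup>L \<eta>' (\<lambda>t. f (g t))"
      unfolding \<nu>_def by (rule integral_distr[OF gm' bcont_measurable[OF f]])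
    ultimately show ?thesis by simp
  qed
  ultimately show ?thesis using r by blast
qed

text \<open>The form in which tightness is verified below, by Markov's inequality.\<close>

corollary prokhorov_second_moment:
  fixes \<mu> :: "nat \<Rightarrow> (real ^ 'n) measure"
  assumes \<mu>: "\<And>n. borel_prob (\<mu> n)"
    and C: "\<And>n. (\<integral>\<^sup>+x. ennreal ((norm x)\<^sup>2) \<partial>\<mu> n) \<le> ennreal C"
  shows "\<exists>r \<nu>. strict_mono r \<and> borel_prob \<nu> \<and> (\<forall>f. bcont f \<longrightarrow> (\<lambda>n. integral\<^sup>L (\<mu> (r n)) f) \<longlonglongrightarrow> integral\<^sup>L \<nu> f)"
proof (rule prokhorov[OF \<mu>])
  fix \<epsilon> :: real assume \<epsilon>: "\<epsilon> > 0"
  define D where "D = \<bar>C\<bar> + 1"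
  have D: "D > 0" "C \<le> D" by (auto simp: D_def)
  define K where "K = sqrt (D / \<epsilon>)"
  have K: "K > 0" "K^2 = D / \<epsilon>" using D \<epsilon> by (auto simp: K_def)
  have "measure (\<mu> n) {x. K < norm x} \<le> \<epsilon>" for n
  proof -
    interpret prob_space "\<mu> n" using \<mu> by (simp add: borel_prob_def)
    have sets[measurable_cong]: "sets (\<mu> n) = sets borel" using \<mu> by (simp add: borel_prob_def)
    have [measurable]: "{x. K < norm x} \<in> sets (\<mu> n)" unfolding sets by measurable
    have "ennreal (K^2) * emeasure (\<mu> n) {x. K < norm x} = (\<integral>\<^sup>+x. ennreal (K^2) * indicator {x. K < norm x} x \<partial>\<mu> n)"
      by (simp add: nn_integral_cmult_indicator)
    also have "\<dots> \<le> (\<integral>\<^sup>+x. ennreal ((norm x)\<^sup>2) \<partial>\<mu> n)"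
      using K(1) by (intro nn_integral_mono) (auto simp: indicator_def intro!: ennreal_leI power_mono)
    also have "\<dots> \<le> ennreal C" by (rule C)
    also have "\<dots> \<le> ennreal D" using D by (intro ennreal_leI)
    finally have "K^2 * measure (\<mu> n) {x. K < norm x} \<le> D"
      using D by (simp add: emeasure_eq_measure ennreal_mult'[symmetric])
    then show ?thesis using K D \<epsilon> by (simp add: field_simps)
  qed
  then show "\<exists>K. \<forall>n. measure (\<mu> n) {x. K < norm x} \<le> \<epsilon>" by blast
qed

section \<open>The Wiener integral of a deterministic function\<close>

lemma grid_mono:
  fixes \<tau> :: "nat \<Rightarrow> real"
  assumes "\<And>i. i < n \<Longrightarrow> \<tau> i \<le> \<tau> (Suc i)" "i \<le> j" "j \<le> n"
  shows "\<tau> i \<le> \<tau> j"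
  using assms(2,3)
proof (induction j rule: dec_induct)
  case (step m)
  then show ?case using assms(1)[of m] by force
qed simp

lemma step_function_outside:
  assumes "\<And>i. i < n \<Longrightarrow> \<tau> i \<le> \<tau> (Suc i)" "t \<le> \<tau> 0 \<or> \<tau> n < t"
  shows "step_function n \<tau> c t = 0"
proof -
  have "indicator {\<tau> i<..\<tau> (Suc i)} t = (0::real)" if "i < n" for i
  proof -
    have "\<tau> (Suc i) \<le> \<tau> n" "\<tau> 0 \<le> \<tau> i"
      using grid_mono[of n \<tau> "Suc i" n, OF assms(1)] grid_mono[of n \<tau> 0 i, OF assms(1)] that by simp_all
    then show ?thesis using assms(2) by (auto simp: indicator_def)
  qed
  then show ?thesis unfolding step_function_def by simp
qed

lemma step_function_inside:
  assumes "\<And>i. i < n \<Longrightarrow> \<tau> i \<le> \<tau> (Suc i)" "j < n" "\<tau> j < t" "t \<le> \<tau> (Suc j)"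
  shows "step_function n \<tau> c t = c j"
proof -
  have "indicator {\<tau> i<..\<tau> (Suc i)} t = (if i = j then 1 else 0::real)" if "i < n" for i
  proof -
    consider "i = j" | "Suc i \<le> j" | "Suc j \<le> i" by linarith
    then show ?thesis
    proof cases
      case 2
      then have "\<tau> (Suc i) \<le> \<tau> j" using grid_mono[of n \<tau> "Suc i" j, OF assms(1)] assms(2) by simp
      then show ?thesis using 2 assms(3) by (auto simp: indicator_def)
    next
      case 3
      then have "\<tau> (Suc j) \<le> \<tau> i" using grid_mono[of n \<tau> "Suc j" i, OF assms(1)] that by simp
      then show ?thesis using 3 assms(4) by (auto simp: indicator_def)
    next
      case 1
      then show ?thesis using assms(3,4) by (simp add: indicator_def)
    qed
  qed
  then have "step_function n \<tau> c t = (\<Sum>i<n. if i = j then c i else 0)"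
    unfolding step_function_def by (intro sum.cong) auto
  then show ?thesis using assms(2) by simp
qed

lemma step_function_measurable[measurable]: "step_function n \<tau> c \<in> borel_measurable borel"
  unfolding step_function_def[abs_def] by measurable

lemma step_function_square:
  assumes "\<And>i. i < n \<Longrightarrow> \<tau> i \<le> \<tau> (Suc i)"
  shows "(step_function n \<tau> c t)\<^sup>2 = (\<Sum>i<n. (c i)\<^sup>2 * indicator {\<tau> i<..\<tau> (Suc i)} t)"
  using assms
proof (induction n)
  case (Suc n)
  have IH: "(step_function n \<tau> c t)\<^sup>2 = (\<Sum>i<n. (c i)\<^sup>2 * indicator {\<tau> i<..\<tau> (Suc i)} t)"
    using Suc by simp
  have "step_function (Suc n) \<tau> c t = step_function n \<tau> c t + c n * indicator {\<tau> n<..\<tau> (Suc n)} t"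
    by (simp add: step_function_def)
  moreover have "step_function n \<tau> c t = 0 \<or> indicator {\<tau> n<..\<tau> (Suc n)} t = (0::real)"
    using step_function_outside[of n \<tau> t c] Suc.prems by (auto simp: indicator_def)
  ultimately show ?case using IH by (auto simp: indicator_def)
qed (simp add: step_function_def)

lemma nn_integral_step_function_square:
  assumes "0 \<le> \<tau> 0" and mono: "\<And>i. i < n \<Longrightarrow> \<tau> i \<le> \<tau> (Suc i)"
  shows "(\<integral>\<^sup>+t\<in>{0..}. ennreal ((step_function n \<tau> c t)\<^sup>2) \<partial>lborel) = ennreal (\<Sum>i<n. (c i)\<^sup>2 * (\<tau> (Suc i) - \<tau> i))"
proof -
  have "(\<integral>\<^sup>+t\<in>{0..}. ennreal ((step_function n \<tau> c t)\<^sup>2) \<partial>lborel)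
      = (\<integral>\<^sup>+t. (\<Sum>i<n. ennreal ((c i)\<^sup>2) * indicator {\<tau> i<..\<tau> (Suc i)} t) \<partial>lborel)"
  proof (rule nn_integral_cong)
    fix t :: real
    have "(step_function n \<tau> c t)\<^sup>2 = 0" if "t < 0"
      using step_function_outside[of n \<tau> t c] assms that by auto
    then have "ennreal ((step_function n \<tau> c t)\<^sup>2) * indicator {0..} t = ennreal ((step_function n \<tau> c t)\<^sup>2)"
      by (auto simp: indicator_def not_le)
    also have "\<dots> = (\<Sum>i<n. ennreal ((c i)\<^sup>2) * indicator {\<tau> i<..\<tau> (Suc i)} t)"
    proof -
      have "(step_function n \<tau> c t)\<^sup>2 = (\<Sum>i<n. (c i)\<^sup>2 * indicator {\<tau> i<..\<tau> (Suc i)} t)"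
        by (rule step_function_square) (rule mono)
      then show ?thesis
        by (simp add: sum_ennreal[symmetric] ennreal_mult' del: sum_ennreal)
    qed
    finally show "ennreal ((step_function n \<tau> c t)\<^sup>2) * indicator {0..} t = (\<Sum>i<n. ennreal ((c i)\<^sup>2) * indicator {\<tau> i<..\<tau> (Suc i)} t)" .
  qed
  also have "\<dots> = (\<Sum>i<n. ennreal ((c i)\<^sup>2) * emeasure lborel {\<tau> i<..\<tau> (Suc i)})"
    by (subst nn_integral_sum) (auto simp: nn_integral_cmult_indicator)
  also have "\<dots> = (\<Sum>i<n. ennreal ((c i)\<^sup>2 * (\<tau> (Suc i) - \<tau> i)))"
    by (intro sum.cong refl) (use mono in \<open>auto simp: ennreal_mult'[symmetric] \<close>)
  also have "\<dots> = ennreal (\<Sum>i<n. (c i)\<^sup>2 * (\<tau> (Suc i) - \<tau> i))"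
    by (rule sum_ennreal) (use mono in auto)
  finally show ?thesis .
qed

lemma norm_iexp_diff_le: "cmod (iexp x - iexp y) \<le> \<bar>x - y\<bar>"
proof -
  have "iexp x - iexp y = iexp y * (iexp (x - y) - 1)"
    by (simp add: algebra_simps exp_add[symmetric])
  then have "cmod (iexp x - iexp y) = cmod (iexp (x - y) - 1)" by (simp add: norm_mult)
  then show ?thesis using iexp_approx1[of "x - y" 0] by simp
qed

text \<open>The difference of the characteristic functions is at most \<open>E |\<theta> (Y - X\<^sub>k)|\<close>, and \<open>|d| \<le> \<epsilon> + d\<^sup>2 / \<epsilon>\<close> brings in the
  second moment.\<close>

lemma (in prob_space) char_tendsto_L2:
  fixes X :: "nat \<Rightarrow> 'a \<Rightarrow> real"
  assumes [measurable]: "\<And>k. X k \<in> borel_measurable M" "Y \<in> borel_measurable M"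
    and lim: "(\<lambda>k. \<integral>\<^sup>+\<omega>. ennreal ((Y \<omega> - X k \<omega>)\<^sup>2) \<partial>M) \<longlonglongrightarrow> 0"
  shows "(\<lambda>k. char (distr M borel (X k)) \<theta>) \<longlonglongrightarrow> char (distr M borel Y) \<theta>"
proof (rule LIMSEQ_I)
  fix r :: real assume r: "r > 0"
  define \<epsilon> where "\<epsilon> = r / 3"
  have \<epsilon>: "\<epsilon> > 0" using r by (simp add: \<epsilon>_def)
  have int: "integrable M (\<lambda>\<omega>. iexp (\<theta> * Z \<omega>))" if [measurable]: "Z \<in> borel_measurable M" for Z :: "'a \<Rightarrow> real"
    by (rule integrable_const_bound[of _ 1]) auto
  define \<delta> where "\<delta> = \<epsilon>\<^sup>2 / (\<theta>\<^sup>2 + 1)"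
  have \<delta>: "\<delta> > 0" using \<epsilon> by (simp add: \<delta>_def add_nonneg_pos)
  have "\<forall>\<^sub>F k in sequentially. (\<integral>\<^sup>+\<omega>. ennreal ((Y \<omega> - X k \<omega>)\<^sup>2) \<partial>M) < ennreal \<delta>"
    using order_tendstoD(2)[OF lim, of "ennreal \<delta>"] \<delta> by simp
  then obtain N where N: "\<And>k. k \<ge> N \<Longrightarrow> (\<integral>\<^sup>+\<omega>. ennreal ((Y \<omega> - X k \<omega>)\<^sup>2) \<partial>M) < ennreal \<delta>"
    unfolding eventually_sequentially by blast
  have "norm (char (distr M borel (X k)) \<theta> - char (distr M borel Y) \<theta>) < r" if k: "k \<ge> N" for k
  proof -
    have "char (distr M borel (X k)) \<theta> - char (distr M borel Y) \<theta> = (\<integral>\<omega>. iexp (\<theta> * X k \<omega>) - iexp (\<theta> * Y \<omega>) \<partial>M)"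
      by (subst Bochner_Integration.integral_diff[OF int int]) (simp_all add: char_def integral_distr)
    also have "ennreal (norm \<dots>) \<le> (\<integral>\<^sup>+\<omega>. norm (iexp (\<theta> * X k \<omega>) - iexp (\<theta> * Y \<omega>)) \<partial>M)"
      by (rule integral_norm_bound_ennreal) (intro Bochner_Integration.integrable_diff int assms)
    also have "\<dots> \<le> (\<integral>\<^sup>+\<omega>. ennreal \<epsilon> + ennreal (\<theta>\<^sup>2 / \<epsilon>) * ennreal ((Y \<omega> - X k \<omega>)\<^sup>2) \<partial>M)"
    proof (rule nn_integral_mono)
      fix \<omega>
      define d where "d = \<theta> * (Y \<omega> - X k \<omega>)"
      have "norm (iexp (\<theta> * X k \<omega>) - iexp (\<theta> * Y \<omega>)) \<le> \<bar>d\<bar>"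
        using norm_iexp_diff_le[of "\<theta> * X k \<omega>" "\<theta> * Y \<omega>"] by (simp add: d_def abs_minus_commute algebra_simps)
      also have "\<bar>d\<bar> \<le> \<epsilon> + d\<^sup>2 / \<epsilon>"
      proof (cases "\<bar>d\<bar> \<le> \<epsilon>")
        case True
        have "0 \<le> d\<^sup>2 / \<epsilon>" using \<epsilon> by simp
        then show ?thesis using True by linarith
      next
        case False
        then have "\<epsilon> * \<bar>d\<bar> \<le> \<bar>d\<bar> * \<bar>d\<bar>" by (intro mult_right_mono) auto
        then have "\<bar>d\<bar> \<le> d\<^sup>2 / \<epsilon>" using \<epsilon> by (simp add: field_simps power2_eq_square)
        then show ?thesis using \<epsilon> by simp
      qed
      also have "\<epsilon> + d\<^sup>2 / \<epsilon> = \<epsilon> + \<theta>\<^sup>2 / \<epsilon> * (Y \<omega> - X k \<omega>)\<^sup>2" by (simp add: d_def power_mult_distrib)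
      finally have "ennreal (norm (iexp (\<theta> * X k \<omega>) - iexp (\<theta> * Y \<omega>))) \<le> ennreal (\<epsilon> + \<theta>\<^sup>2 / \<epsilon> * (Y \<omega> - X k \<omega>)\<^sup>2)"
        by (rule ennreal_leI)
      also have "\<dots> = ennreal \<epsilon> + ennreal (\<theta>\<^sup>2 / \<epsilon>) * ennreal ((Y \<omega> - X k \<omega>)\<^sup>2)"
        using \<epsilon> by (simp add: ennreal_mult'[symmetric])
      finally show "ennreal (norm (iexp (\<theta> * X k \<omega>) - iexp (\<theta> * Y \<omega>))) \<le> ennreal \<epsilon> + ennreal (\<theta>\<^sup>2 / \<epsilon>) * ennreal ((Y \<omega> - X k \<omega>)\<^sup>2)" .
    qed
    also have "\<dots> = ennreal \<epsilon> + ennreal (\<theta>\<^sup>2 / \<epsilon>) * (\<integral>\<^sup>+\<omega>. ennreal ((Y \<omega> - X k \<omega>)\<^sup>2) \<partial>M)"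
      by (subst nn_integral_add) (auto simp: nn_integral_cmult emeasure_space_1)
    also have "\<dots> \<le> ennreal \<epsilon> + ennreal (\<theta>\<^sup>2 / \<epsilon>) * ennreal \<delta>"
      using N[OF k] by (intro add_mono mult_left_mono) (auto intro: less_imp_le)
    also have "\<dots> = ennreal (\<epsilon> + \<theta>\<^sup>2 / \<epsilon> * \<delta>)" using \<epsilon> \<delta> by (simp add: ennreal_mult'[symmetric])
    finally have "norm (char (distr M borel (X k)) \<theta> - char (distr M borel Y) \<theta>) \<le> \<epsilon> + \<theta>\<^sup>2 / \<epsilon> * \<delta>"
      by (subst (asm) ennreal_le_iff) (use \<epsilon> \<delta> in auto)
    also have "\<theta>\<^sup>2 / \<epsilon> * \<delta> = \<epsilon> * (\<theta>\<^sup>2 / (\<theta>\<^sup>2 + 1))" using \<epsilon> by (simp add: \<delta>_def power2_eq_square)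
    also have "\<dots> \<le> \<epsilon> * 1" using \<epsilon> by (intro mult_left_mono) (auto simp: divide_le_eq_1 add_nonneg_pos)
    finally show ?thesis using \<epsilon> by (simp add: \<epsilon>_def)
  qed
  then show "\<exists>N. \<forall>k\<ge>N. norm (char (distr M borel (X k)) \<theta> - char (distr M borel Y) \<theta>) < r" by blast
qed

text \<open>Convergence in \<open>L\<^sup>2\<close> implies convergence of the squared norms \<open>Vs\<close> to \<open>V\<close>; here \<open>d\<close> stands for the squared
  distance.\<close>

lemma L2_norm_tendsto:
  fixes V :: real and Vs :: "nat \<Rightarrow> real" and d :: "nat \<Rightarrow> real"
  assumes d: "d \<longlonglongrightarrow> 0" "\<And>k. 0 \<le> d k" and V: "0 \<le> V"
    and up: "\<And>\<epsilon>. \<epsilon> > 0 \<Longrightarrow> \<forall>\<^sub>F k in sequentially. Vs k \<le> (1 + \<epsilon>) * V + (1 + 1 / \<epsilon>) * d k"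
    and lo: "\<And>\<epsilon>. \<epsilon> > 0 \<Longrightarrow> \<forall>\<^sub>F k in sequentially. V \<le> (1 + \<epsilon>) * Vs k + (1 + 1 / \<epsilon>) * d k"
  shows "Vs \<longlonglongrightarrow> V"
proof (rule order_tendstoI)
  fix a assume a: "V < a"
  define \<epsilon> where "\<epsilon> = (a - V) / (2 * (V + 1))"
  have \<epsilon>: "\<epsilon> > 0" using a V by (simp add: \<epsilon>_def)
  have "\<epsilon> * V \<le> (a - V) / 2"
  proof -
    have "\<epsilon> * V \<le> \<epsilon> * (V + 1)" using \<epsilon> by simp
    also have "\<dots> = (a - V) / 2" using V by (simp add: \<epsilon>_def field_simps)
    finally show ?thesis .
  qed
  then have "(1 + \<epsilon>) * V < a" using a by (simp add: algebra_simps)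
  moreover have "(\<lambda>k. (1 + \<epsilon>) * V + (1 + 1 / \<epsilon>) * d k) \<longlonglongrightarrow> (1 + \<epsilon>) * V + (1 + 1 / \<epsilon>) * 0"
    by (intro tendsto_intros d)
  ultimately have "\<forall>\<^sub>F k in sequentially. (1 + \<epsilon>) * V + (1 + 1 / \<epsilon>) * d k < a"
    by (intro order_tendstoD(2)) auto
  with up[OF \<epsilon>] show "\<forall>\<^sub>F k in sequentially. Vs k < a" by eventually_elim linarith
next
  fix a assume a: "a < V"
  define \<epsilon> where "\<epsilon> = (V - a) / (2 * (\<bar>a\<bar> + 1))"
  have \<epsilon>: "\<epsilon> > 0" using a by (simp add: \<epsilon>_def)
  have "\<epsilon> * a \<le> (V - a) / 2"
  proof -
    have "\<epsilon> * a \<le> \<epsilon> * (\<bar>a\<bar> + 1)" using \<epsilon> by simp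
    also have "\<dots> = (V - a) / 2" by (simp add: \<epsilon>_def field_simps add_nonneg_pos)
    finally show ?thesis .
  qed
  then have "V - (1 + \<epsilon>) * a > 0" using a by (simp add: algebra_simps)
  moreover have "(\<lambda>k. (1 + 1 / \<epsilon>) * d k) \<longlonglongrightarrow> (1 + 1 / \<epsilon>) * 0" by (intro tendsto_intros d)
  ultimately have "\<forall>\<^sub>F k in sequentially. (1 + 1 / \<epsilon>) * d k < V - (1 + \<epsilon>) * a"
    by (intro order_tendstoD(2)) auto
  with lo[OF \<epsilon>] show "\<forall>\<^sub>F k in sequentially. a < Vs k"
  proof eventually_elim
    case (elim k)
    then have "(1 + \<epsilon>) * a < (1 + \<epsilon>) * Vs k" by linarith
    then show ?case using \<epsilon> by (simp add: mult_less_cancel_left_pos)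
  qed
qed

text \<open>Minkowski's inequality in quadratic form: optimising over \<open>\<epsilon>\<close> gives the triangle inequality in \<open>L\<^sup>2\<close>. In
  this form it can be integrated.\<close>

lemma square_le_weighted:
  fixes a b \<epsilon> :: real
  assumes "\<epsilon> > 0"
  shows "a\<^sup>2 \<le> (1 + \<epsilon>) * b\<^sup>2 + (1 + 1 / \<epsilon>) * (a - b)\<^sup>2"
proof -
  have "(1 + \<epsilon>) * b\<^sup>2 + (1 + 1 / \<epsilon>) * (a - b)\<^sup>2 - a\<^sup>2 = (\<epsilon> * b - (a - b))\<^sup>2 / \<epsilon>"
    using assms by (simp add: field_simps power2_eq_square)
  moreover have "0 \<le> (\<epsilon> * b - (a - b))\<^sup>2 / \<epsilon>" using assms by simp
  ultimately show ?thesis by linarith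
qed

lemma ennreal_sum_of_products:
  "0 \<le> a \<Longrightarrow> 0 \<le> b \<Longrightarrow> 0 \<le> c \<Longrightarrow> 0 \<le> d \<Longrightarrow>
    ennreal a * ennreal b + ennreal c * ennreal d = ennreal (a * b + c * d)"
  by (simp add: ennreal_mult)

lemma nn_integral_square_weighted:
  fixes f h :: "real \<Rightarrow> real"
  assumes [measurable]: "f \<in> borel_measurable borel" "h \<in> borel_measurable borel"
    and F: "(\<integral>\<^sup>+t\<in>{0..}. ennreal ((f t)\<^sup>2) \<partial>lborel) = ennreal F"
    and H: "(\<integral>\<^sup>+t\<in>{0..}. ennreal ((h t)\<^sup>2) \<partial>lborel) = ennreal H"
    and d: "(\<integral>\<^sup>+t\<in>{0..}. ennreal ((f t - h t)\<^sup>2) \<partial>lborel) = ennreal d"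
    and pos: "0 \<le> F" "0 \<le> H" "0 \<le> d" "\<epsilon> > 0"
  shows "F \<le> (1 + \<epsilon>) * H + (1 + 1 / \<epsilon>) * d"
proof -
  have "ennreal F \<le> (\<integral>\<^sup>+t. ennreal (1 + \<epsilon>) * (ennreal ((h t)\<^sup>2) * indicator {0..} t) + ennreal (1 + 1 / \<epsilon>) * (ennreal ((f t - h t)\<^sup>2) * indicator {0..} t) \<partial>lborel)"
    unfolding F[symmetric]
  proof (rule nn_integral_mono)
    fix t
    have "ennreal ((f t)\<^sup>2) \<le> ennreal ((1 + \<epsilon>) * (h t)\<^sup>2 + (1 + 1 / \<epsilon>) * (f t - h t)\<^sup>2)"
      using square_le_weighted[OF pos(4), of "f t" "h t"] by (rule ennreal_leI)
    also have "\<dots> = ennreal (1 + \<epsilon>) * ennreal ((h t)\<^sup>2) + ennreal (1 + 1 / \<epsilon>) * ennreal ((f t - h t)\<^sup>2)"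
      using pos(4) by (subst ennreal_plus) (auto simp: ennreal_mult' simp del: ennreal_plus)
    finally show "ennreal ((f t)\<^sup>2) * indicator {0..} t \<le> ennreal (1 + \<epsilon>) * (ennreal ((h t)\<^sup>2) * indicator {0..} t) + ennreal (1 + 1 / \<epsilon>) * (ennreal ((f t - h t)\<^sup>2) * indicator {0..} t)"
      by (simp add: indicator_def)
  qed
  also have "\<dots> = ennreal (1 + \<epsilon>) * ennreal H + ennreal (1 + 1 / \<epsilon>) * ennreal d"
    unfolding H[symmetric] d[symmetric] by (subst nn_integral_add) (auto simp: nn_integral_cmult)
  also have "\<dots> = ennreal ((1 + \<epsilon>) * H + (1 + 1 / \<epsilon>) * d)"
    using pos by (subst ennreal_plus) (auto simp: ennreal_mult' simp del: ennreal_plus)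
  finally show ?thesis using pos by (subst (asm) ennreal_le_iff) auto
qed

context wiener
begin

lemma step_integral_measurable:
  assumes "0 \<le> \<tau> 0" "\<And>i. i < n \<Longrightarrow> \<tau> i \<le> \<tau> (Suc i)"
  shows "step_integral W n \<tau> c \<in> borel_measurable M"
proof -
  have "0 \<le> \<tau> i" if "i \<le> n" for i
    using grid_mono[of n \<tau> 0 i, OF assms(2) le0 that] assms(1) by linarith
  then show ?thesis unfolding step_integral_def[abs_def]
    by (intro borel_measurable_sum borel_measurable_times borel_measurable_const borel_measurable_diff W_measurable) simp_all
qed

lemma step_integral_char:
  assumes \<tau>: "0 \<le> \<tau> 0" "\<And>i. i < n \<Longrightarrow> \<tau> i \<le> \<tau> (Suc i)"
  shows "char (distr M borel (step_integral W n \<tau> c)) \<theta>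
    = of_real (exp (- (\<theta>\<^sup>2 / 2) * (\<Sum>i<n. (c i)\<^sup>2 * (\<tau> (Suc i) - \<tau> i))))"
proof -
  have t0: "0 \<le> \<tau> i" if "i \<le> n" for i using grid_mono[of n \<tau> 0 i, OF \<tau>(2) le0 that] \<tau>(1) by linarith
  have ind: "indep_vars (\<lambda>_. borel) (\<lambda>i \<omega>. c i * (W (\<tau> (Suc i)) \<omega> - W (\<tau> i) \<omega>)) {..<n}"
    by (rule indep_vars_compose2[OF increments_indep[OF \<tau>]]) auto
  have "char (distr M borel (step_integral W n \<tau> c)) \<theta>
      = (\<Prod>i<n. char (distr M borel (\<lambda>\<omega>. c i * (W (\<tau> (Suc i)) \<omega> - W (\<tau> i) \<omega>))) \<theta>)"
    unfolding step_integral_def[abs_def] by (rule char_distr_sum[OF ind])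
  also have "\<dots> = (\<Prod>i<n. of_real (exp (- (\<theta>\<^sup>2 / 2) * ((c i)\<^sup>2 * (\<tau> (Suc i) - \<tau> i)))))"
  proof (rule prod.cong[OF refl])
    fix i assume i: "i \<in> {..<n}"
    have le: "0 \<le> \<tau> i" "\<tau> i \<le> \<tau> (Suc i)" using t0[of i] \<tau>(2)[of i] i by simp_all
    have m: "(\<lambda>\<omega>. W (\<tau> (Suc i)) \<omega> - W (\<tau> i) \<omega>) \<in> borel_measurable M"
      using le by (intro borel_measurable_diff W_measurable) auto
    have "distr M borel (\<lambda>\<omega>. c i * (W (\<tau> (Suc i)) \<omega> - W (\<tau> i) \<omega>))
        = distr (gauss 0 (sqrt (\<tau> (Suc i) - \<tau> i))) borel (\<lambda>x. c i * x)"
      unfolding increment_law[OF le, symmetric] by (subst distr_distr) (use m in \<open>auto simp: comp_def\<close>)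
    then have "char (distr M borel (\<lambda>\<omega>. c i * (W (\<tau> (Suc i)) \<omega> - W (\<tau> i) \<omega>))) \<theta>
        = char (gauss 0 (sqrt (\<tau> (Suc i) - \<tau> i))) (\<theta> * c i)"
      unfolding char_def by (simp add: integral_distr mult_ac)
    also have "\<dots> = of_real (exp (- (\<theta>\<^sup>2 / 2) * ((c i)\<^sup>2 * (\<tau> (Suc i) - \<tau> i))))"
      using le by (simp add: char_gauss power_mult_distrib mult_ac exp_of_real[symmetric] del: exp_of_real)
    finally show "char (distr M borel (\<lambda>\<omega>. c i * (W (\<tau> (Suc i)) \<omega> - W (\<tau> i) \<omega>))) \<theta>
        = of_real (exp (- (\<theta>\<^sup>2 / 2) * ((c i)\<^sup>2 * (\<tau> (Suc i) - \<tau> i))))" .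
  qed
  also have "\<dots> = of_real (exp (- (\<theta>\<^sup>2 / 2) * (\<Sum>i<n. (c i)\<^sup>2 * (\<tau> (Suc i) - \<tau> i))))"
    unfolding sum_distrib_left exp_sum[OF finite_lessThan] by simp
  finally show ?thesis .
qed

text \<open>The step integrals are Gaussian with variance \<open>\<integral> f\<^sub>k\<^sup>2\<close>. Their characteristic functions converge to that of
  \<open>I\<close>, and the variances to \<open>\<integral> f\<^sup>2\<close>.\<close>

theorem wiener_integral_law:
  fixes f :: "real \<Rightarrow> real"
  assumes I: "is_wiener_integral M W f I" and f[measurable]: "f \<in> borel_measurable borel"
    and V: "(\<integral>\<^sup>+t\<in>{0..}. ennreal ((f t)\<^sup>2) \<partial>lborel) = ennreal V" "0 \<le> V"
  shows "distr M borel I = gauss 0 (sqrt V)"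
proof -
  have Im[measurable]: "I \<in> borel_measurable M" using I by (simp add: is_wiener_integral_def)
  obtain n \<tau> c where \<tau>: "\<And>k. 0 \<le> \<tau> k 0" "\<And>k i. i < n k \<Longrightarrow> \<tau> k i \<le> \<tau> k (Suc i)"
    and l1: "(\<lambda>k. \<integral>\<^sup>+t\<in>{0..}. ennreal ((f t - step_function (n k) (\<tau> k) (c k) t)\<^sup>2) \<partial>lborel) \<longlonglongrightarrow> 0"
    and l2: "(\<lambda>k. \<integral>\<^sup>+\<omega>. ennreal ((I \<omega> - step_integral W (n k) (\<tau> k) (c k) \<omega>)\<^sup>2) \<partial>M) \<longlonglongrightarrow> 0"
  proof -
    from I obtain n \<tau> c where "\<forall>k. 0 \<le> \<tau> k 0 \<and> (\<forall>i<n k. \<tau> k i \<le> \<tau> k (Suc i))"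
      "(\<lambda>k. \<integral>\<^sup>+t\<in>{0..}. ennreal ((f t - step_function (n k) (\<tau> k) (c k) t)\<^sup>2) \<partial>lborel) \<longlonglongrightarrow> 0"
      "(\<lambda>k. \<integral>\<^sup>+\<omega>. ennreal ((I \<omega> - step_integral W (n k) (\<tau> k) (c k) \<omega>)\<^sup>2) \<partial>M) \<longlonglongrightarrow> 0"
      unfolding is_wiener_integral_def by blast
    then show ?thesis by (intro that[of \<tau> n c]) auto
  qed
  define Vs where "Vs k = (\<Sum>i<n k. (c k i)\<^sup>2 * (\<tau> k (Suc i) - \<tau> k i))" for k
  define D where "D k = (\<integral>\<^sup>+t\<in>{0..}. ennreal ((f t - step_function (n k) (\<tau> k) (c k) t)\<^sup>2) \<partial>lborel)" for k
  define d where "d k = enn2real (D k)" for k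
  have Vs: "(\<integral>\<^sup>+t\<in>{0..}. ennreal ((step_function (n k) (\<tau> k) (c k) t)\<^sup>2) \<partial>lborel) = ennreal (Vs k)" "0 \<le> Vs k" for k
  proof -
    show "(\<integral>\<^sup>+t\<in>{0..}. ennreal ((step_function (n k) (\<tau> k) (c k) t)\<^sup>2) \<partial>lborel) = ennreal (Vs k)"
      unfolding Vs_def by (rule nn_integral_step_function_square[of "\<tau> k" "n k", OF \<tau>(1)]) (rule \<tau>(2))
    show "0 \<le> Vs k"
      unfolding Vs_def by (intro sum_nonneg mult_nonneg_nonneg) (simp_all add: \<tau>(2))
  qed
  have D0: "D \<longlonglongrightarrow> 0" using l1 by (simp add: D_def[abs_def])
  have d0: "d \<longlonglongrightarrow> 0" unfolding d_def by (intro tendsto_enn2real) (use D0 in simp_all)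
  have ev: "\<forall>\<^sub>F k in sequentially. D k = ennreal (d k)"
  proof -
    have "\<forall>\<^sub>F k in sequentially. D k < 1" by (rule order_tendstoD(2)[OF D0]) simp
    then show ?thesis
    proof eventually_elim
      case (elim k)
      have "D k < top" using elim by (rule less_trans) simp
      then show ?case by (simp add: d_def)
    qed
  qed
  have "Vs \<longlonglongrightarrow> V"
  proof (rule L2_norm_tendsto[OF d0 _ V(2)])
    show "0 \<le> d k" for k by (simp add: d_def)
    fix \<epsilon> :: real assume \<epsilon>: "\<epsilon> > 0"
    show "\<forall>\<^sub>F k in sequentially. Vs k \<le> (1 + \<epsilon>) * V + (1 + 1 / \<epsilon>) * d k"
      using ev
    proof eventually_elim
      case (elim k)
      then show ?case
        by (intro nn_integral_square_weighted[OF step_function_measurable f Vs(1) V(1)])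
           (auto simp: D_def Vs V \<epsilon> d_def power2_commute[of "f _"])
    qed
    show "\<forall>\<^sub>F k in sequentially. V \<le> (1 + \<epsilon>) * Vs k + (1 + 1 / \<epsilon>) * d k"
      using ev
    proof eventually_elim
      case (elim k)
      then show ?case
        by (intro nn_integral_square_weighted[OF f step_function_measurable V(1) Vs(1)])
           (auto simp: D_def Vs V \<epsilon> d_def)
    qed
  qed
  then have lim: "(\<lambda>k. of_real (exp (- (\<theta>\<^sup>2 / 2) * Vs k)) :: complex) \<longlonglongrightarrow> of_real (exp (- (\<theta>\<^sup>2 / 2) * V))" for \<theta>
    by (intro tendsto_intros)
  show ?thesis
  proof (rule gauss_eqI)
    show "real_distribution (distr M borel I)" by (rule real_distribution_distr) simp
    fix \<theta> :: real
    have "(\<lambda>k. char (distr M borel (step_integral W (n k) (\<tau> k) (c k))) \<theta>) \<longlonglongrightarrow> char (distr M borel I) \<theta>"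
      by (rule char_tendsto_L2[OF _ Im l2], rule step_integral_measurable, rule \<tau>(1), rule \<tau>(2))
    moreover have "char (distr M borel (step_integral W (n k) (\<tau> k) (c k))) \<theta> = of_real (exp (- (\<theta>\<^sup>2 / 2) * Vs k))" for k
      unfolding Vs_def by (rule step_integral_char[of "\<tau> k" "n k", OF \<tau>(1)]) (rule \<tau>(2))
    ultimately have "(\<lambda>k. of_real (exp (- (\<theta>\<^sup>2 / 2) * Vs k))) \<longlonglongrightarrow> char (distr M borel I) \<theta>"
      by simp
    from LIMSEQ_unique[OF this lim[of \<theta>]]
    show "char (distr M borel I) \<theta> = exp (\<i> * (\<theta> * 0)) * exp (- ((sqrt V * \<theta>)^2) / 2)"
      using V(2) by (simp add: power_mult_distrib mult_ac)
  qed
qed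

end

text \<open>Existence for \<open>f t = exp (- l t)\<close>. Integration by parts suggests the candidate
  \<open>I = l \<integral>\<^sub>0\<^sup>\<infinity> exp (- l s) W s ds\<close>, an average of \<open>W\<close> over an exponential law; summation by parts
  shows that the step integral on the grid of mesh \<open>1 / \<kappa>\<close> up to time \<open>\<kappa>\<close> is the same average of
  a discretised path, up to the boundary term \<open>exp (- l \<kappa>) W \<kappa>\<close>. Jensen's
  inequality for the exponential law reduces the mean square error to second moments of increments.\<close>

lemma (in prob_space) nn_square_expectation_le:
  fixes D :: "'a \<Rightarrow> real"
  assumes [measurable]: "D \<in> borel_measurable M"
  shows "ennreal ((\<integral>x. D x \<partial>M)\<^sup>2) \<le> (\<integral>\<^sup>+x. ennreal ((D x)\<^sup>2) \<partial>M)"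
proof (cases "integrable M D")
  case True
  have "ennreal ((\<integral>x. D x \<partial>M)\<^sup>2) = (ennreal (norm (\<integral>x. D x \<partial>M)))\<^sup>2"
    by (simp add: ennreal_power)
  also have "\<dots> \<le> (\<integral>\<^sup>+x. norm (D x) \<partial>M)\<^sup>2"
    by (intro power_mono integral_norm_bound_ennreal True) simp
  also have "\<dots> = (\<integral>\<^sup>+x. ennreal (norm (D x)) * 1 \<partial>M)\<^sup>2" by simp
  also have "\<dots> \<le> (\<integral>\<^sup>+x. (ennreal (norm (D x)))\<^sup>2 \<partial>M) * (\<integral>\<^sup>+x. 1\<^sup>2 \<partial>M)"
    by (rule Cauchy_Schwarz_nn_integral) auto
  also have "\<dots> = (\<integral>\<^sup>+x. ennreal ((D x)\<^sup>2) \<partial>M)" by (simp add: emeasure_space_1 ennreal_power)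
  finally show ?thesis .
qed (simp add: not_integrable_integral_eq)

lemma uniform_grid_cell:
  fixes \<kappa> :: nat and t :: real
  assumes "\<kappa> > 0" "0 < t" "t \<le> \<kappa>"
  shows "\<exists>i<\<kappa> * \<kappa>. real i / \<kappa> < t \<and> t \<le> real (Suc i) / \<kappa>"
proof -
  define i where "i = nat (\<lceil>t * \<kappa>\<rceil> - 1)"
  have pos: "0 < t * \<kappa>" using assms by simp
  then have c: "1 \<le> \<lceil>t * \<kappa>\<rceil>" by linarith
  then have ri: "real i = of_int \<lceil>t * \<kappa>\<rceil> - 1" by (simp add: i_def)
  have "t * \<kappa> \<le> real \<kappa> * real \<kappa>" using assms by (intro mult_right_mono) auto
  then have "\<lceil>t * \<kappa>\<rceil> \<le> int (\<kappa> * \<kappa>)" by (simp add: ceiling_le_iff)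
  then have "i < \<kappa> * \<kappa>" using c by (simp add: i_def nat_less_iff)
  moreover have "real i < t * \<kappa>" "t * \<kappa> \<le> real (Suc i)" using ri by linarith+
  ultimately show ?thesis using assms(1)
    by (intro exI[of _ i]) (auto simp: pos_divide_less_eq pos_le_divide_eq)
qed

lemma nn_integral_exponential_moment:
  assumes "0 < l"
  shows "(\<integral>\<^sup>+s. ennreal (s ^ i) \<partial>density lborel (exponential_density l)) = ennreal (fact i / l ^ i)"
proof -
  have "(\<integral>\<^sup>+s. ennreal (s ^ i) \<partial>density lborel (exponential_density l))
      = (\<integral>\<^sup>+s. ennreal (exponential_density l s * s ^ i) \<partial>lborel)"
    by (subst nn_integral_density) (auto simp: ennreal_mult' exponential_density_nonneg assms)
  then show ?thesis using nn_integral_erlang_ith_moment[OF assms, of 0 i] by simp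
qed

lemma exponential_measure_interval:
  assumes "0 < l" "0 \<le> a" "a \<le> b"
  shows "measure (density lborel (exponential_density l)) {a<..b} = exp (- l * a) - exp (- l * b)"
proof -
  let ?Q = "density lborel (exponential_density l)"
  interpret Q: prob_space ?Q using assms by (simp add: prob_space_exponential_density)
  have at: "measure ?Q {..c} = 1 - exp (- l * c)" if "0 \<le> c" for c
    using emeasure_erlang_density[OF assms(1), of 0 c] that assms(1)
    by (simp add: erlang_CDF_0 Q.emeasure_eq_measure)
  have "{a<..b} = {..b} - {..a}" using assms by auto
  then have "measure ?Q {a<..b} = measure ?Q {..b} - measure ?Q {..a}"
    using assms by (simp add: Q.finite_measure_Diff)
  then show ?thesis using at[of a] at[of b] assms by simp
qed

context wiener
begin

lemma is_wiener_integral_exp: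
  assumes l: "0 < l"
  shows "is_wiener_integral M W (\<lambda>t. exp (- l * t)) (\<lambda>\<omega>. \<integral>s. W (max 0 s) \<omega> \<partial>density lborel (exponential_density l))"
proof -
  define Q where "Q = density lborel (exponential_density l)"
  interpret Q: prob_space Q unfolding Q_def using l by (simp add: prob_space_exponential_density)
  interpret P: pair_prob_space Q M ..
  have Qs[measurable_cong]: "sets Q = sets borel" by (simp add: Q_def)
  have Wj: "(\<lambda>p. W (max 0 (fst p)) (snd p)) \<in> borel_measurable (borel \<Otimes>\<^sub>M M)"
    using measurable_continuous_process[of W M] W_measurable W_continuous by (simp add: case_prod_beta)
  have WQ[measurable]: "(\<lambda>p. W (max 0 (fst p)) (snd p)) \<in> borel_measurable (Q \<Otimes>\<^sub>M M)"
    using Wj by (simp cong: measurable_cong_sets sets_pair_measure_cong add: Qs)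
  have WQ'[measurable]: "(\<lambda>p. W (max 0 (snd p)) (fst p)) \<in> borel_measurable (M \<Otimes>\<^sub>M Q)"
    using measurable_compose[OF measurable_pair_swap' WQ] by (simp add: case_prod_beta)
  define I where "I \<omega> = (\<integral>s. W (max 0 s) \<omega> \<partial>Q)" for \<omega>
  have I[measurable]: "I \<in> borel_measurable M"
    unfolding I_def using Q.borel_measurable_lebesgue_integral[of "\<lambda>\<omega> s. W (max 0 s) \<omega>"] WQ'
    by (simp add: case_prod_beta)
  have Qpos: "AE s in Q. 0 < s"
  proof -
    have "AE s in lborel. s \<noteq> (0::real)" by (rule AE_lborel_singleton)
    then show ?thesis unfolding Q_def
      by (subst AE_density) (auto elim!: eventually_mono simp: exponential_density_def)
  qed
  have Wint: "AE \<omega> in M. integrable Q (\<lambda>s. W (max 0 s) \<omega>)"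
  proof -
    have "(\<integral>\<^sup>+\<omega>. \<integral>\<^sup>+s. ennreal ((W (max 0 s) \<omega>)\<^sup>2) \<partial>Q \<partial>M) = (\<integral>\<^sup>+s. \<integral>\<^sup>+\<omega>. ennreal ((W (max 0 s) \<omega>)\<^sup>2) \<partial>M \<partial>Q)"
      using P.Fubini'[of "\<lambda>s \<omega>. ennreal ((W (max 0 s) \<omega>)\<^sup>2)"] by (simp add: case_prod_beta)
    also have "\<dots> = (\<integral>\<^sup>+s. ennreal (s ^ 1) \<partial>Q)"
      using Qpos by (intro nn_integral_cong_AE) (auto elim!: eventually_mono simp: W_second_moment)
    also have "\<dots> < \<infinity>" unfolding Q_def nn_integral_exponential_moment[OF l] by simp
    finally have "(\<integral>\<^sup>+\<omega>. \<integral>\<^sup>+s. ennreal ((W (max 0 s) \<omega>)\<^sup>2) \<partial>Q \<partial>M) \<noteq> \<infinity>" by simp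
    moreover have "(\<lambda>\<omega>. \<integral>\<^sup>+s. ennreal ((W (max 0 s) \<omega>)\<^sup>2) \<partial>Q) \<in> borel_measurable M"
      using Q.borel_measurable_nn_integral[of "\<lambda>\<omega> s. ennreal ((W (max 0 s) \<omega>)\<^sup>2)" M] WQ' by (simp add: case_prod_beta)
    ultimately have "AE \<omega> in M. (\<integral>\<^sup>+s. ennreal ((W (max 0 s) \<omega>)\<^sup>2) \<partial>Q) \<noteq> \<infinity>"
      by (intro nn_integral_PInf_AE)
    with AE_space show ?thesis
    proof eventually_elim
      case (elim \<omega>)
      have m: "(\<lambda>s. W (max 0 s) \<omega>) \<in> borel_measurable Q"
        using measurable_compose[OF measurable_Pair2'[OF elim(1)] WQ] by simp
      have "integrable Q (\<lambda>s. (W (max 0 s) \<omega>)\<^sup>2)"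
        using elim(2) m by (intro integrableI_nonneg) (auto simp: less_top)
      then show ?case by (rule Q.square_integrable_imp_integrable[OF m])
    qed
  qed
  \<comment> \<open>\<open>n = \<kappa>\<^sup>2\<close> cells of length \<open>1 / \<kappa>\<close> cover \<open>(0, \<kappa>]\<close>.\<close>
  define \<kappa> where "\<kappa> k = Suc k" for k :: nat
  define n where "n k = \<kappa> k * \<kappa> k" for k
  define \<tau> where "\<tau> k i = real i / \<kappa> k" for k i
  define c where "c k i = exp (- l * \<tau> k i)" for k i
  have \<kappa>0: "real (\<kappa> k) > 0" for k by (simp add: \<kappa>_def)
  have \<tau>0: "\<tau> k 0 = 0" for k by (simp add: \<tau>_def)
  have \<tau>m: "\<tau> k i \<le> \<tau> k (Suc i)" for k i unfolding \<tau>_def by (intro divide_right_mono) auto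
  have \<tau>pos: "0 \<le> \<tau> k i" for k i unfolding \<tau>_def by simp
  have \<tau>d: "\<tau> k (Suc i) - \<tau> k i = 1 / \<kappa> k" for k i unfolding \<tau>_def by (simp add: diff_divide_distrib[symmetric])
  have \<tau>n: "\<tau> k (n k) = \<kappa> k" for k using \<kappa>0[of k] by (simp add: \<tau>_def n_def)
  have cell: "\<exists>i<n k. \<tau> k i < t \<and> t \<le> \<tau> k (Suc i)" if "0 < t" "t \<le> \<kappa> k" for k and t :: real
    using uniform_grid_cell[of "\<kappa> k" t] that \<kappa>0[of k] by (simp add: n_def \<tau>_def)
  have inv0: "(\<lambda>k. C / real (\<kappa> k)) \<longlonglongrightarrow> 0" for C
    unfolding \<kappa>_def using tendsto_mult_right_zero[OF LIMSEQ_inverse_real_of_nat, of C] by (simp add: divide_inverse)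
  have f_lim: "(\<lambda>k. \<integral>\<^sup>+t\<in>{0..}. ennreal ((exp (- l * t) - step_function (n k) (\<tau> k) (c k) t)\<^sup>2) \<partial>lborel) \<longlonglongrightarrow> 0"
  proof (rule tendsto_sandwich[OF _ _ tendsto_const])
    define C where "C = l\<^sup>2 + 1 / (2 * l) * (1 / (2 * l))"
    show "\<forall>\<^sub>F k in sequentially. (\<integral>\<^sup>+t\<in>{0..}. ennreal ((exp (- l * t) - step_function (n k) (\<tau> k) (c k) t)\<^sup>2) \<partial>lborel) \<le> ennreal (C / \<kappa> k)"
    proof (intro always_eventually allI)
      fix k
      have "(\<integral>\<^sup>+t\<in>{0..}. ennreal ((exp (- l * t) - step_function (n k) (\<tau> k) (c k) t)\<^sup>2) \<partial>lborel)
          \<le> (\<integral>\<^sup>+t. ennreal ((l / \<kappa> k)\<^sup>2) * indicator {0..real (\<kappa> k)} t + ennreal (1 / (2 * l * \<kappa> k)) * ennreal (exponential_density (2 * l) t * t ^ 1) \<partial>lborel)"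
      proof (rule nn_integral_mono_AE)
        have "AE t in lborel. t \<noteq> (0::real)" by (rule AE_lborel_singleton)
        then show "AE t in lborel. ennreal ((exp (- l * t) - step_function (n k) (\<tau> k) (c k) t)\<^sup>2) * indicator {0..} t
            \<le> ennreal ((l / \<kappa> k)\<^sup>2) * indicator {0..real (\<kappa> k)} t + ennreal (1 / (2 * l * \<kappa> k)) * ennreal (exponential_density (2 * l) t * t ^ 1)"
        proof eventually_elim
          case (elim t)
          consider "t < 0" | "0 < t" "t \<le> \<kappa> k" | "0 < t" "\<kappa> k < t" using elim by linarith
          then show ?case
          proof cases
            case 2
            then obtain i where i: "i < n k" "\<tau> k i < t" "t \<le> \<tau> k (Suc i)" using cell[OF 2] by blast
            have "step_function (n k) (\<tau> k) (c k) t = c k i"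
              by (rule step_function_inside[of "n k" "\<tau> k", OF \<tau>m i])
            moreover have "(exp (- l * t) - c k i)\<^sup>2 \<le> (l / \<kappa> k)\<^sup>2"
            proof -
              have 1: "exp (- l * t) \<le> c k i" using i l by (simp add: c_def)
              have "c k i - exp (- l * t) = c k i * (1 - exp (- (l * (t - \<tau> k i))))"
                by (simp add: c_def algebra_simps exp_add[symmetric])
              also have "\<dots> \<le> 1 * (l * (t - \<tau> k i))"
                using i l \<tau>pos[of k i] exp_ge_add_one_self[of "- (l * (t - \<tau> k i))"] by (intro mult_mono) (auto simp: c_def)
              also have "\<dots> \<le> l * (1 / \<kappa> k)" 
                unfolding mult_1 using i l \<tau>d[of k i] by (intro mult_left_mono) linarith+
              finally have "\<bar>exp (- l * t) - c k i\<bar> \<le> l / \<kappa> k" using 1 by simp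
              then have "\<bar>exp (- l * t) - c k i\<bar>\<^sup>2 \<le> (l / \<kappa> k)\<^sup>2" by (rule power_mono) simp
              then show ?thesis by simp
            qed
            ultimately show ?thesis using 2 l by (auto simp: indicator_def intro!: add_increasing2 ennreal_leI)
          next
            case 3
            have "step_function (n k) (\<tau> k) (c k) t = 0"
              by (rule step_function_outside[of "n k" "\<tau> k", OF \<tau>m]) (use 3 \<tau>n in auto)
            moreover have "(exp (- l * t))\<^sup>2 \<le> 1 / (2 * l * \<kappa> k) * (exponential_density (2 * l) t * t ^ 1)"
            proof -
              have "(exp (- l * t))\<^sup>2 = exp (- (2 * l * t))" by (simp add: exp_double[symmetric])
              also have "\<dots> = 1 * exp (- (2 * l * t))" by simp
              \<comment> \<open>Beyond the grid \<open>1 \<le> t / \<kappa>\<close>, and the first moment of an exponential law is finite.\<close>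
              also have "\<dots> \<le> t / \<kappa> k * exp (- (2 * l * t))"
                using 3 \<kappa>0[of k] by (intro mult_right_mono) (simp_all add: pos_le_divide_eq)
              also have "\<dots> = 1 / (2 * l * \<kappa> k) * (exponential_density (2 * l) t * t ^ 1)"
                using 3 l by (simp add: exponential_density_def mult_ac)
              finally show ?thesis .
            qed
            ultimately show ?thesis using 3 l by (auto simp: indicator_def ennreal_mult'[symmetric] intro!: ennreal_leI)
          qed simp
        qed
      qed
      also have "\<dots> = ennreal ((l / \<kappa> k)\<^sup>2) * ennreal (\<kappa> k) + ennreal (1 / (2 * l * \<kappa> k)) * ennreal (1 / (2 * l))"
        using nn_integral_erlang_ith_moment[of "2 * l" 0 1] l
        by (subst nn_integral_add) (auto simp: nn_integral_cmult nn_integral_cmult_indicator)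
      also have "\<dots> = ennreal ((l / \<kappa> k)\<^sup>2 * \<kappa> k + 1 / (2 * l * \<kappa> k) * (1 / (2 * l)))"
        by (rule ennreal_sum_of_products) (use l in auto)
      also have "(l / \<kappa> k)\<^sup>2 * \<kappa> k + 1 / (2 * l * \<kappa> k) * (1 / (2 * l)) = C / \<kappa> k"
        using l \<kappa>0[of k] by (simp add: C_def field_simps power2_eq_square)
      finally show "(\<integral>\<^sup>+t\<in>{0..}. ennreal ((exp (- l * t) - step_function (n k) (\<tau> k) (c k) t)\<^sup>2) \<partial>lborel) \<le> ennreal (C / \<kappa> k)" .
    qed
    show "(\<lambda>k. ennreal (C / \<kappa> k)) \<longlonglongrightarrow> 0" using tendsto_ennrealI[OF inv0[of C]] by simp
  qed simp
  have I_lim: "(\<lambda>k. \<integral>\<^sup>+\<omega>. ennreal ((I \<omega> - step_integral W (n k) (\<tau> k) (c k) \<omega>)\<^sup>2) \<partial>M) \<longlonglongrightarrow> 0"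
  proof (rule tendsto_sandwich[OF _ _ tendsto_const])
    define C where "C = 2 * (1 + 2 / l\<^sup>2) + 2 * (1 / (2 * l\<^sup>2))"
    show "\<forall>\<^sub>F k in sequentially. (\<integral>\<^sup>+\<omega>. ennreal ((I \<omega> - step_integral W (n k) (\<tau> k) (c k) \<omega>)\<^sup>2) \<partial>M) \<le> ennreal (C / \<kappa> k)"
    proof (intro always_eventually allI)
      fix k
      define Wk where "Wk s \<omega> = step_function (n k) (\<tau> k) (\<lambda>i. W (\<tau> k (Suc i)) \<omega>) s" for s \<omega>
      define D where "D s \<omega> = W (max 0 s) \<omega> - Wk s \<omega>" for s \<omega>
      have WkQ[measurable]: "(\<lambda>p. Wk (fst p) (snd p)) \<in> borel_measurable (Q \<Otimes>\<^sub>M M)"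
      proof -
        have [measurable]: "(\<lambda>p. W (\<tau> k (Suc i)) (snd p)) \<in> borel_measurable (Q \<Otimes>\<^sub>M M)" for i
          using \<tau>pos by (intro measurable_compose[OF measurable_snd W_measurable])
        show ?thesis unfolding Wk_def step_function_def by measurable
      qed
      have DQ[measurable]: "(\<lambda>p. D (fst p) (snd p)) \<in> borel_measurable (Q \<Otimes>\<^sub>M M)" unfolding D_def by measurable
      have DQ'[measurable]: "(\<lambda>p. D (snd p) (fst p)) \<in> borel_measurable (M \<Otimes>\<^sub>M Q)"
        using measurable_compose[OF measurable_pair_swap' DQ] by (simp add: case_prod_beta)
      have Wk_int: "has_bochner_integral Q (\<lambda>s. Wk s \<omega>) (\<Sum>i<n k. W (\<tau> k (Suc i)) \<omega> * (c k i - c k (Suc i)))" for \<omega>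
        unfolding Wk_def step_function_def
      proof (intro has_bochner_integral_sum has_bochner_integral_mult_right)
        fix i
        have "has_bochner_integral Q (indicator {\<tau> k i<..\<tau> k (Suc i)}) (measure Q {\<tau> k i<..\<tau> k (Suc i)})"
          by (rule has_bochner_integral_real_indicator) (auto simp: Qs less_top[symmetric])
        then show "has_bochner_integral Q (indicator {\<tau> k i<..\<tau> k (Suc i)}) (c k i - c k (Suc i))"
          unfolding Q_def exponential_measure_interval[OF l \<tau>pos \<tau>m] by (simp add: c_def)
      qed
      \<comment> \<open>Summation by parts.\<close>
      have parts: "(\<Sum>i<m. W (\<tau> k (Suc i)) \<omega> * (c k i - c k (Suc i)))
          = step_integral W m (\<tau> k) (c k) \<omega> + c k 0 * W (\<tau> k 0) \<omega> - c k m * W (\<tau> k m) \<omega>" for m \<omega>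
        by (induction m) (simp_all add: step_integral_def algebra_simps)
      have AE_eq: "AE \<omega> in M. I \<omega> - step_integral W (n k) (\<tau> k) (c k) \<omega> = (\<integral>s. D s \<omega> \<partial>Q) - c k (n k) * W (\<kappa> k) \<omega>"
        using Wint W_0
      proof eventually_elim
        case (elim \<omega>)
        have "(\<integral>s. D s \<omega> \<partial>Q) = I \<omega> - (\<integral>s. Wk s \<omega> \<partial>Q)"
          unfolding D_def I_def using Wk_int[of \<omega>] elim(1)
          by (intro Bochner_Integration.integral_diff) (auto simp: has_bochner_integral_iff)
        then show ?case
          using Wk_int[of \<omega>] parts[of \<omega> "n k"] elim(2) by (simp add: has_bochner_integral_iff \<tau>0 \<tau>n)
      qed
      have ED: "(\<integral>\<^sup>+\<omega>. ennreal ((D s \<omega>)\<^sup>2) \<partial>M) \<le> ennreal (1 / \<kappa> k) + ennreal (1 / \<kappa> k) * ennreal (s ^ 2)" if s: "0 < s" for s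
      proof (cases "s \<le> \<kappa> k")
        case True
        then obtain i where i: "i < n k" "\<tau> k i < s" "s \<le> \<tau> k (Suc i)" using cell[OF s True] by blast
        have "D s \<omega> = - (W (\<tau> k (Suc i)) \<omega> - W s \<omega>)" for \<omega>
          unfolding D_def Wk_def step_function_inside[of "n k" "\<tau> k", OF \<tau>m i] using s by simp
        then have "(\<integral>\<^sup>+\<omega>. ennreal ((D s \<omega>)\<^sup>2) \<partial>M) = ennreal (\<tau> k (Suc i) - s)"
          using increment_second_moment[of s "\<tau> k (Suc i)"] s i by (simp only: power2_minus less_imp_le)
        also have "\<dots> \<le> ennreal (1 / \<kappa> k)" using \<tau>d[of k i] i by (intro ennreal_leI) linarith
        finally show ?thesis by (rule order_trans) simp
      next
        case False
        then have "D s \<omega> = W s \<omega>" for \<omega>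
          unfolding D_def Wk_def using step_function_outside[of "n k" "\<tau> k" s, OF \<tau>m] \<tau>n s by simp
        then have "(\<integral>\<^sup>+\<omega>. ennreal ((D s \<omega>)\<^sup>2) \<partial>M) = ennreal s" using W_second_moment[of s] s by simp
        \<comment> \<open>Beyond the grid \<open>s \<le> s\<^sup>2 / \<kappa>\<close>.\<close>
        also have "\<dots> \<le> ennreal (1 / \<kappa> k * s ^ 2)"
          using False s \<kappa>0[of k] by (intro ennreal_leI) (simp add: field_simps power2_eq_square)
        also have "\<dots> = ennreal (1 / \<kappa> k) * ennreal (s ^ 2)" by (subst ennreal_mult') auto
        finally show ?thesis by (rule order_trans) simp
      qed
      have "(\<integral>\<^sup>+\<omega>. ennreal ((I \<omega> - step_integral W (n k) (\<tau> k) (c k) \<omega>)\<^sup>2) \<partial>M)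
          \<le> (\<integral>\<^sup>+\<omega>. 2 * (\<integral>\<^sup>+s. ennreal ((D s \<omega>)\<^sup>2) \<partial>Q) + ennreal (2 * (c k (n k))\<^sup>2) * ennreal ((W (\<kappa> k) \<omega>)\<^sup>2) \<partial>M)"
      proof (rule nn_integral_mono_AE)
        show "AE \<omega> in M. ennreal ((I \<omega> - step_integral W (n k) (\<tau> k) (c k) \<omega>)\<^sup>2)
            \<le> 2 * (\<integral>\<^sup>+s. ennreal ((D s \<omega>)\<^sup>2) \<partial>Q) + ennreal (2 * (c k (n k))\<^sup>2) * ennreal ((W (\<kappa> k) \<omega>)\<^sup>2)"
          using AE_eq AE_space
        proof eventually_elim
          case (elim \<omega>)
          have m: "(\<lambda>s. D s \<omega>) \<in> borel_measurable Q"
            using measurable_compose[OF measurable_Pair2'[OF elim(2)] DQ] by simp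
          define x where "x = (\<integral>s. D s \<omega> \<partial>Q)"
          define y where "y = c k (n k) * W (\<kappa> k) \<omega>"
          have "(x - y)\<^sup>2 \<le> 2 * x\<^sup>2 + 2 * y\<^sup>2"
            using zero_le_power2[of "x + y"] by (simp add: power2_eq_square algebra_simps)
          then have "ennreal ((x - y)\<^sup>2) \<le> ennreal (2 * x\<^sup>2 + 2 * y\<^sup>2)" by (rule ennreal_leI)
          also have "\<dots> = 2 * ennreal (x\<^sup>2) + ennreal (2 * (c k (n k))\<^sup>2) * ennreal ((W (\<kappa> k) \<omega>)\<^sup>2)"
            by (subst ennreal_plus) (auto simp: ennreal_mult' y_def power_mult_distrib mult.assoc)
          also have "\<dots> \<le> 2 * (\<integral>\<^sup>+s. ennreal ((D s \<omega>)\<^sup>2) \<partial>Q) + ennreal (2 * (c k (n k))\<^sup>2) * ennreal ((W (\<kappa> k) \<omega>)\<^sup>2)"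
            unfolding x_def by (intro add_right_mono mult_left_mono Q.nn_square_expectation_le m) simp
          finally show ?case unfolding elim(1) x_def y_def .
        qed
      qed
      also have "\<dots> = 2 * (\<integral>\<^sup>+\<omega>. \<integral>\<^sup>+s. ennreal ((D s \<omega>)\<^sup>2) \<partial>Q \<partial>M) + ennreal (2 * (c k (n k))\<^sup>2) * (\<integral>\<^sup>+\<omega>. ennreal ((W (\<kappa> k) \<omega>)\<^sup>2) \<partial>M)"
      proof -
        have [measurable]: "(\<lambda>\<omega>. \<integral>\<^sup>+s. ennreal ((D s \<omega>)\<^sup>2) \<partial>Q) \<in> borel_measurable M"
          using Q.borel_measurable_nn_integral[of "\<lambda>\<omega> s. ennreal ((D s \<omega>)\<^sup>2)" M] DQ' by (simp add: case_prod_beta)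
        show ?thesis by (subst nn_integral_add) (auto simp: nn_integral_cmult)
      qed
      also have "(\<integral>\<^sup>+\<omega>. \<integral>\<^sup>+s. ennreal ((D s \<omega>)\<^sup>2) \<partial>Q \<partial>M) = (\<integral>\<^sup>+s. \<integral>\<^sup>+\<omega>. ennreal ((D s \<omega>)\<^sup>2) \<partial>M \<partial>Q)"
        using P.Fubini'[of "\<lambda>s \<omega>. ennreal ((D s \<omega>)\<^sup>2)"] by (simp add: case_prod_beta)
      also have "\<dots> \<le> (\<integral>\<^sup>+s. ennreal (1 / \<kappa> k) + ennreal (1 / \<kappa> k) * ennreal (s ^ 2) \<partial>Q)"
        using Qpos by (intro nn_integral_mono_AE) (auto elim!: eventually_mono intro!: ED)
      also have "\<dots> = ennreal (1 / \<kappa> k) + ennreal (1 / \<kappa> k) * ennreal (2 / l\<^sup>2)"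
        using nn_integral_exponential_moment[OF l, of 2] unfolding Q_def[symmetric]
        by (subst nn_integral_add) (auto simp: nn_integral_cmult Q.emeasure_space_1)
      also have "\<dots> = ennreal (1 / \<kappa> k * (1 + 2 / l\<^sup>2))"
        using l by (simp add: ennreal_mult'[symmetric] ennreal_plus[symmetric] distrib_left del: ennreal_plus)
      also have "(\<integral>\<^sup>+\<omega>. ennreal ((W (\<kappa> k) \<omega>)\<^sup>2) \<partial>M) = ennreal (\<kappa> k)" by (rule W_second_moment) simp
      also have "2 * ennreal (1 / \<kappa> k * (1 + 2 / l\<^sup>2)) + ennreal (2 * (c k (n k))\<^sup>2) * ennreal (\<kappa> k)
          = ennreal (2 * (1 / \<kappa> k * (1 + 2 / l\<^sup>2)) + 2 * (c k (n k))\<^sup>2 * \<kappa> k)"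
        by (rule ennreal_sum_of_products[of 2, unfolded ennreal_numeral]) (use l in auto)
      also have "\<dots> \<le> ennreal (C / \<kappa> k)"
      proof (rule ennreal_leI)
        define y where "y = l * \<kappa> k"
        have y: "y > 0" using l \<kappa>0[of k] by (simp add: y_def)
        have "(c k (n k))\<^sup>2 = exp (- (2 * y))" by (simp add: c_def \<tau>n y_def exp_double[symmetric])
        moreover have "2 * y\<^sup>2 \<le> exp (2 * y)"
          using exp_lower_Taylor_quadratic[of "2 * y"] y by (simp add: power_mult_distrib)
        then have "exp (- (2 * y)) \<le> 1 / (2 * y\<^sup>2)"
          using y by (simp add: exp_minus inverse_eq_divide frac_le)
        \<comment> \<open>The boundary term \<open>\<kappa> exp (- 2 l \<kappa>)\<close> is \<open>O(1 / \<kappa>)\<close>.\<close>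
        ultimately have "2 * (c k (n k))\<^sup>2 * \<kappa> k \<le> 2 * (1 / (2 * y\<^sup>2)) * \<kappa> k" by (intro mult_right_mono mult_left_mono) auto
        also have "\<dots> = 2 * (1 / (2 * l\<^sup>2)) / \<kappa> k" using \<kappa>0[of k] l by (simp add: y_def power2_eq_square field_simps)
        finally show "2 * (1 / \<kappa> k * (1 + 2 / l\<^sup>2)) + 2 * (c k (n k))\<^sup>2 * \<kappa> k \<le> C / \<kappa> k"
          by (simp add: C_def add_divide_distrib)
      qed
      finally show "(\<integral>\<^sup>+\<omega>. ennreal ((I \<omega> - step_integral W (n k) (\<tau> k) (c k) \<omega>)\<^sup>2) \<partial>M) \<le> ennreal (C / \<kappa> k)"
        by (simp add: add_right_mono mult_left_mono)
    qed
    show "(\<lambda>k. ennreal (C / \<kappa> k)) \<longlonglongrightarrow> 0" using tendsto_ennrealI[OF inv0[of C]] by simp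
  qed simp
  have "is_wiener_integral M W (\<lambda>t. exp (- l * t)) I"
    unfolding is_wiener_integral_def
    by (intro conjI exI[of _ n] exI[of _ \<tau>] exI[of _ c] I f_lim I_lim) (simp add: \<tau>0 \<tau>m)
  then show ?thesis by (simp add: I_def[abs_def] Q_def)
qed

corollary wiener_integral_exp_law:
  assumes l: "0 < l"
  shows "wiener_integral M W (\<lambda>t. exp (- l * t)) \<in> borel_measurable M"
    and "distr M borel (wiener_integral M W (\<lambda>t. exp (- l * t))) = gauss 0 (sqrt (1 / (2 * l)))"
proof -
  have I: "is_wiener_integral M W (\<lambda>t. exp (- l * t)) (wiener_integral M W (\<lambda>t. exp (- l * t)))"
    unfolding wiener_integral_def 
    using someI_ex[of "is_wiener_integral M W (\<lambda>t. exp (- l * t))"] is_wiener_integral_exp[OF l] by blast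
  then show "wiener_integral M W (\<lambda>t. exp (- l * t)) \<in> borel_measurable M" by (simp add: is_wiener_integral_def)
  have "(\<integral>\<^sup>+t\<in>{0..}. ennreal ((exp (- l * t))\<^sup>2) \<partial>lborel) = (\<integral>\<^sup>+t. ennreal (1 / (2 * l)) * ennreal (exponential_density (2 * l) t * t ^ 0) \<partial>lborel)"
    by (intro nn_integral_cong) (use l in \<open>auto simp: exponential_density_def indicator_def ennreal_mult'[symmetric] exp_double[symmetric] mult_ac\<close>)
  also have "\<dots> = ennreal (1 / (2 * l))"
    using nn_integral_erlang_ith_moment[of "2 * l" 0 0] l by (subst nn_integral_cmult) auto
  finally show "distr M borel (wiener_integral M W (\<lambda>t. exp (- l * t))) = gauss 0 (sqrt (1 / (2 * l)))"
    using l by (intro wiener_integral_law[OF I]) auto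
qed

end

section \<open>The three-dimensional system and its Ornstein--Uhlenbeck component\<close>

lemma f1_components[simp]: "f1 $ 1 = 1" "f1 $ 2 = 0" "f1 $ 3 = 0"
  by (simp_all add: f1_def)

lemma drift_S_components[simp]:
  "drift_S l1 l2 l3 \<kappa> u $ 1 = - l1 * u$1 - ((u$2)\<^sup>2 + (u$3)\<^sup>2) + \<kappa>"
  "drift_S l1 l2 l3 \<kappa> u $ 2 = - l2 * u$2 + u$1 * u$2"
  "drift_S l1 l2 l3 \<kappa> u $ 3 = - l3 * u$3 + u$1 * u$3"
  by (simp_all add: drift_S_def)

lemma A_lin_components[simp]:
  "A_lin l1 l2 l3 u $ 1 = - (l1 * u$1)" "A_lin l1 l2 l3 u $ 2 = - (l2 * u$2)" "A_lin l1 l2 l3 u $ 3 = - (l3 * u$3)"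
  by (simp_all add: A_lin_def)

lemma inner_3: "(x::real^3) \<bullet> y = x$1 * y$1 + x$2 * y$2 + x$3 * y$3"
  by (simp add: inner_vec_def sum_3)

lemma vec3_eq_iff: "(x::real^3) = y \<longleftrightarrow> x$1 = y$1 \<and> x$2 = y$2 \<and> x$3 = y$3"
  by (simp add: vec_eq_iff forall_3)

lemma norm_f1[simp]: "norm f1 = 1"
  by (simp add: norm_eq_sqrt_inner inner_3)

lemma norm_le_3: "norm (x::real^3) \<le> \<bar>x$1\<bar> + \<bar>x$2\<bar> + \<bar>x$3\<bar>"
  using norm_le_l1_cart[of x] by (simp add: sum_3)

lemma drift_S_local_lipschitz: "\<exists>L. L-lipschitz_on (cball 0 R) (drift_S l1 l2 l3 \<kappa>)"
proof (intro exI lipschitz_onI)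
  define r where "r = \<bar>R\<bar>"
  define L where "L = (\<bar>l1\<bar> + 4 * r) + (\<bar>l2\<bar> + 2 * r) + (\<bar>l3\<bar> + 2 * r)"
  show "0 \<le> L" by (simp add: L_def r_def)
  fix x y :: "real^3" assume "x \<in> cball 0 R" "y \<in> cball 0 R"
  then have nx: "norm x \<le> r" "norm y \<le> r" by (auto simp: r_def)
  have c: "\<bar>x$i\<bar> \<le> r" "\<bar>y$i\<bar> \<le> r" for i
    using component_le_norm_cart[of x i] component_le_norm_cart[of y i] nx by linarith+
  define D where "D = norm (x - y)"
  have d: "\<bar>x$i - y$i\<bar> \<le> D" for i using component_le_norm_cart[of "x - y" i] by (simp add: D_def)
  have D0: "0 \<le> D" and r0: "0 \<le> r" by (auto simp: D_def r_def)
  have prod: "\<bar>x$i * x$j - y$i * y$j\<bar> \<le> 2 * r * D" for i j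
  proof -
    have "x$i * x$j - y$i * y$j = x$i * (x$j - y$j) + (x$i - y$i) * y$j" by (simp add: algebra_simps)
    also have "\<bar>\<dots>\<bar> \<le> \<bar>x$i\<bar> * \<bar>x$j - y$j\<bar> + \<bar>x$i - y$i\<bar> * \<bar>y$j\<bar>"
      by (metis abs_mult abs_triangle_ineq)
    also have "\<dots> \<le> r * D + D * r" using c d D0 r0 by (intro add_mono mult_mono) auto
    finally show ?thesis by (simp add: mult_ac)
  qed
  have lin: "\<bar>l * (x$i - y$i)\<bar> \<le> \<bar>l\<bar> * D" for l i using d by (simp add: abs_mult mult_left_mono)
  have "\<bar>(drift_S l1 l2 l3 \<kappa> x - drift_S l1 l2 l3 \<kappa> y) $ 1\<bar> \<le> (\<bar>l1\<bar> + 4 * r) * D"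
  proof -
    have "(drift_S l1 l2 l3 \<kappa> x - drift_S l1 l2 l3 \<kappa> y) $ 1 = - (l1 * (x$1 - y$1)) - (x$2 * x$2 - y$2 * y$2) - (x$3 * x$3 - y$3 * y$3)"
      by (simp add: power2_eq_square algebra_simps)
    also have "\<bar>\<dots>\<bar> \<le> (\<bar>l1\<bar> + 4 * r) * D"
      using lin[of l1 1] prod[of 2 2] prod[of 3 3] by (simp add: algebra_simps abs_le_iff)
    finally show ?thesis .
  qed
  moreover have "\<bar>(drift_S l1 l2 l3 \<kappa> x - drift_S l1 l2 l3 \<kappa> y) $ 2\<bar> \<le> (\<bar>l2\<bar> + 2 * r) * D"
  proof -
    have "(drift_S l1 l2 l3 \<kappa> x - drift_S l1 l2 l3 \<kappa> y) $ 2 = - (l2 * (x$2 - y$2)) + (x$1 * x$2 - y$1 * y$2)"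
      by (simp add: algebra_simps)
    also have "\<bar>\<dots>\<bar> \<le> (\<bar>l2\<bar> + 2 * r) * D"
      using lin[of l2 2] prod[of 1 2] by (simp add: algebra_simps abs_le_iff)
    finally show ?thesis .
  qed
  moreover have "\<bar>(drift_S l1 l2 l3 \<kappa> x - drift_S l1 l2 l3 \<kappa> y) $ 3\<bar> \<le> (\<bar>l3\<bar> + 2 * r) * D"
  proof -
    have "(drift_S l1 l2 l3 \<kappa> x - drift_S l1 l2 l3 \<kappa> y) $ 3 = - (l3 * (x$3 - y$3)) + (x$1 * x$3 - y$1 * y$3)"
      by (simp add: algebra_simps)
    also have "\<bar>\<dots>\<bar> \<le> (\<bar>l3\<bar> + 2 * r) * D"
      using lin[of l3 3] prod[of 1 3] by (simp add: algebra_simps abs_le_iff)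
    finally show ?thesis .
  qed
  ultimately show "dist (drift_S l1 l2 l3 \<kappa> x) (drift_S l1 l2 l3 \<kappa> y) \<le> L * dist x y"
    using norm_le_3[of "drift_S l1 l2 l3 \<kappa> x - drift_S l1 l2 l3 \<kappa> y"]
    unfolding dist_norm D_def[symmetric] L_def distrib_right by linarith
qed

text \<open>The cubic terms cancel in the energy balance. Of the terms with \<open>\<beta>\<close> and \<open>\<kappa>\<close> only \<open>\<beta> (y\<^sub>2\<^sup>2 + y\<^sub>3\<^sup>2)\<close> is quadratic in \<open>y\<close>
  and competes with the damping; half of the damping is spent on it and on the linear terms.\<close>

lemma drift_S_energy:
  assumes l: "0 < l1" and m: "0 < m" "m \<le> l1" "m \<le> l2" "m \<le> l3"
  shows "2 * (y \<bullet> drift_S l1 l2 l3 \<kappa> (y + \<beta> *\<^sub>R f1)) \<le> (- m + 2 / m * \<beta>\<^sup>2) * (y \<bullet> y) + (2 * \<kappa>\<^sup>2 / l1 + 2 * l1 * \<beta>\<^sup>2)"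
proof -
  define a b c where "a = y$1" and "b = y$2" and "c = y$3"
  define \<rho> where "\<rho> = b\<^sup>2 + c\<^sup>2"
  have \<rho>: "0 \<le> \<rho>" by (simp add: \<rho>_def)
  have eq: "y \<bullet> drift_S l1 l2 l3 \<kappa> (y + \<beta> *\<^sub>R f1) = - l1 * a\<^sup>2 - l1 * a * \<beta> + \<kappa> * a - l2 * b\<^sup>2 - l3 * c\<^sup>2 + \<beta> * \<rho>"
    by (simp add: inner_3 a_def b_def c_def \<rho>_def power2_eq_square algebra_simps)
  have 1: "\<kappa> * a \<le> l1 * a\<^sup>2 / 4 + \<kappa>\<^sup>2 / l1"
  proof -
    have "l1 * a\<^sup>2 / 4 + \<kappa>\<^sup>2 / l1 - \<kappa> * a = (l1 * a / 2 - \<kappa>)\<^sup>2 / l1"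
      using l by (simp add: power2_eq_square field_simps)
    moreover have "0 \<le> (l1 * a / 2 - \<kappa>)\<^sup>2 / l1" using l by simp
    ultimately show ?thesis by linarith
  qed
  have 2: "- (l1 * a * \<beta>) \<le> l1 * a\<^sup>2 / 4 + l1 * \<beta>\<^sup>2"
  proof -
    have "l1 * a\<^sup>2 / 4 + l1 * \<beta>\<^sup>2 + l1 * a * \<beta> = l1 * (a / 2 + \<beta>)\<^sup>2"
      by (simp add: power2_eq_square field_simps)
    moreover have "0 \<le> l1 * (a / 2 + \<beta>)\<^sup>2" using l by simp
    ultimately show ?thesis by linarith
  qed
  have 3: "2 * \<beta> * \<rho> \<le> (m + 2 / m * \<beta>\<^sup>2) * \<rho>"
  proof (rule mult_right_mono[OF _ \<rho>])
    have "m + \<beta>\<^sup>2 / m - 2 * \<beta> = (m - \<beta>)\<^sup>2 / m" using m by (simp add: power2_eq_square field_simps)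
    moreover have "0 \<le> (m - \<beta>)\<^sup>2 / m" using m by simp
    ultimately have "2 * \<beta> \<le> m + \<beta>\<^sup>2 / m" by linarith
    moreover have "0 \<le> \<beta>\<^sup>2 / m" using m by simp
    ultimately show "2 * \<beta> \<le> m + 2 / m * \<beta>\<^sup>2" by simp
  qed
  have 4: "m * a\<^sup>2 \<le> l1 * a\<^sup>2" "m * b\<^sup>2 \<le> l2 * b\<^sup>2" "m * c\<^sup>2 \<le> l3 * c\<^sup>2"
    using m by (auto intro!: mult_right_mono)
  have 5: "0 \<le> 2 / m * \<beta>\<^sup>2 * a\<^sup>2" using m by simp
  have yy: "y \<bullet> y = a\<^sup>2 + \<rho>" by (simp add: inner_3 a_def b_def c_def \<rho>_def power2_eq_square)
  have "m * \<rho> \<le> l2 * b\<^sup>2 + l3 * c\<^sup>2" using 4 by (simp add: \<rho>_def distrib_left)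
  then show ?thesis unfolding eq yy using 1 2 3 4(1) 5 by (simp add: algebra_simps add_divide_distrib)
qed

lemma coercive_drift_S:
  assumes "0 < l1" "0 < l2" "0 < l3"
  shows "coercive_drift (drift_S l1 l2 l3 \<kappa>) (\<sigma> *\<^sub>R f1)"
proof
  show "\<exists>L. L-lipschitz_on (cball 0 R) (drift_S l1 l2 l3 \<kappa>)" for R by (rule drift_S_local_lipschitz)
  fix B :: real
  define m where "m = min l1 (min l2 l3)"
  have m: "0 < m" "m \<le> l1" "m \<le> l2" "m \<le> l3" using assms by (auto simp: m_def)
  define C where "C = 2 / m * (B * \<sigma>)\<^sup>2 + (2 * \<kappa>\<^sup>2 / l1 + 2 * l1 * (B * \<sigma>)\<^sup>2)"
  show "\<exists>C. \<forall>y \<beta>. \<bar>\<beta>\<bar> \<le> B \<longrightarrow> y \<bullet> drift_S l1 l2 l3 \<kappa> (y + \<beta> *\<^sub>R \<sigma> *\<^sub>R f1) \<le> C * (1 + y \<bullet> y)"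
  proof (intro exI[of _ C] allI impI)
    fix y :: "real^3" and \<beta> :: real assume \<beta>: "\<bar>\<beta>\<bar> \<le> B"
    have sq: "(\<beta> * \<sigma>)\<^sup>2 \<le> (B * \<sigma>)\<^sup>2"
      using \<beta> by (auto simp: power_mult_distrib intro!: mult_right_mono) (metis abs_le_square_iff abs_of_nonneg abs_ge_zero order_trans)
    have yy: "0 \<le> y \<bullet> y" by simp
    have "2 * (y \<bullet> drift_S l1 l2 l3 \<kappa> (y + (\<beta> * \<sigma>) *\<^sub>R f1)) \<le> (- m + 2 / m * (\<beta> * \<sigma>)\<^sup>2) * (y \<bullet> y) + (2 * \<kappa>\<^sup>2 / l1 + 2 * l1 * (\<beta> * \<sigma>)\<^sup>2)"
      by (rule drift_S_energy[OF assms(1) m])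
    also have "\<dots> \<le> 2 / m * (B * \<sigma>)\<^sup>2 * (y \<bullet> y) + (2 * \<kappa>\<^sup>2 / l1 + 2 * l1 * (B * \<sigma>)\<^sup>2)"
    proof (intro add_mono mult_right_mono mult_left_mono order_refl sq)
      have "2 / m * (\<beta> * \<sigma>)\<^sup>2 \<le> 2 / m * (B * \<sigma>)\<^sup>2" using sq m by (intro mult_left_mono) auto
      then show "- m + 2 / m * (\<beta> * \<sigma>)\<^sup>2 \<le> 2 / m * (B * \<sigma>)\<^sup>2" using m by linarith
    qed (use assms in auto)
    also have "\<dots> \<le> C * (y \<bullet> y) + C"
    proof (intro add_mono mult_right_mono)
      show "2 / m * (B * \<sigma>)\<^sup>2 \<le> C" "2 * \<kappa>\<^sup>2 / l1 + 2 * l1 * (B * \<sigma>)\<^sup>2 \<le> C"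
        using assms m by (auto simp: C_def add_nonneg_nonneg)
    qed (rule yy)
    finally have "2 * (y \<bullet> drift_S l1 l2 l3 \<kappa> (y + (\<beta> * \<sigma>) *\<^sub>R f1)) \<le> C * (1 + y \<bullet> y)" by (simp add: algebra_simps)
    moreover have "0 \<le> C * (1 + y \<bullet> y)" using assms m by (auto simp: C_def add_nonneg_nonneg)
    ultimately show "y \<bullet> drift_S l1 l2 l3 \<kappa> (y + \<beta> *\<^sub>R \<sigma> *\<^sub>R f1) \<le> C * (1 + y \<bullet> y)" by simp
  qed
qed

lemma coercive_drift_lin: "coercive_drift (\<lambda>z. A_lin l1 l2 l3 z + \<kappa> *\<^sub>R f1) (\<sigma> *\<^sub>R f1)"
proof (rule lipschitz_imp_coercive_drift[OF lipschitz_onI])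
  fix x y :: "real^3"
  have "dist (A_lin l1 l2 l3 x + \<kappa> *\<^sub>R f1) (A_lin l1 l2 l3 y + \<kappa> *\<^sub>R f1) = norm (A_lin l1 l2 l3 (x - y))"
  proof -
    have "(A_lin l1 l2 l3 x + \<kappa> *\<^sub>R f1) - (A_lin l1 l2 l3 y + \<kappa> *\<^sub>R f1) = A_lin l1 l2 l3 (x - y)"
      by (simp add: vec3_eq_iff algebra_simps)
    then show ?thesis by (simp only: dist_norm)
  qed
  also have "\<dots> \<le> \<bar>l1\<bar> * \<bar>(x - y)$1\<bar> + \<bar>l2\<bar> * \<bar>(x - y)$2\<bar> + \<bar>l3\<bar> * \<bar>(x - y)$3\<bar>"
    using norm_le_3[of "A_lin l1 l2 l3 (x - y)"] by (simp only: A_lin_components abs_minus_cancel abs_mult)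
  also have "\<dots> \<le> \<bar>l1\<bar> * norm (x - y) + \<bar>l2\<bar> * norm (x - y) + \<bar>l3\<bar> * norm (x - y)"
    by (intro add_mono mult_left_mono component_le_norm_cart) auto
  finally show "dist (A_lin l1 l2 l3 x + \<kappa> *\<^sub>R f1) (A_lin l1 l2 l3 y + \<kappa> *\<^sub>R f1) \<le> (\<bar>l1\<bar> + \<bar>l2\<bar> + \<bar>l3\<bar>) * dist x y"
    by (simp add: dist_norm distrib_right)
qed simp

lemma coercive_drift_ou: "coercive_drift (\<lambda>z::real. \<kappa> - l * z) \<sigma>"
proof (rule lipschitz_imp_coercive_drift[OF lipschitz_onI])
  show "dist (\<kappa> - l * x) (\<kappa> - l * y) \<le> \<bar>l\<bar> * dist x y" for x y :: real
    by (simp add: dist_real_def abs_mult[symmetric] algebra_simps abs_minus_commute)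
qed simp

locale three_dim_system = wiener M W
  for M :: "'w measure" and W :: "real \<Rightarrow> 'w \<Rightarrow> real" +
  fixes l1 l2 l3 \<kappa> \<sigma> :: real
  assumes l1: "0 < l1" and l2: "0 < l2" and l3: "0 < l3"
begin

sublocale S: coercive_sde "drift_S l1 l2 l3 \<kappa>" "\<sigma> *\<^sub>R f1" M W
  by (intro coercive_sde.intro coercive_drift_S l1 l2 l3 wiener_axioms)

sublocale lin: coercive_sde "\<lambda>z. A_lin l1 l2 l3 z + \<kappa> *\<^sub>R f1" "\<sigma> *\<^sub>R f1" M W
  by (intro coercive_sde.intro coercive_drift_lin wiener_axioms)

sublocale ou: coercive_sde "\<lambda>z::real. \<kappa> - l1 * z" \<sigma> M W
  by (intro coercive_sde.intro coercive_drift_ou wiener_axioms)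

text \<open>On the axis the quadratic terms vanish and the drift of either system is a multiple of \<open>f1\<close>.\<close>

lemma on_axis:
  assumes w: "continuous_on {0..} w"
    and bw: "\<And>z. b' (z *\<^sub>R f1) = (\<kappa> - l1 * z) *\<^sub>R f1"
  shows "path_sol b' (\<sigma> *\<^sub>R f1) (x *\<^sub>R f1) w T (\<lambda>t. ou.flow x w t *\<^sub>R f1)"
  unfolding path_sol_def
proof (intro conjI ballI)
  have c: "continuous_on {0..} (ou.flow x w)" by (rule ou.flow_continuous[OF w])
  show "continuous_on {0..T} (\<lambda>t. ou.flow x w t *\<^sub>R f1)"
    by (intro continuous_intros continuous_on_subset[OF c]) auto
  fix t assume t: "t \<in> {0..T}"
  have i: "(\<lambda>s. \<kappa> - l1 * ou.flow x w s) integrable_on {0..t}"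
    by (intro integrable_continuous_real continuous_intros continuous_on_subset[OF c]) auto
  have "integral {0..t} (\<lambda>s. b' (ou.flow x w s *\<^sub>R f1)) = integral {0..t} (\<lambda>s. \<kappa> - l1 * ou.flow x w s) *\<^sub>R f1"
    unfolding bw using has_integral_scaleR_left[OF integrable_integral[OF i], of f1] by (rule integral_unique)
  then show "ou.flow x w t *\<^sub>R f1 = x *\<^sub>R f1 + integral {0..t} (\<lambda>s. b' (ou.flow x w s *\<^sub>R f1)) + w t *\<^sub>R \<sigma> *\<^sub>R f1"
    using ou.flow_eq[OF w, of t x] t by (simp add: scaleR_add_left[symmetric] del: scaleR_add_left)
qed

lemma S_on_axis: "\<omega> \<in> space M \<Longrightarrow> 0 \<le> t \<Longrightarrow> S.sol (x *\<^sub>R f1) t \<omega> = ou.sol x t \<omega> *\<^sub>R f1"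
  unfolding S.sol_def ou.sol_def
  by (rule S.flow_unique[OF W_continuous on_axis[OF W_continuous]]) (auto simp: vec3_eq_iff)

lemma lin_on_axis: "\<omega> \<in> space M \<Longrightarrow> 0 \<le> t \<Longrightarrow> lin.sol (x *\<^sub>R f1) t \<omega> = ou.sol x t \<omega> *\<^sub>R f1"
  unfolding lin.sol_def ou.sol_def
  by (rule lin.flow_unique[OF W_continuous on_axis[OF W_continuous]]) (auto simp: vec3_eq_iff)

lemma ou_euler:
  "ou.euler \<delta> y \<xi> n = (1 - l1 * \<delta>) ^ n * y + \<delta> * \<kappa> * (\<Sum>j<n. (1 - l1 * \<delta>) ^ j)
     + (\<Sum>j<n. \<sigma> * (1 - l1 * \<delta>) ^ (n - Suc j) * \<xi> j)"
proof (induction n)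
  case (Suc n)
  have 1: "(\<Sum>j<Suc n. (1 - l1 * \<delta>) ^ j) = 1 + (1 - l1 * \<delta>) * (\<Sum>j<n. (1 - l1 * \<delta>) ^ j)"
    by (simp add: sum.lessThan_Suc_shift sum_distrib_left del: sum.lessThan_Suc)
  have "(\<Sum>j<n. \<sigma> * (1 - l1 * \<delta>) ^ (Suc n - Suc j) * \<xi> j) = (1 - l1 * \<delta>) * (\<Sum>j<n. \<sigma> * (1 - l1 * \<delta>) ^ (n - Suc j) * \<xi> j)"
    unfolding sum_distrib_left
  proof (rule sum.cong[OF refl])
    fix j assume "j \<in> {..<n}"
    then have "Suc n - Suc j = Suc (n - Suc j)" by auto
    then show "\<sigma> * (1 - l1 * \<delta>) ^ (Suc n - Suc j) * \<xi> j = (1 - l1 * \<delta>) * (\<sigma> * (1 - l1 * \<delta>) ^ (n - Suc j) * \<xi> j)" by simp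
  qed
  then have 2: "(\<Sum>j<Suc n. \<sigma> * (1 - l1 * \<delta>) ^ (Suc n - Suc j) * \<xi> j)
      = (1 - l1 * \<delta>) * (\<Sum>j<n. \<sigma> * (1 - l1 * \<delta>) ^ (n - Suc j) * \<xi> j) + \<sigma> * \<xi> n" by simp
  define e where "e = ou.euler \<delta> y \<xi> n"
  have "ou.euler \<delta> y \<xi> (Suc n) = e + \<delta> *\<^sub>R (\<kappa> - l1 * e) + \<xi> n *\<^sub>R \<sigma>" by (simp only: ou.euler.simps e_def)
  then have "ou.euler \<delta> y \<xi> (Suc n) = (1 - l1 * \<delta>) * ou.euler \<delta> y \<xi> n + \<delta> * \<kappa> + \<sigma> * \<xi> n"
    unfolding e_def[symmetric] real_scaleR_def by (simp only: algebra_simps)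
  then show ?case unfolding 1 2 Suc.IH by (simp add: algebra_simps)
qed simp

definition ou_mean :: "real \<Rightarrow> real \<Rightarrow> real" where
  "ou_mean x t = exp (- l1 * t) * x + \<kappa> * (1 - exp (- l1 * t)) / l1"

definition ou_sd :: "real \<Rightarrow> real" where
  "ou_sd t = \<sigma> * sqrt ((1 - (exp (- l1 * t))\<^sup>2) / (2 * l1))"

text \<open>The Euler scheme is an affine function of independent normal increments, hence normal with
  explicit mean and variance; its limit gives the law of the Ornstein--Uhlenbeck process.\<close>

lemma ou_law:
  assumes t: "0 \<le> t"
  shows "distr M borel (ou.sol x t) = gauss (ou_mean x t) (ou_sd t)"
proof (rule gauss_eqI)
  show "real_distribution (distr M borel (ou.sol x t))" by (rule real_distribution_distr) (use t in simp)
  fix \<theta> :: real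
  define \<delta> where "\<delta> n = t / real (Suc n)" for n
  define a where "a n = 1 - l1 * \<delta> n" for n
  define p where "p n = a n ^ Suc n" for n
  define E where "E n \<omega> = ou.euler (\<delta> n) x (\<lambda>i. ou.increment 0 (\<delta> n) i \<omega>) (Suc n)" for n \<omega>
  define c where "c n j = \<sigma> * a n ^ (Suc n - Suc j)" for n j
  define \<tau> where "\<tau> n i = real i * \<delta> n" for n i
  define mn where "mn n = p n * x + \<kappa> * (1 - p n) / l1" for n
  define vn where "vn n = (\<Sum>j<Suc n. (c n j)\<^sup>2 * (\<tau> n (Suc j) - \<tau> n j))" for n
  have \<delta>0: "0 \<le> \<delta> n" for n using t by (simp add: \<delta>_def)
  have \<tau>: "0 \<le> \<tau> n 0" "\<tau> n i \<le> \<tau> n (Suc i)" for n i using \<delta>0 by (auto simp: \<tau>_def mult_right_mono)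
  have geo: "\<delta> n * (\<Sum>j<Suc n. a n ^ j) = (1 - p n) / l1" for n
    using one_diff_power_eq[of "a n" "Suc n"] l1 by (simp add: a_def p_def field_simps)
  have E_eq: "E n \<omega> = mn n + step_integral W (Suc n) (\<tau> n) (c n) \<omega>" for n \<omega>
  proof -
    have "E n \<omega> = p n * x + \<kappa> * (\<delta> n * (\<Sum>j<Suc n. a n ^ j)) + step_integral W (Suc n) (\<tau> n) (c n) \<omega>"
      unfolding E_def ou_euler step_integral_def c_def \<tau>_def ou.increment_def a_def[symmetric] p_def[symmetric] by simp
    then show ?thesis unfolding geo mn_def by simp
  qed
  have Sm: "step_integral W (Suc n) (\<tau> n) (c n) \<in> borel_measurable M" for n
    by (rule step_integral_measurable; rule \<tau>)
  have Em: "E n \<in> borel_measurable M" for n unfolding E_eq[abs_def] using Sm by measurable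
  have charE: "char (distr M borel (E n)) \<theta> = iexp (\<theta> * mn n) * of_real (exp (- (\<theta>\<^sup>2 / 2) * vn n))" for n
  proof -
    have "char (distr M borel (E n)) \<theta> = (\<integral>\<omega>. iexp (\<theta> * E n \<omega>) \<partial>M)"
      unfolding char_def by (rule integral_distr) (use Em in auto)
    also have "\<dots> = (\<integral>\<omega>. iexp (\<theta> * mn n) * iexp (\<theta> * step_integral W (Suc n) (\<tau> n) (c n) \<omega>) \<partial>M)"
      unfolding E_eq by (simp add: algebra_simps exp_add[symmetric])
    also have "\<dots> = iexp (\<theta> * mn n) * char (distr M borel (step_integral W (Suc n) (\<tau> n) (c n))) \<theta>"
      unfolding char_def by (simp add: integral_distr[OF Sm])
    also have "char (distr M borel (step_integral W (Suc n) (\<tau> n) (c n))) \<theta> = of_real (exp (- (\<theta>\<^sup>2 / 2) * vn n))"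
      unfolding vn_def by (rule step_integral_char; rule \<tau>)
    finally show ?thesis .
  qed
  have plim: "p \<longlonglongrightarrow> exp (- l1 * t)"
  proof -
    have "(\<lambda>n. (1 + (- l1 * t) / real n) ^ n) \<longlonglongrightarrow> exp (- l1 * t)" by (rule tendsto_exp_limit_sequentially)
    from LIMSEQ_Suc[OF this] show ?thesis unfolding p_def[abs_def] a_def \<delta>_def by simp
  qed
  have \<delta>lim: "\<delta> \<longlonglongrightarrow> 0"
    using tendsto_mult_right_zero[OF LIMSEQ_inverse_real_of_nat, of t] by (simp add: \<delta>_def[abs_def] divide_inverse)
  have mlim: "mn \<longlonglongrightarrow> ou_mean x t"
    unfolding mn_def[abs_def] ou_mean_def by (intro tendsto_intros plim) (use l1 in auto)
  \<comment> \<open>A geometric sum; the bound on the step makes the denominator nonzero.\<close>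
  have v_eq: "vn n = \<sigma>\<^sup>2 * ((1 - (p n)\<^sup>2) / (l1 * (2 - l1 * \<delta> n)))" if "l1 * \<delta> n < 2" for n
  proof -
    have "vn n = \<sigma>\<^sup>2 * (\<delta> n * (\<Sum>j<Suc n. ((a n)\<^sup>2) ^ (Suc n - Suc j)))"
      unfolding vn_def c_def \<tau>_def sum_distrib_left
      by (intro sum.cong refl) (simp add: power_mult_distrib algebra_simps power_mult[symmetric])
    also have "(\<Sum>j<Suc n. ((a n)\<^sup>2) ^ (Suc n - Suc j)) = (\<Sum>j<Suc n. ((a n)\<^sup>2) ^ j)"
      by (rule sum.nat_diff_reindex)
    also have "\<delta> n * (\<Sum>j<Suc n. ((a n)\<^sup>2) ^ j) = (1 - (p n)\<^sup>2) / (l1 * (2 - l1 * \<delta> n))"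
    proof -
      have "(p n)\<^sup>2 = ((a n)\<^sup>2) ^ Suc n" unfolding p_def by (simp only: power_mult[symmetric] mult.commute)
      then have "1 - (p n)\<^sup>2 = (1 - (a n)\<^sup>2) * (\<Sum>j<Suc n. ((a n)\<^sup>2) ^ j)"
        using one_diff_power_eq[of "(a n)\<^sup>2" "Suc n"] by simp
      also have "1 - (a n)\<^sup>2 = l1 * (2 - l1 * \<delta> n) * \<delta> n" by (simp add: a_def power2_eq_square algebra_simps)
      finally have "1 - (p n)\<^sup>2 = (l1 * (2 - l1 * \<delta> n)) * (\<delta> n * (\<Sum>j<Suc n. ((a n)\<^sup>2) ^ j))" by (simp only: mult.assoc)
      moreover have "l1 * (2 - l1 * \<delta> n) \<noteq> 0" using that l1 by simp
      ultimately show ?thesis by (metis nonzero_mult_div_cancel_left)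
    qed
    finally show ?thesis .
  qed
  have vlim: "vn \<longlonglongrightarrow> (ou_sd t)\<^sup>2"
  proof -
    have "(\<lambda>n. \<sigma>\<^sup>2 * ((1 - (p n)\<^sup>2) / (l1 * (2 - l1 * \<delta> n)))) \<longlonglongrightarrow> \<sigma>\<^sup>2 * ((1 - (exp (- l1 * t))\<^sup>2) / (l1 * (2 - l1 * 0)))"
      by (intro tendsto_intros plim \<delta>lim) (use l1 in auto)
    moreover have "\<sigma>\<^sup>2 * ((1 - (exp (- l1 * t))\<^sup>2) / (l1 * (2 - l1 * 0))) = (ou_sd t)\<^sup>2"
    proof -
      have "(exp (- l1 * t))\<^sup>2 \<le> 1" using l1 t by (simp add: power_le_one)
      then show ?thesis using l1 by (simp add: ou_sd_def power_mult_distrib mult.commute)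
    qed
    moreover have "\<forall>\<^sub>F n in sequentially. \<sigma>\<^sup>2 * ((1 - (p n)\<^sup>2) / (l1 * (2 - l1 * \<delta> n))) = vn n"
    proof -
      have "(\<lambda>n. l1 * \<delta> n) \<longlonglongrightarrow> l1 * 0" by (intro tendsto_intros \<delta>lim)
      then have "\<forall>\<^sub>F n in sequentially. l1 * \<delta> n < 2" by (intro order_tendstoD(2)) auto
      then show ?thesis by eventually_elim (simp add: v_eq)
    qed
    ultimately show ?thesis using Lim_transform_eventually by fastforce
  qed
  have "(\<lambda>n. char (distr M borel (E n)) \<theta>) \<longlonglongrightarrow> char (distr M borel (ou.sol x t)) \<theta>"
  proof -
    have "(\<lambda>n. \<integral>\<omega>. iexp (\<theta> * E n \<omega>) \<partial>M) \<longlonglongrightarrow> (\<integral>\<omega>. iexp (\<theta> * ou.sol x t \<omega>) \<partial>M)"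
    proof (rule integral_dominated_convergence[where w="\<lambda>_. 1"])
      show "AE \<omega> in M. (\<lambda>n. iexp (\<theta> * E n \<omega>)) \<longlonglongrightarrow> iexp (\<theta> * ou.sol x t \<omega>)"
        using ou.euler_tendsto_sol[OF t, of x] 
      proof eventually_elim
        case (elim \<omega>)
        then have "(\<lambda>n. E n \<omega>) \<longlonglongrightarrow> ou.sol x t \<omega>" unfolding E_def \<delta>_def .
        then show ?case by (intro tendsto_intros)
      qed
    qed (use Em t in auto)
    then show ?thesis unfolding char_def using Em t by (simp add: integral_distr)
  qed
  moreover have "(\<lambda>n. char (distr M borel (E n)) \<theta>) \<longlonglongrightarrow> iexp (\<theta> * ou_mean x t) * of_real (exp (- (\<theta>\<^sup>2 / 2) * (ou_sd t)\<^sup>2))"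
    unfolding charE by (intro tendsto_intros mlim vlim)
  ultimately have "char (distr M borel (ou.sol x t)) \<theta> = iexp (\<theta> * ou_mean x t) * of_real (exp (- (\<theta>\<^sup>2 / 2) * (ou_sd t)\<^sup>2))"
    by (rule LIMSEQ_unique)
  then show "char (distr M borel (ou.sol x t)) \<theta> = exp (\<i> * (\<theta> * ou_mean x t)) * exp (- ((ou_sd t * \<theta>)^2) / 2)"
    by (simp add: power_mult_distrib mult_ac)
qed

abbreviation ou_limit :: "real measure" where
  "ou_limit \<equiv> gauss (\<kappa> / l1) (\<sigma> / sqrt (2 * l1))"

lemma ou_params_tendsto:
  "(ou_mean x \<longlongrightarrow> \<kappa> / l1) at_top" "(ou_sd \<longlongrightarrow> \<sigma> / sqrt (2 * l1)) at_top"
proof -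
  have e: "((\<lambda>t. exp (- l1 * t)) \<longlongrightarrow> 0) at_top"
    using l1 by (intro filterlim_compose[OF exp_at_bot] filterlim_tendsto_neg_mult_at_bot[OF tendsto_const]) (auto simp: filterlim_ident)
  have "((\<lambda>t. exp (- l1 * t) * x + \<kappa> * (1 - exp (- l1 * t)) / l1) \<longlongrightarrow> 0 * x + \<kappa> * (1 - 0) / l1) at_top"
    by (intro tendsto_intros e) (use l1 in auto)
  then show "(ou_mean x \<longlongrightarrow> \<kappa> / l1) at_top" by (simp add: ou_mean_def[abs_def])
  have "((\<lambda>t. \<sigma> * sqrt ((1 - (exp (- l1 * t))\<^sup>2) / (2 * l1))) \<longlongrightarrow> \<sigma> * sqrt ((1 - 0\<^sup>2) / (2 * l1))) at_top"
    by (intro tendsto_intros e) (use l1 in auto)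
  then show "(ou_sd \<longlongrightarrow> \<sigma> / sqrt (2 * l1)) at_top" by (simp add: ou_sd_def[abs_def] real_sqrt_divide)
qed

lemma ou_expectation:
  assumes "f \<in> borel_measurable borel" "0 \<le> t"
  shows "(\<integral>\<omega>. f (ou.sol x t \<omega>) \<partial>M) = integral\<^sup>L (gauss (ou_mean x t) (ou_sd t)) (f :: real \<Rightarrow> real)"
  unfolding ou_law[OF assms(2), of x, symmetric] by (subst integral_distr) (use assms in auto)

lemma ou_stable:
  assumes f: "bcont f"
  shows "((\<lambda>t. \<integral>\<omega>. f (ou.sol x t \<omega>) \<partial>M) \<longlongrightarrow> integral\<^sup>L ou_limit f) at_top"
proof (rule Lim_transform_eventually)
  show "((\<lambda>t. integral\<^sup>L (gauss (ou_mean x t) (ou_sd t)) f) \<longlongrightarrow> integral\<^sup>L ou_limit f) at_top"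
    by (rule gauss_tendsto[OF f ou_params_tendsto])
  show "\<forall>\<^sub>F t in at_top. integral\<^sup>L (gauss (ou_mean x t) (ou_sd t)) f = (\<integral>\<omega>. f (ou.sol x t \<omega>) \<partial>M)"
    using eventually_ge_at_top[of 0] by eventually_elim (simp add: ou_expectation bcont_measurable[OF f])
qed

lemma ou_second_moment:
  assumes t: "0 \<le> t"
  shows "(\<integral>\<^sup>+\<omega>. ennreal ((ou.sol x t \<omega>)\<^sup>2) \<partial>M) \<le> ennreal ((\<bar>x\<bar> + \<bar>\<kappa>\<bar> / l1)\<^sup>2 + \<sigma>\<^sup>2 / (2 * l1))"
proof -
  have e: "0 \<le> exp (- l1 * t)" "exp (- l1 * t) \<le> 1" using l1 t by auto
  have "(\<integral>\<^sup>+\<omega>. ennreal ((ou.sol x t \<omega>)\<^sup>2) \<partial>M) = (\<integral>\<^sup>+z. ennreal (z\<^sup>2) \<partial>gauss (ou_mean x t) (ou_sd t))"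
    unfolding ou_law[OF t, of x, symmetric] by (subst nn_integral_distr) (use t in auto)
  also have "\<dots> = ennreal ((ou_mean x t)\<^sup>2 + (ou_sd t)\<^sup>2)"
    by (subst nn_integral_eq_integral[OF gauss_second_moment(1)]) (auto simp: gauss_second_moment(2))
  also have "\<dots> \<le> ennreal ((\<bar>x\<bar> + \<bar>\<kappa>\<bar> / l1)\<^sup>2 + \<sigma>\<^sup>2 / (2 * l1))"
  proof (intro ennreal_leI add_mono)
    have "\<bar>ou_mean x t\<bar> \<le> exp (- l1 * t) * \<bar>x\<bar> + \<bar>\<kappa>\<bar> * (1 - exp (- l1 * t)) / l1"
      unfolding ou_mean_def using e l1 by (intro order_trans[OF abs_triangle_ineq] add_mono) (auto simp: abs_mult)
    also have "\<dots> \<le> 1 * \<bar>x\<bar> + \<bar>\<kappa>\<bar> * 1 / l1"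
      using e l1 by (intro add_mono mult_right_mono divide_right_mono mult_left_mono) auto
    finally have "\<bar>ou_mean x t\<bar>\<^sup>2 \<le> (\<bar>x\<bar> + \<bar>\<kappa>\<bar> / l1)\<^sup>2" by (intro power_mono) auto
    then show "(ou_mean x t)\<^sup>2 \<le> (\<bar>x\<bar> + \<bar>\<kappa>\<bar> / l1)\<^sup>2" by simp
    have "(exp (- l1 * t))\<^sup>2 \<le> 1" using e by (simp add: power_le_one)
    then have "(ou_sd t)\<^sup>2 = \<sigma>\<^sup>2 * ((1 - (exp (- l1 * t))\<^sup>2) / (2 * l1))"
      using l1 by (simp add: ou_sd_def power_mult_distrib)
    also have "\<dots> \<le> \<sigma>\<^sup>2 * (1 / (2 * l1))" using l1 by (intro mult_left_mono divide_right_mono) auto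
    finally show "(ou_sd t)\<^sup>2 \<le> \<sigma>\<^sup>2 / (2 * l1)" by simp
  qed
  finally show ?thesis .
qed

section \<open>The Gaussian invariant measure\<close>

lemma distr_gauss_affine: "distr (gauss m s) borel (\<lambda>x. a + c * x) = gauss (a + c * m) (c * s)"
  unfolding gauss_def by (subst distr_distr) (auto simp: comp_def algebra_simps intro!: arg_cong[of _ _ "distr _ _"])

lemma f1_embedding_measurable[measurable]: "(\<lambda>z::real. z *\<^sub>R f1) \<in> borel_measurable borel"
  by (intro borel_measurable_continuous_onI continuous_intros)

lemma nu_eq: "nu M W l1 \<sigma> \<kappa> = distr ou_limit borel (\<lambda>z. z *\<^sub>R f1)"
proof -
  let ?I = "wiener_integral M W (\<lambda>t. exp (- l1 * t))"
  note I = wiener_integral_exp_law[OF l1]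
  have "ou_limit = distr (gauss 0 (sqrt (1 / (2 * l1)))) borel (\<lambda>z. \<kappa> / l1 + \<sigma> * z)"
    unfolding distr_gauss_affine by (simp add: real_sqrt_divide)
  also have "\<dots> = distr M borel (\<lambda>\<omega>. \<kappa> / l1 + \<sigma> * ?I \<omega>)"
    unfolding I(2)[symmetric] by (subst distr_distr) (use I(1) in \<open>auto simp: comp_def\<close>)
  finally have "distr ou_limit borel (\<lambda>z. z *\<^sub>R f1) = distr M borel (\<lambda>\<omega>. (\<kappa> / l1 + \<sigma> * ?I \<omega>) *\<^sub>R f1)"
    using I(1) by (simp add: distr_distr comp_def)
  then show ?thesis by (simp add: nu_def law_def scaleR_add_left)
qed

lemma borel_prob_nu: "borel_prob (nu M W l1 \<sigma> \<kappa>)"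
  unfolding nu_eq borel_prob_def
  by (auto intro!: prob_space.prob_space_distr prob_space_gauss)

lemma integral_nu:
  fixes f :: "real^3 \<Rightarrow> real"
  assumes "f \<in> borel_measurable borel"
  shows "integral\<^sup>L (nu M W l1 \<sigma> \<kappa>) f = integral\<^sup>L ou_limit (\<lambda>z. f (z *\<^sub>R f1))"
  unfolding nu_eq by (rule integral_distr) (use assms in auto)

lemma gaussian_nu: "gaussian_measure (nu M W l1 \<sigma> \<kappa>)"
  unfolding gaussian_measure_def
proof (intro conjI allI borel_prob_nu)
  fix w :: "real^3"
  define s where "s = \<bar>w$1 * (\<sigma> / sqrt (2 * l1))\<bar>"
  define m where "m = w$1 * (\<kappa> / l1)"
  have "distr (nu M W l1 \<sigma> \<kappa>) borel (\<lambda>x. w \<bullet> x) = distr ou_limit borel (\<lambda>z. 0 + w$1 * z)"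
    unfolding nu_eq by (subst distr_distr) (auto simp: comp_def inner_3 mult.commute)
  also have "\<dots> = gauss m (w$1 * (\<sigma> / sqrt (2 * l1)))" unfolding distr_gauss_affine m_def by simp
  also have "gauss m r = gauss m \<bar>r\<bar>" for r by (cases "r < 0") (simp_all add: gauss_uminus)
  then have "gauss m (w$1 * (\<sigma> / sqrt (2 * l1))) = gauss m s" unfolding s_def .
  finally have eq: "distr (nu M W l1 \<sigma> \<kappa>) borel (\<lambda>x. w \<bullet> x) = gauss m s" .
  show "\<exists>m. distr (nu M W l1 \<sigma> \<kappa>) borel (\<lambda>x. w \<bullet> x) = return borel m \<or>
      (\<exists>s>0. distr (nu M W l1 \<sigma> \<kappa>) borel (\<lambda>x. w \<bullet> x) = density lborel (normal_density m s))"
  proof (cases "s = 0")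
    case True
    then show ?thesis unfolding eq by (auto simp: gauss_degenerate)
  next
    case False
    then have "s > 0" by (simp add: s_def)
    then show ?thesis unfolding eq using gauss_density by blast
  qed
qed

text \<open>On the axis spanned by \<open>f1\<close> both systems reduce to the Ornstein--Uhlenbeck equation, whose laws
  converge. A limit of laws is invariant by the Markov and Feller properties.\<close>

lemma axis_limit_invariant:
  assumes "coercive_sde b' (\<sigma> *\<^sub>R f1) M W"
    and axis: "\<And>\<omega> t. \<omega> \<in> space M \<Longrightarrow> 0 \<le> t \<Longrightarrow> coercive_sde.sol b' (\<sigma> *\<^sub>R f1) W (0 *\<^sub>R f1) t \<omega> = ou.sol 0 t \<omega> *\<^sub>R f1"
  shows "sde_invariant M W b' (\<sigma> *\<^sub>R f1) (nu M W l1 \<sigma> \<kappa>)"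
proof -
  interpret B: coercive_sde b' "\<sigma> *\<^sub>R f1" M W by (rule assms)
  have lim: "(\<lambda>n. B.semi (real n + s) f 0) \<longlonglongrightarrow> integral\<^sup>L (nu M W l1 \<sigma> \<kappa>) f" if f: "bcont f" and s: "0 \<le> s" for f s
  proof -
    have fb: "bcont (\<lambda>z. f (z *\<^sub>R f1))" by (intro bcont_compose[OF f] continuous_intros)
    have "(\<lambda>n. \<integral>\<omega>. f (ou.sol 0 (real n + s) \<omega> *\<^sub>R f1) \<partial>M) \<longlonglongrightarrow> integral\<^sup>L ou_limit (\<lambda>z. f (z *\<^sub>R f1))"
      by (rule filterlim_compose[OF ou_stable[OF fb]])
         (rule filterlim_at_top_mono[OF filterlim_real_sequentially], use s in simp)
    moreover have "B.semi (real n + s) f 0 = (\<integral>\<omega>. f (ou.sol 0 (real n + s) \<omega> *\<^sub>R f1) \<partial>M)" for n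
      unfolding B.semi_def using axis s by (intro Bochner_Integration.integral_cong) auto
    ultimately show ?thesis by (simp add: integral_nu bcont_measurable[OF f])
  qed
  have int: "integral\<^sup>L (distr M borel (B.sol 0 (real n))) f = B.semi (real n) f 0" if f: "bcont f" for f n
    unfolding B.semi_def by (rule integral_distr) (auto intro: bcont_measurable f)
  show ?thesis
  proof (rule B.limit_invariant[OF borel_prob_nu, of "\<lambda>n. distr M borel (B.sol 0 (real n))"])
    show "(\<lambda>n. integral\<^sup>L (distr M borel (B.sol 0 (real n))) f) \<longlonglongrightarrow> integral\<^sup>L (nu M W l1 \<sigma> \<kappa>) f" if f: "bcont f" for f
      using lim[OF f, of 0] by (simp add: int[OF f])
    fix s :: real and f :: "real^3 \<Rightarrow> real" assume s: "0 \<le> s" and f: "bcont f"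
    have "(\<lambda>n. B.semi (real n + s) f 0 - B.semi (real n + 0) f 0) \<longlonglongrightarrow> integral\<^sup>L (nu M W l1 \<sigma> \<kappa>) f - integral\<^sup>L (nu M W l1 \<sigma> \<kappa>) f"
      by (intro tendsto_diff lim f s) simp
    then show "(\<lambda>n. integral\<^sup>L (distr M borel (B.sol 0 (real n))) (B.semi s f) - integral\<^sup>L (distr M borel (B.sol 0 (real n))) f) \<longlonglongrightarrow> 0"
      by (simp add: int f B.feller[OF f s] B.markov[OF f _ s])
  qed
qed

lemma nu_invariant_S: "sde_invariant M W (drift_S l1 l2 l3 \<kappa>) (\<sigma> *\<^sub>R f1) (nu M W l1 \<sigma> \<kappa>)"
  by (rule axis_limit_invariant[OF S.coercive_sde_axioms S_on_axis])

lemma nu_invariant_lin: "sde_invariant M W (\<lambda>z. A_lin l1 l2 l3 z + \<kappa> *\<^sub>R f1) (\<sigma> *\<^sub>R f1) (nu M W l1 \<sigma> \<kappa>)"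
  by (rule axis_limit_invariant[OF lin.coercive_sde_axioms lin_on_axis])

end

section \<open>Time integrals of continuous processes\<close>

lemma nn_integral_Icc_continuous:
  fixes f :: "real \<Rightarrow> real"
  assumes c: "continuous_on {a..b} f" and nn: "\<And>s. s \<in> {a..b} \<Longrightarrow> 0 \<le> f s"
  shows "(\<integral>\<^sup>+s\<in>{a..b}. ennreal (f s) \<partial>lborel) = ennreal (integral {a..b} f)"
proof -
  have si: "set_integrable lborel {a..b} f" by (rule borel_integrable_atLeastAtMost'[OF c])
  have "(\<integral>\<^sup>+s\<in>{a..b}. ennreal (f s) \<partial>lborel) = (\<integral>\<^sup>+s. ennreal (indicator {a..b} s *\<^sub>R f s) \<partial>lborel)"
    by (intro nn_integral_cong) (auto simp: indicator_def)
  also have "\<dots> = ennreal (\<integral>s. indicator {a..b} s *\<^sub>R f s \<partial>lborel)"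
    by (rule nn_integral_eq_integral) (use si nn in \<open>auto simp: set_integrable_def indicator_def\<close>)
  also have "(\<integral>s. indicator {a..b} s *\<^sub>R f s \<partial>lborel) = integral {a..b} f"
    using set_borel_integral_eq_integral(2)[OF si] by (simp add: set_lebesgue_integral_def)
  finally show ?thesis .
qed

lemma (in prob_space) measurable_time_integral:
  fixes X :: "real \<Rightarrow> 'a \<Rightarrow> 'b::euclidean_space"
  assumes Xm: "\<And>s. 0 \<le> s \<Longrightarrow> X s \<in> borel_measurable M"
    and Xc: "\<And>\<omega>. \<omega> \<in> space M \<Longrightarrow> continuous_on {0..} (\<lambda>s. X s \<omega>)"
    and a: "0 \<le> a"
  shows "(\<lambda>\<omega>. integral {a..b} (\<lambda>s. X s \<omega>)) \<in> borel_measurable M"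
proof -
  have gj: "(\<lambda>p. X (max 0 (fst p)) (snd p)) \<in> borel_measurable (borel \<Otimes>\<^sub>M M)"
    using measurable_continuous_process[OF Xm Xc] by (simp add: case_prod_beta)
  have "(\<lambda>p. indicator {a..b} (snd p) *\<^sub>R X (max 0 (snd p)) (fst p)) \<in> borel_measurable (M \<Otimes>\<^sub>M lborel)"
  proof -
    have [measurable]: "(\<lambda>p. X (max 0 (snd p)) (fst p)) \<in> borel_measurable (M \<Otimes>\<^sub>M lborel)"
      using measurable_compose[OF measurable_pair_swap' gj] by (simp add: case_prod_beta cong: measurable_cong_sets sets_pair_measure_cong)
    show ?thesis by measurable
  qed
  then have m: "(\<lambda>\<omega>. \<integral>s. indicator {a..b} s *\<^sub>R X (max 0 s) \<omega> \<partial>lborel) \<in> borel_measurable M"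
    using lborel.borel_measurable_lebesgue_integral[of "\<lambda>\<omega> s. indicator {a..b} s *\<^sub>R X (max 0 s) \<omega>" M]
    by (simp add: case_prod_beta)
  have "(\<integral>s. indicator {a..b} s *\<^sub>R X (max 0 s) \<omega> \<partial>lborel) = integral {a..b} (\<lambda>s. X s \<omega>)" if \<omega>: "\<omega> \<in> space M" for \<omega>
  proof -
    have "continuous_on {a..b} (\<lambda>s. X s \<omega>)" by (rule continuous_on_subset[OF Xc[OF \<omega>]]) (use a in auto)
    then have "set_integrable lborel {a..b} (\<lambda>s. X s \<omega>)" by (rule borel_integrable_atLeastAtMost')
    from set_borel_integral_eq_integral(2)[OF this] show ?thesis
      unfolding set_lebesgue_integral_def
      by (subst (asm) eq_commute) (use a in \<open>auto intro!: Bochner_Integration.integral_cong simp: indicator_def\<close>)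
  qed
  then show ?thesis using m by (simp cong: measurable_cong)
qed

lemma (in prob_space) nn_expectation_time_integral_eq:
  fixes g :: "real \<Rightarrow> 'a \<Rightarrow> real"
  assumes gm: "\<And>s. 0 \<le> s \<Longrightarrow> g s \<in> borel_measurable M"
    and gc: "\<And>\<omega>. \<omega> \<in> space M \<Longrightarrow> continuous_on {0..} (\<lambda>s. g s \<omega>)"
    and nn: "\<And>s \<omega>. \<omega> \<in> space M \<Longrightarrow> 0 \<le> s \<Longrightarrow> 0 \<le> g s \<omega>"
    and a: "0 \<le> a"
  shows "(\<integral>\<^sup>+\<omega>. ennreal (integral {a..b} (\<lambda>s. g s \<omega>)) \<partial>M) = (\<integral>\<^sup>+s\<in>{a..b}. (\<integral>\<^sup>+\<omega>. ennreal (g s \<omega>) \<partial>M) \<partial>lborel)"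
proof -
  interpret P: pair_sigma_finite lborel M ..
  have gj: "(\<lambda>p. g (max 0 (fst p)) (snd p)) \<in> borel_measurable (borel \<Otimes>\<^sub>M M)"
    using measurable_continuous_process[OF gm gc] by (simp add: case_prod_beta)
  have gj': "(\<lambda>p. g (max 0 (fst p)) (snd p)) \<in> borel_measurable (lborel \<Otimes>\<^sub>M M)"
    using gj by (simp cong: measurable_cong_sets sets_pair_measure_cong)
  have m: "case_prod (\<lambda>s \<omega>. ennreal (g (max 0 s) \<omega>) * indicator {a..b} s) \<in> borel_measurable (lborel \<Otimes>\<^sub>M M)"
  proof -
    have [measurable]: "(\<lambda>p. ennreal (g (max 0 (fst p)) (snd p))) \<in> borel_measurable (lborel \<Otimes>\<^sub>M M)"
      using gj' by measurable
    show ?thesis by (simp add: case_prod_beta)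
  qed
  have "(\<integral>\<^sup>+\<omega>. ennreal (integral {a..b} (\<lambda>s. g s \<omega>)) \<partial>M) = (\<integral>\<^sup>+\<omega>. \<integral>\<^sup>+s. ennreal (g (max 0 s) \<omega>) * indicator {a..b} s \<partial>lborel \<partial>M)"
  proof (rule nn_integral_cong)
    fix \<omega> assume \<omega>: "\<omega> \<in> space M"
    have "ennreal (integral {a..b} (\<lambda>s. g s \<omega>)) = (\<integral>\<^sup>+s\<in>{a..b}. ennreal (g s \<omega>) \<partial>lborel)"
      using a nn[OF \<omega>] by (intro nn_integral_Icc_continuous[symmetric] continuous_on_subset[OF gc[OF \<omega>]]) auto
    also have "\<dots> = (\<integral>\<^sup>+s. ennreal (g (max 0 s) \<omega>) * indicator {a..b} s \<partial>lborel)"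
      using a by (intro nn_integral_cong) (auto simp: indicator_def)
    finally show "ennreal (integral {a..b} (\<lambda>s. g s \<omega>)) = (\<integral>\<^sup>+s. ennreal (g (max 0 s) \<omega>) * indicator {a..b} s \<partial>lborel)" .
  qed
  also have "\<dots> = (\<integral>\<^sup>+s. \<integral>\<^sup>+\<omega>. ennreal (g (max 0 s) \<omega>) * indicator {a..b} s \<partial>M \<partial>lborel)"
    using P.Fubini'[OF m] by simp
  also have "\<dots> = (\<integral>\<^sup>+s\<in>{a..b}. (\<integral>\<^sup>+\<omega>. ennreal (g s \<omega>) \<partial>M) \<partial>lborel)"
    using a by (intro nn_integral_cong) (auto simp: indicator_def)
  finally show ?thesis .
qed

lemma (in prob_space) nn_expectation_time_integral:
  fixes g :: "real \<Rightarrow> 'a \<Rightarrow> real"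
  assumes g: "\<And>s. 0 \<le> s \<Longrightarrow> g s \<in> borel_measurable M"
    "\<And>\<omega>. \<omega> \<in> space M \<Longrightarrow> continuous_on {0..} (\<lambda>s. g s \<omega>)"
    "\<And>s \<omega>. \<omega> \<in> space M \<Longrightarrow> 0 \<le> s \<Longrightarrow> 0 \<le> g s \<omega>"
    and ab: "0 \<le> a" "a \<le> b"
    and C: "0 \<le> C" "\<And>s. s \<in> {a..b} \<Longrightarrow> (\<integral>\<^sup>+\<omega>. ennreal (g s \<omega>) \<partial>M) \<le> ennreal C"
  shows "(\<integral>\<^sup>+\<omega>. ennreal (integral {a..b} (\<lambda>s. g s \<omega>)) \<partial>M) \<le> ennreal (C * (b - a))"
proof -
  have "(\<integral>\<^sup>+\<omega>. ennreal (integral {a..b} (\<lambda>s. g s \<omega>)) \<partial>M) = (\<integral>\<^sup>+s\<in>{a..b}. (\<integral>\<^sup>+\<omega>. ennreal (g s \<omega>) \<partial>M) \<partial>lborel)"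
    by (rule nn_expectation_time_integral_eq) (fact g ab)+
  also have "\<dots> \<le> (\<integral>\<^sup>+s. ennreal C * indicator {a..b} s \<partial>lborel)"
    using C by (intro nn_integral_mono) (auto simp: indicator_def)
  also have "\<dots> = ennreal (C * (b - a))"
    using ab C by (simp add: nn_integral_cmult_indicator ennreal_mult)
  finally show ?thesis .
qed

text \<open>Two instances of Jensen's inequality, by integrating the tangent at the mean value.\<close>

lemma exp_average_le:
  fixes f :: "real \<Rightarrow> real"
  assumes t: "0 < t" and c: "continuous_on {0..t} f"
  shows "exp (integral {0..t} f / t) \<le> integral {0..t} (\<lambda>s. exp (f s)) / t"
proof -
  define m where "m = integral {0..t} f / t"
  have fi: "f integrable_on {0..t}" by (rule integrable_continuous_real[OF c])
  have "integral {0..t} (\<lambda>s. exp m * (1 - m) + exp m * f s) \<le> integral {0..t} (\<lambda>s. exp (f s))"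
  proof (rule integral_le)
    show "(\<lambda>s. exp m * (1 - m) + exp m * f s) integrable_on {0..t}" "(\<lambda>s. exp (f s)) integrable_on {0..t}"
      by (intro integrable_continuous_real continuous_intros c)+
    fix s
    have "exp m * (1 + (f s - m)) \<le> exp m * exp (f s - m)"
      by (intro mult_left_mono exp_ge_add_one_self) simp
    then show "exp m * (1 - m) + exp m * f s \<le> exp (f s)" by (simp add: exp_add[symmetric] algebra_simps)
  qed
  moreover have "integral {0..t} (\<lambda>s. exp m * (1 - m) + exp m * f s) = exp m * t"
  proof -
    have "integral {0..t} (\<lambda>s. exp m * (1 - m) + exp m * f s) = integral {0..t} (\<lambda>s. exp m * (1 - m)) + integral {0..t} (\<lambda>s. exp m * f s)"
      by (rule integral_add) (intro integrable_continuous_real continuous_intros c)+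
    also have "\<dots> = exp m * (1 - m) * t + exp m * (m * t)" using t by (simp add: m_def)
    finally show ?thesis by (simp add: algebra_simps)
  qed
  ultimately show ?thesis using t by (simp add: m_def pos_le_divide_eq)
qed

lemma square_average_le:
  fixes f :: "real \<Rightarrow> real"
  assumes t: "0 < t" and c: "continuous_on {0..t} f"
  shows "(integral {0..t} f / t)\<^sup>2 \<le> integral {0..t} (\<lambda>s. (f s)\<^sup>2) / t"
proof -
  define m where "m = integral {0..t} f / t"
  have "integral {0..t} (\<lambda>s. 2 * m * f s + - (m\<^sup>2)) \<le> integral {0..t} (\<lambda>s. (f s)\<^sup>2)"
  proof (rule integral_le)
    show "(\<lambda>s. 2 * m * f s + - (m\<^sup>2)) integrable_on {0..t}" "(\<lambda>s. (f s)\<^sup>2) integrable_on {0..t}"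
      by (intro integrable_continuous_real continuous_intros c)+
    fix s show "2 * m * f s + - (m\<^sup>2) \<le> (f s)\<^sup>2"
      using zero_le_power2[of "f s - m"] by (simp add: power2_eq_square algebra_simps)
  qed
  moreover have "integral {0..t} (\<lambda>s. 2 * m * f s + - (m\<^sup>2)) = m\<^sup>2 * t"
  proof -
    have "integral {0..t} (\<lambda>s. 2 * m * f s + - (m\<^sup>2)) = integral {0..t} (\<lambda>s. 2 * m * f s) + integral {0..t} (\<lambda>s. - (m\<^sup>2))"
      by (rule integral_add) (intro integrable_continuous_real continuous_intros c)+
    also have "\<dots> = 2 * m * (m * t) - m\<^sup>2 * t" using t by (simp add: m_def)
    finally show ?thesis by (simp add: power2_eq_square algebra_simps)
  qed
  ultimately show ?thesis using t by (simp add: m_def pos_le_divide_eq)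
qed

section \<open>A uniform second moment bound\<close>

context three_dim_system
begin

definition damping :: real where "damping = min l1 (min l2 l3)"

lemma damping: "0 < damping" "damping \<le> l1" "damping \<le> l2" "damping \<le> l3"
  using l1 l2 l3 by (auto simp: damping_def)

text \<open>Gronwall with the energy balance. The noise enters through \<open>J\<close> only, exponentially in the growth factor
  and linearly in the inhomogeneity.\<close>

lemma energy_path:
  fixes v :: "real^3"
  assumes w: "continuous_on {0..} w" and t: "0 \<le> t"
  defines "J \<equiv> integral {0..t} (\<lambda>s. (\<sigma> * w s)\<^sup>2)"
    and "Y \<equiv> S.flow v w t - w t *\<^sub>R \<sigma> *\<^sub>R f1"
  shows "Y \<bullet> Y \<le> exp (2 / damping * J) * (exp (- damping * t) * (v \<bullet> v) + 2 * \<kappa>\<^sup>2 / l1 * t + 2 * l1 * J)"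
proof -
  define Z where "Z s = S.flow v w s - w s *\<^sub>R \<sigma> *\<^sub>R f1" for s
  define p where "p s = - damping + 2 / damping * (\<sigma> * w s)\<^sup>2" for s
  define q where "q s = 2 * \<kappa>\<^sup>2 / l1 + 2 * l1 * (\<sigma> * w s)\<^sup>2" for s
  have cw: "continuous_on {0..s} w" for s using w by (rule continuous_on_subset) auto
  have cp: "continuous_on {0..s} p" for s unfolding p_def by (intro continuous_intros cw)
  have cq: "continuous_on {0..s} q" for s unfolding q_def by (intro continuous_intros cw)
  have c2: "continuous_on {0..s} (\<lambda>s. (\<sigma> * w s)\<^sup>2)" for s by (intro continuous_intros cw)
  have Z0: "Z 0 = v" using S.flow_eq[OF w, of 0 v] by (simp add: Z_def)
  have G: "Z t \<bullet> Z t \<le> exp (integral {0..t} p) * (Z 0 \<bullet> Z 0 + integral {0..t} (\<lambda>s. exp (- integral {0..s} p) * q s))"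
  proof (rule gronwall_linear[OF t _ _ cp cq])
    show "continuous_on {0..t} (\<lambda>s. Z s \<bullet> Z s)"
      using path_sol_continuous_diff[OF S.flow_path_sol[OF w] S.continuous_drift, of t v]
      by (auto simp: Z_def[abs_def] intro!: continuous_intros)
    fix s assume s: "0 < s" "s < t"
    have "(Z has_vector_derivative drift_S l1 l2 l3 \<kappa> (S.flow v w s)) (at s)"
      unfolding Z_def[abs_def] by (rule path_sol_has_derivative[OF S.flow_path_sol[OF w] S.continuous_drift s])
    then have d: "((\<lambda>s. Z s \<bullet> Z s) has_real_derivative 2 * (Z s \<bullet> drift_S l1 l2 l3 \<kappa> (S.flow v w s))) (at s)"
      by (rule has_real_derivative_inner_self)
    have "S.flow v w s = Z s + (\<sigma> * w s) *\<^sub>R f1" by (simp add: Z_def mult.commute)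
    then have "2 * (Z s \<bullet> drift_S l1 l2 l3 \<kappa> (S.flow v w s)) \<le> p s * (Z s \<bullet> Z s) + q s"
      unfolding p_def q_def using drift_S_energy[OF l1 damping, of "Z s" \<kappa> "\<sigma> * w s"] by simp
    with d show "\<exists>d. ((\<lambda>s. Z s \<bullet> Z s) has_real_derivative d) (at s) \<and> d \<le> p s * (Z s \<bullet> Z s) + q s" by blast
  qed
  have Pint: "integral {0..s} p = - damping * s + 2 / damping * integral {0..s} (\<lambda>s. (\<sigma> * w s)\<^sup>2)" if "0 \<le> s" for s
  proof -
    have "integral {0..s} p = integral {0..s} (\<lambda>s. - damping) + integral {0..s} (\<lambda>s. 2 / damping * (\<sigma> * w s)\<^sup>2)"
      unfolding p_def by (rule integral_add) (intro integrable_continuous_real continuous_intros cw)+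
    then show ?thesis using that by simp
  qed
  have Qint: "integral {0..t} q = 2 * \<kappa>\<^sup>2 / l1 * t + 2 * l1 * J"
  proof -
    have "integral {0..t} q = integral {0..t} (\<lambda>s. 2 * \<kappa>\<^sup>2 / l1) + integral {0..t} (\<lambda>s. 2 * l1 * (\<sigma> * w s)\<^sup>2)"
      unfolding q_def by (rule integral_add) (intro integrable_continuous_real continuous_intros cw)+
    then show ?thesis using t by (simp add: J_def)
  qed
  have q0: "0 \<le> q s" for s unfolding q_def using l1 by (auto intro!: add_nonneg_nonneg)
  have "integral {0..t} (\<lambda>s. exp (- integral {0..s} p) * q s) \<le> integral {0..t} (\<lambda>s. exp (damping * t) * q s)"
  proof (rule integral_le)
    show "(\<lambda>s. exp (damping * t) * q s) integrable_on {0..t}"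
      by (intro integrable_continuous_real continuous_intros cq)
    show "(\<lambda>s. exp (- integral {0..s} p) * q s) integrable_on {0..t}"
      by (intro integrable_continuous_real continuous_intros cq indefinite_integral_continuous_1 cp)
    fix s assume s: "s \<in> {0..t}"
    have "0 \<le> integral {0..s} (\<lambda>s. (\<sigma> * w s)\<^sup>2)" by (intro integral_nonneg integrable_continuous_real c2) auto
    then have "0 \<le> 2 / damping * integral {0..s} (\<lambda>s. (\<sigma> * w s)\<^sup>2)" using damping(1) by simp
    moreover have "damping * s \<le> damping * t" using s damping(1) by (intro mult_left_mono) auto
    ultimately have "- integral {0..s} p \<le> damping * t" using Pint[of s] s by simp
    then show "exp (- integral {0..s} p) * q s \<le> exp (damping * t) * q s" using q0 by (intro mult_right_mono) auto
  qed
  also have "\<dots> = exp (damping * t) * integral {0..t} q" by simp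
  finally have "Z t \<bullet> Z t \<le> exp (integral {0..t} p) * (v \<bullet> v + exp (damping * t) * integral {0..t} q)"
    using G unfolding Z0 by (rule_tac order_trans[OF G[unfolded Z0] mult_left_mono]) auto
  also have "\<dots> = exp (2 / damping * J) * (exp (- damping * t) * (v \<bullet> v) + exp (- damping * t) * exp (damping * t) * integral {0..t} q)"
    unfolding Pint[OF t] J_def[symmetric] exp_add by (simp add: algebra_simps)
  also have "exp (- damping * t) * exp (damping * t) = 1" by (simp add: exp_add[symmetric])
  finally show ?thesis unfolding Qint by (simp add: Z_def Y_def algebra_simps)
qed

lemma noise_measurable:
  assumes "0 \<le> t"
  shows "(\<lambda>\<omega>. integral {0..t} (\<lambda>s. (\<sigma> * W s \<omega>)\<^sup>2)) \<in> borel_measurable M"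
  by (rule measurable_time_integral) (auto intro!: continuous_intros W_continuous)

text \<open>Jensen's inequality in time moves the exponential inside the time integral, where the exponential square
  moment of the single Gaussian variable \<open>W s\<close> is explicit.\<close>

lemma exp_noise_bound:
  assumes t: "0 \<le> t" and p: "0 \<le> p" and small: "2 * p * \<sigma>\<^sup>2 * t\<^sup>2 < 1"
  shows "(\<integral>\<^sup>+\<omega>. ennreal (exp (p * integral {0..t} (\<lambda>s. (\<sigma> * W s \<omega>)\<^sup>2))) \<partial>M) \<le> ennreal (1 / sqrt (1 - 2 * p * \<sigma>\<^sup>2 * t\<^sup>2))"
proof (cases "t = 0")
  case True
  then show ?thesis by (simp add: emeasure_space_1)
next
  case False
  then have t: "0 < t" using t by simp
  define a where "a = p * t * \<sigma>\<^sup>2"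
  have a: "0 \<le> a" using t p by (simp add: a_def)
  define g where "g s \<omega> = exp (a * (W s \<omega>)\<^sup>2) / t" for s \<omega>
  define C where "C = 1 / sqrt (1 - 2 * p * \<sigma>\<^sup>2 * t\<^sup>2)"
  have C0: "0 \<le> C" using small by (simp add: C_def)
  have "(\<integral>\<^sup>+\<omega>. ennreal (exp (p * integral {0..t} (\<lambda>s. (\<sigma> * W s \<omega>)\<^sup>2))) \<partial>M) \<le> (\<integral>\<^sup>+\<omega>. ennreal (integral {0..t} (\<lambda>s. g s \<omega>)) \<partial>M)"
  proof (rule nn_integral_mono)
    fix \<omega> assume \<omega>: "\<omega> \<in> space M"
    have cW: "continuous_on {0..t} (\<lambda>s. W s \<omega>)" by (rule continuous_on_subset[OF W_continuous[OF \<omega>]]) auto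
    have "p * integral {0..t} (\<lambda>s. (\<sigma> * W s \<omega>)\<^sup>2) = integral {0..t} (\<lambda>s. a * (W s \<omega>)\<^sup>2) / t"
      using t by (simp add: a_def power_mult_distrib)
    then have "exp (p * integral {0..t} (\<lambda>s. (\<sigma> * W s \<omega>)\<^sup>2)) \<le> integral {0..t} (\<lambda>s. g s \<omega>)"
    proof -
      have "continuous_on {0..t} (\<lambda>s. a * (W s \<omega>)\<^sup>2)" by (intro continuous_intros cW)
      from exp_average_le[OF t this] show ?thesis
        unfolding g_def integral_divide \<open>p * integral {0..t} (\<lambda>s. (\<sigma> * W s \<omega>)\<^sup>2) = integral {0..t} (\<lambda>s. a * (W s \<omega>)\<^sup>2) / t\<close> .
    qed
    then show "ennreal (exp (p * integral {0..t} (\<lambda>s. (\<sigma> * W s \<omega>)\<^sup>2))) \<le> ennreal (integral {0..t} (\<lambda>s. g s \<omega>))"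
      by (rule ennreal_leI)
  qed
  also have "\<dots> \<le> ennreal (C / t * (t - 0))"
  proof (intro nn_expectation_time_integral)
    show "g s \<in> borel_measurable M" if "0 \<le> s" for s unfolding g_def[abs_def] using that by measurable
    show "continuous_on {0..} (\<lambda>s. g s \<omega>)" if "\<omega> \<in> space M" for \<omega>
      unfolding g_def using t by (intro continuous_intros W_continuous that) auto
    fix s assume s: "s \<in> {0..t}"
    have le: "2 * a * s \<le> 2 * p * \<sigma>\<^sup>2 * t\<^sup>2"
    proof -
      have "2 * a * s \<le> 2 * a * t" using s a by (intro mult_left_mono) auto
      then show ?thesis by (simp add: a_def power2_eq_square mult_ac)
    qed
    have "(\<integral>\<^sup>+\<omega>. ennreal (g s \<omega>) \<partial>M) = (\<integral>\<^sup>+\<omega>. ennreal (1 / t) * ennreal (exp (a * (W s \<omega>)\<^sup>2)) \<partial>M)"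
      unfolding g_def using t by (intro nn_integral_cong) (simp add: ennreal_mult'[symmetric])
    also have "\<dots> = ennreal (1 / t) * (\<integral>\<^sup>+\<omega>. ennreal (exp (a * (W s \<omega>)\<^sup>2)) \<partial>M)"
      using s by (intro nn_integral_cmult) auto
    also have "(\<integral>\<^sup>+\<omega>. ennreal (exp (a * (W s \<omega>)\<^sup>2)) \<partial>M) = (\<integral>\<^sup>+x. ennreal (exp (a * x\<^sup>2)) \<partial>gauss 0 (sqrt s))"
      using s nn_integral_W[of s "\<lambda>x. ennreal (exp (a * x\<^sup>2))"] by simp
    also have "\<dots> = ennreal (1 / sqrt (1 - 2 * a * s))"
      using gauss_exp_square[of "sqrt s" a] s le small by simp
    also have "\<dots> \<le> ennreal C" unfolding C_def using le small by (intro ennreal_leI frac_le) auto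
    also have "ennreal (1 / t) * ennreal C = ennreal (C / t)" using t C0 by (simp add: ennreal_mult'[symmetric])
    finally show "(\<integral>\<^sup>+\<omega>. ennreal (g s \<omega>) \<partial>M) \<le> ennreal (C / t)" by (simp add: mult_left_mono)
  qed (use t C0 in \<open>auto simp: g_def\<close>)
  also have "\<dots> = ennreal C" using t by simp
  finally show ?thesis by (simp add: C_def)
qed

text \<open>With \<open>J = \<integral>\<^sub>0\<^sup>h \<sigma>\<^sup>2 W\<^sup>2\<close> and damping rate \<open>m\<close>, the first condition makes \<open>E exp (2 J / m)\<close> cost at most
  \<open>exp (m h / 2)\<close>, half of the damping; the second one, which the first estimate also uses, keeps \<open>E exp (2 J / m)\<close> and \<open>E exp (3 J / m)\<close> below \<open>2\<close>.\<close>

lemma short_time_step: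
  obtains h where "0 < h" "16 * \<sigma>\<^sup>2 * h \<le> damping\<^sup>2" "12 * \<sigma>\<^sup>2 * h\<^sup>2 \<le> damping"
proof
  define s where "s = \<sigma>\<^sup>2 + 1"
  have s: "s > 0" "\<sigma>\<^sup>2 \<le> s" by (auto simp: s_def add_nonneg_pos)
  define h where "h = min (damping\<^sup>2 / (16 * s)) (min 1 (damping / (12 * s)))"
  show h: "0 < h" using damping(1) s by (simp add: h_def)
  have "16 * \<sigma>\<^sup>2 * h \<le> 16 * s * h" using s h by (intro mult_right_mono) auto
  also have "\<dots> \<le> 16 * s * (damping\<^sup>2 / (16 * s))" using s by (intro mult_left_mono) (auto simp: h_def)
  finally show "16 * \<sigma>\<^sup>2 * h \<le> damping\<^sup>2" using s by simp
  have "12 * \<sigma>\<^sup>2 * h\<^sup>2 \<le> 12 * s * h\<^sup>2" using s by (intro mult_right_mono) auto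
  also have "\<dots> = 12 * s * h * h" by (simp add: power2_eq_square)
  also have "\<dots> \<le> 12 * s * (damping / (12 * s)) * 1" using s h damping(1) by (intro mult_mono) (auto simp: h_def)
  finally show "12 * \<sigma>\<^sup>2 * h\<^sup>2 \<le> damping" using s by simp
qed

lemma inverse_sqrt_le_exp:
  fixes x :: real
  assumes "0 \<le> x" "x \<le> 1/2"
  shows "1 / sqrt (1 - x) \<le> exp (2 * x)"
proof -
  have "1 - x \<le> sqrt (1 - x)" using assms by (intro real_le_rsqrt) (simp add: power2_eq_square mult_left_le_one_le)
  then have "1 / sqrt (1 - x) \<le> 1 / (1 - x)" using assms by (intro frac_le) auto
  also have "\<dots> \<le> 1 + 2 * x"
  proof -
    have "0 \<le> x * (1 - 2 * x)" using assms by (intro mult_nonneg_nonneg) auto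
    then have "1 \<le> (1 + 2 * x) * (1 - x)" by (simp add: algebra_simps power2_eq_square)
    then show ?thesis using assms by (simp add: pos_divide_le_eq)
  qed
  also have "\<dots> \<le> exp (2 * x)" by (rule exp_ge_add_one_self)
  finally show ?thesis .
qed

text \<open>Over a short time \<open>h\<close> the exponential moment of the noise is \<open>1 + O(h\<^sup>2)\<close> and loses against the
  damping factor \<open>exp (- m h)\<close>: the energy contracts on average.\<close>

lemma lyapunov_step:
  obtains h \<theta> A B where "0 < h" "0 \<le> \<theta>" "\<theta> < 1" "0 \<le> A" "0 \<le> B"
    "\<And>v t. t \<in> {0..h} \<Longrightarrow> (\<integral>\<^sup>+\<omega>. ennreal ((norm (S.sol v t \<omega>))\<^sup>2) \<partial>M) \<le> ennreal (A * (norm v)\<^sup>2 + B)"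
    "\<And>v. (\<integral>\<^sup>+\<omega>. ennreal ((norm (S.sol v h \<omega>))\<^sup>2) \<partial>M) \<le> ennreal (\<theta> * (norm v)\<^sup>2 + B)"
proof -
  obtain h where h: "0 < h" "16 * \<sigma>\<^sup>2 * h \<le> damping\<^sup>2" "12 * \<sigma>\<^sup>2 * h\<^sup>2 \<le> damping" by (rule short_time_step)
  let ?m = damping
  note m = damping(1)
  \<comment> \<open>Then \<open>(1 + \<epsilon>) exp (- m h / 2) = (1 + exp (- m h / 2)) / 2 < 1\<close>.\<close>
  define \<epsilon> where "\<epsilon> = (exp (?m * h / 2) - 1) / 2"
  have \<epsilon>: "0 < \<epsilon>" using m h by (simp add: \<epsilon>_def)
  define q0 where "q0 = 2 * \<kappa>\<^sup>2 / l1"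
  define q1 where "q1 = 2 * l1"
  have q: "0 \<le> q0" "0 \<le> q1" using l1 by (auto simp: q0_def q1_def)
  define B where "B = (1 + \<epsilon>) * (2 * (q0 * h) + 2 * (q1 * ?m)) + (1 + 1 / \<epsilon>) * \<sigma>\<^sup>2 * h"
  have B: "0 \<le> B" using \<epsilon> q m h by (auto simp: B_def intro!: add_nonneg_nonneg mult_nonneg_nonneg)
  have main: "(\<integral>\<^sup>+\<omega>. ennreal ((norm (S.sol v t \<omega>))\<^sup>2) \<partial>M) \<le> ennreal ((1 + \<epsilon>) * exp (- (?m * t / 2)) * (norm v)\<^sup>2 + B)"
    if t: "t \<in> {0..h}" for v t
  proof -
    define J where "J \<omega> = integral {0..t} (\<lambda>s. (\<sigma> * W s \<omega>)\<^sup>2)" for \<omega>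
    have Jm[measurable]: "J \<in> borel_measurable M" unfolding J_def[abs_def] using t by (intro noise_measurable) auto
    have J0: "0 \<le> J \<omega>" if "\<omega> \<in> space M" for \<omega>
      unfolding J_def using continuous_on_subset[OF W_continuous[OF that], of "{0..t}"]
      by (intro integral_nonneg integrable_continuous_real continuous_intros) auto
    have t2: "\<sigma>\<^sup>2 * t\<^sup>2 \<le> \<sigma>\<^sup>2 * h\<^sup>2" using t by (intro mult_left_mono power_mono) auto
    have st: "12 * (\<sigma>\<^sup>2 * t\<^sup>2) \<le> ?m" using t2 h(3) by linarith
    define x where "x = 2 * (2 / ?m) * \<sigma>\<^sup>2 * t\<^sup>2"
    have x: "0 \<le> x" "x \<le> 1/2" using st m by (auto simp: x_def field_simps)
    have x': "2 * x \<le> ?m * t / 2"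
    proof -
      have "16 * \<sigma>\<^sup>2 * t \<le> ?m\<^sup>2" using t h(2) by (intro order_trans[OF mult_left_mono h(2)]) auto
      then have "16 * \<sigma>\<^sup>2 * t * t \<le> ?m\<^sup>2 * t" using t by (intro mult_right_mono) auto
      then show ?thesis using m by (simp add: x_def field_simps power2_eq_square)
    qed
    have E2: "(\<integral>\<^sup>+\<omega>. ennreal (exp (2 / ?m * J \<omega>)) \<partial>M) \<le> ennreal (exp (?m * t / 2))"
    proof -
      have "(\<integral>\<^sup>+\<omega>. ennreal (exp (2 / ?m * J \<omega>)) \<partial>M) \<le> ennreal (1 / sqrt (1 - x))"
        unfolding J_def x_def using exp_noise_bound[of t "2 / ?m"] t m x by (simp add: x_def)
      also have "\<dots> \<le> ennreal (exp (?m * t / 2))"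
        using inverse_sqrt_le_exp[OF x] x' by (intro ennreal_leI) (meson exp_le_cancel_iff order_trans)
      finally show ?thesis .
    qed
    have E2': "(\<integral>\<^sup>+\<omega>. ennreal (exp (2 / ?m * J \<omega>)) \<partial>M) \<le> ennreal 2"
    proof -
      have "1 / 2 \<le> sqrt (1 - x)" using x by (intro real_le_rsqrt) (simp add: power2_eq_square)
      then have "1 / sqrt (1 - x) \<le> 1 / (1 / 2)" by (intro frac_le) auto
      then have le: "1 / sqrt (1 - x) \<le> 2" by simp
      have E: "(\<integral>\<^sup>+\<omega>. ennreal (exp (2 / ?m * J \<omega>)) \<partial>M) \<le> ennreal (1 / sqrt (1 - x))"
        unfolding J_def x_def using exp_noise_bound[of t "2 / ?m"] t m x by (simp add: x_def)
      show ?thesis by (rule order_trans[OF E ennreal_leI[OF le]])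
    qed
    have E3: "(\<integral>\<^sup>+\<omega>. ennreal (exp (3 / ?m * J \<omega>)) \<partial>M) \<le> ennreal 2"
    proof -
      define z where "z = 2 * (3 / ?m) * \<sigma>\<^sup>2 * t\<^sup>2"
      have z: "0 \<le> z" "z \<le> 1/2" using st m by (auto simp: z_def field_simps)
      have "(\<integral>\<^sup>+\<omega>. ennreal (exp (3 / ?m * J \<omega>)) \<partial>M) \<le> ennreal (1 / sqrt (1 - z))"
        unfolding J_def z_def using exp_noise_bound[of t "3 / ?m"] t m z by (simp add: z_def)
      also have "\<dots> \<le> ennreal 2"
      proof (rule ennreal_leI)
        have "1 / 2 \<le> sqrt (1 - z)" using z by (intro real_le_rsqrt) (simp add: power2_eq_square)
        then have "1 / sqrt (1 - z) \<le> 1 / (1 / 2)" by (intro frac_le) auto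
        then show "1 / sqrt (1 - z) \<le> 2" by simp
      qed
      finally show ?thesis .
    qed
    have pw: "(norm (S.sol v t \<omega>))\<^sup>2 \<le> ((1 + \<epsilon>) * (exp (- ?m * t) * (norm v)\<^sup>2 + q0 * t)) * exp (2 / ?m * J \<omega>)
        + ((1 + \<epsilon>) * (q1 * ?m)) * exp (3 / ?m * J \<omega>) + ((1 + 1 / \<epsilon>) * \<sigma>\<^sup>2) * (W t \<omega>)\<^sup>2" if \<omega>: "\<omega> \<in> space M" for \<omega>
    proof -
      define Y where "Y = S.sol v t \<omega> - W t \<omega> *\<^sub>R \<sigma> *\<^sub>R f1"
      have n: "norm (S.sol v t \<omega>) \<le> norm Y + \<bar>\<sigma> * W t \<omega>\<bar>"
        using norm_triangle_ineq[of Y "W t \<omega> *\<^sub>R \<sigma> *\<^sub>R f1"] by (simp add: Y_def abs_mult mult.commute)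
      have "(norm (S.sol v t \<omega>))\<^sup>2 \<le> (norm Y + \<bar>\<sigma> * W t \<omega>\<bar>)\<^sup>2" using n by (intro power_mono) auto
      also have "\<dots> \<le> (1 + \<epsilon>) * (norm Y)\<^sup>2 + (1 + 1 / \<epsilon>) * (\<sigma> * W t \<omega>)\<^sup>2"
        using square_le_weighted[OF \<epsilon>, of "norm Y + \<bar>\<sigma> * W t \<omega>\<bar>" "norm Y"] by simp
      also have "(1 + \<epsilon>) * (norm Y)\<^sup>2 \<le> (1 + \<epsilon>) * (exp (2 / ?m * J \<omega>) * (exp (- ?m * t) * (norm v)\<^sup>2 + q0 * t) + q1 * ?m * exp (3 / ?m * J \<omega>))"
      proof (rule mult_left_mono)
        have "Y \<bullet> Y \<le> exp (2 / ?m * J \<omega>) * (exp (- ?m * t) * (v \<bullet> v) + q0 * t + q1 * J \<omega>)"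
          unfolding Y_def J_def S.sol_def q0_def q1_def by (rule energy_path[OF W_continuous[OF \<omega>]]) (use t in auto)
        also have "\<dots> = exp (2 / ?m * J \<omega>) * (exp (- ?m * t) * (norm v)\<^sup>2 + q0 * t) + q1 * (exp (2 / ?m * J \<omega>) * J \<omega>)"
          by (simp add: power2_norm_eq_inner algebra_simps)
        \<comment> \<open>The factor \<open>J\<close> costs one more unit \<open>J / m\<close> in the exponent, because \<open>y \<le> exp y\<close>.\<close>
        also have "exp (2 / ?m * J \<omega>) * J \<omega> \<le> ?m * exp (3 / ?m * J \<omega>)"
        proof -
          have "J \<omega> / ?m \<le> exp (J \<omega> / ?m)" using exp_ge_add_one_self[of "J \<omega> / ?m"] by linarith
          then have "J \<omega> \<le> ?m * exp (J \<omega> / ?m)" using m by (simp add: pos_divide_le_eq mult.commute)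
          then have "exp (2 / ?m * J \<omega>) * J \<omega> \<le> exp (2 / ?m * J \<omega>) * (?m * exp (J \<omega> / ?m))" by (intro mult_left_mono) auto
          also have "\<dots> = ?m * exp (2 / ?m * J \<omega> + J \<omega> / ?m)" unfolding exp_add by (simp only: mult_ac)
          also have "2 / ?m * J \<omega> + J \<omega> / ?m = 3 / ?m * J \<omega>" by (simp add: add_divide_distrib[symmetric])
          finally show ?thesis .
        qed
        finally show "(norm Y)\<^sup>2 \<le> exp (2 / ?m * J \<omega>) * (exp (- ?m * t) * (norm v)\<^sup>2 + q0 * t) + q1 * ?m * exp (3 / ?m * J \<omega>)"
          using q by (simp add: power2_norm_eq_inner mult_left_mono mult.assoc)
      qed (use \<epsilon> in simp)
      finally show ?thesis by (simp add: algebra_simps power_mult_distrib)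
    qed
    define c1 where "c1 = (1 + \<epsilon>) * (exp (- ?m * t) * (norm v)\<^sup>2)"
    define c1' where "c1' = (1 + \<epsilon>) * (q0 * t)"
    define c2 where "c2 = (1 + \<epsilon>) * (q1 * ?m)"
    define c3 where "c3 = (1 + 1 / \<epsilon>) * \<sigma>\<^sup>2"
    have c: "0 \<le> c1" "0 \<le> c1'" "0 \<le> c2" "0 \<le> c3" using \<epsilon> q m t by (auto simp: c1_def c1'_def c2_def c3_def)
    have "(\<integral>\<^sup>+\<omega>. ennreal ((norm (S.sol v t \<omega>))\<^sup>2) \<partial>M)
        \<le> (\<integral>\<^sup>+\<omega>. ennreal c1 * ennreal (exp (2 / ?m * J \<omega>)) + ennreal c1' * ennreal (exp (2 / ?m * J \<omega>)) + ennreal c2 * ennreal (exp (3 / ?m * J \<omega>)) + ennreal c3 * ennreal ((W t \<omega>)\<^sup>2) \<partial>M)"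
    proof (rule nn_integral_mono)
      fix \<omega> assume "\<omega> \<in> space M"
      from pw[OF this] have "ennreal ((norm (S.sol v t \<omega>))\<^sup>2) \<le> ennreal (c1 * exp (2 / ?m * J \<omega>) + c1' * exp (2 / ?m * J \<omega>) + c2 * exp (3 / ?m * J \<omega>) + c3 * (W t \<omega>)\<^sup>2)"
        by (intro ennreal_leI) (simp add: c1_def c1'_def c2_def c3_def distrib_left distrib_right)
      also have "\<dots> = ennreal c1 * ennreal (exp (2 / ?m * J \<omega>)) + ennreal c1' * ennreal (exp (2 / ?m * J \<omega>)) + ennreal c2 * ennreal (exp (3 / ?m * J \<omega>)) + ennreal c3 * ennreal ((W t \<omega>)\<^sup>2)"
        using c by (simp add: ennreal_mult)
      finally show "ennreal ((norm (S.sol v t \<omega>))\<^sup>2) \<le> ennreal c1 * ennreal (exp (2 / ?m * J \<omega>)) + ennreal c1' * ennreal (exp (2 / ?m * J \<omega>)) + ennreal c2 * ennreal (exp (3 / ?m * J \<omega>)) + ennreal c3 * ennreal ((W t \<omega>)\<^sup>2)" .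
    qed
    also have "\<dots> = ennreal c1 * (\<integral>\<^sup>+\<omega>. ennreal (exp (2 / ?m * J \<omega>)) \<partial>M) + ennreal c1' * (\<integral>\<^sup>+\<omega>. ennreal (exp (2 / ?m * J \<omega>)) \<partial>M)
        + ennreal c2 * (\<integral>\<^sup>+\<omega>. ennreal (exp (3 / ?m * J \<omega>)) \<partial>M) + ennreal c3 * (\<integral>\<^sup>+\<omega>. ennreal ((W t \<omega>)\<^sup>2) \<partial>M)"
      using t by (simp add: nn_integral_add nn_integral_cmult)
    also have "\<dots> \<le> ennreal c1 * ennreal (exp (?m * t / 2)) + ennreal c1' * ennreal 2 + ennreal c2 * ennreal 2 + ennreal c3 * ennreal t"
      using E2 E2' E3 W_second_moment[of t] t by (intro add_mono mult_left_mono) auto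
    also have "\<dots> = ennreal (c1 * exp (?m * t / 2) + c1' * 2 + c2 * 2 + c3 * t)"
      using c t by (simp add: ennreal_mult)
    also have "\<dots> \<le> ennreal ((1 + \<epsilon>) * exp (- (?m * t / 2)) * (norm v)\<^sup>2 + B)"
    proof (rule ennreal_leI)
      have "c1 * exp (?m * t / 2) = (1 + \<epsilon>) * exp (- (?m * t / 2)) * (norm v)\<^sup>2"
      proof -
        have "exp (- ?m * t) * exp (?m * t / 2) = exp (- (?m * t / 2))" by (simp add: exp_add[symmetric])
        moreover have "c1 * exp (?m * t / 2) = (1 + \<epsilon>) * (exp (- ?m * t) * exp (?m * t / 2)) * (norm v)\<^sup>2"
          unfolding c1_def by (simp only: mult_ac)
        ultimately show ?thesis by (simp only:)
      qed
      moreover have "c1' * 2 + c2 * 2 + c3 * t \<le> B"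
      proof -
        have "c1' \<le> (1 + \<epsilon>) * (q0 * h)" unfolding c1'_def using t \<epsilon> q by (intro mult_left_mono) auto
        moreover have "c3 * t \<le> c3 * h" using t c by (intro mult_left_mono) auto
        ultimately show ?thesis by (simp add: B_def c2_def c3_def algebra_simps)
      qed
      ultimately show "c1 * exp (?m * t / 2) + c1' * 2 + c2 * 2 + c3 * t \<le> (1 + \<epsilon>) * exp (- (?m * t / 2)) * (norm v)\<^sup>2 + B" by linarith
    qed
    finally show ?thesis .
  qed
  show ?thesis
  proof (rule that[of h "(1 + \<epsilon>) * exp (- (?m * h / 2))" "1 + \<epsilon>" B])
    show "0 < h" by (rule h)
    show "0 \<le> (1 + \<epsilon>) * exp (- (?m * h / 2))" "0 \<le> 1 + \<epsilon>" "0 \<le> B" using \<epsilon> B by auto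
    show "(1 + \<epsilon>) * exp (- (?m * h / 2)) < 1"
    proof -
      have e: "exp (?m * h / 2) * exp (- (?m * h / 2)) = 1" by (simp add: exp_add[symmetric])
      have "1 + \<epsilon> < exp (?m * h / 2)" using m h by (simp add: \<epsilon>_def field_simps)
      then have "(1 + \<epsilon>) * exp (- (?m * h / 2)) < exp (?m * h / 2) * exp (- (?m * h / 2))" by (intro mult_strict_right_mono) auto
      then show ?thesis using e by simp
    qed
    show "(\<integral>\<^sup>+\<omega>. ennreal ((norm (S.sol v h \<omega>))\<^sup>2) \<partial>M) \<le> ennreal ((1 + \<epsilon>) * exp (- (?m * h / 2)) * (norm v)\<^sup>2 + B)" for v
      using main[of h v] h by simp
    fix v :: "real^3" and t assume t: "t \<in> {0..h}"
    have "(1 + \<epsilon>) * exp (- (?m * t / 2)) * (norm v)\<^sup>2 \<le> (1 + \<epsilon>) * 1 * (norm v)\<^sup>2"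
      using \<epsilon> m t by (intro mult_right_mono mult_left_mono) auto
    then show "(\<integral>\<^sup>+\<omega>. ennreal ((norm (S.sol v t \<omega>))\<^sup>2) \<partial>M) \<le> ennreal ((1 + \<epsilon>) * (norm v)\<^sup>2 + B)"
      using main[OF t, of v] by (intro order_trans[OF main[OF t, of v] ennreal_leI]) simp
  qed
qed

text \<open>The Markov property is available for bounded test functions, so the contraction is iterated for
  the truncated squares \<open>min K |x|\<^sup>2\<close>.\<close>

lemma second_moment_bound:
  "\<exists>D\<ge>0. \<forall>t\<ge>0. (\<integral>\<^sup>+\<omega>. ennreal ((norm (S.sol v t \<omega>))\<^sup>2) \<partial>M) \<le> ennreal D"
proof -
  obtain h \<theta> A B where h: "0 < h" and \<theta>: "0 \<le> \<theta>" "\<theta> < 1" and AB: "0 \<le> A" "0 \<le> B"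
    and short: "\<And>v t. t \<in> {0..h} \<Longrightarrow> (\<integral>\<^sup>+\<omega>. ennreal ((norm (S.sol v t \<omega>))\<^sup>2) \<partial>M) \<le> ennreal (A * (norm v)\<^sup>2 + B)"
    and step: "\<And>v. (\<integral>\<^sup>+\<omega>. ennreal ((norm (S.sol v h \<omega>))\<^sup>2) \<partial>M) \<le> ennreal (\<theta> * (norm v)\<^sup>2 + B)"
    using lyapunov_step by blast
  \<comment> \<open>\<open>B / (1 - \<theta>)\<close> is the fixed point of \<open>D \<mapsto> \<theta> D + B\<close>; the other term covers the times in \<open>[0, h]\<close>.\<close>
  define D where "D = max (A * (norm v)\<^sup>2 + B) (B / (1 - \<theta>))"
  have D0: "0 \<le> D" using AB by (simp add: D_def le_max_iff_disj)
  have D1: "\<theta> * D + B \<le> D"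
  proof -
    have "B / (1 - \<theta>) \<le> D" by (simp add: D_def)
    then have "B \<le> D * (1 - \<theta>)" using \<theta> by (simp add: pos_divide_le_eq)
    then show ?thesis by (simp add: algebra_simps)
  qed
  define f where "f K x = min (real K) ((norm x)\<^sup>2)" for K :: nat and x :: "real^3"
  have fb: "bcont (f K)" for K
    unfolding f_def by (intro bcontI[where C="real K"] continuous_intros) auto
  have f_int: "integrable M (\<lambda>\<omega>. f K (S.sol y s \<omega>))" if "0 \<le> s" for K y s
    by (rule integrable_bcont[OF fb]) (use that in simp)
  have f0: "0 \<le> f K x" for K x by (simp add: f_def)
  have next_step: "(\<integral>\<^sup>+\<omega>. ennreal ((norm (S.sol v (t + h) \<omega>))\<^sup>2) \<partial>M) \<le> ennreal D"
    if t: "0 \<le> t" and IH: "(\<integral>\<^sup>+\<omega>. ennreal ((norm (S.sol v t \<omega>))\<^sup>2) \<partial>M) \<le> ennreal D" for t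
  proof -
    have th: "0 \<le> t + h" using t h by simp
    have trunc: "(\<integral>\<^sup>+\<omega>. ennreal (f K (S.sol v (t + h) \<omega>)) \<partial>M) \<le> ennreal D" for K
    proof -
      have sb: "S.semi h (f K) y \<le> \<theta> * (norm y)\<^sup>2 + B" for y
      proof -
        have "ennreal (S.semi h (f K) y) = (\<integral>\<^sup>+\<omega>. ennreal (f K (S.sol y h \<omega>)) \<partial>M)"
          unfolding S.semi_def
          by (rule nn_integral_eq_integral[symmetric]) (use h f_int f0 in auto)
        also have "\<dots> \<le> (\<integral>\<^sup>+\<omega>. ennreal ((norm (S.sol y h \<omega>))\<^sup>2) \<partial>M)"
          by (intro nn_integral_mono ennreal_leI) (simp add: f_def)
        also have "\<dots> \<le> ennreal (\<theta> * (norm y)\<^sup>2 + B)" by (rule step)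
        finally show ?thesis using \<theta> AB by (subst (asm) ennreal_le_iff) auto
      qed
      have "(\<integral>\<^sup>+\<omega>. ennreal (f K (S.sol v (t + h) \<omega>)) \<partial>M) = ennreal (S.semi (t + h) (f K) v)"
        unfolding S.semi_def
        by (rule nn_integral_eq_integral) (use th f_int f0 in auto)
      also have "S.semi (t + h) (f K) v = S.semi t (S.semi h (f K)) v"
        by (rule S.markov[OF fb t]) (use h in simp)
      also have "ennreal \<dots> = (\<integral>\<^sup>+\<omega>. ennreal (S.semi h (f K) (S.sol v t \<omega>)) \<partial>M)"
        unfolding S.semi_def[of t]
      proof (rule nn_integral_eq_integral[symmetric])
        show "integrable M (\<lambda>\<omega>. S.semi h (f K) (S.sol v t \<omega>))"
          by (rule integrable_bcont[OF S.feller[OF fb]]) (use t h in auto)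
        show "AE \<omega> in M. 0 \<le> S.semi h (f K) (S.sol v t \<omega>)"
          unfolding S.semi_def using f0 by simp
      qed
      also have "\<dots> \<le> (\<integral>\<^sup>+\<omega>. ennreal \<theta> * ennreal ((norm (S.sol v t \<omega>))\<^sup>2) + ennreal B \<partial>M)"
      proof (rule nn_integral_mono)
        fix \<omega>
        have "ennreal (S.semi h (f K) (S.sol v t \<omega>)) \<le> ennreal (\<theta> * (norm (S.sol v t \<omega>))\<^sup>2 + B)"
          by (rule ennreal_leI[OF sb])
        also have "\<dots> = ennreal \<theta> * ennreal ((norm (S.sol v t \<omega>))\<^sup>2) + ennreal B"
          using \<theta> AB by (simp add: ennreal_mult)
        finally show "ennreal (S.semi h (f K) (S.sol v t \<omega>)) \<le> ennreal \<theta> * ennreal ((norm (S.sol v t \<omega>))\<^sup>2) + ennreal B" .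
      qed
      also have "\<dots> = ennreal \<theta> * (\<integral>\<^sup>+\<omega>. ennreal ((norm (S.sol v t \<omega>))\<^sup>2) \<partial>M) + ennreal B"
        using t by (simp add: nn_integral_add nn_integral_cmult emeasure_space_1)
      also have "\<dots> \<le> ennreal \<theta> * ennreal D + ennreal B" using IH by (intro add_mono mult_left_mono) auto
      also have "\<dots> = ennreal (\<theta> * D + B)" using \<theta> AB D0 by (simp add: ennreal_mult)
      also have "\<dots> \<le> ennreal D" by (rule ennreal_leI[OF D1])
      finally show ?thesis .
    qed
    have "(\<lambda>K. \<integral>\<^sup>+\<omega>. ennreal (f K (S.sol v (t + h) \<omega>)) \<partial>M) \<longlonglongrightarrow> (\<integral>\<^sup>+\<omega>. ennreal ((norm (S.sol v (t + h) \<omega>))\<^sup>2) \<partial>M)"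
    proof (rule nn_integral_LIMSEQ)
      show "incseq (\<lambda>K \<omega>. ennreal (f K (S.sol v (t + h) \<omega>)))"
        by (auto simp: incseq_def le_fun_def f_def intro!: ennreal_leI)
      show "(\<lambda>\<omega>. ennreal (f K (S.sol v (t + h) \<omega>))) \<in> borel_measurable M" for K
        using th unfolding f_def by measurable
      fix \<omega>
      obtain N :: nat where N: "(norm (S.sol v (t + h) \<omega>))\<^sup>2 \<le> N" using real_arch_simple by blast
      have "f K (S.sol v (t + h) \<omega>) = (norm (S.sol v (t + h) \<omega>))\<^sup>2" if "K \<ge> N" for K
      proof -
        have "(norm (S.sol v (t + h) \<omega>))\<^sup>2 \<le> real K" using N that by linarith
        then show ?thesis by (simp add: f_def)
      qed
      then show "(\<lambda>K. ennreal (f K (S.sol v (t + h) \<omega>))) \<longlonglongrightarrow> ennreal ((norm (S.sol v (t + h) \<omega>))\<^sup>2)"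
        by (intro tendsto_eventually) (auto simp: eventually_sequentially intro!: exI[of _ N])
    qed
    then show ?thesis using trunc by (intro LIMSEQ_le_const2) auto
  qed
  have grid: "(\<integral>\<^sup>+\<omega>. ennreal ((norm (S.sol v (r + real n * h) \<omega>))\<^sup>2) \<partial>M) \<le> ennreal D" if r: "r \<in> {0..h}" for n r
  proof (induction n)
    case 0
    show ?case using order_trans[OF short[OF r, of v] ennreal_leI[of _ D]] by (simp add: D_def)
  next
    case (Suc n)
    have "0 \<le> r + real n * h" using r h by simp
    from next_step[OF this Suc] show ?case by (simp add: algebra_simps)
  qed
  have "(\<integral>\<^sup>+\<omega>. ennreal ((norm (S.sol v t \<omega>))\<^sup>2) \<partial>M) \<le> ennreal D" if t: "0 \<le> t" for t
  proof -
    define n where "n = nat \<lfloor>t / h\<rfloor>"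
    have "0 \<le> t / h" using t h by simp
    then have n: "real n \<le> t / h" "t / h < real n + 1" by (auto simp: n_def)
    then have "t - real n * h \<in> {0..h}" using h by (simp add: field_simps)
    from grid[OF this, of n] show ?thesis by simp
  qed
  then show ?thesis using D0 by blast
qed

section \<open>Time averages\<close>

text \<open>Jensen's inequality path by path, then Fubini. The process \<open>X\<close> is abstract because this is applied to the
  chosen solution of the equation, which agrees with the flow only almost surely.\<close>

lemma time_average_second_moment:
  fixes X :: "real \<Rightarrow> 'w \<Rightarrow> real^3"
  assumes Xm: "\<And>s. 0 \<le> s \<Longrightarrow> X s \<in> borel_measurable M"
    and Xc: "\<And>\<omega>. \<omega> \<in> space M \<Longrightarrow> continuous_on {0..} (\<lambda>s. X s \<omega>)"
    and D: "0 \<le> D" "\<And>s. 0 \<le> s \<Longrightarrow> (\<integral>\<^sup>+\<omega>. ennreal ((norm (X s \<omega>))\<^sup>2) \<partial>M) \<le> ennreal D"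
    and T: "0 < T"
  shows "(\<lambda>\<omega>. (1 / T) *\<^sub>R integral {0..T} (\<lambda>s. X s \<omega>)) \<in> borel_measurable M"
    and "(\<integral>\<^sup>+\<omega>. ennreal ((norm ((1 / T) *\<^sub>R integral {0..T} (\<lambda>s. X s \<omega>)))\<^sup>2) \<partial>M) \<le> ennreal D"
proof -
  have cX: "continuous_on {0..T} (\<lambda>s. X s \<omega>)" if "\<omega> \<in> space M" for \<omega>
    by (rule continuous_on_subset[OF Xc[OF that]]) auto
  have "(\<lambda>\<omega>. integral {0..T} (\<lambda>s. X s \<omega>)) \<in> borel_measurable M"
    by (rule measurable_time_integral[OF Xm Xc]) auto
  then show "(\<lambda>\<omega>. (1 / T) *\<^sub>R integral {0..T} (\<lambda>s. X s \<omega>)) \<in> borel_measurable M" by measurable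
  have "(\<integral>\<^sup>+\<omega>. ennreal ((norm ((1 / T) *\<^sub>R integral {0..T} (\<lambda>s. X s \<omega>)))\<^sup>2) \<partial>M)
      \<le> (\<integral>\<^sup>+\<omega>. ennreal (integral {0..T} (\<lambda>s. (norm (X s \<omega>))\<^sup>2 / T)) \<partial>M)"
  proof (intro nn_integral_mono ennreal_leI)
    fix \<omega> assume \<omega>: "\<omega> \<in> space M"
    have "norm (integral {0..T} (\<lambda>s. X s \<omega>)) \<le> integral {0..T} (\<lambda>s. norm (X s \<omega>))"
      by (intro integral_norm_bound_integral integrable_continuous_real continuous_intros cX \<omega>) auto
    then have "norm ((1 / T) *\<^sub>R integral {0..T} (\<lambda>s. X s \<omega>)) \<le> integral {0..T} (\<lambda>s. norm (X s \<omega>)) / T"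
      using T by (simp add: divide_right_mono)
    then have "(norm ((1 / T) *\<^sub>R integral {0..T} (\<lambda>s. X s \<omega>)))\<^sup>2 \<le> (integral {0..T} (\<lambda>s. norm (X s \<omega>)) / T)\<^sup>2"
      by (intro power_mono) auto
    also have "\<dots> \<le> integral {0..T} (\<lambda>s. (norm (X s \<omega>))\<^sup>2) / T"
      by (rule square_average_le[OF T]) (intro continuous_intros cX \<omega>)
    finally show "(norm ((1 / T) *\<^sub>R integral {0..T} (\<lambda>s. X s \<omega>)))\<^sup>2 \<le> integral {0..T} (\<lambda>s. (norm (X s \<omega>))\<^sup>2 / T)" by simp
  qed
  also have "\<dots> \<le> ennreal (D / T * (T - 0))"
  proof (rule nn_expectation_time_integral)
    show "(\<lambda>\<omega>. (norm (X s \<omega>))\<^sup>2 / T) \<in> borel_measurable M" if "0 \<le> s" for s using Xm[OF that] by measurable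
    show "continuous_on {0..} (\<lambda>s. (norm (X s \<omega>))\<^sup>2 / T)" if "\<omega> \<in> space M" for \<omega>
      using T by (intro continuous_intros Xc that) auto
    fix s assume s: "s \<in> {0..T}"
    have "(\<integral>\<^sup>+\<omega>. ennreal ((norm (X s \<omega>))\<^sup>2 / T) \<partial>M) = (\<integral>\<^sup>+\<omega>. ennreal (1 / T) * ennreal ((norm (X s \<omega>))\<^sup>2) \<partial>M)"
      using T by (intro nn_integral_cong) (simp add: ennreal_mult'[symmetric])
    also have "\<dots> = ennreal (1 / T) * (\<integral>\<^sup>+\<omega>. ennreal ((norm (X s \<omega>))\<^sup>2) \<partial>M)"
      using Xm[of s] s by (intro nn_integral_cmult) auto
    also have "\<dots> \<le> ennreal (1 / T) * ennreal D" using D(2)[of s] s by (intro mult_left_mono) auto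
    also have "\<dots> = ennreal (D / T)" using T D by (simp add: ennreal_mult'[symmetric])
    finally show "(\<integral>\<^sup>+\<omega>. ennreal ((norm (X s \<omega>))\<^sup>2 / T) \<partial>M) \<le> ennreal (D / T)" .
  qed (use T D in auto)
  also have "\<dots> = ennreal D" using T by simp
  finally show "(\<integral>\<^sup>+\<omega>. ennreal ((norm ((1 / T) *\<^sub>R integral {0..T} (\<lambda>s. X s \<omega>)))\<^sup>2) \<partial>M) \<le> ennreal D" .
qed

lemma time_averages_converge:
  "\<exists>t::nat \<Rightarrow> real. (\<forall>n. 0 < t n) \<and> strict_mono t \<and> filterlim t at_top sequentially \<and>
     (\<exists>\<mu>. borel_prob \<mu> \<and>
        weakly_converges
          (\<lambda>n. law M (\<lambda>\<omega>. (1 / t n) *\<^sub>R integral {0..t n} (\<lambda>s. sol_S M W l1 l2 l3 \<kappa> \<sigma> v s \<omega>)))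
          \<mu> sequentially)"
proof -
  define X where "X = sol_S M W l1 l2 l3 \<kappa> \<sigma> v"
  have X: "X = sde_solution M W (drift_S l1 l2 l3 \<kappa>) (\<sigma> *\<^sub>R f1) v" by (simp add: X_def sol_S_def)
  have Xm: "X s \<in> borel_measurable M" if "0 \<le> s" for s unfolding X by (rule S.sde_solution_measurable[OF that])
  have Xc: "continuous_on {0..} (\<lambda>s. X s \<omega>)" if "\<omega> \<in> space M" for \<omega> unfolding X by (rule S.sde_solution_continuous[OF that])
  obtain D where D: "0 \<le> D" "\<And>t. 0 \<le> t \<Longrightarrow> (\<integral>\<^sup>+\<omega>. ennreal ((norm (S.sol v t \<omega>))\<^sup>2) \<partial>M) \<le> ennreal D"
    using second_moment_bound[of v] by blast
  have XD: "(\<integral>\<^sup>+\<omega>. ennreal ((norm (X s \<omega>))\<^sup>2) \<partial>M) \<le> ennreal D" if s: "0 \<le> s" for s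
  proof -
    have "(\<integral>\<^sup>+\<omega>. ennreal ((norm (X s \<omega>))\<^sup>2) \<partial>M) = (\<integral>\<^sup>+\<omega>. ennreal ((norm (S.sol v s \<omega>))\<^sup>2) \<partial>M)"
      using S.sde_solution_AE[of v] s unfolding X by (intro nn_integral_cong_AE) (auto elim!: eventually_mono)
    then show ?thesis using D(2)[OF s] by simp
  qed
  define A where "A n \<omega> = (1 / real (Suc n)) *\<^sub>R integral {0..real (Suc n)} (\<lambda>s. X s \<omega>)" for n \<omega>
  have Am: "A n \<in> borel_measurable M" for n
    unfolding A_def[abs_def] by (rule time_average_second_moment(1)[OF Xm Xc D(1) XD]) auto
  have A2: "(\<integral>\<^sup>+\<omega>. ennreal ((norm (A n \<omega>))\<^sup>2) \<partial>M) \<le> ennreal D" for n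
    unfolding A_def by (rule time_average_second_moment(2)[OF Xm Xc D(1) XD]) auto
  obtain r \<mu> where r: "strict_mono r" and \<mu>: "borel_prob \<mu>"
    and lim: "\<forall>f. bcont f \<longrightarrow> (\<lambda>n. integral\<^sup>L (law M (A (r n))) f) \<longlonglongrightarrow> integral\<^sup>L \<mu> f"
  proof -
    have 1: "borel_prob (law M (A n))" for n
      unfolding borel_prob_def law_def using Am by (simp add: prob_space_distr)
    have 2: "(\<integral>\<^sup>+x. ennreal ((norm x)\<^sup>2) \<partial>law M (A n)) \<le> ennreal D" for n
      unfolding law_def using A2[of n] Am[of n] by (subst nn_integral_distr) auto
    show ?thesis using prokhorov_second_moment[of "\<lambda>n. law M (A n)", OF 1 2] that by blast
  qed
  define t where "t n = real (Suc (r n))" for n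
  have "(\<lambda>\<omega>. (1 / t n) *\<^sub>R integral {0..t n} (\<lambda>s. X s \<omega>)) = A (r n)" for n
    by (simp add: fun_eq_iff A_def t_def)
  moreover have "strict_mono t" using r by (simp add: strict_mono_def t_def)
  moreover have "filterlim t at_top sequentially"
    unfolding t_def
    by (rule filterlim_at_top_mono[OF filterlim_compose[OF filterlim_real_sequentially filterlim_subseq[OF r]]]) simp
  ultimately show ?thesis
    unfolding X_def[symmetric] weakly_converges_def
    using \<mu> lim by (intro exI[of _ t]) (auto simp: t_def bcont_def)
qed

text \<open>Krylov--Bogoliubov: the time averages of the laws are asymptotically invariant because shifting
  the window \<open>[0, T]\<close> by \<open>s\<close> changes the integral of a function bounded by \<open>C\<close> by at most \<open>2 s C\<close>.\<close>

lemma krylov_bogoliubov: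
  "\<exists>r \<mu>. strict_mono (r :: nat \<Rightarrow> nat) \<and> sde_invariant M W (drift_S l1 l2 l3 \<kappa>) (\<sigma> *\<^sub>R f1) \<mu> \<and>
     (\<forall>f. bcont f \<longrightarrow> (\<lambda>n. integral {0..real (Suc (r n))} (\<lambda>t. S.semi t f v) / real (Suc (r n))) \<longlonglongrightarrow> integral\<^sup>L \<mu> f)"
proof -
  obtain D where D: "0 \<le> D" "\<And>t. 0 \<le> t \<Longrightarrow> (\<integral>\<^sup>+\<omega>. ennreal ((norm (S.sol v t \<omega>))\<^sup>2) \<partial>M) \<le> ennreal D"
    using second_moment_bound[of v] by blast
  \<comment> \<open>The uniform law on \<open>[0, n + 1]\<close>; \<open>m n\<close> below is the law of the solution at an independent uniform time.\<close>
  define U where "U n = density lborel (\<lambda>t. ennreal (indicator {0..real (Suc n)} t / real (Suc n)))" for n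
  have Us[measurable_cong]: "sets (U n) = sets borel" for n by (simp add: U_def)
  have PU: "prob_space (U n)" for n
  proof (rule prob_spaceI)
    have "emeasure (U n) (space (U n)) = (\<integral>\<^sup>+t. ennreal (1 / real (Suc n)) * indicator {0..real (Suc n)} t \<partial>lborel)"
      unfolding U_def by (subst emeasure_density) (auto intro!: nn_integral_cong simp: indicator_def)
    also have "\<dots> = ennreal (1 / real (Suc n)) * ennreal (real (Suc n))"
      by (subst nn_integral_cmult_indicator) auto
    also have "\<dots> = 1" by (subst ennreal_mult'[symmetric]) auto
    finally show "emeasure (U n) (space (U n)) = 1" .
  qed
  have jm: "(\<lambda>p. S.sol v (max 0 (fst p)) (snd p)) \<in> borel_measurable (borel \<Otimes>\<^sub>M M)"
    using measurable_continuous_process[of "S.sol v" M] S.sol_continuous by (simp add: case_prod_beta)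
  have jmU[measurable]: "(\<lambda>p. S.sol v (max 0 (fst p)) (snd p)) \<in> borel_measurable (U n \<Otimes>\<^sub>M M)" for n
    using jm by (simp cong: measurable_cong_sets sets_pair_measure_cong add: Us)
  define m where "m n = distr (U n \<Otimes>\<^sub>M M) borel (\<lambda>p. S.sol v (max 0 (fst p)) (snd p))" for n
  have mp: "borel_prob (m n)" for n
  proof -
    interpret U: prob_space "U n" by (rule PU)
    interpret P: pair_prob_space "U n" M ..
    show ?thesis unfolding m_def borel_prob_def by (simp add: P.prob_space_distr)
  qed
  have semi_c: "continuous_on {0..} (\<lambda>t. S.semi t f v)" if f: "bcont f" for f
    unfolding S.semi_def by (rule continuous_on_expectation[OF f]) (auto intro: S.sol_continuous)
  have mint: "integral\<^sup>L (m n) f = integral {0..real (Suc n)} (\<lambda>t. S.semi t f v) / real (Suc n)" if f: "bcont f" for f n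
  proof -
    interpret U: prob_space "U n" by (rule PU)
    interpret P: pair_prob_space "U n" M ..
    have fm: "f \<in> borel_measurable borel" by (rule bcont_measurable[OF f])
    have sm: "(\<lambda>t. S.semi (max 0 t) f v) \<in> borel_measurable borel"
    proof (rule borel_measurable_continuous_onI)
      show "continuous_on UNIV (\<lambda>t. S.semi (max 0 t) f v)"
        by (rule continuous_on_compose2[OF semi_c[OF f]]) (auto intro!: continuous_intros)
    qed
    have "integral\<^sup>L (m n) f = (\<integral>p. f (S.sol v (max 0 (fst p)) (snd p)) \<partial>(U n \<Otimes>\<^sub>M M))"
      unfolding m_def by (rule integral_distr[OF jmU fm])
    also have "\<dots> = (\<integral>t. S.semi (max 0 t) f v \<partial>U n)"
      unfolding S.semi_def using P.integral_fst'[OF P.integrable_bcont[OF f jmU]] by simp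
    also have "\<dots> = (\<integral>t. (indicator {0..real (Suc n)} t / real (Suc n)) *\<^sub>R S.semi (max 0 t) f v \<partial>lborel)"
      unfolding U_def by (rule integral_density) (use sm in auto)
    also have "\<dots> = (\<integral>t. (indicator {0..real (Suc n)} t *\<^sub>R S.semi t f v) / real (Suc n) \<partial>lborel)"
      by (intro Bochner_Integration.integral_cong) (auto simp: indicator_def)
    also have "\<dots> = (\<integral>t. indicator {0..real (Suc n)} t *\<^sub>R S.semi t f v \<partial>lborel) / real (Suc n)"
      by simp
    also have "(\<integral>t. indicator {0..real (Suc n)} t *\<^sub>R S.semi t f v \<partial>lborel) = integral {0..real (Suc n)} (\<lambda>t. S.semi t f v)"
      using set_borel_integral_eq_integral(2)[OF borel_integrable_atLeastAtMost'[OF continuous_on_subset[OF semi_c[OF f]]], of 0 "real (Suc n)"]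
      by (simp add: set_lebesgue_integral_def)
    finally show ?thesis .
  qed
  have m2: "(\<integral>\<^sup>+x. ennreal ((norm x)\<^sup>2) \<partial>m n) \<le> ennreal D" for n
  proof -
    interpret U: prob_space "U n" by (rule PU)
    have "(\<integral>\<^sup>+x. ennreal ((norm x)\<^sup>2) \<partial>m n) = (\<integral>\<^sup>+p. ennreal ((norm (S.sol v (max 0 (fst p)) (snd p)))\<^sup>2) \<partial>(U n \<Otimes>\<^sub>M M))"
      unfolding m_def by (rule nn_integral_distr) auto
    also have "\<dots> = (\<integral>\<^sup>+t. \<integral>\<^sup>+\<omega>. ennreal ((norm (S.sol v (max 0 t) \<omega>))\<^sup>2) \<partial>M \<partial>U n)"
      by (subst nn_integral_fst[symmetric]) auto
    also have "\<dots> \<le> (\<integral>\<^sup>+t. ennreal D \<partial>U n)" using D by (intro nn_integral_mono) auto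
    also have "\<dots> = ennreal D" by (simp add: U.emeasure_space_1)
    finally show ?thesis .
  qed
  obtain r \<mu> where r: "strict_mono r" and \<mu>: "borel_prob \<mu>"
    and lim: "\<And>f. bcont f \<Longrightarrow> (\<lambda>n. integral\<^sup>L (m (r n)) f) \<longlonglongrightarrow> integral\<^sup>L \<mu> f"
    using prokhorov_second_moment[of m, OF mp m2] by blast
  have "sde_invariant M W (drift_S l1 l2 l3 \<kappa>) (\<sigma> *\<^sub>R f1) \<mu>"
  proof (rule S.limit_invariant[OF \<mu> lim])
    fix s :: real and f :: "real^3 \<Rightarrow> real" assume s: "0 \<le> s" and f: "bcont f"
    obtain C where C: "0 \<le> C" "\<And>x. \<bar>f x\<bar> \<le> C" using bcont_bound[OF f] by metis
    define F where "F t = S.semi t f v" for t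
    have Fc: "continuous_on {0..} F" unfolding F_def by (rule semi_c[OF f])
    have Fi: "F integrable_on {a..b}" if "0 \<le> a" for a b
      by (rule integrable_continuous_real, rule continuous_on_subset[OF Fc]) (use that in auto)
    have Fb: "\<bar>F t\<bar> \<le> C" if "0 \<le> t" for t
      unfolding F_def S.semi_def by (rule expectation_bcont_le[OF f _ C(2)]) (use that in auto)
    have shift: "\<bar>integral {0..T} (\<lambda>t. F (t + s)) - integral {0..T} F\<bar> \<le> 2 * C * s" if T: "0 \<le> T" for T
    proof -
      have "integral {0..T} (\<lambda>t. F (t + s)) = integral {s..T + s} F"
        using integral_shift_Icc_real[of 0 T F s] by (simp add: comp_def add.commute)
      moreover have "integral {0..s} F + integral {s..T + s} F = integral {0..T + s} F"
        by (rule Henstock_Kurzweil_Integration.integral_combine[OF _ _ Fi]) (use s T in auto)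
      moreover have "integral {0..T} F + integral {T..T + s} F = integral {0..T + s} F"
        by (rule Henstock_Kurzweil_Integration.integral_combine[OF _ _ Fi]) (use s T in auto)
      moreover have "norm (integral {0..s} F) \<le> C * (s - 0)"
        by (rule integral_bound) (use s Fb Fc in \<open>auto intro: continuous_on_subset\<close>)
      moreover have "norm (integral {T..T + s} F) \<le> C * (T + s - T)"
        by (rule integral_bound) (use s T Fb Fc in \<open>auto intro: continuous_on_subset\<close>)
      ultimately show ?thesis by (simp add: abs_le_iff)
    qed
    have diff: "\<bar>integral\<^sup>L (m n) (S.semi s f) - integral\<^sup>L (m n) f\<bar> \<le> 2 * C * s * (1 / real (Suc n))" for n
    proof -
      have "integral {0..real (Suc n)} (\<lambda>t. S.semi t (S.semi s f) v) = integral {0..real (Suc n)} (\<lambda>t. F (t + s))"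
        unfolding F_def by (intro integral_cong) (simp add: S.markov[OF f _ s])
      then have "\<bar>integral\<^sup>L (m n) (S.semi s f) - integral\<^sup>L (m n) f\<bar> = \<bar>integral {0..real (Suc n)} (\<lambda>t. F (t + s)) - integral {0..real (Suc n)} F\<bar> / real (Suc n)"
        unfolding mint[OF f] mint[OF S.feller[OF f s]] F_def by (simp add: diff_divide_distrib[symmetric])
      also have "\<dots> \<le> 2 * C * s / real (Suc n)" by (intro divide_right_mono shift) auto
      finally show ?thesis by simp
    qed
    have "(\<lambda>n. integral\<^sup>L (m n) (S.semi s f) - integral\<^sup>L (m n) f) \<longlonglongrightarrow> 0"
    proof (rule Lim_null_comparison)
      show "\<forall>\<^sub>F n in sequentially. norm (integral\<^sup>L (m n) (S.semi s f) - integral\<^sup>L (m n) f) \<le> 2 * C * s * (1 / real (Suc n))"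
        using diff by simp
      show "(\<lambda>n. 2 * C * s * (1 / real (Suc n))) \<longlonglongrightarrow> 0"
        using tendsto_mult_right_zero[OF LIMSEQ_inverse_real_of_nat, of "2 * C * s"] by (simp add: inverse_eq_divide)
    qed
    from LIMSEQ_subseq_LIMSEQ[OF this r]
    show "(\<lambda>n. integral\<^sup>L (m (r n)) (S.semi s f) - integral\<^sup>L (m (r n)) f) \<longlonglongrightarrow> 0" by (simp add: comp_def)
  qed
  moreover have "(\<lambda>n. integral {0..real (Suc (r n))} (\<lambda>t. S.semi t f v) / real (Suc (r n))) \<longlonglongrightarrow> integral\<^sup>L \<mu> f" if f: "bcont f" for f
    using lim[OF f] by (simp only: mint[OF f])
  ultimately show ?thesis using r by blast
qed

end

section \<open>Stability below the threshold\<close>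

text \<open>A bounded continuous function is uniformly continuous on balls only; the second moments of \<open>Y\<close> control the
  mass outside a ball of radius \<open>K\<close>. Outside an event of small probability \<open>X\<close> and \<open>Y\<close> both lie in the ball
  of radius \<open>K + 1\<close> and are close.\<close>

lemma (in prob_space) converging_together:
  fixes X Y :: "real \<Rightarrow> 'a \<Rightarrow> 'b::euclidean_space"
  assumes X: "\<And>t. 0 \<le> t \<Longrightarrow> X t \<in> borel_measurable M" and Y: "\<And>t. 0 \<le> t \<Longrightarrow> Y t \<in> borel_measurable M"
    and near: "\<And>\<epsilon>. \<epsilon> > 0 \<Longrightarrow> ((\<lambda>t. prob {\<omega>\<in>space M. \<epsilon> < norm (X t \<omega> - Y t \<omega>)}) \<longlongrightarrow> 0) at_top"
    and C: "0 \<le> C" "\<And>t. 0 \<le> t \<Longrightarrow> (\<integral>\<^sup>+\<omega>. ennreal ((norm (Y t \<omega>))\<^sup>2) \<partial>M) \<le> ennreal C"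
    and f: "bcont f" and lim: "((\<lambda>t. \<integral>\<omega>. f (Y t \<omega>) \<partial>M) \<longlongrightarrow> L) at_top"
  shows "((\<lambda>t. \<integral>\<omega>. f (X t \<omega>) \<partial>M) \<longlongrightarrow> L) at_top"
proof -
  obtain B where B: "0 \<le> B" "\<And>x. \<bar>f x\<bar> \<le> B" using bcont_bound[OF f] by metis
  have "((\<lambda>t. (\<integral>\<omega>. f (X t \<omega>) \<partial>M) - (\<integral>\<omega>. f (Y t \<omega>) \<partial>M)) \<longlongrightarrow> 0) at_top"
  proof (rule tendstoI)
    fix e :: real assume e: "0 < e"
    \<comment> \<open>The error is at most \<open>e'\<close>, plus \<open>2 B\<close> on each of two events of probability at most \<open>e'\<close>.\<close>
    define e' where "e' = e / (2 * (1 + 4 * B))"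
    have e': "0 < e'" using e B by (simp add: e'_def)
    define K where "K = sqrt ((C + 1) / e')"
    have K: "0 < K" "K\<^sup>2 = (C + 1) / e'" using C e' by (auto simp: K_def)
    have "uniformly_continuous_on (cball 0 (K + 1)) f"
      using f unfolding bcont_def by (intro compact_uniformly_continuous) (auto intro: continuous_on_subset)
    then obtain d where d: "0 < d" "\<And>x y. x \<in> cball 0 (K + 1) \<Longrightarrow> y \<in> cball 0 (K + 1) \<Longrightarrow> dist x y < d \<Longrightarrow> dist (f x) (f y) < e'"
      unfolding uniformly_continuous_on_def using e' by metis
    define \<delta> where "\<delta> = min 1 d / 2"
    have \<delta>: "0 < \<delta>" "\<delta> < d" "\<delta> \<le> 1" using d(1) by (auto simp: \<delta>_def)
    have "\<forall>\<^sub>F t in at_top. prob {\<omega>\<in>space M. \<delta> < norm (X t \<omega> - Y t \<omega>)} < e'"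
      using near[OF \<delta>(1)] e' by (intro order_tendstoD(2)) auto
    then show "\<forall>\<^sub>F t in at_top. dist ((\<integral>\<omega>. f (X t \<omega>) \<partial>M) - (\<integral>\<omega>. f (Y t \<omega>) \<partial>M)) 0 < e"
      using eventually_ge_at_top[of 0]
    proof eventually_elim
      case (elim t)
      note [measurable] = X[OF elim(2)] Y[OF elim(2)]
      define A1 where "A1 = {\<omega>\<in>space M. \<delta> < norm (X t \<omega> - Y t \<omega>)}"
      define A2 where "A2 = {\<omega>\<in>space M. K < norm (Y t \<omega>)}"
      have A[measurable]: "A1 \<in> sets M" "A2 \<in> sets M" unfolding A1_def A2_def by measurable
      have "prob A2 \<le> e'"
      proof -
        have "ennreal (K\<^sup>2) * emeasure M A2 = (\<integral>\<^sup>+\<omega>. ennreal (K\<^sup>2) * indicator A2 \<omega> \<partial>M)"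
          by (simp add: nn_integral_cmult_indicator)
        also have "\<dots> \<le> (\<integral>\<^sup>+\<omega>. ennreal ((norm (Y t \<omega>))\<^sup>2) \<partial>M)"
          using K(1) by (intro nn_integral_mono) (auto simp: A2_def indicator_def intro!: ennreal_leI power_mono)
        also have "\<dots> \<le> ennreal C" by (rule C(2)[OF elim(2)])
        finally have "K\<^sup>2 * prob A2 \<le> C" using C(1) by (simp add: emeasure_eq_measure ennreal_mult'[symmetric])
        then have "(C + 1) * prob A2 \<le> C * e'" unfolding K(2) using e' by (simp add: field_simps)
        also have "\<dots> \<le> (C + 1) * e'" using e' by simp
        finally show ?thesis using C(1) by (simp add: mult_le_cancel_left)
      qed
      have fX: "integrable M (\<lambda>\<omega>. f (X t \<omega>))" "integrable M (\<lambda>\<omega>. f (Y t \<omega>))"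
        by (rule integrable_bcont[OF f]; simp)+
      have "\<bar>(\<integral>\<omega>. f (X t \<omega>) \<partial>M) - (\<integral>\<omega>. f (Y t \<omega>) \<partial>M)\<bar> = \<bar>\<integral>\<omega>. f (X t \<omega>) - f (Y t \<omega>) \<partial>M\<bar>"
        using fX by simp
      also have "\<dots> \<le> (\<integral>\<omega>. \<bar>f (X t \<omega>) - f (Y t \<omega>)\<bar> \<partial>M)" by (rule integral_abs_bound)
      also have "\<dots> \<le> (\<integral>\<omega>. e' + 2 * B * (indicator A1 \<omega> + indicator A2 \<omega>) \<partial>M)"
      proof (rule integral_mono)
        show "integrable M (\<lambda>\<omega>. \<bar>f (X t \<omega>) - f (Y t \<omega>)\<bar>)" using fX by simp
        show "integrable M (\<lambda>\<omega>. e' + 2 * B * (indicator A1 \<omega> + indicator A2 \<omega>))"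
          by (intro Bochner_Integration.integrable_add integrable_mult_right) (auto simp: less_top[symmetric])
        fix \<omega> assume \<omega>: "\<omega> \<in> space M"
        show "\<bar>f (X t \<omega>) - f (Y t \<omega>)\<bar> \<le> e' + 2 * B * (indicator A1 \<omega> + indicator A2 \<omega>)"
        proof (cases "\<omega> \<in> A1 \<or> \<omega> \<in> A2")
          case True
          have "\<bar>f (X t \<omega>) - f (Y t \<omega>)\<bar> \<le> 2 * B" using B(2)[of "X t \<omega>"] B(2)[of "Y t \<omega>"] by linarith
          also have "\<dots> \<le> 2 * B * (indicator A1 \<omega> + indicator A2 \<omega>)"
            using True B(1) by (auto simp: indicator_def)
          finally show ?thesis using e' by linarith
        next
          case False
          then have "norm (X t \<omega> - Y t \<omega>) \<le> \<delta>" "norm (Y t \<omega>) \<le> K" using \<omega> by (auto simp: A1_def A2_def)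
          moreover have "norm (X t \<omega>) \<le> norm (Y t \<omega>) + norm (X t \<omega> - Y t \<omega>)" by (rule norm_triangle_sub)
          ultimately have "dist (f (X t \<omega>)) (f (Y t \<omega>)) < e'"
            using \<delta> by (intro d(2)) (auto simp: dist_norm)
          then show ?thesis using False by (simp add: dist_real_def)
        qed
      qed
      also have "\<dots> = e' + 2 * B * (prob A1 + prob A2)"
      proof -
        have "integrable M (indicator A1 :: 'a \<Rightarrow> real)" "integrable M (indicator A2 :: 'a \<Rightarrow> real)"
          by (auto simp: less_top[symmetric])
        then show ?thesis by (subst Bochner_Integration.integral_add) (auto simp: prob_space)
      qed
      also have "\<dots> \<le> e' + 2 * B * (e' + e')"
        using elim(1) \<open>prob A2 \<le> e'\<close> B(1) unfolding A1_def[symmetric] by (intro add_left_mono mult_left_mono add_mono) auto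
      also have "\<dots> = e' * (1 + 4 * B)" by (simp add: algebra_simps)
      also have "\<dots> = e / 2"
      proof -
        have "1 + 4 * B \<noteq> 0" using B(1) by linarith
        then show ?thesis unfolding e'_def by (metis divide_divide_eq_left nonzero_eq_divide_eq)
      qed
      finally show ?case using e by (simp add: dist_real_def)
    qed
  qed
  from tendsto_add[OF this lim] show ?thesis by simp
qed

lemma (in prob_space) prob_gt_le_expectation:
  fixes X :: "'a \<Rightarrow> real"
  assumes [measurable]: "X \<in> borel_measurable M" and a: "0 < a" and C: "0 \<le> C"
    and le: "(\<integral>\<^sup>+\<omega>. ennreal (X \<omega>) \<partial>M) \<le> ennreal C"
  shows "prob {\<omega>\<in>space M. a < X \<omega>} \<le> C / a"
proof -
  have "ennreal a * emeasure M {\<omega>\<in>space M. a < X \<omega>} = (\<integral>\<^sup>+\<omega>. ennreal a * indicator {\<omega>\<in>space M. a < X \<omega>} \<omega> \<partial>M)"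
    by (simp add: nn_integral_cmult_indicator)
  also have "\<dots> \<le> (\<integral>\<^sup>+\<omega>. ennreal (X \<omega>) \<partial>M)"
    by (intro nn_integral_mono) (auto simp: indicator_def intro!: ennreal_leI)
  also have "\<dots> \<le> ennreal C" by (rule le)
  finally have "a * prob {\<omega>\<in>space M. a < X \<omega>} \<le> C" using C a by (simp add: emeasure_eq_measure ennreal_mult'[symmetric])
  then show ?thesis using a by (simp add: pos_le_divide_eq mult.commute)
qed

lemma (in prob_space) nn_expectation_abs_le:
  fixes X :: "'a \<Rightarrow> real"
  assumes [measurable]: "X \<in> borel_measurable M" and a: "0 < a" and C: "0 \<le> C"
    and le: "(\<integral>\<^sup>+\<omega>. ennreal ((X \<omega>)\<^sup>2) \<partial>M) \<le> ennreal C"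
  shows "(\<integral>\<^sup>+\<omega>. ennreal \<bar>X \<omega>\<bar> \<partial>M) \<le> ennreal (a + C / a)"
proof -
  have "(\<integral>\<^sup>+\<omega>. ennreal \<bar>X \<omega>\<bar> \<partial>M) \<le> (\<integral>\<^sup>+\<omega>. ennreal a + ennreal (1 / a) * ennreal ((X \<omega>)\<^sup>2) \<partial>M)"
  proof (rule nn_integral_mono)
    fix \<omega>
    have "\<bar>X \<omega>\<bar> \<le> a + 1 / a * (X \<omega>)\<^sup>2"
    proof (cases "\<bar>X \<omega>\<bar> \<le> a")
      case True
      moreover have "0 \<le> 1 / a * (X \<omega>)\<^sup>2" using a by simp
      ultimately show ?thesis by linarith
    next
      case False
      then have "a * \<bar>X \<omega>\<bar> \<le> \<bar>X \<omega>\<bar> * \<bar>X \<omega>\<bar>" by (intro mult_right_mono) auto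
      then have "\<bar>X \<omega>\<bar> \<le> 1 / a * (X \<omega>)\<^sup>2" using a by (simp add: field_simps power2_eq_square)
      then show ?thesis using a by simp
    qed
    then have "ennreal \<bar>X \<omega>\<bar> \<le> ennreal (a + 1 / a * (X \<omega>)\<^sup>2)" by (rule ennreal_leI)
    also have "\<dots> = ennreal a + ennreal (1 / a) * ennreal ((X \<omega>)\<^sup>2)" using a by (simp add: ennreal_mult'[symmetric])
    finally show "ennreal \<bar>X \<omega>\<bar> \<le> ennreal a + ennreal (1 / a) * ennreal ((X \<omega>)\<^sup>2)" .
  qed
  also have "\<dots> = ennreal a + ennreal (1 / a) * (\<integral>\<^sup>+\<omega>. ennreal ((X \<omega>)\<^sup>2) \<partial>M)"
    by (simp add: nn_integral_add nn_integral_cmult emeasure_space_1)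
  also have "\<dots> \<le> ennreal a + ennreal (1 / a) * ennreal C" using le by (intro add_left_mono mult_left_mono) auto
  also have "\<dots> = ennreal (a + C / a)" using a C by (simp add: ennreal_mult'[symmetric])
  finally show ?thesis .
qed

context three_dim_system
begin

lemma S_flow_derivative:
  assumes w: "continuous_on {0..} w" and s: "0 < s"
  shows "((\<lambda>s. S.flow v w s $ 1 - \<sigma> * w s) has_real_derivative - l1 * S.flow v w s $ 1 - ((S.flow v w s $ 2)\<^sup>2 + (S.flow v w s $ 3)\<^sup>2) + \<kappa>) (at s)"
    and "((\<lambda>s. S.flow v w s $ 2) has_real_derivative - l2 * S.flow v w s $ 2 + S.flow v w s $ 1 * S.flow v w s $ 2) (at s)"
    and "((\<lambda>s. S.flow v w s $ 3) has_real_derivative - l3 * S.flow v w s $ 3 + S.flow v w s $ 1 * S.flow v w s $ 3) (at s)"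
proof -
  have "((\<lambda>s. S.flow v w s - w s *\<^sub>R \<sigma> *\<^sub>R f1) has_vector_derivative drift_S l1 l2 l3 \<kappa> (S.flow v w s)) (at s)"
    by (rule path_sol_has_derivative[OF S.flow_path_sol[OF w, of v "s + 1"] S.continuous_drift]) (use s in auto)
  then have "((\<lambda>s. (S.flow v w s - w s *\<^sub>R \<sigma> *\<^sub>R f1) $ i) has_real_derivative drift_S l1 l2 l3 \<kappa> (S.flow v w s) $ i) (at s)" for i
    unfolding has_real_derivative_iff_has_vector_derivative
    by (rule bounded_linear.has_vector_derivative[OF bounded_linear_vec_nth])
  from this[of 1] this[of 2] this[of 3]
  show "((\<lambda>s. S.flow v w s $ 1 - \<sigma> * w s) has_real_derivative - l1 * S.flow v w s $ 1 - ((S.flow v w s $ 2)\<^sup>2 + (S.flow v w s $ 3)\<^sup>2) + \<kappa>) (at s)"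
    "((\<lambda>s. S.flow v w s $ 2) has_real_derivative - l2 * S.flow v w s $ 2 + S.flow v w s $ 1 * S.flow v w s $ 2) (at s)"
    "((\<lambda>s. S.flow v w s $ 3) has_real_derivative - l3 * S.flow v w s $ 3 + S.flow v w s $ 1 * S.flow v w s $ 3) (at s)"
    by (simp_all add: mult.commute)
qed

text \<open>With \<open>J = z - u\<^sub>1\<close> one has \<open>J' = - l1 J + u\<^sub>2\<^sup>2 + u\<^sub>3\<^sup>2\<close>, hence \<open>J \<ge> 0\<close>, and \<open>u\<^sub>2\<^sup>2 + u\<^sub>3\<^sup>2\<close> grows at most at the rate
  \<open>2 (z - min l2 l3)\<close>. Integrating the equation of \<open>z\<close> expresses \<open>\<integral>\<^sub>0\<^sup>r z\<close> by \<open>\<kappa> r / l1\<close> and boundary terms, which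
  is where the decay \<open>exp (- 2 A r / l1)\<close> comes from when \<open>A > 0\<close>. The estimate is split at a time \<open>r < t\<close>:
  what happened before \<open>r\<close> is forgotten, what happens after \<open>r\<close> is small.\<close>

lemma distance_to_axis:
  fixes v :: "real^3"
  assumes w: "continuous_on {0..} w" and rt: "0 \<le> r" "r \<le> t"
  defines "z \<equiv> ou.flow (v$1) w" and "u \<equiv> S.flow v w"
    and "A \<equiv> l1 * min l2 l3 - \<kappa>"
  defines "D \<equiv> (norm v)\<^sup>2 * exp (- (2 * A * r / l1) + (2 / l1 * (\<bar>v$1\<bar> + \<bar>z r\<bar> + \<bar>\<sigma> * w r\<bar>) + 2 * integral {r..t} (\<lambda>s. \<bar>z s\<bar>)))"
  shows "norm (u t - z t *\<^sub>R f1) \<le> exp (- l1 * (t - r)) * (\<bar>z r\<bar> + norm (u r)) + (t - r) * D + 2 * sqrt D"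
proof -
  define \<mu> where "\<mu> = min l2 l3"
  have \<mu>: "0 < \<mu>" "\<mu> \<le> l2" "\<mu> \<le> l3" using l2 l3 by (auto simp: \<mu>_def)
  define J where "J s = z s - u s $ 1" for s
  define R where "R s = (u s $ 2)\<^sup>2 + (u s $ 3)\<^sup>2" for s
  have R0: "0 \<le> R s" for s by (simp add: R_def)
  have cz: "continuous_on {a..b} z" if "0 \<le> a" for a b
    unfolding z_def by (rule continuous_on_subset[OF ou.flow_continuous[OF w]]) (use that in auto)
  have cu: "continuous_on {a..b} u" if "0 \<le> a" for a b
    unfolding u_def by (rule continuous_on_subset[OF S.flow_continuous[OF w]]) (use that in auto)
  have cJ: "continuous_on {a..b} J" if "0 \<le> a" for a b
    unfolding J_def by (intro continuous_intros cz cu that)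
  have cR: "continuous_on {a..b} R" if "0 \<le> a" for a b
    unfolding R_def by (intro continuous_intros cu that)
  have dJ: "(J has_real_derivative - l1 * J s + R s) (at s)" if s: "0 < s" for s
  proof -
    have "((\<lambda>s. z s - w s *\<^sub>R \<sigma>) has_vector_derivative \<kappa> - l1 * z s) (at s)"
      unfolding z_def by (rule path_sol_has_derivative[OF ou.flow_path_sol[OF w, of _ "s + 1"] ou.continuous_drift]) (use s in auto)
    then have "((\<lambda>s. z s - w s * \<sigma>) has_real_derivative \<kappa> - l1 * z s) (at s)"
      by (simp add: has_real_derivative_iff_has_vector_derivative)
    from DERIV_diff[OF this S_flow_derivative(1)[OF w s, of v]]
    show ?thesis unfolding J_def R_def u_def
      by (rule DERIV_cong[THEN DERIV_cong_ev[OF refl _ refl, THEN iffD1, rotated]]) (auto simp: algebra_simps)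
  qed
  have dR: "\<exists>d. (R has_real_derivative d) (at s) \<and> d \<le> 2 * (u s $ 1 - \<mu>) * R s" if s: "0 < s" for s
  proof (intro exI conjI)
    show "(R has_real_derivative 2 * (u s $ 2) * (- l2 * u s $ 2 + u s $ 1 * u s $ 2) + 2 * (u s $ 3) * (- l3 * u s $ 3 + u s $ 1 * u s $ 3)) (at s)"
      unfolding R_def u_def
      by (rule derivative_eq_intros S_flow_derivative(2,3)[OF w s] refl | simp)+
    have "\<mu> * (u s $ 2)\<^sup>2 \<le> l2 * (u s $ 2)\<^sup>2" "\<mu> * (u s $ 3)\<^sup>2 \<le> l3 * (u s $ 3)\<^sup>2"
      using \<mu> by (auto intro!: mult_right_mono)
    then show "2 * (u s $ 2) * (- l2 * u s $ 2 + u s $ 1 * u s $ 2) + 2 * (u s $ 3) * (- l3 * u s $ 3 + u s $ 1 * u s $ 3) \<le> 2 * (u s $ 1 - \<mu>) * R s"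
      unfolding R_def by (simp add: power2_eq_square algebra_simps)
  qed
  have J_init: "J 0 = 0" "R 0 \<le> (norm v)\<^sup>2"
  proof -
    have "u 0 = v + w 0 *\<^sub>R \<sigma> *\<^sub>R f1" using S.flow_eq[OF w, of 0 v] by (simp add: u_def)
    moreover have "z 0 = v$1 + w 0 * \<sigma>" using ou.flow_eq[OF w, of 0 "v$1"] by (simp add: z_def)
    ultimately show "J 0 = 0" "R 0 \<le> (norm v)\<^sup>2"
      unfolding J_def R_def power2_norm_eq_inner inner_3 by (simp_all add: power2_eq_square)
  qed
  have J0: "0 \<le> J s" if s: "0 \<le> s" for s
  proof -
    have "- J s \<le> exp (integral {0..s} (\<lambda>_. - l1)) * (- J 0)"
    proof (rule gronwall_homogeneous[OF s])
      show "continuous_on {0..s} (\<lambda>s. - J s)" by (intro continuous_intros cJ) simp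
      fix r assume r: "0 < r" "r < s"
      show "\<exists>d. ((\<lambda>s. - J s) has_real_derivative d) (at r) \<and> d \<le> - l1 * - J r"
        using DERIV_minus[OF dJ[OF r(1)]] R0[of r] by (intro exI[of _ "- (- l1 * J r + R r)"]) auto
    qed auto
    then show ?thesis using J_init by simp
  qed
  have Rgrow: "R b \<le> exp (integral {a..b} (\<lambda>s. 2 * (z s - \<mu>))) * R a" if ab: "0 \<le> a" "a \<le> b" for a b
  proof (rule gronwall_homogeneous[OF ab(2) cR[OF ab(1)]])
    show "continuous_on {a..b} (\<lambda>s. 2 * (z s - \<mu>))" by (intro continuous_intros cz ab)
    fix s assume s: "a < s" "s < b"
    obtain d where d: "(R has_real_derivative d) (at s)" "d \<le> 2 * (u s $ 1 - \<mu>) * R s" using dR[of s] s ab by auto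
    have "u s $ 1 \<le> z s" using J0[of s] s ab by (simp add: J_def)
    then have "2 * (u s $ 1 - \<mu>) * R s \<le> 2 * (z s - \<mu>) * R s" using R0 by (intro mult_right_mono) auto
    with d show "\<exists>d. (R has_real_derivative d) (at s) \<and> d \<le> 2 * (z s - \<mu>) * R s" by force
  qed
  have iz: "z integrable_on {a..b}" "(\<lambda>s. \<bar>z s\<bar>) integrable_on {a..b}" if "0 \<le> a" for a b
    using cz[OF that] by (auto intro!: integrable_continuous_real continuous_intros)
  have D: "R s \<le> D" if s: "s \<in> {r..t}" for s
  proof -
    have "integral {r..s} (\<lambda>s. 2 * (z s - \<mu>)) \<le> integral {r..s} (\<lambda>s. 2 * \<bar>z s\<bar>)"
    proof (rule integral_le)
      show "(\<lambda>s. 2 * (z s - \<mu>)) integrable_on {r..s}" "(\<lambda>s. 2 * \<bar>z s\<bar>) integrable_on {r..s}"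
        using cz[OF rt(1)] by (auto intro!: integrable_continuous_real continuous_intros)
      show "2 * (z x - \<mu>) \<le> 2 * \<bar>z x\<bar>" for x using \<mu>(1) abs_ge_self[of "z x"] by simp
    qed
    also have "\<dots> = 2 * integral {r..s} (\<lambda>s. \<bar>z s\<bar>)" by simp
    also have "\<dots> \<le> 2 * integral {r..t} (\<lambda>s. \<bar>z s\<bar>)"
      using s rt by (intro mult_left_mono integral_subset_le iz) auto
    finally have 1: "exp (integral {r..s} (\<lambda>s. 2 * (z s - \<mu>))) \<le> exp (2 * integral {r..t} (\<lambda>s. \<bar>z s\<bar>))" by simp
    \<comment> \<open>The equation of \<open>z\<close>, solved for the integral.\<close>
    have zint: "integral {0..r} z = (v$1 - z r + \<kappa> * r + \<sigma> * w r) / l1"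
    proof -
      have "z r = v$1 + integral {0..r} (\<lambda>s. \<kappa> - l1 * z s) + w r * \<sigma>"
        using ou.flow_eq[OF w rt(1), of "v$1"] by (simp add: z_def)
      also have "integral {0..r} (\<lambda>s. \<kappa> - l1 * z s) = integral {0..r} (\<lambda>s. \<kappa>) - integral {0..r} (\<lambda>s. l1 * z s)"
        by (rule integral_diff) (auto intro!: integrable_continuous_real continuous_intros cz)
      finally show ?thesis using l1 rt by (simp add: field_simps)
    qed
    have "integral {0..r} (\<lambda>s. 2 * (z s - \<mu>)) = 2 * integral {0..r} z - 2 * \<mu> * r"
    proof -
      have "integral {0..r} (\<lambda>s. 2 * z s - 2 * \<mu>) = integral {0..r} (\<lambda>s. 2 * z s) - integral {0..r} (\<lambda>s. 2 * \<mu>)"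
        by (rule integral_diff) (auto intro!: integrable_continuous_real continuous_intros cz)
      then show ?thesis using rt by (simp add: right_diff_distrib)
    qed
    also have "\<dots> = - (2 * A * r / l1) + 2 / l1 * (v$1 - z r + \<sigma> * w r)"
      unfolding zint A_def \<mu>_def[symmetric] using l1 by (simp add: field_simps)
    also have "\<dots> \<le> - (2 * A * r / l1) + 2 / l1 * (\<bar>v$1\<bar> + \<bar>z r\<bar> + \<bar>\<sigma> * w r\<bar>)"
      using l1 by (intro add_left_mono mult_left_mono) auto
    finally have 2: "exp (integral {0..r} (\<lambda>s. 2 * (z s - \<mu>))) \<le> exp (- (2 * A * r / l1) + 2 / l1 * (\<bar>v$1\<bar> + \<bar>z r\<bar> + \<bar>\<sigma> * w r\<bar>))" by simp
    have "R s \<le> exp (integral {r..s} (\<lambda>s. 2 * (z s - \<mu>))) * R r" using s rt by (intro Rgrow) auto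
    also have "\<dots> \<le> exp (2 * integral {r..t} (\<lambda>s. \<bar>z s\<bar>)) * (exp (- (2 * A * r / l1) + 2 / l1 * (\<bar>v$1\<bar> + \<bar>z r\<bar> + \<bar>\<sigma> * w r\<bar>)) * (norm v)\<^sup>2)"
    proof (rule mult_mono[OF 1])
      have "R r \<le> exp (integral {0..r} (\<lambda>s. 2 * (z s - \<mu>))) * R 0" using rt by (intro Rgrow) auto
      also have "\<dots> \<le> exp (- (2 * A * r / l1) + 2 / l1 * (\<bar>v$1\<bar> + \<bar>z r\<bar> + \<bar>\<sigma> * w r\<bar>)) * (norm v)\<^sup>2"
        using R0 by (intro mult_mono[OF 2] J_init) auto
      finally show "R r \<le> exp (- (2 * A * r / l1) + 2 / l1 * (\<bar>v$1\<bar> + \<bar>z r\<bar> + \<bar>\<sigma> * w r\<bar>)) * (norm v)\<^sup>2" .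
    qed (use R0 in auto)
    also have "\<dots> = D" unfolding D_def exp_add by (simp only: mult_ac)
    finally show ?thesis .
  qed
  have D0: "0 \<le> D" unfolding D_def by simp
  have "J t \<le> exp (integral {r..t} (\<lambda>_. - l1)) * (J r + integral {r..t} (\<lambda>s. exp (- integral {r..s} (\<lambda>_. - l1)) * D))"
  proof (rule gronwall_linear[OF rt(2) cJ[OF rt(1)]])
    fix s assume s: "r < s" "s < t"
    show "\<exists>d. (J has_real_derivative d) (at s) \<and> d \<le> - l1 * J s + D"
      using dJ[of s] D[of s] s rt by (intro exI[of _ "- l1 * J s + R s"]) auto
  qed auto
  also have "integral {r..t} (\<lambda>s. exp (- integral {r..s} (\<lambda>_. - l1)) * D) \<le> integral {r..t} (\<lambda>s. exp (l1 * (t - r)) * D)"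
  proof (rule integral_le)
    show "(\<lambda>s. exp (- integral {r..s} (\<lambda>_. - l1)) * D) integrable_on {r..t}"
      by (intro integrable_continuous_real continuous_intros indefinite_integral_continuous_1)
    fix s assume s: "s \<in> {r..t}"
    have "l1 * (s - r) \<le> l1 * (t - r)" using s l1 by (intro mult_left_mono) auto
    then show "exp (- integral {r..s} (\<lambda>_. - l1)) * D \<le> exp (l1 * (t - r)) * D"
      using s D0 by (intro mult_right_mono) (auto simp: algebra_simps)
  qed auto
  finally have "J t \<le> exp (- l1 * (t - r)) * (J r + exp (l1 * (t - r)) * D * (t - r))"
    using rt by (simp add: mult_left_mono mult_ac)
  also have "\<dots> = exp (- l1 * (t - r)) * J r + (exp (- l1 * (t - r)) * exp (l1 * (t - r))) * ((t - r) * D)"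
    by (simp add: algebra_simps)
  also have "exp (- l1 * (t - r)) * exp (l1 * (t - r)) = 1" by (simp add: exp_add[symmetric])
  also have "exp (- l1 * (t - r)) * J r \<le> exp (- l1 * (t - r)) * (\<bar>z r\<bar> + norm (u r))"
    using component_le_norm_cart[of "u r" 1] by (intro mult_left_mono) (auto simp: J_def)
  finally have Jt: "J t \<le> exp (- l1 * (t - r)) * (\<bar>z r\<bar> + norm (u r)) + (t - r) * D" by simp
  have Rt: "R t \<le> D" using D[of t] rt by simp
  have "(u t $ 2)\<^sup>2 \<le> D" "(u t $ 3)\<^sup>2 \<le> D"
    using Rt zero_le_power2[of "u t $ 2"] zero_le_power2[of "u t $ 3"] unfolding R_def by linarith+
  then have "\<bar>u t $ 2\<bar> \<le> sqrt D" "\<bar>u t $ 3\<bar> \<le> sqrt D"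
    by (auto intro!: real_le_rsqrt)
  moreover have "norm (u t - z t *\<^sub>R f1) \<le> \<bar>u t $ 1 - z t\<bar> + \<bar>u t $ 2\<bar> + \<bar>u t $ 3\<bar>"
    using norm_le_3[of "u t - z t *\<^sub>R f1"] by simp
  moreover have "\<bar>u t $ 1 - z t\<bar> = J t" using J0[of t] rt by (simp add: J_def)
  ultimately show ?thesis using Jt by linarith
qed

lemma stability_rates:
  fixes l A V \<epsilon> K a b :: real
  assumes "0 < l" "0 < A" "0 < V" "0 < \<epsilon>"
  shows "((\<lambda>t. sqrt t * (V * exp (- (A * (t - sqrt t) / l))) + 2 * sqrt (V * exp (- (A * (t - sqrt t) / l)))) \<longlongrightarrow> 0) at_top"
    and "((\<lambda>t. K / (\<epsilon> * exp (l * sqrt t)) + (a + b * sqrt t) / (A * (t - sqrt t) / l)) \<longlongrightarrow> 0) at_top"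
  using assms by real_asymp+

text \<open>The solution is compared at time \<open>t\<close> with the Ornstein--Uhlenbeck process \<open>Z\<close>, splitting at \<open>r = t - sqrt t\<close>:
  the remaining time \<open>sqrt t\<close> suffices to forget the state at time \<open>r\<close>, and what the noise contributes to the
  exponent, of order \<open>sqrt t\<close> in mean, is negligible against the linear decay \<open>2 A r / l1\<close>. By Markov's inequality half
  of that decay survives up to a small probability.\<close>

theorem S_stable:
  assumes below: "\<kappa> < l1 * min l2 l3" and f: "bcont f"
  shows "((\<lambda>t. S.semi t f v) \<longlongrightarrow> integral\<^sup>L (nu M W l1 \<sigma> \<kappa>) f) at_top"
  unfolding S.semi_def
proof (rule converging_together[where Y="\<lambda>t \<omega>. ou.sol (v$1) t \<omega> *\<^sub>R f1", OF _ _ _ _ _ f])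
  define Z where "Z = ou.sol (v$1)"
  define X where "X = S.sol v"
  define C1 where "C1 = (\<bar>v$1\<bar> + \<bar>\<kappa>\<bar> / l1)\<^sup>2 + \<sigma>\<^sup>2 / (2 * l1)"
  have C1: "0 \<le> C1" using l1 by (simp add: C1_def)
  have Z2: "(\<integral>\<^sup>+\<omega>. ennreal ((Z t \<omega>)\<^sup>2) \<partial>M) \<le> ennreal C1" if "0 \<le> t" for t
    unfolding Z_def C1_def by (rule ou_second_moment[OF that])
  obtain D1 where D1: "0 \<le> D1" "\<And>t. 0 \<le> t \<Longrightarrow> (\<integral>\<^sup>+\<omega>. ennreal ((norm (X t \<omega>))\<^sup>2) \<partial>M) \<le> ennreal D1"
    using second_moment_bound[of v] unfolding X_def by blast
  have Zm[measurable]: "Z t \<in> borel_measurable M" if "0 \<le> t" for t using that by (simp add: Z_def)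
  have Xm[measurable]: "X t \<in> borel_measurable M" if "0 \<le> t" for t using that by (simp add: X_def)
  show "S.sol v t \<in> borel_measurable M" if "0 \<le> t" for t using that by simp
  show "(\<lambda>\<omega>. ou.sol (v$1) t \<omega> *\<^sub>R f1) \<in> borel_measurable M" if "0 \<le> t" for t using that by measurable
  show "0 \<le> C1" by (rule C1)
  show "(\<integral>\<^sup>+\<omega>. ennreal ((norm (ou.sol (v$1) t \<omega> *\<^sub>R f1))\<^sup>2) \<partial>M) \<le> ennreal C1" if "0 \<le> t" for t
    using Z2[OF that] by (simp add: Z_def)
  have fb: "bcont (\<lambda>z. f (z *\<^sub>R f1))" by (intro bcont_compose[OF f] continuous_intros)
  show "((\<lambda>t. \<integral>\<omega>. f (ou.sol (v$1) t \<omega> *\<^sub>R f1) \<partial>M) \<longlongrightarrow> integral\<^sup>L (nu M W l1 \<sigma> \<kappa>) f) at_top"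
    using ou_stable[OF fb, of "v$1"] by (simp add: integral_nu bcont_measurable[OF f])
  fix \<epsilon> :: real assume \<epsilon>: "0 < \<epsilon>"
  define A where "A = l1 * min l2 l3 - \<kappa>"
  have A: "0 < A" using below by (simp add: A_def)
  define V where "V = (norm v)\<^sup>2 + 1"
  have V: "0 < V" "(norm v)\<^sup>2 \<le> V" by (auto simp: V_def add_nonneg_pos)
  define K1 where "K1 = 1 + C1"
  define K0 where "K0 = K1 + (1 + D1)"
  have K: "0 \<le> K1" "0 \<le> K0" using C1 D1 by (auto simp: K0_def K1_def)
  define a where "a = 2 / l1 * (\<bar>v$1\<bar> + K1)"
  define b where "b = 2 / l1 * (2 * \<bar>\<sigma>\<bar>) + 2 * K1"
  have ab: "0 \<le> a" "0 \<le> b" using K l1 by (auto simp: a_def b_def)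
  have absZ: "(\<integral>\<^sup>+\<omega>. ennreal \<bar>Z t \<omega>\<bar> \<partial>M) \<le> ennreal K1" if "0 \<le> t" for t
    using nn_expectation_abs_le[OF Zm[OF that] _ C1 Z2[OF that], of 1] by (simp add: K1_def)
  have absX: "(\<integral>\<^sup>+\<omega>. ennreal (norm (X t \<omega>)) \<partial>M) \<le> ennreal (1 + D1)" if "0 \<le> t" for t
  proof -
    have "(\<lambda>\<omega>. norm (X t \<omega>)) \<in> borel_measurable M" using that by measurable
    from nn_expectation_abs_le[OF this _ D1(1) D1(2)[OF that], of 1] show ?thesis by simp
  qed
  have "((\<lambda>t. prob {\<omega>\<in>space M. \<epsilon> < norm (X t \<omega> - Z t \<omega> *\<^sub>R f1)}) \<longlongrightarrow> 0) at_top"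
  proof (rule tendsto_sandwich[OF _ _ tendsto_const stability_rates(2)[of l1 A 1 "\<epsilon> / 2" K0 a b]])
    show "\<forall>\<^sub>F t in at_top. 0 \<le> prob {\<omega>\<in>space M. \<epsilon> < norm (X t \<omega> - Z t \<omega> *\<^sub>R f1)}" by simp
    have "\<forall>\<^sub>F t in at_top. sqrt t * (V * exp (- (A * (t - sqrt t) / l1))) + 2 * sqrt (V * exp (- (A * (t - sqrt t) / l1))) < \<epsilon> / 2"
      using stability_rates(1)[OF l1 A V(1) \<epsilon>] \<epsilon> by (intro order_tendstoD(2)) auto
    then show "\<forall>\<^sub>F t in at_top. prob {\<omega>\<in>space M. \<epsilon> < norm (X t \<omega> - Z t \<omega> *\<^sub>R f1)}
        \<le> K0 / (\<epsilon> / 2 * exp (l1 * sqrt t)) + (a + b * sqrt t) / (A * (t - sqrt t) / l1)"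
      using eventually_gt_at_top[of 1]
    proof eventually_elim
      case (elim t)
      define r where "r = t - sqrt t"
      have "sqrt t < t" using elim(2) real_less_lsqrt[of t t] by (simp add: power2_eq_square)
      then have r: "0 < r" "0 \<le> r" "r \<le> t" "t - r = sqrt t" "0 < t" using elim(2) by (auto simp: r_def)
      define G where "G \<omega> = \<bar>Z r \<omega>\<bar> + norm (X r \<omega>)" for \<omega>
      define I where "I \<omega> = integral {r..t} (\<lambda>s. \<bar>Z s \<omega>\<bar>)" for \<omega>
      define Q where "Q \<omega> = 2 / l1 * (\<bar>v$1\<bar> + \<bar>Z r \<omega>\<bar> + \<bar>\<sigma> * W r \<omega>\<bar>) + 2 * I \<omega>" for \<omega>
      note [measurable] = Zm[OF r(2)] Xm[OF r(2)] W_measurable[OF r(2)] Zm[of t] Xm[of t]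
      have absc: "continuous_on {0..} (\<lambda>s. \<bar>Z s \<omega>\<bar>)" if "\<omega> \<in> space M" for \<omega>
        unfolding Z_def by (intro continuous_intros ou.sol_continuous that)
      have absm: "(\<lambda>\<omega>. \<bar>Z s \<omega>\<bar>) \<in> borel_measurable M" if "0 \<le> s" for s using that by measurable
      have Im[measurable]: "I \<in> borel_measurable M"
        unfolding I_def[abs_def] by (rule measurable_time_integral[OF absm absc r(2)])
      have Gm[measurable]: "G \<in> borel_measurable M" unfolding G_def[abs_def] by measurable
      have Qm[measurable]: "Q \<in> borel_measurable M" unfolding Q_def[abs_def] by measurable
      have EG: "(\<integral>\<^sup>+\<omega>. ennreal (G \<omega>) \<partial>M) \<le> ennreal K0"
      proof -
        have "(\<integral>\<^sup>+\<omega>. ennreal (G \<omega>) \<partial>M) = (\<integral>\<^sup>+\<omega>. ennreal \<bar>Z r \<omega>\<bar> \<partial>M) + (\<integral>\<^sup>+\<omega>. ennreal (norm (X r \<omega>)) \<partial>M)"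
          unfolding G_def by (simp add: nn_integral_add)
        also have "\<dots> \<le> ennreal K1 + ennreal (1 + D1)" by (intro add_mono absZ absX r)
        also have "\<dots> = ennreal K0" unfolding K0_def using K D1 by (intro ennreal_plus[symmetric]) auto
        finally show ?thesis .
      qed
      have EW: "(\<integral>\<^sup>+\<omega>. ennreal \<bar>W r \<omega>\<bar> \<partial>M) \<le> ennreal (2 * sqrt t)"
      proof -
        have "(\<integral>\<^sup>+\<omega>. ennreal \<bar>W r \<omega>\<bar> \<partial>M) \<le> ennreal (sqrt t + t / sqrt t)"
          by (rule nn_expectation_abs_le) (use r W_second_moment[OF r(2)] in \<open>auto intro: ennreal_leI\<close>)
        then show ?thesis using r by (simp add: real_div_sqrt)
      qed
      have EI: "(\<integral>\<^sup>+\<omega>. ennreal (I \<omega>) \<partial>M) \<le> ennreal (K1 * sqrt t)"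
        unfolding I_def r(4)[symmetric]
        by (rule nn_expectation_time_integral[OF absm absc _ r(2,3) K(1)]) (use absZ r in auto)
      have I0: "0 \<le> I \<omega>" if "\<omega> \<in> space M" for \<omega>
        unfolding I_def using continuous_on_subset[OF absc[OF that], of "{r..t}"] r
        by (intro integral_nonneg integrable_continuous_real) auto
      have EQ: "(\<integral>\<^sup>+\<omega>. ennreal (Q \<omega>) \<partial>M) \<le> ennreal (a + b * sqrt t)"
      proof -
        define c where "c = 2 / l1"
        have c: "0 \<le> c" using l1 by (simp add: c_def)
        have "(\<integral>\<^sup>+\<omega>. ennreal (Q \<omega>) \<partial>M) = (\<integral>\<^sup>+\<omega>. ennreal (c * \<bar>v$1\<bar>) + ennreal c * ennreal \<bar>Z r \<omega>\<bar> + ennreal (c * \<bar>\<sigma>\<bar>) * ennreal \<bar>W r \<omega>\<bar> + ennreal 2 * ennreal (I \<omega>) \<partial>M)"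
        proof (rule nn_integral_cong)
          fix \<omega> assume \<omega>: "\<omega> \<in> space M"
          have "Q \<omega> = c * \<bar>v$1\<bar> + c * \<bar>Z r \<omega>\<bar> + (c * \<bar>\<sigma>\<bar>) * \<bar>W r \<omega>\<bar> + 2 * I \<omega>"
            by (simp add: Q_def c_def abs_mult distrib_left)
          then show "ennreal (Q \<omega>) = ennreal (c * \<bar>v$1\<bar>) + ennreal c * ennreal \<bar>Z r \<omega>\<bar> + ennreal (c * \<bar>\<sigma>\<bar>) * ennreal \<bar>W r \<omega>\<bar> + ennreal 2 * ennreal (I \<omega>)"
            using c I0[OF \<omega>] by (simp add: ennreal_mult del: ennreal_numeral)
        qed
        also have "\<dots> = ennreal (c * \<bar>v$1\<bar>) + ennreal c * (\<integral>\<^sup>+\<omega>. ennreal \<bar>Z r \<omega>\<bar> \<partial>M) + ennreal (c * \<bar>\<sigma>\<bar>) * (\<integral>\<^sup>+\<omega>. ennreal \<bar>W r \<omega>\<bar> \<partial>M) + ennreal 2 * (\<integral>\<^sup>+\<omega>. ennreal (I \<omega>) \<partial>M)"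
          by (simp add: nn_integral_add nn_integral_cmult emeasure_space_1 del: ennreal_numeral)
        also have "\<dots> \<le> ennreal (c * \<bar>v$1\<bar>) + ennreal c * ennreal K1 + ennreal (c * \<bar>\<sigma>\<bar>) * ennreal (2 * sqrt t) + ennreal 2 * ennreal (K1 * sqrt t)"
          using absZ[OF r(2)] EW EI by (intro add_mono mult_left_mono) auto
        also have "\<dots> = ennreal (c * \<bar>v$1\<bar> + c * K1 + (c * \<bar>\<sigma>\<bar>) * (2 * sqrt t) + 2 * (K1 * sqrt t))"
          using c K r by (simp add: ennreal_mult del: ennreal_numeral)
        also have "c * \<bar>v$1\<bar> + c * K1 + (c * \<bar>\<sigma>\<bar>) * (2 * sqrt t) + 2 * (K1 * sqrt t) = a + b * sqrt t"
          by (simp add: a_def b_def c_def algebra_simps)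
        finally show ?thesis .
      qed
      have "{\<omega>\<in>space M. \<epsilon> < norm (X t \<omega> - Z t \<omega> *\<^sub>R f1)}
          \<subseteq> {\<omega>\<in>space M. \<epsilon> / 2 * exp (l1 * sqrt t) < G \<omega>} \<union> {\<omega>\<in>space M. A * r / l1 < Q \<omega>}"
      proof (rule subsetI, rule ccontr)
        fix \<omega> assume "\<omega> \<in> {\<omega>\<in>space M. \<epsilon> < norm (X t \<omega> - Z t \<omega> *\<^sub>R f1)}"
          and "\<omega> \<notin> {\<omega>\<in>space M. \<epsilon> / 2 * exp (l1 * sqrt t) < G \<omega>} \<union> {\<omega>\<in>space M. A * r / l1 < Q \<omega>}"
        then have \<omega>: "\<omega> \<in> space M" and far: "\<epsilon> < norm (X t \<omega> - Z t \<omega> *\<^sub>R f1)"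
          and G: "G \<omega> \<le> \<epsilon> / 2 * exp (l1 * sqrt t)" and Q: "Q \<omega> \<le> A * r / l1" by auto
        define D where "D = (norm v)\<^sup>2 * exp (- (2 * A * r / l1) + Q \<omega>)"
        have D: "0 \<le> D" "D \<le> V * exp (- (A * r / l1))"
        proof -
          show "0 \<le> D" by (simp add: D_def)
          have "exp (- (2 * A * r / l1) + Q \<omega>) \<le> exp (- (A * r / l1))" using Q by simp
          then show "D \<le> V * exp (- (A * r / l1))" unfolding D_def using V by (intro mult_mono) auto
        qed
        have "norm (X t \<omega> - Z t \<omega> *\<^sub>R f1) \<le> exp (- l1 * (t - r)) * G \<omega> + (t - r) * D + 2 * sqrt D"
          using distance_to_axis[OF W_continuous[OF \<omega>] r(2,3), of v]
          unfolding X_def Z_def S.sol_def ou.sol_def G_def D_def Q_def I_def A_def .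
        also have "\<dots> \<le> \<epsilon> / 2 + (sqrt t * (V * exp (- (A * r / l1))) + 2 * sqrt (V * exp (- (A * r / l1))))"
        proof -
          have "exp (- l1 * (t - r)) * G \<omega> \<le> exp (- l1 * (t - r)) * (\<epsilon> / 2 * exp (l1 * sqrt t))"
            using G by (intro mult_left_mono) auto
          also have "\<dots> = \<epsilon> / 2 * (exp (- l1 * sqrt t) * exp (l1 * sqrt t))" unfolding r(4) by simp
          also have "exp (- l1 * sqrt t) * exp (l1 * sqrt t) = 1" by (simp add: exp_add[symmetric])
          finally have "exp (- l1 * (t - r)) * G \<omega> \<le> \<epsilon> / 2" by simp
          moreover have "(t - r) * D \<le> sqrt t * (V * exp (- (A * r / l1)))" unfolding r(4) using D r by (intro mult_left_mono) auto
          moreover have "sqrt D \<le> sqrt (V * exp (- (A * r / l1)))" using D by simp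
          ultimately show ?thesis by linarith
        qed
        also have "\<dots> < \<epsilon>" using elim(1) by (simp add: r_def)
        finally show False using far by simp
      qed
      then have "prob {\<omega>\<in>space M. \<epsilon> < norm (X t \<omega> - Z t \<omega> *\<^sub>R f1)}
          \<le> prob ({\<omega>\<in>space M. \<epsilon> / 2 * exp (l1 * sqrt t) < G \<omega>} \<union> {\<omega>\<in>space M. A * r / l1 < Q \<omega>})"
        by (intro finite_measure_mono) auto
      also have "\<dots> \<le> prob {\<omega>\<in>space M. \<epsilon> / 2 * exp (l1 * sqrt t) < G \<omega>} + prob {\<omega>\<in>space M. A * r / l1 < Q \<omega>}"
        by (rule measure_Un_le) auto
      also have "\<dots> \<le> K0 / (\<epsilon> / 2 * exp (l1 * sqrt t)) + (a + b * sqrt t) / (A * r / l1)"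
        using \<epsilon> A l1 r K ab by (intro add_mono prob_gt_le_expectation EG EQ Gm Qm) auto
      finally show ?case by (simp add: r_def)
    qed
  qed (use l1 A \<epsilon> in auto)
  then show "((\<lambda>t. prob {\<omega>\<in>space M. \<epsilon> < norm (S.sol v t \<omega> - ou.sol (v$1) t \<omega> *\<^sub>R f1)}) \<longlongrightarrow> 0) at_top"
    by (simp add: X_def Z_def)
qed

corollary S_unique_invariant:
  assumes "\<kappa> < l1 * min l2 l3" and "sde_invariant M W (drift_S l1 l2 l3 \<kappa>) (\<sigma> *\<^sub>R f1) \<mu>"
  shows "\<mu> = nu M W l1 \<sigma> \<kappa>"
  by (rule S.stable_imp_unique[OF S_stable[OF assms(1)] borel_prob_nu assms(2)])

corollary S_laws_converge:
  assumes "\<kappa> < l1 * min l2 l3"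
  shows "weakly_converges (\<lambda>t. law M (sol_S M W l1 l2 l3 \<kappa> \<sigma> v t)) (nu M W l1 \<sigma> \<kappa>) at_top"
  unfolding weakly_converges_def
proof (intro allI impI)
  fix f :: "real^3 \<Rightarrow> real" assume "continuous_on UNIV f \<and> bounded (range f)"
  then have f: "bcont f" by (simp add: bcont_def)
  have "\<forall>\<^sub>F t in at_top. S.semi t f v = integral\<^sup>L (law M (sol_S M W l1 l2 l3 \<kappa> \<sigma> v t)) f"
    using eventually_ge_at_top[of 0]
  proof eventually_elim
    case (elim t)
    have "integral\<^sup>L (law M (sol_S M W l1 l2 l3 \<kappa> \<sigma> v t)) f = integral\<^sup>L (distr M borel (S.sol v t)) f"
      using S.law_sde_solution[OF elim, of v] by (simp add: sol_S_def)
    also have "\<dots> = S.semi t f v"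
      unfolding S.semi_def by (rule integral_distr) (use elim bcont_measurable[OF f] in auto)
    finally show ?case by simp
  qed
  then show "((\<lambda>t. integral\<^sup>L (law M (sol_S M W l1 l2 l3 \<kappa> \<sigma> v t)) f) \<longlongrightarrow> integral\<^sup>L (nu M W l1 \<sigma> \<kappa>) f) at_top"
    by (rule Lim_transform_eventually[OF S_stable[OF assms f]])
qed

section \<open>Further invariant measures above the threshold\<close>

text \<open>Along a solution with \<open>u\<^sub>i = 1\<close> initially, \<open>log u\<^sub>i\<close> has derivative \<open>u\<^sub>1 - l\<close>, and \<open>log y \<le> y\<close>. As \<open>u\<^sub>i\<close> has bounded
  second moments, the time average of \<open>u\<^sub>1\<close> is at most \<open>l\<close> in the limit, whereas the mean of \<open>u\<^sub>1\<close>
  under the Gaussian measure is \<open>\<kappa> / l1\<close>.\<close>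

lemma log_growth:
  assumes w: "continuous_on {0..} w" and T: "0 \<le> T" and v: "v $ i = 1"
    and der: "\<And>s. 0 < s \<Longrightarrow> ((\<lambda>s. S.flow v w s $ i) has_real_derivative - l * S.flow v w s $ i + S.flow v w s $ 1 * S.flow v w s $ i) (at s)"
    and i: "f1 $ i = 0"
  shows "integral {0..T} (\<lambda>s. S.flow v w s $ 1) \<le> l * T + \<bar>S.flow v w T $ i\<bar>"
proof -
  define u where "u s = S.flow v w s" for s
  have cu: "continuous_on {0..T} u"
    unfolding u_def by (rule continuous_on_subset[OF S.flow_continuous[OF w]]) auto
  define P where "P = integral {0..T} (\<lambda>s. u s $ 1 - l)"
  have "- (u T $ i) \<le> exp P * - (u 0 $ i)"
    unfolding P_def
  proof (rule gronwall_homogeneous[OF T])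
    show "continuous_on {0..T} (\<lambda>s. - (u s $ i))" "continuous_on {0..T} (\<lambda>s. u s $ 1 - l)" by (intro continuous_intros cu)+
    fix s assume s: "0 < s" "s < T"
    show "\<exists>d. ((\<lambda>s. - (u s $ i)) has_real_derivative d) (at s) \<and> d \<le> (u s $ 1 - l) * - (u s $ i)"
      using DERIV_minus[OF der[OF s(1)]] unfolding u_def
      by (intro exI[of _ "- (- l * S.flow v w s $ i + S.flow v w s $ 1 * S.flow v w s $ i)"]) (auto simp: algebra_simps)
  qed
  moreover have "u 0 $ i = 1" using S.flow_eq[OF w, of 0 v] v i by (simp add: u_def)
  ultimately have "exp P \<le> u T $ i" by simp
  then have "P \<le> \<bar>u T $ i\<bar>" using exp_ge_add_one_self[of P] by linarith
  moreover have "P = integral {0..T} (\<lambda>s. u s $ 1) - l * T"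
  proof -
    have "P = integral {0..T} (\<lambda>s. u s $ 1) - integral {0..T} (\<lambda>s. l)"
      unfolding P_def by (rule integral_diff) (intro integrable_continuous_real continuous_intros cu)+
    then show ?thesis using T by simp
  qed
  ultimately show ?thesis by (simp add: u_def)
qed

text \<open>Weak convergence sees bounded functions only, so the first coordinate is truncated; second moments bound the
  truncation error by \<open>O(1 / K)\<close>.\<close>

definition clip :: "real \<Rightarrow> real^3 \<Rightarrow> real" where
  "clip K x = max (- K) (min K (x $ 1))"

lemma clip_bcont: "0 \<le> K \<Longrightarrow> bcont (clip K)"
  unfolding clip_def[abs_def] by (intro bcontI[where C=K] continuous_intros) auto

lemma clip_le:
  assumes "0 < K"
  shows "clip K x \<le> x $ 1 + (x $ 1)\<^sup>2 / K" "x $ 1 \<le> clip K x + (x $ 1)\<^sup>2 / K"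
proof -
  have big: "\<bar>x $ 1\<bar> \<le> (x $ 1)\<^sup>2 / K" if "K \<le> \<bar>x $ 1\<bar>"
  proof -
    have "K * \<bar>x $ 1\<bar> \<le> \<bar>x $ 1\<bar> * \<bar>x $ 1\<bar>" using that by (intro mult_right_mono) auto
    then show ?thesis using assms by (simp add: pos_le_divide_eq power2_eq_square mult.commute)
  qed
  have "0 \<le> (x $ 1)\<^sup>2 / K" using assms by simp
  then show "clip K x \<le> x $ 1 + (x $ 1)\<^sup>2 / K" "x $ 1 \<le> clip K x + (x $ 1)\<^sup>2 / K"
    using big assms unfolding clip_def by (auto simp: max_def min_def abs_if split: if_splits)
qed

text \<open>The expectation of \<open>log_growth\<close>. The constant \<open>K\<close> is added to make the integrands nonnegative, for which Fubini's
  theorem needs no integrability.\<close>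

lemma clip_average_le:
  assumes K: "0 < K" and T: "0 < T" and l: "0 \<le> l" and v: "v $ i = 1" and i: "f1 $ i = 0"
    and der: "\<And>w s. continuous_on {0..} w \<Longrightarrow> 0 < s \<Longrightarrow> ((\<lambda>s. S.flow v w s $ i) has_real_derivative - l * S.flow v w s $ i + S.flow v w s $ 1 * S.flow v w s $ i) (at s)"
    and D: "0 \<le> D" "\<And>t. 0 \<le> t \<Longrightarrow> (\<integral>\<^sup>+\<omega>. ennreal ((norm (S.sol v t \<omega>))\<^sup>2) \<partial>M) \<le> ennreal D"
  shows "integral {0..T} (\<lambda>t. S.semi t (clip K) v) / T \<le> l + D / K + (1 + D) / T"
proof -
  let ?u = "S.sol v"
  have K0: "0 \<le> K" using K by simp
  have cb: "bcont (clip K)" by (rule clip_bcont[OF K0])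
  have cm[measurable]: "clip K \<in> borel_measurable borel" by (rule bcont_measurable[OF cb])
  have cc: "continuous_on UNIV (clip K)" using cb by (simp add: bcont_def)
  have clip_ge: "0 \<le> clip K x + K" for x using K by (simp add: clip_def)
  have cu: "continuous_on {0..T} (\<lambda>s. ?u s \<omega>)" if "\<omega> \<in> space M" for \<omega>
    by (rule continuous_on_subset[OF S.sol_continuous[OF that]]) auto
  have semi_c: "continuous_on {0..T} (\<lambda>t. S.semi t (clip K) v)"
    unfolding S.semi_def by (rule continuous_on_expectation[OF cb]) (auto intro: cu)
  have semi_ge: "0 \<le> S.semi t (clip K) v + K" if t: "0 \<le> t" for t
  proof -
    have "\<bar>S.semi t (clip K) v\<bar> \<le> K"
      unfolding S.semi_def by (rule expectation_bcont_le[OF cb]) (use t K in \<open>auto simp: clip_def\<close>)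
    then show ?thesis by linarith
  qed
  have "ennreal (integral {0..T} (\<lambda>t. S.semi t (clip K) v + K)) = (\<integral>\<^sup>+t\<in>{0..T}. ennreal (S.semi t (clip K) v + K) \<partial>lborel)"
    by (rule nn_integral_Icc_continuous[symmetric]) (auto intro!: continuous_intros semi_c semi_ge)
  also have "\<dots> = (\<integral>\<^sup>+t\<in>{0..T}. (\<integral>\<^sup>+\<omega>. ennreal (clip K (?u t \<omega>) + K) \<partial>M) \<partial>lborel)"
  proof (intro nn_integral_cong)
    fix t
    have "ennreal (S.semi t (clip K) v + K) = (\<integral>\<^sup>+\<omega>. ennreal (clip K (?u t \<omega>) + K) \<partial>M)" if t: "0 \<le> t"
    proof -
      have int: "integrable M (\<lambda>\<omega>. clip K (?u t \<omega>))" by (rule integrable_bcont[OF cb]) (use t in simp)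
      have "(\<integral>\<^sup>+\<omega>. ennreal (clip K (?u t \<omega>) + K) \<partial>M) = ennreal (\<integral>\<omega>. clip K (?u t \<omega>) + K \<partial>M)"
        by (rule nn_integral_eq_integral) (use int clip_ge in auto)
      also have "(\<integral>\<omega>. clip K (?u t \<omega>) + K \<partial>M) = S.semi t (clip K) v + K"
        using int by (simp add: S.semi_def prob_space)
      finally show ?thesis by simp
    qed
    then show "ennreal (S.semi t (clip K) v + K) * indicator {0..T} t = (\<integral>\<^sup>+\<omega>. ennreal (clip K (?u t \<omega>) + K) \<partial>M) * indicator {0..T} t"
      by (auto simp: indicator_def)
  qed
  also have "\<dots> = (\<integral>\<^sup>+\<omega>. ennreal (integral {0..T} (\<lambda>t. clip K (?u t \<omega>) + K)) \<partial>M)"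
  proof (rule nn_expectation_time_integral_eq[symmetric])
    show "(\<lambda>\<omega>. clip K (?u s \<omega>) + K) \<in> borel_measurable M" if "0 \<le> s" for s using that by measurable
    show "continuous_on {0..} (\<lambda>s. clip K (?u s \<omega>) + K)" if "\<omega> \<in> space M" for \<omega>
      by (intro continuous_intros continuous_on_compose2[OF cc S.sol_continuous[OF that]]) auto
  qed (use clip_ge in auto)
  also have "\<dots> \<le> (\<integral>\<^sup>+\<omega>. ennreal ((l + K) * T + 1) + ennreal ((norm (?u T \<omega>))\<^sup>2) + ennreal (integral {0..T} (\<lambda>t. (norm (?u t \<omega>))\<^sup>2 / K)) \<partial>M)"
  proof (rule nn_integral_mono)
    fix \<omega> assume \<omega>: "\<omega> \<in> space M"
    define S2 where "S2 = integral {0..T} (\<lambda>t. (norm (?u t \<omega>))\<^sup>2 / K)"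
    have S20: "0 \<le> S2" unfolding S2_def using K
      by (intro integral_nonneg integrable_continuous_real continuous_intros cu \<omega>) auto
    have "integral {0..T} (\<lambda>t. clip K (?u t \<omega>) + K) \<le> integral {0..T} (\<lambda>t. (?u t \<omega> $ 1 + (norm (?u t \<omega>))\<^sup>2 / K) + K)"
    proof (rule integral_le)
      show "(\<lambda>t. clip K (?u t \<omega>) + K) integrable_on {0..T}"
        by (intro integrable_continuous_real continuous_intros continuous_on_compose2[OF cc cu[OF \<omega>]]) auto
      show "(\<lambda>t. (?u t \<omega> $ 1 + (norm (?u t \<omega>))\<^sup>2 / K) + K) integrable_on {0..T}"
        using K by (intro integrable_continuous_real continuous_intros cu \<omega>) auto
      fix t
      have "\<bar>?u t \<omega> $ 1\<bar>\<^sup>2 \<le> (norm (?u t \<omega>))\<^sup>2" by (intro power_mono component_le_norm_cart) auto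
      then have "(?u t \<omega> $ 1)\<^sup>2 / K \<le> (norm (?u t \<omega>))\<^sup>2 / K" using K by (intro divide_right_mono) auto
      then show "clip K (?u t \<omega>) + K \<le> (?u t \<omega> $ 1 + (norm (?u t \<omega>))\<^sup>2 / K) + K"
        using clip_le(1)[OF K, of "?u t \<omega>"] by linarith
    qed
    also have "\<dots> = (integral {0..T} (\<lambda>t. ?u t \<omega> $ 1) + S2) + K * T"
    proof -
      have 1: "(\<lambda>t. ?u t \<omega> $ 1) integrable_on {0..T}" "(\<lambda>t. (norm (?u t \<omega>))\<^sup>2 / K) integrable_on {0..T}"
        using K by (intro integrable_continuous_real continuous_intros cu \<omega>; simp)+
      have "integral {0..T} (\<lambda>t. (?u t \<omega> $ 1 + (norm (?u t \<omega>))\<^sup>2 / K) + K) = integral {0..T} (\<lambda>t. ?u t \<omega> $ 1 + (norm (?u t \<omega>))\<^sup>2 / K) + integral {0..T} (\<lambda>t. K)"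
        by (rule integral_add) (auto intro!: integrable_add 1)
      also have "integral {0..T} (\<lambda>t. ?u t \<omega> $ 1 + (norm (?u t \<omega>))\<^sup>2 / K) = integral {0..T} (\<lambda>t. ?u t \<omega> $ 1) + S2"
        unfolding S2_def by (rule integral_add[OF 1])
      finally show ?thesis using T by simp
    qed
    also have "integral {0..T} (\<lambda>t. ?u t \<omega> $ 1) \<le> l * T + \<bar>?u T \<omega> $ i\<bar>"
      unfolding S.sol_def by (rule log_growth[OF W_continuous[OF \<omega>] _ v der[OF W_continuous[OF \<omega>]] i]) (use T in auto)
    also have "\<bar>?u T \<omega> $ i\<bar> \<le> 1 + (norm (?u T \<omega>))\<^sup>2"
    proof -
      have "norm (?u T \<omega>) \<le> 1 + (norm (?u T \<omega>))\<^sup>2"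
        using zero_le_power2[of "norm (?u T \<omega>) - 1/2"] by (simp add: power2_eq_square algebra_simps)
      then show ?thesis using component_le_norm_cart[of "?u T \<omega>" i] by linarith
    qed
    finally have "integral {0..T} (\<lambda>t. clip K (?u t \<omega>) + K) \<le> ((l + K) * T + 1) + (norm (?u T \<omega>))\<^sup>2 + S2"
      by (simp add: algebra_simps)
    then have "ennreal (integral {0..T} (\<lambda>t. clip K (?u t \<omega>) + K)) \<le> ennreal (((l + K) * T + 1) + (norm (?u T \<omega>))\<^sup>2 + S2)"
      by (rule ennreal_leI)
    also have "\<dots> = ennreal ((l + K) * T + 1) + ennreal ((norm (?u T \<omega>))\<^sup>2) + ennreal S2"
      using S20 l K T by (subst ennreal_plus, simp, simp, subst ennreal_plus) auto
    finally show "ennreal (integral {0..T} (\<lambda>t. clip K (?u t \<omega>) + K)) \<le> ennreal ((l + K) * T + 1) + ennreal ((norm (?u T \<omega>))\<^sup>2) + ennreal (integral {0..T} (\<lambda>t. (norm (?u t \<omega>))\<^sup>2 / K))"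
      unfolding S2_def .
  qed
  also have "\<dots> = ennreal ((l + K) * T + 1) + (\<integral>\<^sup>+\<omega>. ennreal ((norm (?u T \<omega>))\<^sup>2) \<partial>M) + (\<integral>\<^sup>+\<omega>. ennreal (integral {0..T} (\<lambda>t. (norm (?u t \<omega>))\<^sup>2 / K)) \<partial>M)"
  proof -
    have [measurable]: "(\<lambda>\<omega>. integral {0..T} (\<lambda>t. (norm (?u t \<omega>))\<^sup>2 / K)) \<in> borel_measurable M"
      by (rule measurable_time_integral) (use K in \<open>auto intro!: continuous_intros S.sol_continuous\<close>)
    have [measurable]: "?u T \<in> borel_measurable M" using T by simp
    have sum: "(\<integral>\<^sup>+\<omega>. ennreal c + ennreal (F \<omega>) + ennreal (G \<omega>) \<partial>M) = ennreal c + (\<integral>\<^sup>+\<omega>. ennreal (F \<omega>) \<partial>M) + (\<integral>\<^sup>+\<omega>. ennreal (G \<omega>) \<partial>M)"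
      if [measurable]: "F \<in> borel_measurable M" "G \<in> borel_measurable M" for c and F G :: "'w \<Rightarrow> real"
      by (simp add: nn_integral_add emeasure_space_1)
    show ?thesis by (rule sum) measurable
  qed
  also have "\<dots> \<le> ennreal ((l + K) * T + 1) + ennreal D + ennreal (D / K * (T - 0))"
  proof (intro add_mono order_refl nn_expectation_time_integral)
    show "(\<integral>\<^sup>+\<omega>. ennreal ((norm (?u T \<omega>))\<^sup>2) \<partial>M) \<le> ennreal D" using D(2)[of T] T by simp
    show "(\<lambda>\<omega>. (norm (?u s \<omega>))\<^sup>2 / K) \<in> borel_measurable M" if "0 \<le> s" for s using that by measurable
    show "continuous_on {0..} (\<lambda>s. (norm (?u s \<omega>))\<^sup>2 / K)" if "\<omega> \<in> space M" for \<omega>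
      using K by (intro continuous_intros S.sol_continuous that) auto
    fix s assume s: "s \<in> {0..T}"
    have "(\<integral>\<^sup>+\<omega>. ennreal ((norm (?u s \<omega>))\<^sup>2 / K) \<partial>M) = (\<integral>\<^sup>+\<omega>. ennreal (1 / K) * ennreal ((norm (?u s \<omega>))\<^sup>2) \<partial>M)"
      using K by (intro nn_integral_cong) (simp add: ennreal_mult'[symmetric])
    also have "\<dots> = ennreal (1 / K) * (\<integral>\<^sup>+\<omega>. ennreal ((norm (?u s \<omega>))\<^sup>2) \<partial>M)"
      using s by (intro nn_integral_cmult) auto
    also have "\<dots> \<le> ennreal (1 / K) * ennreal D" using D(2)[of s] s by (intro mult_left_mono) auto
    also have "\<dots> = ennreal (D / K)" using K D by (simp add: ennreal_mult'[symmetric])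
    finally show "(\<integral>\<^sup>+\<omega>. ennreal ((norm (?u s \<omega>))\<^sup>2 / K) \<partial>M) \<le> ennreal (D / K)" .
  qed (use T K D in auto)
  also have "\<dots> = ennreal ((l + K) * T + 1 + D + D / K * T)"
    using l K T D by (subst ennreal_plus, simp, simp, subst ennreal_plus) auto
  finally have "integral {0..T} (\<lambda>t. S.semi t (clip K) v + K) \<le> (l + K) * T + 1 + D + D / K * T"
    using l K T D by (subst (asm) ennreal_le_iff) auto
  moreover have "integral {0..T} (\<lambda>t. S.semi t (clip K) v + K) = integral {0..T} (\<lambda>t. S.semi t (clip K) v) + K * T"
  proof -
    have "integral {0..T} (\<lambda>t. S.semi t (clip K) v + K) = integral {0..T} (\<lambda>t. S.semi t (clip K) v) + integral {0..T} (\<lambda>t. K)"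
      by (rule integral_add) (intro integrable_continuous_real continuous_intros semi_c)+
    then show ?thesis using T by simp
  qed
  ultimately have "integral {0..T} (\<lambda>t. S.semi t (clip K) v) \<le> (l + D / K) * T + (1 + D)"
    by (simp add: algebra_simps)
  then have "integral {0..T} (\<lambda>t. S.semi t (clip K) v) / T \<le> ((l + D / K) * T + (1 + D)) / T" using T by (intro divide_right_mono) auto
  then show ?thesis using T by (simp add: add_divide_distrib)
qed

text \<open>The mean of the first coordinate separates the Krylov--Bogoliubov limit from the Gaussian measure.\<close>

lemma another_invariant_measure:
  assumes above: "l1 * l < \<kappa>" and l: "0 \<le> l" and v: "v $ i = 1" and i: "f1 $ i = 0"
    and der: "\<And>w s. continuous_on {0..} w \<Longrightarrow> 0 < s \<Longrightarrow> ((\<lambda>s. S.flow v w s $ i) has_real_derivative - l * S.flow v w s $ i + S.flow v w s $ 1 * S.flow v w s $ i) (at s)"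
  shows "\<exists>\<mu>. sde_invariant M W (drift_S l1 l2 l3 \<kappa>) (\<sigma> *\<^sub>R f1) \<mu> \<and> \<mu> \<noteq> nu M W l1 \<sigma> \<kappa>"
proof -
  obtain r \<mu> where r: "strict_mono r" and inv: "sde_invariant M W (drift_S l1 l2 l3 \<kappa>) (\<sigma> *\<^sub>R f1) \<mu>"
    and lim: "\<And>f. bcont f \<Longrightarrow> (\<lambda>n. integral {0..real (Suc (r n))} (\<lambda>t. S.semi t f v) / real (Suc (r n))) \<longlonglongrightarrow> integral\<^sup>L \<mu> f"
    using krylov_bogoliubov[of v] by blast
  obtain D where D: "0 \<le> D" "\<And>t. 0 \<le> t \<Longrightarrow> (\<integral>\<^sup>+\<omega>. ennreal ((norm (S.sol v t \<omega>))\<^sup>2) \<partial>M) \<le> ennreal D"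
    using second_moment_bound[of v] by blast
  have upper: "integral\<^sup>L \<mu> (clip K) \<le> l + D / K" if K: "0 < K" for K
  proof (rule LIMSEQ_le[OF lim[OF clip_bcont]])
    have "(\<lambda>n. l + D / K + (1 + D) * inverse (real (Suc (r n)))) \<longlonglongrightarrow> l + D / K + (1 + D) * 0"
      using LIMSEQ_subseq_LIMSEQ[OF LIMSEQ_inverse_real_of_nat r] by (intro tendsto_intros) (simp add: comp_def)
    then show "(\<lambda>n. l + D / K + (1 + D) * inverse (real (Suc (r n)))) \<longlonglongrightarrow> l + D / K" by simp
    show "\<exists>N. \<forall>n\<ge>N. integral {0..real (Suc (r n))} (\<lambda>t. S.semi t (clip K) v) / real (Suc (r n)) \<le> l + D / K + (1 + D) * inverse (real (Suc (r n)))"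
      using clip_average_le[OF K _ l v i der D] by (intro exI[of _ 0] allI impI) (simp add: divide_inverse)
  qed (use K in simp)
  define C2 where "C2 = (\<kappa> / l1)\<^sup>2 + (\<sigma> / sqrt (2 * l1))\<^sup>2"
  have lower: "\<kappa> / l1 - C2 / K \<le> integral\<^sup>L (nu M W l1 \<sigma> \<kappa>) (clip K)" if K: "0 < K" for K
  proof -
    interpret G: prob_space ou_limit by (rule prob_space_gauss)
    have cb: "bcont (\<lambda>z. clip K (z *\<^sub>R f1))" using K by (intro bcont_compose[OF clip_bcont] continuous_intros) simp
    have int: "integrable ou_limit (\<lambda>z. clip K (z *\<^sub>R f1))"
      using G.integrable_bcont[OF cb, of "\<lambda>z. z"] by simp
    have "\<kappa> / l1 = (\<integral>z. z \<partial>ou_limit)" by (simp add: gauss_first_moment(2))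
    also have "\<dots> \<le> (\<integral>z. clip K (z *\<^sub>R f1) + z\<^sup>2 / K \<partial>ou_limit)"
    proof (rule integral_mono)
      show "integrable ou_limit (\<lambda>z. z)" by (rule gauss_first_moment)
      show "integrable ou_limit (\<lambda>z. clip K (z *\<^sub>R f1) + z\<^sup>2 / K)"
        using int gauss_second_moment(1) by (intro Bochner_Integration.integrable_add) auto
      show "z \<le> clip K (z *\<^sub>R f1) + z\<^sup>2 / K" for z using clip_le(2)[OF K, of "z *\<^sub>R f1"] by simp
    qed
    also have "\<dots> = integral\<^sup>L ou_limit (\<lambda>z. clip K (z *\<^sub>R f1)) + C2 / K"
      using int gauss_second_moment[of "\<kappa> / l1" "\<sigma> / sqrt (2 * l1)"]
      by (subst Bochner_Integration.integral_add) (auto simp: C2_def)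
    finally show ?thesis using K by (simp add: integral_nu bcont_measurable[OF clip_bcont])
  qed
  have "\<mu> \<noteq> nu M W l1 \<sigma> \<kappa>"
  proof
    assume eq: "\<mu> = nu M W l1 \<sigma> \<kappa>"
    define gap where "gap = \<kappa> / l1 - l"
    have gap: "0 < gap" using above l1 by (simp add: gap_def field_simps)
    \<comment> \<open>So large that the truncation errors \<open>D / K\<close> and \<open>C2 / K\<close> together stay below the gap.\<close>
    define K where "K = (D + C2 + 1) / gap"
    have DC: "0 \<le> D + C2" using D(1) by (simp add: C2_def)
    then have K: "0 < K" using gap by (simp add: K_def)
    have "\<kappa> / l1 - C2 / K \<le> l + D / K" using upper[OF K] lower[OF K] eq by simp
    then have "gap \<le> (D + C2) / K" by (simp add: gap_def add_divide_distrib)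
    then have "gap * K \<le> D + C2" using K by (simp add: pos_le_divide_eq)
    moreover have "gap * K = D + C2 + 1" using gap by (simp add: K_def)
    ultimately show False by simp
  qed
  then show ?thesis using inv by blast
qed

corollary S_non_uniqueness:
  assumes above: "l1 * min l2 l3 < \<kappa>"
  shows "\<exists>\<mu>. sde_invariant M W (drift_S l1 l2 l3 \<kappa>) (\<sigma> *\<^sub>R f1) \<mu> \<and> \<mu> \<noteq> nu M W l1 \<sigma> \<kappa>"
proof (cases "l2 \<le> l3")
  case True
  show ?thesis
  proof (rule another_invariant_measure[of l2 "axis 2 1" 2])
    show "l1 * l2 < \<kappa>" "0 \<le> l2" using above True l2 by auto
  qed (rule S_flow_derivative(2) | simp add: axis_def)+
next
  case False
  show ?thesis
  proof (rule another_invariant_measure[of l3 "axis 3 1" 3])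
    show "l1 * l3 < \<kappa>" "0 \<le> l3" using above False l3 by auto
  qed (rule S_flow_derivative(3) | simp add: axis_def)+
qed

end

section \<open>Invariant measures and stability of the system\<close>

theorem theorem3p7:
  fixes l\<^sub>1 l\<^sub>2 l\<^sub>3 \<kappa> :: real
    and M :: "'w measure"
    and W :: "real \<Rightarrow> 'w \<Rightarrow> real"
  assumes "l\<^sub>1 > 0" and "l\<^sub>2 > 0" and "l\<^sub>3 > 0"
    and "wiener_process M W"
  shows
    "(\<forall>\<sigma>>0.
        (\<forall>v. \<exists>t::nat \<Rightarrow> real. (\<forall>n. 0 < t n) \<and> strict_mono t \<and> filterlim t at_top sequentially \<and>
           (\<exists>\<mu>. borel_prob \<mu> \<and>
              weakly_converges
                (\<lambda>n. law M (\<lambda>\<omega>. (1 / t n) *\<^sub>R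
                   integral {0..t n} (\<lambda>s. sol_S M W l\<^sub>1 l\<^sub>2 l\<^sub>3 \<kappa> \<sigma> v s \<omega>)))
                \<mu> sequentially)) \<and>
        (\<exists>\<mu>. invariant_S M W l\<^sub>1 l\<^sub>2 l\<^sub>3 \<kappa> \<sigma> \<mu>)) \<and>
     (\<forall>\<sigma>::real.
        gaussian_measure (nu M W l\<^sub>1 \<sigma> \<kappa>) \<and>
        invariant_S M W l\<^sub>1 l\<^sub>2 l\<^sub>3 \<kappa> \<sigma> (nu M W l\<^sub>1 \<sigma> \<kappa>) \<and>
        invariant_lin M W l\<^sub>1 l\<^sub>2 l\<^sub>3 \<kappa> \<sigma> (nu M W l\<^sub>1 \<sigma> \<kappa>)) \<and>
     (\<kappa> < l\<^sub>1 * min l\<^sub>2 l\<^sub>3 \<longrightarrow>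
       (\<forall>\<sigma>\<ge>0.
          (\<forall>\<mu>. invariant_S M W l\<^sub>1 l\<^sub>2 l\<^sub>3 \<kappa> \<sigma> \<mu> \<longleftrightarrow> \<mu> = nu M W l\<^sub>1 \<sigma> \<kappa>) \<and>
          (\<forall>v. weakly_converges (\<lambda>t. law M (sol_S M W l\<^sub>1 l\<^sub>2 l\<^sub>3 \<kappa> \<sigma> v t))
                 (nu M W l\<^sub>1 \<sigma> \<kappa>) at_top))) \<and>
     (\<kappa> > l\<^sub>1 * min l\<^sub>2 l\<^sub>3 \<longrightarrow>
       (\<forall>\<sigma>>0. \<exists>\<mu>. invariant_S M W l\<^sub>1 l\<^sub>2 l\<^sub>3 \<kappa> \<sigma> \<mu> \<and> \<mu> \<noteq> nu M W l\<^sub>1 \<sigma> \<kappa>))"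
proof -
  have sys: "three_dim_system M W l\<^sub>1 l\<^sub>2 l\<^sub>3"
    using assms by (intro three_dim_system.intro wiener.intro three_dim_system_axioms.intro)
  note facts = three_dim_system.time_averages_converge[OF sys]
    three_dim_system.gaussian_nu[OF sys]
    three_dim_system.nu_invariant_S[OF sys] three_dim_system.nu_invariant_lin[OF sys]
    three_dim_system.S_unique_invariant[OF sys] three_dim_system.S_laws_converge[OF sys]
    three_dim_system.S_non_uniqueness[OF sys]
  show ?thesis
    unfolding invariant_S_def invariant_lin_def
    by (intro conjI allI impI iffI) (use facts in blast)+
qed

end
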